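(* Let $\mathcal{D}\subset\mathbb{R}^2$ be a bounded, convex, polygonal domain and let $\sigma\in L^\infty(\mathcal{D})\cap W^{s,q}(\mathcal{D})$, with $s\in(0,1]$ and $q\in(2,\infty)$, satisfy $\sigma(x)\ge\sigma_0>0$ for almost every $x\in\mathcal{D}$. Let $(\mathcal{T}_h)_{h\in(0,1]}$ be a family of admissible and quasi-uniform triangulations of $\mathcal{D}$. Let $f\in L^p(\mathcal{D})$ with $p\in[2,\infty]$, let $u\in H^1_0(\mathcal{D})$ be the unique weak solution of $$\int_{\mathcal{D}}\sigma\,\nabla u\cdot\nabla v\,\mathrm{d}x=\int_{\mathcal{D}}f v\,\mathrm{d}x\quad\text{for all } v\in H^1_0(\mathcal{D}),$$ and assume that $u\in H^1_0(\mathcal{D})\cap H^2(\mathcal{D})$. For $h\in(0,1]$ let $u_h^{MC}\colon\Omega\to S_h$ be the ($\mathbb{P}$-a.s. unique) solution of the randomized discrete problem: $\mathbb{P}$-almost surely, $a_{MC}(u_h^{MC},v_h)=F_{MC}(v_h)$ for all $v_h\in S_h$. Let $\ell_h=\max(1,\log(1/h))$. Then there exists a constant $C\in(0,\infty)$, independent of $h$, such that the following holds. (i) If $p\in[2,\infty)$, then for every $h\in(0,1]$ $$\|u-u_h^{MC}\|_{L^2(\Omega;H^1_0(\mathcal{D}))}\le C h\|u\|_{H^2(\mathcal{D})}+C h^s\|u\|_{H^2(\mathcal{D})}|\sigma|_{W^{s,q}(\mathcal{D})}+C h^{1-\frac{2}{p}}\|f\|_{L^p(\mathcal{D})}.$$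 (ii) If $p=\infty$, then for every $h\in(0,1]$ $$\|u-u_h^{MC}\|_{L^2(\Omega;H^1_0(\mathcal{D}))}\le C h\|u\|_{H^2(\mathcal{D})}+C h^s\|u\|_{H^2(\mathcal{D})}|\sigma|_{W^{s,q}(\mathcal{D})}+C \ell_h^{\frac12}h\|f\|_{L^\infty(\mathcal{D})}.$$
   Context: Triangulations: for each $h\in(0,1]$, $\mathcal{T}_h$ is a finite set of pairwise disjoint open triangles $T\subset\mathcal{D}$ with $\bigcup_{T\in\mathcal{T}_h}\overline{T}=\overline{\mathcal{D}}$, such that no vertex of a triangle lies in the interior of an edge of another triangle (admissibility); $h$ is the maximal edge length of the triangles in $\mathcal{T}_h$, and $|T|$ is the area of $T$. The family is quasi-uniform if the interior angles of all triangles are bounded below by a positive constant independent of $h$, and there is $c\in(0,\infty)$ with $|T|\ge c h^2$ for every $h\in(0,1]$ and $T\in\mathcal{T}_h$. Finite element space: $S_h=\{v_h\in C(\overline{\mathcal{D}}): v_h=0\text{ on }\partial\mathcal{D},\ v_h|_T\text{ is a polynomial of degree}\le1\ \forall T\in\mathcal{T}_h\}$. Randomized forms: $(\Omega,\mathcal{F},\mathbb{P})$ is a probability space and, for each $h$, $(Z_T)_{T\in\mathcal{T}_h}$ is an independent family of random variables with $Z_T$ uniformly distributed on $T$. For $v_h,w_h\in S_h$, $$a_{MC}(v_h,w_h)=\sum_{T\in\mathcal{T}_h}|T|\,\sigma(Z_T)\nabla v_h(Z_T)\cdot\nabla w_h(Z_T),\qquad F_{MC}(v_h)=\sum_{T\in\mathcal{T}_h}|T|\,f(Z_T)v_h(Z_T).$$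 Norms: $|v|_{H^1(\mathcal{D})}=(\int_{\mathcal{D}}|\nabla v|^2\,\mathrm{d}x)^{1/2}$ is used as the norm on $H^1_0(\mathcal{D})$, and $\|X\|_{L^2(\Omega;H^1_0(\mathcal{D}))}=(\mathbb{E}[|X|_{H^1(\mathcal{D})}^2])^{1/2}$. For $s\in(0,1)$, $W^{s,q}(\mathcal{D})$ is the Sobolev--Slobodeckij space with semi-norm $|\sigma|_{W^{s,q}(\mathcal{D})}=\big(\int_{\mathcal{D}}\int_{\mathcal{D}}\frac{|\sigma(x)-\sigma(z)|^q}{|x-z|^{2+sq}}\,\mathrm{d}x\,\mathrm{d}z\big)^{1/q}$; for $s=1$, $W^{1,q}(\mathcal{D})$ is the usual Sobolev space with the semi-norm given by the $L^q$-norms of the first-order weak derivatives. Constants $C$ are generic and not allowed to depend on $h$. *)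

theory Defs
  imports "HOL-Probability.Probability"
begin

section \<open>Lebesgue spaces\<close>

text \<open>Functions are total on the plane; only their values on the domain \<open>D\<close> (up to null sets)
  enter. The exponent \<open>p\<close> ranges over the extended reals \<open>[1, \<infinity>]\<close>.\<close>

definition Lp_space :: "ereal \<Rightarrow> (real^2) set \<Rightarrow> (real^2 \<Rightarrow> real) set" where
  "Lp_space p D = {f \<in> borel_measurable (lebesgue_on D).
     if p = \<infinity> then esssup (lebesgue_on D) (\<lambda>x. ereal \<bar>f x\<bar>) < \<infinity>
     else integrable (lebesgue_on D) (\<lambda>x. \<bar>f x\<bar> powr real_of_ereal p)}"

definition Lp_norm :: "ereal \<Rightarrow> (real^2) set \<Rightarrow> (real^2 \<Rightarrow> real) \<Rightarrow> real" where
  "Lp_norm p D f =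
     (if p = \<infinity> then real_of_ereal (esssup (lebesgue_on D) (\<lambda>x. ereal \<bar>f x\<bar>))
      else (LINT x|lebesgue_on D. \<bar>f x\<bar> powr real_of_ereal p) powr (1 / real_of_ereal p))"


section \<open>Test functions and weak derivatives\<close>

definition partial_deriv :: "2 \<Rightarrow> (real^2 \<Rightarrow> real) \<Rightarrow> real^2 \<Rightarrow> real" where
  "partial_deriv i \<phi> x = frechet_derivative \<phi> (at x) (axis i 1)"

definition gradient :: "(real^2 \<Rightarrow> real) \<Rightarrow> real^2 \<Rightarrow> real^2" where
  "gradient \<phi> x = (\<chi> i. partial_deriv i \<phi> x)"

fun C_k :: "nat \<Rightarrow> (real^2 \<Rightarrow> real) \<Rightarrow> bool" where
  "C_k 0 \<phi> \<longleftrightarrow> continuous_on UNIV \<phi>"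
| "C_k (Suc k) \<phi> \<longleftrightarrow> (\<forall>x. \<phi> differentiable (at x)) \<and> (\<forall>i. C_k k (partial_deriv i \<phi>))"

definition test_function :: "(real^2) set \<Rightarrow> (real^2 \<Rightarrow> real) \<Rightarrow> bool" where
  "test_function D \<phi> \<longleftrightarrow> (\<forall>k. C_k k \<phi>) \<and>
     compact (closure {x. \<phi> x \<noteq> 0}) \<and> closure {x. \<phi> x \<noteq> 0} \<subseteq> D"

definition locally_integrable :: "(real^2) set \<Rightarrow> (real^2 \<Rightarrow> real) \<Rightarrow> bool" where
  "locally_integrable D f \<longleftrightarrow> (\<forall>K. compact K \<and> K \<subseteq> D \<longrightarrow> set_integrable lebesgue K f)"

definition is_weak_deriv ::
  "(real^2) set \<Rightarrow> 2 \<Rightarrow> (real^2 \<Rightarrow> real) \<Rightarrow> (real^2 \<Rightarrow> real) \<Rightarrow> bool" where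
  "is_weak_deriv D i v g \<longleftrightarrow> locally_integrable D v \<and> locally_integrable D g \<and>
     (\<forall>\<phi>. test_function D \<phi> \<longrightarrow>
        (LINT x|lebesgue_on D. v x * partial_deriv i \<phi> x) = - (LINT x|lebesgue_on D. g x * \<phi> x))"

text \<open>A representative of the weak derivative, which is unique up to null sets if it exists.\<close>

definition weak_deriv :: "(real^2) set \<Rightarrow> 2 \<Rightarrow> (real^2 \<Rightarrow> real) \<Rightarrow> real^2 \<Rightarrow> real" where
  "weak_deriv D i v = (SOME g. is_weak_deriv D i v g)"

definition weak_gradient :: "(real^2) set \<Rightarrow> (real^2 \<Rightarrow> real) \<Rightarrow> real^2 \<Rightarrow> real^2" where
  "weak_gradient D v x = (\<chi> i. weak_deriv D i v x)"


section \<open>Sobolev spaces\<close>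

definition W1_space :: "ereal \<Rightarrow> (real^2) set \<Rightarrow> (real^2 \<Rightarrow> real) set" where
  "W1_space q D = {v \<in> Lp_space q D. \<forall>i. \<exists>g \<in> Lp_space q D. is_weak_deriv D i v g}"

abbreviation H1_space :: "(real^2) set \<Rightarrow> (real^2 \<Rightarrow> real) set" where
  "H1_space \<equiv> W1_space 2"

definition H1_seminorm :: "(real^2) set \<Rightarrow> (real^2 \<Rightarrow> real) \<Rightarrow> real" where
  "H1_seminorm D v = sqrt (LINT x|lebesgue_on D. (norm (weak_gradient D v x))\<^sup>2)"

definition H1_norm :: "(real^2) set \<Rightarrow> (real^2 \<Rightarrow> real) \<Rightarrow> real" where
  "H1_norm D v = sqrt ((Lp_norm 2 D v)\<^sup>2 + (H1_seminorm D v)\<^sup>2)"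

definition H10_space :: "(real^2) set \<Rightarrow> (real^2 \<Rightarrow> real) set" where
  "H10_space D = {v \<in> H1_space D.
     \<forall>\<epsilon>>0. \<exists>\<phi>. test_function D \<phi> \<and> H1_norm D (\<lambda>x. v x - \<phi> x) < \<epsilon>}"

definition H2_space :: "(real^2) set \<Rightarrow> (real^2 \<Rightarrow> real) set" where
  "H2_space D = {v \<in> H1_space D. \<forall>i. weak_deriv D i v \<in> H1_space D}"

definition H2_norm :: "(real^2) set \<Rightarrow> (real^2 \<Rightarrow> real) \<Rightarrow> real" where
  "H2_norm D v = sqrt ((Lp_norm 2 D v)\<^sup>2
     + (\<Sum>i\<in>UNIV. (Lp_norm 2 D (weak_deriv D i v))\<^sup>2)
     + (\<Sum>i\<in>UNIV. \<Sum>j\<in>UNIV. (Lp_norm 2 D (weak_deriv D j (weak_deriv D i v)))\<^sup>2))"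

text \<open>The Slobodeckij double integral; on the diagonal the integrand is \<open>0 / 0 = 0\<close>.\<close>

definition slobodeckij_integral ::
  "real \<Rightarrow> real \<Rightarrow> (real^2) set \<Rightarrow> (real^2 \<Rightarrow> real) \<Rightarrow> ennreal" where
  "slobodeckij_integral s q D v =
     (\<integral>\<^sup>+ x. (\<integral>\<^sup>+ z. ennreal (\<bar>v x - v z\<bar> powr q / norm (x - z) powr (2 + s * q))
        \<partial>lebesgue_on D) \<partial>lebesgue_on D)"

text \<open>Both definitions are meant for \<open>s \<in> (0, 1]\<close> and \<open>q \<in> [1, \<infinity>)\<close>.\<close>

definition W_space :: "real \<Rightarrow> real \<Rightarrow> (real^2) set \<Rightarrow> (real^2 \<Rightarrow> real) set" where
  "W_space s q D =
     (if s = 1 then W1_space (ereal q) D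
      else {v \<in> Lp_space (ereal q) D. slobodeckij_integral s q D v < \<infinity>})"

definition W_seminorm :: "real \<Rightarrow> real \<Rightarrow> (real^2) set \<Rightarrow> (real^2 \<Rightarrow> real) \<Rightarrow> real" where
  "W_seminorm s q D v =
     (if s = 1 then (\<Sum>i\<in>UNIV. Lp_norm (ereal q) D (weak_deriv D i v) powr q) powr (1 / q)
      else enn2real (slobodeckij_integral s q D v) powr (1 / q))"


section \<open>The boundary value problem\<close>

definition convex_polygonal_domain :: "(real^2) set \<Rightarrow> bool" where
  "convex_polygonal_domain D \<longleftrightarrow>
     open D \<and> D \<noteq> {} \<and> bounded D \<and> convex D \<and> polytope (closure D)"

definition weak_solution ::
  "(real^2) set \<Rightarrow> (real^2 \<Rightarrow> real) \<Rightarrow> (real^2 \<Rightarrow> real) \<Rightarrow> (real^2 \<Rightarrow> real) \<Rightarrow> bool" where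
  "weak_solution D \<sigma> f u \<longleftrightarrow> u \<in> H10_space D \<and>
     (\<forall>v \<in> H10_space D.
        (LINT x|lebesgue_on D. \<sigma> x * (weak_gradient D u x \<bullet> weak_gradient D v x))
        = (LINT x|lebesgue_on D. f x * v x))"


section \<open>Triangulations\<close>

definition open_triangle :: "(real^2) set \<Rightarrow> bool" where
  "open_triangle T \<longleftrightarrow>
     (\<exists>a b c. \<not> collinear {a, b, c} \<and> T = interior (convex hull {a, b, c}))"

definition vertices :: "(real^2) set \<Rightarrow> (real^2) set" where
  "vertices T = {a. a extreme_point_of closure T}"

text \<open>The angle at \<open>a\<close> in the triangle with vertices \<open>a\<close>, \<open>b\<close>, \<open>c\<close>.\<close>

definition interior_angle :: "real^2 \<Rightarrow> real^2 \<Rightarrow> real^2 \<Rightarrow> real" where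
  "interior_angle a b c = arccos (((b - a) \<bullet> (c - a)) / (norm (b - a) * norm (c - a)))"

definition admissible_triangulation :: "(real^2) set \<Rightarrow> (real^2) set set \<Rightarrow> bool" where
  "admissible_triangulation D \<T> \<longleftrightarrow>
     finite \<T> \<and> (\<forall>T\<in>\<T>. open_triangle T \<and> T \<subseteq> D) \<and> pairwise disjnt \<T> \<and>
     (\<Union>T\<in>\<T>. closure T) = closure D \<and>
     (\<forall>T\<in>\<T>. \<forall>T'\<in>\<T>. T \<noteq> T' \<longrightarrow>
        (\<forall>x\<in>vertices T. \<forall>a\<in>vertices T'. \<forall>b\<in>vertices T'. x \<notin> open_segment a b))"

definition mesh_size :: "(real^2) set set \<Rightarrow> real" where
  "mesh_size \<T> = Max {dist a b | T a b. T \<in> \<T> \<and> a \<in> vertices T \<and> b \<in> vertices T}"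

definition quasi_uniform :: "(real \<Rightarrow> (real^2) set set) \<Rightarrow> bool" where
  "quasi_uniform \<T> \<longleftrightarrow>
     (\<exists>\<theta>>0. \<forall>h\<in>{0<..1}. \<forall>T\<in>\<T> h. \<forall>a\<in>vertices T. \<forall>b\<in>vertices T. \<forall>c\<in>vertices T.
        a \<noteq> b \<and> b \<noteq> c \<and> a \<noteq> c \<longrightarrow> \<theta> \<le> interior_angle a b c) \<and>
     (\<exists>c>0. \<forall>h\<in>{0<..1}. \<forall>T\<in>\<T> h. c * h\<^sup>2 \<le> measure lebesgue T)"


section \<open>The randomized finite element method\<close>

definition fe_space :: "(real^2) set \<Rightarrow> (real^2) set set \<Rightarrow> (real^2 \<Rightarrow> real) set" where
  "fe_space D \<T> = {v. continuous_on (closure D) v \<and> (\<forall>x\<in>frontier D. v x = 0) \<and>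
     (\<forall>T\<in>\<T>. \<exists>\<alpha> \<beta>. \<forall>x\<in>T. v x = \<alpha> + \<beta> \<bullet> x)}"

text \<open>Below, \<open>z\<close> assigns a sample point to every triangle. The gradients are classical: functions
  in \<^const>\<open>fe_space\<close> are affine on each (open) triangle.\<close>

definition a_MC ::
  "(real^2) set set \<Rightarrow> (real^2 \<Rightarrow> real) \<Rightarrow> ((real^2) set \<Rightarrow> real^2) \<Rightarrow>
   (real^2 \<Rightarrow> real) \<Rightarrow> (real^2 \<Rightarrow> real) \<Rightarrow> real" where
  "a_MC \<T> \<sigma> z v w =
     (\<Sum>T\<in>\<T>. measure lebesgue T * \<sigma> (z T) * (gradient v (z T) \<bullet> gradient w (z T)))"

definition F_MC ::
  "(real^2) set set \<Rightarrow> (real^2 \<Rightarrow> real) \<Rightarrow> ((real^2) set \<Rightarrow> real^2) \<Rightarrow> (real^2 \<Rightarrow> real) \<Rightarrow> real" where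
  "F_MC \<T> f z v = (\<Sum>T\<in>\<T>. measure lebesgue T * f (z T) * v (z T))"

definition uniform_samples ::
  "'w measure \<Rightarrow> (real^2) set set \<Rightarrow> ((real^2) set \<Rightarrow> 'w \<Rightarrow> real^2) \<Rightarrow> bool" where
  "uniform_samples P \<T> Z \<longleftrightarrow>
     prob_space.indep_vars P (\<lambda>_. borel) Z \<T> \<and>
     (\<forall>T\<in>\<T>. distr P lborel (Z T) = uniform_measure lborel T)"

definition MC_solution ::
  "'w measure \<Rightarrow> (real^2) set \<Rightarrow> (real^2) set set \<Rightarrow> (real^2 \<Rightarrow> real) \<Rightarrow> (real^2 \<Rightarrow> real) \<Rightarrow>
   ((real^2) set \<Rightarrow> 'w \<Rightarrow> real^2) \<Rightarrow> ('w \<Rightarrow> real^2 \<Rightarrow> real) \<Rightarrow> bool" where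
  "MC_solution P D \<T> \<sigma> f Z U \<longleftrightarrow>
     (\<forall>\<omega>\<in>space P. U \<omega> \<in> fe_space D \<T>) \<and>
     (AE \<omega> in P. \<forall>v\<in>fe_space D \<T>.
        a_MC \<T> \<sigma> (\<lambda>T. Z T \<omega>) (U \<omega>) v = F_MC \<T> f (\<lambda>T. Z T \<omega>) v)"

text \<open>The norm of \<open>L\<^sup>2(\<Omega>; H\<^sup>1\<^sub>0(D))\<close>, with value \<open>\<infinity>\<close> if the second moment is infinite, so that
  an upper bound by a real number includes finiteness.\<close>

definition L2_H10_norm :: "'w measure \<Rightarrow> (real^2) set \<Rightarrow> ('w \<Rightarrow> real^2 \<Rightarrow> real) \<Rightarrow> ennreal" where
  "L2_H10_norm P D X =
     (let E = (\<integral>\<^sup>+ \<omega>. ennreal ((H1_seminorm D (X \<omega>))\<^sup>2) \<partial>P)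
      in if E = \<infinity> then \<infinity> else ennreal (sqrt (enn2real E)))"

end

theory Submission
imports Defs
begin

text \<open>The difference \<open>w\<close> of the discrete solution and the nodal interpolant \<open>v\<close> of \<open>u\<close> is tested in the
randomized equation. With \<open>Z\<close> the sample points, \<open>\<sigma>\<^sub>0 |w|\<^sup>2\<close> is at most the sum of three terms:
\<open>F_MC(w) - F(w)\<close>, the integral of \<open>\<sigma> (grad u - grad v) grad w\<close>, and the sum over \<open>T\<close> of
\<open>(grad v grad w)(integral of \<sigma> over T - |T| \<sigma>(Z T))\<close>. The second term is the interpolation error.
The expected square of the third is governed by the variances \<open>V T\<close> of \<open>\<sigma>\<close> on the triangles; since
\<open>\<Sum>T. |T| V T powr (q/2) \<le> C h powr (s q) |\<sigma>| powr q\<close>, a Sobolev inequality with the weight \<open>V\<close>, applied to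
\<open>grad u\<close>, produces the factor \<open>h powr s\<close>. In the first term \<open>w\<close> is replaced on \<open>T\<close> by its mean over a ball
in \<open>T\<close>, which is the inner product of \<open>grad w\<close> with a kernel \<open>K T\<close> of squared \<open>L\<^sup>2\<close>-norm \<open>O(log (1/h))\<close>. The
deviations \<open>\<xi> T = |T| f(Z T) - integral of f over T\<close> are independent and centred, so
\<open>E \<parallel>\<Sum>T. \<xi> T K T\<parallel>\<^sup>2 = (\<Sum>T. E (\<xi> T)\<^sup>2 \<parallel>K T\<parallel>\<^sup>2) \<le> C h\<^sup>2 log (1/h) \<parallel>f\<parallel>\<^sup>2\<close>, which is enough for every \<open>p\<close>.\<close>

text \<open>The test function \<open>w\<close> depends on the same samples as the load error, so no
  expectation can be taken for a fixed \<open>w\<close>. Each error term is therefore bounded by a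
  factor free of \<open>w\<close> times the norm of grad w. For the load this asks for point values
  bounded by the gradient, which fails in the plane but at mesh scale costs only a logarithm: the
  kernel is y/|y|^2 truncated at a radius proportional to h, and each dyadic annulus contributes
  equally to its square norm. One estimate then serves all p, since for finite p the logarithm is at
  most a constant times h powr (-4/p).

  The interpolant needs point values of u, which is only given through weak derivatives. They arise
  as limits of values of smooth approximations, controlled by Taylor polynomials averaged over small
  copies of D; the same device shows that they vanish on the boundary. Convexity provides the
  approximations: contracting the argument of a function towards an interior compact set lets it be
  mollified up to the boundary, and expanding it instead turns finite element functions into test
  functions.\<close>

abbreviation "bmeas == borel_measurable borel"
abbreviation "ind == indicator"
abbreviation "pd == partial_deriv"
abbreviation "L1 == integrable lborel"
abbreviation "area == measure lebesgue"
abbreviation "NI F == nn_integral lborel F"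
abbreviation "nnI S F == NI (%x. ennreal (F x) * ind S x)"

section \<open>Smooth functions\<close>

lemma partial_deriv_eq:
 assumes "(ph has_derivative ph') (at x)"
 shows "pd i ph x = ph' (axis i 1)"
 using frechet_derivative_at[OF assms] by (simp add: partial_deriv_def)

lemma C_k_imp_continuous: "C_k k ph ==> continuous_on UNIV ph"
 by (cases k) (auto simp: differentiable_imp_continuous_within continuous_on_eq_continuous_within)

lemma C_k_Suc_imp: "C_k (Suc k) ph ==> C_k k ph"
 by (induction k arbitrary: ph)
  (auto simp: differentiable_imp_continuous_within continuous_on_eq_continuous_within)

lemma partial_deriv_add:
 assumes "ALL x. f differentiable (at x)" "ALL x. g differentiable (at x)"
 shows "pd i (%x. f x + g x) = (%x. pd i f x + pd i g x)"
proof
 fix x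
 have "((%x. f x + g x) has_derivative (%v. frechet_derivative f (at x) v + frechet_derivative g (at x) v)) (at x)"
  using assms by (intro derivative_intros) (auto simp: frechet_derivative_works)
 from partial_deriv_eq[OF this]
 show "pd i (%x. f x + g x) x = pd i f x + pd i g x" by (simp add: partial_deriv_def)
qed

lemma partial_deriv_mult:
 assumes "ALL x. f differentiable (at x)" "ALL x. g differentiable (at x)"
 shows "pd i (%x. f x * g x) = (%x. f x * pd i g x + pd i f x * g x)"
proof
 fix x
 have "((%x. f x * g x) has_derivative
   (%v. f x * frechet_derivative g (at x) v + frechet_derivative f (at x) v * g x)) (at x)"
  using assms by (intro derivative_intros) (auto simp: frechet_derivative_works)
 from partial_deriv_eq[OF this]
 show "pd i (%x. f x * g x) x = f x * pd i g x + pd i f x * g x" by (simp add: partial_deriv_def)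
qed

lemma partial_deriv_const: "pd i (%x. c) = (%x. 0)"
 using partial_deriv_eq[OF has_derivative_const] by blast

lemma C_k_const: "C_k k (%x. c)"
 by (induction k arbitrary: c) (auto simp: partial_deriv_const)

lemma C_k_add: "C_k k f ==> C_k k g ==> C_k k (%x. f x + g x)"
proof (induction k arbitrary: f g)
 case 0
 thus ?case by (simp add: continuous_on_add)
next
 case (Suc k)
 thus ?case by (auto simp: partial_deriv_add)
qed

lemma C_k_mult: "C_k k f ==> C_k k g ==> C_k k (%x. f x * g x)"
proof (induction k arbitrary: f g)
 case 0
 thus ?case by (simp add: continuous_on_mult)
next
 case (Suc k)
 hence "C_k k f" "C_k k g" using C_k_Suc_imp by blast+
 with Suc show ?case by (auto simp: partial_deriv_mult intro!: C_k_add)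
qed

text \<open>Dilations combined with translations are the substitutions that occur in mollification:
  its kernels are a fixed test function composed with them.\<close>

lemma partial_deriv_reparam:
 fixes a :: real
 assumes "ALL x. f differentiable (at x)"
 shows "pd i (%x. f (a *\<^sub>R x + c)) = (%x. a * pd i f (a *\<^sub>R x + c))"
proof
 fix x
 have lin: "linear (frechet_derivative f (at (a *\<^sub>R x + c)))" using assms linear_frechet_derivative by blast
 have "(f has_derivative frechet_derivative f (at (a *\<^sub>R x + c))) (at (a *\<^sub>R x + c))"
  using assms by (auto simp: frechet_derivative_works)
 hence "((%x. f (a *\<^sub>R x + c)) has_derivative
   (%v. frechet_derivative f (at (a *\<^sub>R x + c)) (a *\<^sub>R v))) (at x)"
  by (intro has_derivative_compose[where f="%x. a *\<^sub>R x + c" and g=f]) (auto intro!: derivative_eq_intros)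
 from partial_deriv_eq[OF this]
 show "pd i (%x. f (a *\<^sub>R x + c)) x = a * pd i f (a *\<^sub>R x + c)"
  by (simp add: partial_deriv_def linear_scale[OF lin])
qed

lemma differentiable_reparam:
 fixes f :: "'a::real_normed_vector => 'b::real_normed_vector"
 assumes "ALL x. f differentiable (at x)"
 shows "(%x. f (a *\<^sub>R x + c)) differentiable (at x)"
 using assms by (intro differentiable_compose[of f "%x. a *\<^sub>R x + c"] derivative_intros) auto

lemma C_k_reparam: "C_k k f ==> C_k k (%x. f (a *\<^sub>R x + c))"
proof (induction k arbitrary: f)
 case 0
 thus ?case
  by (auto intro!: continuous_on_compose2[of UNIV f] continuous_intros)
next
 case (Suc k)
 thus ?case
  by (auto simp: partial_deriv_reparam differentiable_reparam intro!: C_k_mult C_k_const)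
qed

section \<open>Bump functions\<close>

text \<open>The functions p(1/t) exp(-1/t), continued by zero, form a family closed under
  differentiation; this turns the smoothness of exp(-1/t) into an induction over the order with
  \<open>p\<close> arbitrary.\<close>

definition exp_inv_poly :: "real poly => real => real" where
 "exp_inv_poly p t = (if 0 < t then poly p (1 / t) * exp (- (1 / t)) else 0)"

lemma poly_times_exp_minus_tendsto_0: "((%x::real. poly p x * exp (- x)) \<longlongrightarrow> 0) at_top"
proof -
 have "((%x::real. \<Sum>i\<le>degree p. coeff p i * (x ^ i / exp x)) \<longlongrightarrow> (\<Sum>i\<le>degree p. coeff p i * 0)) at_top"
  by (intro tendsto_intros tendsto_power_div_exp_0)
 moreover have "(%x::real. \<Sum>i\<le>degree p. coeff p i * (x ^ i / exp x)) = (%x. poly p x * exp (- x))"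
  by (simp add: poly_altdef sum_distrib_right exp_minus divide_inverse mult.assoc)
 ultimately show ?thesis by simp
qed

text \<open>For t > 0 the product rule produces the factor 1/t^2 and the polynomial p - p'. Only t =
  0 needs a limit, and there the difference quotient is again a polynomial in 1/t times
  exp(-1/t).\<close>

lemma exp_inv_poly_has_derivative:
 "(exp_inv_poly p has_real_derivative exp_inv_poly ([:0, 0, 1:] * (p - pderiv p)) t) (at t)"
proof -
 consider "t > 0" | "t < 0" | "t = 0" by linarith
 thus ?thesis
 proof cases
  case 1
  have "((%t. poly p (1 / t) * exp (- (1 / t))) has_real_derivative
    exp_inv_poly ([:0, 0, 1:] * (p - pderiv p)) t) (at t)"
   using 1 by (auto intro!: derivative_eq_intros DERIV_chain2[OF poly_DERIV]
     simp: exp_inv_poly_def field_simps power2_eq_square)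
  thus ?thesis
   by (rule has_field_derivative_transform_within_open[where S="{0<..}"]) (use 1 in \<open>auto simp: exp_inv_poly_def\<close>)
 next
  case 2
  have "((%t. 0) has_real_derivative exp_inv_poly ([:0, 0, 1:] * (p - pderiv p)) t) (at t)"
   using 2 by (simp add: exp_inv_poly_def)
  thus ?thesis
   by (rule has_field_derivative_transform_within_open[where S="{..<0}"]) (use 2 in \<open>auto simp: exp_inv_poly_def\<close>)
 next
  case 3
  have "((%t::real. poly (pCons 0 p) (inverse t) * exp (- inverse t)) \<longlongrightarrow> 0) (at_right 0)"
   by (rule filterlim_compose[OF poly_times_exp_minus_tendsto_0 filterlim_inverse_at_top_right])
  hence r: "((%t. exp_inv_poly p t / t) \<longlongrightarrow> 0) (at_right 0)"
   by (rule Lim_transform_eventually)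
    (rule eventually_mono[OF eventually_at_right_less], simp add: exp_inv_poly_def divide_inverse)
  have l: "((%t. exp_inv_poly p t / t) \<longlongrightarrow> 0) (at_left 0)"
   by (rule tendsto_eventually) (simp add: eventually_at_filter exp_inv_poly_def)
  from r l have "((%t. exp_inv_poly p t / t) \<longlongrightarrow> 0) (at 0)" using filterlim_at_split by blast
  thus ?thesis using 3 by (simp add: has_field_derivative_iff exp_inv_poly_def)
 qed
qed

lemma C_k_exp_inv_poly: "C_k k (%x. exp_inv_poly p (a * x $ i + b))"
proof (induction k arbitrary: p)
 case 0
 have "continuous_on UNIV (exp_inv_poly p)"
  using exp_inv_poly_has_derivative DERIV_isCont continuous_at_imp_continuous_on by blast
 thus ?case
  by (auto intro!: continuous_on_compose2[of UNIV "exp_inv_poly p"] continuous_intros)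
next
 case (Suc k)
 let ?q = "[:0, 0, 1:] * (p - pderiv p)"
 have d: "((%x. exp_inv_poly p (a * x $ i + b)) has_derivative
   (%v. exp_inv_poly ?q (a * x $ i + b) * (a * v $ i))) (at x)" for x :: "real^2"
 proof (rule has_derivative_compose[where f="%x. a * x $ i + b" and g="exp_inv_poly p" and
    f'="%v. a * v $ i" and g'="%v. exp_inv_poly ?q (a * x $ i + b) * v"])
  show "((%x. a * x $ i + b) has_derivative (%v. a * v $ i)) (at x)"
   by (auto intro!: derivative_eq_intros bounded_linear.has_derivative[OF bounded_linear_vec_nth])
  show "(exp_inv_poly p has_derivative (%v. exp_inv_poly ?q (a * x $ i + b) * v)) (at (a * x $ i + b))"
   by (rule exp_inv_poly_has_derivative[unfolded has_field_derivative_def])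
 qed
 have "pd j (%x. exp_inv_poly p (a * x $ i + b)) = (%x. (if i = j then a else 0) * exp_inv_poly ?q (a * x $ i + b))" for j
  using partial_deriv_eq[OF d] by (auto simp: axis_def)
 moreover have "(%x. exp_inv_poly p (a * x $ i + b)) differentiable (at x)" for x :: "real^2"
  using d differentiable_def by blast
 ultimately show ?case
  by (auto intro!: C_k_mult C_k_const Suc)
qed

text \<open>A product of four factors exp(-1/(n d)), with d the distance to one side of the box. The
  parameter \<open>n\<close> steepens the factors, so that the bumps tend to the indicator of the
  open box while their support stays the same closed box.\<close>

definition box_bump :: "real^2 => real^2 => real => real^2 => real" where
 "box_bump a b n x = (exp_inv_poly 1 (n * x $ 1 + - n * a $ 1) * exp_inv_poly 1 (- n * x $ 1 + n * b $ 1)) *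
  (exp_inv_poly 1 (n * x $ 2 + - n * a $ 2) * exp_inv_poly 1 (- n * x $ 2 + n * b $ 2))"

lemma C_k_box_bump: "C_k k (box_bump a b n)"
 unfolding box_bump_def by (intro C_k_mult C_k_exp_inv_poly)

lemma exp_inv_poly_1_bounds: "0 <= exp_inv_poly 1 t" "exp_inv_poly 1 t <= 1"
 and exp_inv_poly_1_pos: "exp_inv_poly 1 t ~= 0 \<longleftrightarrow> 0 < t"
 by (auto simp: exp_inv_poly_def)

lemma box_bump_bounds: "0 <= box_bump a b n x" "box_bump a b n x <= 1"
 unfolding box_bump_def by (auto intro!: mult_nonneg_nonneg mult_le_one exp_inv_poly_1_bounds)

lemma mem_box_2: "(x::real^2) : box a b \<longleftrightarrow> a $ 1 < x $ 1 & x $ 1 < b $ 1 & a $ 2 < x $ 2 & x $ 2 < b $ 2"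
 by (auto simp: mem_box_cart forall_2)

lemma box_bump_nonzero: "0 < n ==> box_bump a b n x ~= 0 \<longleftrightarrow> x : box a b"
 unfolding box_bump_def mem_box_2 using exp_inv_poly_1_pos by (auto simp: mult_less_cancel_left)

lemma box_bump_tendsto_indicator:
 "(%n. box_bump a b (real (Suc n)) x) \<longlonglongrightarrow> ind (box a b) x"
proof (cases "x : box a b")
 case False
 thus ?thesis using box_bump_nonzero[of "real (Suc _)" a b x] by (simp add: indicator_def) 
next
 case True
 have one: "(%n. exp_inv_poly 1 (real (Suc n) * t)) \<longlonglongrightarrow> 1" if "0 < t" for t
 proof -
  have "(%n. exp (- (1 / t * (1 / real (Suc n))))) \<longlonglongrightarrow> exp (- (1 / t * 0))"
   by (intro tendsto_intros LIMSEQ_Suc[OF lim_1_over_n])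
  moreover have "exp (- (1 / t * (1 / real (Suc n)))) = exp_inv_poly 1 (real (Suc n) * t)" for n
   using that by (simp add: exp_inv_poly_def mult.commute del: of_nat_Suc)
  ultimately show ?thesis by simp
 qed
 have "(%n. box_bump a b (real (Suc n)) x) \<longlonglongrightarrow> (1 * 1) * (1 * 1)" unfolding box_bump_def
  using True one[of "x $ 1 - a $ 1"] one[of "b $ 1 - x $ 1"] one[of "x $ 2 - a $ 2"] one[of "b $ 2 - x $ 2"]
  by (intro tendsto_mult) (auto simp: mem_box_2 algebra_simps)
 thus ?thesis using True by simp
qed

section \<open>Test functions\<close>

lemma tf_C_k: "test_function D ph ==> C_k k ph"
 by (simp add: test_function_def)

text \<open>Any compact superset of the nonzero points certifies the support condition, so closures
  need not be computed.\<close>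

lemma test_functionI:
 assumes "!!k. C_k k ph" "compact K" "K \<subseteq> D" "!!x. x \<notin> K ==> ph x = 0"
 shows "test_function D ph"
proof -
 have "closure {x. ph x ~= 0} \<subseteq> K" using assms(4) by (intro closure_minimal compact_imp_closed assms(2)) blast
 moreover have "compact (closure {x. ph x ~= 0})"
  using compact_Int_closed[OF assms(2), of "closure {x. ph x ~= 0}"] calculation by (simp add: inf.absorb2)
 ultimately show ?thesis
  using assms(1,3) unfolding test_function_def by blast
qed

lemma test_functionE:
 assumes "test_function D ph"
 obtains K where "compact K" "K \<subseteq> D" "ALL x. x \<notin> K --> ph x = 0"
proof 
 show "compact (closure {x. ph x ~= 0})" "closure {x. ph x ~= 0} \<subseteq> D" using assms by (auto simp: test_function_def)
 show "ALL x. x \<notin> closure {x. ph x ~= 0} --> ph x = 0" using closure_subset[of "{x. ph x ~= 0}"] by blast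
qed

lemma test_function_box_bump:
 assumes "0 < n" "cbox a b \<subseteq> D"
 shows "test_function D (box_bump a b n)"
 using assms box_bump_nonzero[OF assms(1), of a b] box_subset_cbox[of a b]
 by (intro test_functionI[of _ "cbox a b"] C_k_box_bump) auto

lemma tf_differentiable:
 "test_function D ph ==> ph differentiable (at x)"
 using tf_C_k[of D ph "Suc 0"] by simp

lemma tf_continuous: "test_function D ph ==> continuous_on A ph"
 by (rule continuous_on_subset[OF C_k_imp_continuous[OF tf_C_k[of D ph 0]]]) auto

lemma tf_partial:
 assumes "test_function D ph"
 shows "test_function D (pd i ph)"
proof -
 obtain K where K: "compact K" "K \<subseteq> D" "ALL x. x \<notin> K --> ph x = 0"
  using test_functionE[OF assms] by metis
 have "pd i ph x = 0" if "x \<notin> K" for x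
 proof -
  have "((%x. 0) has_derivative (%v. 0)) (at x)" by simp
  hence "(ph has_derivative (%v. 0)) (at x)"
   by (rule has_derivative_transform_within_open[where s="- K"])
    (use K that in \<open>auto dest: compact_imp_closed\<close>)
  thus ?thesis using partial_deriv_eq by blast
 qed
 moreover have "C_k k (pd i ph)" for k
  using tf_C_k[OF assms, of "Suc k"] by simp
 ultimately show ?thesis using K by (intro test_functionI[where K=K]) auto
qed

lemma tf_cmult:
 assumes "test_function D ph"
 shows "test_function D (%x. c * ph x)"
proof -
 obtain K where K: "compact K" "K \<subseteq> D" "ALL x. x \<notin> K --> ph x = 0"
  using test_functionE[OF assms] by metis
 show ?thesis
  by (rule test_functionI[of _ K]) (use K in \<open>auto intro!: C_k_mult C_k_const tf_C_k[OF assms]\<close>)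
qed

lemma tf_bounded:
 assumes "test_function D ph"
 obtains B where "0 < B" "!!x. \<bar>ph x\<bar> <= B"
proof -
 obtain K where K: "compact K" "K \<subseteq> D" "ALL x. x \<notin> K --> ph x = 0"
  using test_functionE[OF assms] by metis
 have "bounded (ph ` K)" using compact_continuous_image[OF tf_continuous[OF assms] K(1)] compact_imp_bounded by blast
 then obtain B where "0 < B" "!!x. x : K ==> \<bar>ph x\<bar> <= B" by (auto simp: bounded_pos)
 thus ?thesis using that[of B] K(3) by (metis abs_zero less_imp_le)
qed

lemma has_derivative_partials:
 fixes v :: "real^2"
 assumes "(ph has_derivative ph') (at x)"
 shows "ph' v = (SUM i:UNIV. v $ i * pd i ph x)"
proof -
 have lin: "linear ph'" using assms has_derivative_linear by blast
 have "ph' v = ph' (SUM i:UNIV. v $ i *\<^sub>R axis i 1)" using basis_expansion[of v] by (simp add: scalar_mult_eq_scaleR)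
 also have "... = (SUM i:UNIV. v $ i * pd i ph x)"
  by (simp add: linear_sum[OF lin] linear_scale[OF lin] partial_deriv_eq[OF assms])
 finally show ?thesis .
qed

lemma has_derivative_gradient:
 assumes "(ph has_derivative ph') (at x)"
 shows "ph' v = gradient ph x \<bullet> v"
 using has_derivative_partials[OF assms, of v] by (simp add: inner_vec_def gradient_def mult.commute)

lemma C1_lipschitz:
 assumes "ALL x. ph differentiable (at x)" "!!x. norm (gradient ph x) <= B"
 shows "\<bar>ph x - ph y\<bar> <= B * norm (x - y)"
proof -
 have "norm (ph x - ph y) <= B * norm (x - y)"
 proof (rule differentiable_bound[OF convex_UNIV])
  show "(ph has_derivative frechet_derivative ph (at x)) (at x within UNIV)" for x
   using assms(1) by (simp add: frechet_derivative_works)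
  show "onorm (frechet_derivative ph (at x)) <= B" for x
  proof (rule onorm_le)
   fix v
   have "norm (frechet_derivative ph (at x) v) = \<bar>gradient ph x \<bullet> v\<bar>"
    using has_derivative_gradient[of ph "frechet_derivative ph (at x)" x v] assms(1) by (simp add: frechet_derivative_works)
   also have "... <= norm (gradient ph x) * norm v" by (rule Cauchy_Schwarz_ineq2)
   also have "... <= B * norm v" using assms(2) by (intro mult_right_mono) auto
   finally show "norm (frechet_derivative ph (at x) v) <= B * norm v" .
  qed
 qed auto
 thus ?thesis by simp
qed

lemma tf_gradient_bounded:
 assumes "test_function D ph"
 obtains B where "0 < B" "!!x. norm (gradient ph x) <= B"
proof -
 obtain B1 where B1: "0 < B1" "!!x. \<bar>pd 1 ph x\<bar> <= B1"
  using tf_bounded[OF tf_partial[OF assms]] by metis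
 obtain B2 where B2: "0 < B2" "!!x. \<bar>pd 2 ph x\<bar> <= B2"
  using tf_bounded[OF tf_partial[OF assms]] by metis
 have "norm (gradient ph x) <= B1 + B2" for x
  using norm_le_l1_cart[of "gradient ph x"] B1(2)[of x] B2(2)[of x] by (simp add: gradient_def sum_2)
 thus ?thesis using that[of "B1 + B2"] B1 B2 by simp
qed

lemma tf_lipschitz:
 assumes "test_function D ph"
 obtains L where "0 < L" "!!x y. \<bar>ph x - ph y\<bar> <= L * norm (x - y)"
proof -
 obtain B where B: "0 < B" "!!x. norm (gradient ph x) <= B"
  using tf_gradient_bounded[OF assms] by metis
 thus ?thesis
  using that[of B] C1_lipschitz[of ph B] tf_differentiable[OF assms] by auto
qed


section \<open>Weak derivatives are unique\<close>

lemma continuous_imp_lebesgue_measurable: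
 fixes f :: "'a::euclidean_space => real"
 assumes "continuous_on UNIV f"
 shows "f : borel_measurable lebesgue"
 using borel_measurable_continuous_onI[OF assms] by (intro measurable_completion) simp

text \<open>The densities of the positive and of the negative part agree on open boxes. Boxes are
  stable under intersection and generate the Borel sets, so the two finite measures coincide, and
  densities of a finite measure are unique almost everywhere.\<close>

lemma AE_zero_if_box_integrals_zero:
 fixes G :: "'a::euclidean_space => real"
 assumes G: "integrable lborel G" and zero: "!!c d. (LBINT x. ind (box c d) x * G x) = 0"
 shows "AE x in lborel. G x = 0"
proof -
 have [measurable]: "G : bmeas" using G by auto
 have eq: "emeasure (density lborel (%x. ennreal (G x))) (box c d) =
   emeasure (density lborel (%x. ennreal (- G x))) (box c d)" for c d
 proof -
  have int: "L1 (%x. max 0 (G x) * ind (box c d) x)"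
    "L1 (%x. max 0 (- G x) * ind (box c d) x)"
   using G by (auto intro!: integrable_real_mult_indicator)
  have "(LBINT x. max 0 (G x) * ind (box c d) x) - (LBINT x. max 0 (- G x) * ind (box c d) x)
    = (LBINT x. ind (box c d) x * G x)"
   by (subst Bochner_Integration.integral_diff[symmetric, OF int])
    (auto intro!: Bochner_Integration.integral_cong simp: indicator_def)
  hence *: "(LBINT x. max 0 (G x) * ind (box c d) x) = (LBINT x. max 0 (- G x) * ind (box c d) x)"
   by (simp add: zero)
  have "emeasure (density lborel (%x. ennreal (G x))) (box c d) = NI (%x. ennreal (max 0 (G x) * ind (box c d) x))"
   by (auto simp: emeasure_density max_def indicator_def ennreal_neg intro!: nn_integral_cong)
  also have "... = ennreal (LBINT x. max 0 (G x) * ind (box c d) x)" by (rule nn_integral_eq_integral[OF int(1)]) auto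
  also have "... = NI (%x. ennreal (max 0 (- G x) * ind (box c d) x))"
   unfolding * by (rule nn_integral_eq_integral[OF int(2), symmetric]) auto
  also have "... = emeasure (density lborel (%x. ennreal (- G x))) (box c d)"
   by (auto simp: emeasure_density max_def indicator_def ennreal_neg intro!: nn_integral_cong)
  finally show ?thesis .
 qed
 have fin: "NI (%x. ennreal (G x)) ~= \<infinity>" using G by (auto simp: real_integrable_def)
 have "density lborel (%x. ennreal (G x)) = density lborel (%x. ennreal (- G x))"
 proof (rule measure_eqI_generator_eq)
  let ?E = "range (%(a, b). box a b::'a set)"
  show "Int_stable ?E" by (auto simp: Int_stable_def box_Int_box)
  show "?E \<subseteq> Pow UNIV" "sets (density lborel (%x. ennreal (G x))) = sigma_sets UNIV ?E"
    "sets (density lborel (%x. ennreal (- G x))) = sigma_sets UNIV ?E"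
   by (simp_all add: borel_eq_box)
  let ?A = "%n::nat. box (- (real n *\<^sub>R One)) (real n *\<^sub>R One) :: 'a set"
  show "range ?A \<subseteq> ?E" "(\<Union>i. ?A i) = UNIV" unfolding UN_box_eq_UNIV by auto
  have "emeasure (density lborel (%x. ennreal (G x))) A <= NI (%x. ennreal (G x))"
   if "A : sets borel" for A
   using that by (auto simp: emeasure_density indicator_def intro!: nn_integral_mono)
  thus "emeasure (density lborel (%x. ennreal (G x))) (?A i) ~= \<infinity>" for i
   using fin by (metis borel_open open_box infinity_ennreal_def top.extremum_uniqueI)
 qed (use eq in auto)
 hence "AE x in lborel. ennreal (G x) = ennreal (- G x)"
  by (subst (asm) finite_density_unique) (use fin in auto)
 thus ?thesis
 proof (rule AE_mp, intro AE_I2 impI)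
  fix x assume "ennreal (G x) = ennreal (- G x)"
  thus "G x = 0"
   by (cases "0 <= G x") (auto simp: ennreal_neg ennreal_eq_0_iff dest!: sym[of 0])
 qed
qed

text \<open>An open set is a countable union of closed boxes, and the faces of each box are null;
  hence a property may be checked on open boxes whose closure lies in \<open>D\<close>.\<close>

lemma AE_zero_on_open:
 fixes D :: "'a::euclidean_space set"
 assumes "open D" "!!a b. cbox a b \<subseteq> D ==> AE x in lebesgue. x : box a b --> P x"
 shows "AE x in lebesgue_on D. P x"
proof -
 obtain \<D> where \<D>: "countable \<D>" "!!X. X : \<D> ==> X \<subseteq> D"
   "!!X. X : \<D> ==> EX a b. X = cbox a b" "\<Union>\<D> = D"
  using open_countable_Union_open_cbox[OF \<open>open D\<close>] by (metis PowD subsetD)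
 have null: "AE x in lebesgue. x : X --> P x" if X: "X : \<D>" for X
 proof -
  obtain a b where ab: "X = cbox a b" using \<D>(3)[OF X] by blast
  have "AE x in lebesgue. x \<notin> cbox a b - box a b"
   by (intro AE_not_in) (simp add: negligible_iff_null_sets[symmetric] negligible_frontier_interval)
  thus ?thesis using assms(2)[of a b] \<D>(2)[OF X] ab by auto
 qed
 have "AE x in lebesgue. ALL X:\<D>. x : X --> P x" using \<D>(1) null by (subst AE_ball_countable) auto
 thus ?thesis
  using \<D>(4) \<open>open D\<close> by (subst AE_restrict_space_iff) (auto elim!: AE_mp)
qed

text \<open>Bumps tending to the indicator of a box are test functions, so by dominated convergence
  the integral of \<open>g\<close> vanishes over every open box whose closure lies in
  \<open>D\<close>.\<close>

lemma fundamental_lemma: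
 assumes D: "open D" and loc: "locally_integrable D g"
  and zero: "!!ph. test_function D ph ==> (LINT x|lebesgue_on D. g x * ph x) = 0"
 shows "AE x in lebesgue_on D. g x = 0"
proof (rule AE_zero_on_open[OF D])
 fix a b assume ab: "cbox a b \<subseteq> D"
 define G where "G x = ind (cbox a b) x * g x" for x
 have G: "integrable lebesgue G" using loc ab by (auto simp: locally_integrable_def set_integrable_def G_def[abs_def])
 have box0: "(LINT x|lebesgue. ind (box c d) x * G x) = 0" if cd: "cbox c d \<subseteq> cbox a b" for c d
 proof -
  let ?s = "%n x. box_bump c d (real (Suc n)) x * G x"
  have meas: "box_bump c d n : borel_measurable lebesgue" for n
   by (rule continuous_imp_lebesgue_measurable[OF C_k_imp_continuous[OF C_k_box_bump[of 0]]])
  have "(%n. LINT x|lebesgue. ?s n x) \<longlonglongrightarrow> (LINT x|lebesgue. ind (box c d) x * G x)"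
  proof (rule integral_dominated_convergence[where w="%x. \<bar>G x\<bar>"])
   show "(%x. ind (box c d) x * G x) : borel_measurable lebesgue"
    using G by (auto intro!: borel_measurable_times borel_measurable_indicator)
   show "?s n : borel_measurable lebesgue" for n
    using G by (intro borel_measurable_times meas) auto
   show "AE x in lebesgue. (%n. ?s n x) \<longlonglongrightarrow> ind (box c d) x * G x"
    by (intro AE_I2 tendsto_mult box_bump_tendsto_indicator tendsto_const)
   show "AE x in lebesgue. norm (?s n x) <= \<bar>G x\<bar>" for n
    using box_bump_bounds by (auto simp: abs_mult mult_left_le_one_le)
  qed (use G in auto)
  moreover have "(LINT x|lebesgue. ?s n x) = 0" for n
  proof -
   have "(LINT x|lebesgue. ?s n x) = (LINT x|lebesgue. ind D x *\<^sub>R (g x * box_bump c d (real (Suc n)) x))"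
    using cd ab box_bump_nonzero[of "real (Suc n)" c d] box_subset_cbox[of c d]
    by (intro Bochner_Integration.integral_cong) (auto simp: G_def indicator_def)
   also have "... = (LINT x|lebesgue_on D. g x * box_bump c d (real (Suc n)) x)"
    using D by (subst integral_restrict_space) auto
   also have "... = 0" using cd ab by (intro zero test_function_box_bump) auto
   finally show ?thesis .
  qed
  ultimately show ?thesis by (simp add: LIMSEQ_const_iff)
 qed
 \<comment> \<open>The uniqueness result for box integrals is about Borel functions;
   \<open>g'\<close> is a Borel representative of \<open>G\<close>.\<close>
 obtain g' where g'[measurable]: "g' : borel_measurable lborel" and ae: "AE x in lborel. G x = g' x"
  using completion_ex_borel_measurable_real G by blast
 have ae': "AE x in lebesgue. G x = g' x" using ae by (rule AE_completion)
 have g'_leb: "g' : borel_measurable lebesgue" using g' by (rule measurable_completion)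
 have "integrable lebesgue g'" by (rule integrable_cong_AE_imp[OF G g'_leb ae'])
 hence int: "integrable lborel g'"
  using integrable_completion[OF g'] by simp
 let ?h = "%x. ind (box a b) x * g' x"
 have "AE x in lborel. ?h x = 0"
 proof (rule AE_zero_if_box_integrals_zero)
  show "integrable lborel ?h" using integrable_real_mult_indicator[of "box a b" lborel g'] int by (simp add: mult.commute)
  fix c d
  \<comment> \<open>All boxes must be tested, not only those inside \<open>box a b\<close>; cutting
    with \<open>box a b\<close> gives a box again, possibly an empty one.\<close>
  obtain c' d' where cd': "box c d \<inter> box a b = box c' d'" "cbox c' d' \<subseteq> cbox a b"
  proof
   show "box c d \<inter> box a b = box (SUM i:Basis. max (c \<bullet> i) (a \<bullet> i) *\<^sub>R i) (SUM i:Basis. min (d \<bullet> i) (b \<bullet> i) *\<^sub>R i)"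
    by (rule box_Int_box)
  qed (auto simp: mem_box)
  have "(LBINT x. ind (box c d) x * ?h x) = (LBINT x. ind (box c' d') x * g' x)"
   unfolding cd'(1)[symmetric] by (intro Bochner_Integration.integral_cong) (auto simp: indicator_def)
  also have "... = (LINT x|lebesgue. ind (box c' d') x * g' x)" by (rule integral_completion[symmetric]) measurable
  also have "... = (LINT x|lebesgue. ind (box c' d') x * G x)"
   using G by (intro integral_cong_AE) (use ae' in \<open>auto intro!: borel_measurable_times borel_measurable_indicator measurable_completion[OF g']\<close>)
  finally show "(LBINT x. ind (box c d) x * ?h x) = 0" using box0[OF cd'(2)] by simp
 qed
 hence "AE x in lebesgue. ?h x = 0" by (rule AE_completion)
 thus "AE x in lebesgue. x : box a b --> g x = 0"
  using ae' by eventually_elim (use box_subset_cbox[of a b] in \<open>auto simp: G_def indicator_def split: if_splits\<close>)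
qed

lemma set_integrable_mult_test_function:
 assumes "locally_integrable D v" "test_function D ph" "open D"
 shows "integrable (lebesgue_on D) (%x. v x * ph x)"
proof -
 obtain K where K: "compact K" "K \<subseteq> D" "ALL x. x \<notin> K --> ph x = 0"
  using test_functionE[OF assms(2)] by metis
 obtain B where B: "0 < B" "!!x. \<bar>ph x\<bar> <= B"
  using tf_bounded[OF assms(2)] by metis
 have v: "integrable lebesgue (%x. ind K x *\<^sub>R v x)"
  using assms(1) K by (auto simp: locally_integrable_def set_integrable_def)
 have ph_leb: "ph : borel_measurable lebesgue" by (rule continuous_imp_lebesgue_measurable[OF tf_continuous[OF assms(2)]])
 have "integrable lebesgue (%x. (ind K x *\<^sub>R v x) * ph x)"
 proof (rule Bochner_Integration.integrable_bound[OF integrable_mult_right[OF v, of B]])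
  show "AE x in lebesgue. norm (ind K x *\<^sub>R v x * ph x) <= norm (B * ind K x *\<^sub>R v x)"
   using B by (intro AE_I2) (auto simp: abs_mult indicator_def mult.commute[of _ "ph _"] intro!: mult_right_mono)
 qed (use v ph_leb in auto)
 also have "(%x. (ind K x *\<^sub>R v x) * ph x) = (%x. ind D x *\<^sub>R (v x * ph x))"
  using K by (auto simp: indicator_def fun_eq_iff)
 finally show ?thesis using assms(3) by (subst integrable_restrict_space) auto
qed

lemma locally_integrable_diff:
 assumes "locally_integrable D v" "locally_integrable D w"
 shows "locally_integrable D (%x. v x - w x)"
 using assms by (simp add: locally_integrable_def set_integral_diff)

lemma weak_deriv_unique:
 assumes "open D" "is_weak_deriv D i v g" "is_weak_deriv D i v g'"
 shows "AE x in lebesgue_on D. g x = g' x"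
proof -
 have loc: "locally_integrable D g" "locally_integrable D g'" using assms by (auto simp: is_weak_deriv_def)
 have "AE x in lebesgue_on D. g x - g' x = 0"
 proof (rule fundamental_lemma[OF assms(1) locally_integrable_diff[OF loc]])
  fix ph assume ph: "test_function D ph"
  have "(LINT x|lebesgue_on D. v x * pd i ph x) = - (LINT x|lebesgue_on D. g x * ph x)"
    "(LINT x|lebesgue_on D. v x * pd i ph x) = - (LINT x|lebesgue_on D. g' x * ph x)"
   using assms(2,3) ph unfolding is_weak_deriv_def by auto
  hence eq: "(LINT x|lebesgue_on D. g x * ph x) = (LINT x|lebesgue_on D. g' x * ph x)" by simp
  have "(LINT x|lebesgue_on D. (g x - g' x) * ph x) =
    (LINT x|lebesgue_on D. g x * ph x) - (LINT x|lebesgue_on D. g' x * ph x)"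
   unfolding left_diff_distrib by (intro Bochner_Integration.integral_diff set_integrable_mult_test_function ph loc assms)
  also have "... = 0" using eq by simp
  finally show "(LINT x|lebesgue_on D. (g x - g' x) * ph x) = 0" .
 qed
 thus ?thesis by simp
qed

text \<open>This ties the arbitrary choice in \<open>weak_deriv\<close> to any concrete weak
  derivative at hand.\<close>

lemma weak_deriv_eq:
 assumes "open D" "is_weak_deriv D i v g"
 shows "AE x in lebesgue_on D. weak_deriv D i v x = g x"
 using weak_deriv_unique[OF assms(1) someI[of "is_weak_deriv D i v", OF assms(2)] assms(2)] by (simp add: weak_deriv_def)

lemma is_weak_deriv_weak_deriv:
 "is_weak_deriv D i v g ==> is_weak_deriv D i v (weak_deriv D i v)"
 unfolding weak_deriv_def by (rule someI[of "is_weak_deriv D i v"])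


section \<open>Integration by parts for Lipschitz functions\<close>

lemma lborel_integral_translate:
 fixes f :: "'a::euclidean_space => real"
 assumes "f : bmeas"
 shows "(LBINT x. f (x + c)) = (LBINT x. f x)"
proof -
 have "(LBINT x. f x) = (LINT x|distr lborel borel ((+) c). f x)" by (simp add: lborel_distr_plus)
 also have "... = (LBINT x. f (c + x))" using assms by (subst integral_distr) auto
 finally show ?thesis by (simp add: add.commute)
qed

lemma lipschitz_imp_continuous:
 fixes f :: "'a::real_normed_vector => real"
 assumes "!!x y. \<bar>f x - f y\<bar> <= L * norm (x - y)"
 shows "continuous_on A f"
proof -
 have "\<bar>L\<bar>-lipschitz_on A f"
 proof (rule lipschitz_onI)
  fix x y
  show "dist (f x) (f y) <= \<bar>L\<bar> * dist x y"
   using order_trans[OF assms[of x y] mult_right_mono[OF abs_ge_self norm_ge_zero]] by (simp add: dist_norm)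
 qed simp
 thus ?thesis by (rule lipschitz_on_continuous_on)
qed

text \<open>Moving the difference quotient from \<open>w\<close> to \<open>k\<close> by translation invariance and
 dominated convergence avoids Fubini and line integrals.\<close>

lemma lipschitz_integration_by_parts:
 fixes w k w' k' :: "'a::euclidean_space => real"
 assumes w: "!!x y. \<bar>w x - w y\<bar> <= L * norm (x - y)"
  and k: "!!x y. \<bar>k x - k y\<bar> <= M * norm (x - y)"
  and supp: "!!x. R < norm x ==> w x = 0"
  and wB: "!!x. \<bar>w x\<bar> <= A" and kB: "!!x. \<bar>k x\<bar> <= B"
  and [measurable]: "w' : bmeas" "k' : bmeas"
  and dw: "AE x in lborel. ((%t. (w (x + t *\<^sub>R e) - w x) / t) \<longlongrightarrow> w' x) (at 0)"
  and dk: "AE x in lborel. ((%t. (k (x + t *\<^sub>R e) - k x) / t) \<longlongrightarrow> k' x) (at 0)"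
 shows "L1 (%x. w' x * k x)" "L1 (%x. w x * k' x)"
  "(LBINT x. w' x * k x) = - (LBINT x. w x * k' x)"
proof -
 have [measurable]: "w : bmeas" "k : bmeas" using lipschitz_imp_continuous[OF w] lipschitz_imp_continuous[OF k]
  by (auto intro: borel_measurable_continuous_onI)
 have A0: "0 <= A" and B0: "0 <= B" using wB[of 0] kB[of 0] by auto
 define t where "t n = 1 / real (Suc n)" for n
 have t0: "t n ~= 0" "\<bar>t n\<bar> <= 1" "\<bar>t n\<bar> > 0" for n by (auto simp: t_def)
 have t_lim: "filterlim t (at 0) sequentially" "filterlim (%n. - t n) (at 0) sequentially"
 proof -
  have "t \<longlonglongrightarrow> 0" unfolding t_def by (rule LIMSEQ_Suc[OF lim_1_over_n])
  moreover from tendsto_minus[OF this] have "(%n. - t n) \<longlonglongrightarrow> 0" by simp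
  ultimately show "filterlim t (at 0) sequentially" "filterlim (%n. - t n) (at 0) sequentially"
   using t0 by (auto simp: filterlim_at)
 qed
 define a where "a n x = (w (x + t n *\<^sub>R e) - w x) / t n * k x" for n x
 define b where "b n x = w x * ((k (x + (- t n) *\<^sub>R e) - k x) / (- t n))" for n x
 define C1 where "C1 = \<bar>L\<bar> * norm e * B"
 define C2 where "C2 = A * (\<bar>M\<bar> * norm e)"
 \<comment> \<open>The translates move points by at most |t n| |e|, and |t n| is at most 1; this
   ball therefore contains all points where a difference quotient is nonzero.\<close>
 let ?I = "%x::'a. ind (cball 0 (\<bar>R\<bar> + norm e)) x :: real"
 have fin: "emeasure lborel (cball (0::'a) (\<bar>R\<bar> + norm e)) < \<infinity>"
  using emeasure_bounded_finite bounded_cball by blast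
 have intI: "L1 (%x. C * ?I x)" for C
  using fin by (auto intro!: integrable_mult_right integrable_real_indicator)
 have quot: "\<bar>(f (x + s *\<^sub>R e) - f x) / s\<bar> <= \<bar>N\<bar> * norm e"
  if "!!x y. \<bar>f x - f y\<bar> <= N * norm (x - y)" "s ~= 0" for f :: "'a => real" and N s x
 proof -
  have "\<bar>f (x + s *\<^sub>R e) - f x\<bar> <= \<bar>N\<bar> * (\<bar>s\<bar> * norm e)"
   using order_trans[OF that(1)[of "x + s *\<^sub>R e" x] mult_right_mono[OF abs_ge_self norm_ge_zero]] by simp
  thus ?thesis using that(2) by (simp add: abs_divide field_simps)
 qed
 have a_bound: "norm (a n x) <= C1 * ?I x" for n x
 proof (cases "norm x <= \<bar>R\<bar> + norm e")
  case True
  have "norm (a n x) <= (\<bar>L\<bar> * norm e) * B" unfolding a_def real_norm_def abs_mult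
   by (intro mult_mono quot[OF w] kB t0) auto
  thus ?thesis using True by (simp add: C1_def)
 next
  case False
  have "norm x <= norm (x + t n *\<^sub>R e) + \<bar>t n\<bar> * norm e"
   using norm_triangle_ineq4[of "x + t n *\<^sub>R e" "t n *\<^sub>R e"] by simp
  also have "\<bar>t n\<bar> * norm e <= 1 * norm e" using t0 by (intro mult_right_mono) auto
  finally have "R < norm (x + t n *\<^sub>R e)" "R < norm x" using False norm_ge_zero[of e] by linarith+
  thus ?thesis using False by (simp add: a_def supp)
 qed
 have b_bound: "norm (b n x) <= C2 * ?I x" for n x
 proof (cases "norm x <= \<bar>R\<bar> + norm e")
  case True
  have "norm (b n x) <= A * (\<bar>M\<bar> * norm e)" unfolding b_def real_norm_def abs_mult
   by (intro mult_mono quot[OF k] wB A0) (use t0 in auto)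
  thus ?thesis using True by (simp add: C2_def)
 next
  case False
  hence "R < norm x" using norm_ge_zero[of e] by linarith
  thus ?thesis using False by (simp add: b_def supp)
 qed
 have a_lim: "AE x in lborel. (%n. a n x) \<longlonglongrightarrow> w' x * k x" using dw by eventually_elim
   (unfold a_def, intro tendsto_mult tendsto_const filterlim_compose[OF _ t_lim(1)])
 have b_lim: "AE x in lborel. (%n. b n x) \<longlonglongrightarrow> w x * k' x" using dk by eventually_elim
   (unfold b_def, intro tendsto_mult tendsto_const filterlim_compose[OF _ t_lim(2)])
 have [measurable]: "a n : bmeas" "b n : bmeas" for n
  unfolding a_def b_def by measurable
 show "L1 (%x. w' x * k x)" by (rule integrable_dominated_convergence[where w="%x. C1 * ?I x" and s=a])
   (use intI a_lim a_bound in auto)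
 show "L1 (%x. w x * k' x)" by (rule integrable_dominated_convergence[where w="%x. C2 * ?I x" and s=b])
   (use intI b_lim b_bound in auto)
 have limA: "(%n. LBINT x. a n x) \<longlonglongrightarrow> (LBINT x. w' x * k x)"
  by (rule integral_dominated_convergence[where w="%x. C1 * ?I x"])
   (use intI a_lim a_bound in auto)
 have limB: "(%n. LBINT x. b n x) \<longlonglongrightarrow> (LBINT x. w x * k' x)"
  by (rule integral_dominated_convergence[where w="%x. C2 * ?I x"])
   (use intI b_lim b_bound in auto)
 have "(LBINT x. a n x) = - (LBINT x. b n x)" for n
 proof -
  have wk: "L1 (%x. w (x + s *\<^sub>R e) * k (x + r *\<^sub>R e))" if "\<bar>s\<bar> <= 1" for s r
  proof (rule Bochner_Integration.integrable_bound[OF intI[of "A * B"]])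
   show "AE x in lborel. norm (w (x + s *\<^sub>R e) * k (x + r *\<^sub>R e)) <= norm (A * B * ?I x)"
   proof (intro AE_I2)
    fix x
    show "norm (w (x + s *\<^sub>R e) * k (x + r *\<^sub>R e)) <= norm (A * B * ?I x)"
    proof (cases "norm x <= \<bar>R\<bar> + norm e")
     case True
     thus ?thesis using wB kB A0 B0 by (auto simp: abs_mult intro!: mult_mono)
    next
     case False
     have "norm x <= norm (x + s *\<^sub>R e) + \<bar>s\<bar> * norm e"
      using norm_triangle_ineq4[of "x + s *\<^sub>R e" "s *\<^sub>R e"] by simp
     also have "\<bar>s\<bar> * norm e <= 1 * norm e" using that by (intro mult_right_mono) auto
     finally have "R < norm (x + s *\<^sub>R e)" using False by linarith
     thus ?thesis by (simp add: supp)
    qed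
   qed
  qed measurable
  have i: "L1 (%x. w (x + t n *\<^sub>R e) * k x)" "L1 (%x. w x * k x)"
    "L1 (%x. w x * k (x + (- t n) *\<^sub>R e))"
   using wk[of "t n" 0] wk[of 0 0] wk[of 0 "- t n"] t0 by auto
  have "(LBINT x. a n x) = (LBINT x. w (x + t n *\<^sub>R e) * k x - w x * k x) / t n"
   unfolding a_def by (subst integral_divide_zero[symmetric])
    (auto intro!: Bochner_Integration.integral_cong simp: field_simps)
  also have "(LBINT x. w (x + t n *\<^sub>R e) * k x - w x * k x) =
    (LBINT x. w (x + t n *\<^sub>R e) * k x) - (LBINT x. w x * k x)"
   by (rule Bochner_Integration.integral_diff[OF i(1,2)])
  also have "(LBINT x. w (x + t n *\<^sub>R e) * k x) = (LBINT x. w x * k (x + (- t n) *\<^sub>R e))"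
   using lborel_integral_translate[of "%x. w x * k (x + (- t n) *\<^sub>R e)" "t n *\<^sub>R e"] by simp
  also have "... - (LBINT x. w x * k x) = (LBINT x. w x * k (x + (- t n) *\<^sub>R e) - w x * k x)"
   by (rule Bochner_Integration.integral_diff[OF i(3,2), symmetric])
  also have "... / t n = - (LBINT x. b n x)"
   unfolding b_def by (subst integral_divide_zero[symmetric], subst integral_minus[symmetric])
    (auto intro!: Bochner_Integration.integral_cong simp: field_simps t0)
  finally show ?thesis .
 qed
 hence "(%n. - (LBINT x. b n x)) \<longlonglongrightarrow> (LBINT x. w' x * k x)" using limA by simp
 thus "(LBINT x. w' x * k x) = - (LBINT x. w x * k' x)"
  using LIMSEQ_unique tendsto_minus[OF limB] by blast
qed

lemma difference_quotient_limit:
 fixes f :: "'a::real_normed_vector => real"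
 assumes "(f has_derivative f') (at x)"
 shows "((%t. (f (x + t *\<^sub>R e) - f x) / t) \<longlongrightarrow> f' e) (at 0)"
proof -
 have lin: "linear f'" using assms has_derivative_linear by blast
 have "((%t. f (x + t *\<^sub>R e)) has_derivative (%t. f' (t *\<^sub>R e))) (at 0)"
  by (rule has_derivative_compose[where f="%t. x + t *\<^sub>R e" and g=f and g'=f' and f'="%t. t *\<^sub>R e"])
   (use assms in \<open>auto intro!: derivative_eq_intros\<close>)
 moreover have "(%t. f' (t *\<^sub>R e)) = times (f' e)" by (auto simp: linear_scale[OF lin])
 ultimately have "((%t. f (x + t *\<^sub>R e)) has_real_derivative f' e) (at 0)" by (simp add: has_field_derivative_def)
 thus ?thesis by (simp add: has_field_derivative_iff)
qed

lemma tf_difference_quotient: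
 assumes "test_function D ph"
 shows "((%t. (ph (x + t *\<^sub>R axis i 1) - ph x) / t) \<longlongrightarrow> pd i ph x) (at 0)"
 unfolding partial_deriv_def by (rule difference_quotient_limit)
  (use tf_differentiable[OF assms] in \<open>simp add: frechet_derivative_works\<close>)

lemma tf_support_bound:
 assumes "test_function D ph"
 obtains R where "!!x. R < norm x ==> ph x = 0"
proof -
 obtain K where K: "compact K" "ALL x. x \<notin> K --> ph x = 0"
  using test_functionE[OF assms] by metis
 obtain R where "ALL x:K. norm x <= R" using compact_imp_bounded[OF K(1)] bounded_iff by blast
 thus ?thesis using that[of R] K(2) by (meson not_le)
qed

text \<open>The compactly supported factor of the integration by parts is here the test function;
  \<open>w\<close> only has to be bounded and Lipschitz on the plane.\<close>

lemma lipschitz_integration_by_parts_test_function: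
 fixes w w' :: "real^2 => real"
 assumes w: "!!x y. \<bar>w x - w y\<bar> <= L * norm (x - y)"
  and wB: "!!x. \<bar>w x\<bar> <= A"
  and w': "w' : bmeas"
  and dw: "AE x in lborel. ((%t. (w (x + t *\<^sub>R axis i 1) - w x) / t) \<longlongrightarrow> w' x) (at 0)"
  and ph: "test_function D ph"
 shows "(LBINT x. w x * pd i ph x) = - (LBINT x. w' x * ph x)"
proof -
 obtain M where M: "!!x y. \<bar>ph x - ph y\<bar> <= M * norm (x - y)"
  using tf_lipschitz[OF ph] by metis
 obtain B where B: "!!x. \<bar>ph x\<bar> <= B" using tf_bounded[OF ph] by metis
 obtain R where R: "!!x. R < norm x ==> ph x = 0" using tf_support_bound[OF ph] by metis
 have "(LBINT x. pd i ph x * w x) = - (LBINT x. ph x * w' x)"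
  by (rule lipschitz_integration_by_parts(3)[where e="axis i 1", OF M w R B wB _ w' _ dw])
   (use tf_difference_quotient[OF ph] tf_continuous[OF tf_partial[OF ph], of UNIV]
   in \<open>auto intro: borel_measurable_continuous_onI\<close>)
 thus ?thesis by (simp add: mult.commute)
qed


section \<open>Mollification\<close>

text \<open>Lipschitz partial derivatives bound the remainder uniformly in the base point, which is
  what differentiation under the integral sign needs below.\<close>

lemma second_order_remainder:
 assumes ps: "test_function E ps"
 obtains M where "0 <= M"
  "!!a k. \<bar>ps (a + k) - ps a - (SUM i:UNIV. k $ i * pd i ps a)\<bar> <= M * (norm k)^2"
proof -
 have "EX L. ALL x y. \<bar>pd i ps x - pd i ps y\<bar> <= L * norm (x - y)" for i
  using tf_lipschitz[OF tf_partial[OF ps, of i]] by metis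
 then obtain L where L: "!!i x y. \<bar>pd i ps x - pd i ps y\<bar> <= L i * norm (x - y)" by metis
 define M where "M = (SUM i:UNIV. \<bar>L i\<bar>)"
 have diff: "(ps has_derivative frechet_derivative ps (at x)) (at x)" for x
  using tf_differentiable[OF ps] by (simp add: frechet_derivative_works)
 have "\<bar>ps (a + k) - ps a - (SUM i:UNIV. k $ i * pd i ps a)\<bar> <= M * (norm k)^2" for a k
 proof -
  have d: "((%t. ps (a + t *\<^sub>R k)) has_real_derivative
    (SUM i:UNIV. k $ i * pd i ps (a + t *\<^sub>R k))) (at t)" for t
  proof -
   have "((%t. ps (a + t *\<^sub>R k)) has_derivative (%s. frechet_derivative ps (at (a + t *\<^sub>R k)) (s *\<^sub>R k))) (at t)"
    by (rule has_derivative_compose[where f="%t. a + t *\<^sub>R k" and g=ps and f'="%t. t *\<^sub>R k" and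
      g'="frechet_derivative ps (at (a + t *\<^sub>R k))"]) (auto intro!: derivative_eq_intros diff)
   moreover have "(%s. frechet_derivative ps (at (a + t *\<^sub>R k)) (s *\<^sub>R k)) =
     times (SUM i:UNIV. k $ i * pd i ps (a + t *\<^sub>R k))"
    by (auto simp: has_derivative_partials[OF diff] sum_distrib_left sum_distrib_right mult_ac fun_eq_iff)
   ultimately show ?thesis by (simp add: has_field_derivative_def)
  qed
  obtain t where t: "0 < t" "t < 1"
    "ps (a + 1 *\<^sub>R k) - ps (a + 0 *\<^sub>R k) = (1 - 0) * (SUM i:UNIV. k $ i * pd i ps (a + t *\<^sub>R k))"
   using MVT2[of 0 1 "%t. ps (a + t *\<^sub>R k)", OF _ d] by auto
  have "\<bar>ps (a + k) - ps a - (SUM i:UNIV. k $ i * pd i ps a)\<bar> =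
    \<bar>SUM i:UNIV. k $ i * (pd i ps (a + t *\<^sub>R k) - pd i ps a)\<bar>"
   using t by (simp add: right_diff_distrib sum_subtractf)
  also have "... <= (SUM i:UNIV. \<bar>k $ i * (pd i ps (a + t *\<^sub>R k) - pd i ps a)\<bar>)" by (rule sum_abs)
  also have "... <= (SUM i:UNIV. norm k * (\<bar>L i\<bar> * norm k))"
  proof (rule sum_mono)
   fix i
   have "\<bar>pd i ps (a + t *\<^sub>R k) - pd i ps a\<bar> <= \<bar>L i\<bar> * norm (t *\<^sub>R k)"
    using L[of i "a + t *\<^sub>R k" a] mult_right_mono[OF abs_ge_self[of "L i"] norm_ge_zero[of "t *\<^sub>R k"]] by simp
   also have "... <= \<bar>L i\<bar> * norm k" using t by (intro mult_left_mono) (auto simp: mult_left_le_one_le)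
   finally show "\<bar>k $ i * (pd i ps (a + t *\<^sub>R k) - pd i ps a)\<bar> <= norm k * (\<bar>L i\<bar> * norm k)"
    unfolding abs_mult by (intro mult_mono component_le_norm_cart) auto
  qed
  also have "... = M * (norm k)^2" by (simp add: M_def sum_distrib_left sum_distrib_right power2_eq_square mult_ac)
  finally show ?thesis .
 qed
 moreover have "0 <= M" by (auto simp: M_def intro: sum_nonneg)
 ultimately show ?thesis using that by blast
qed

text \<open>Integral operators whose kernel is an affine reparametrisation of a test function. The
  variable \<open>x\<close> sits in the smooth kernel, so \<open>w\<close> need only be
  integrable.\<close>

definition kint :: "real => real => (real^2 => real) => (real^2 => real) => real^2 => real" where
 "kint \<alpha> \<beta> ps w x = (LBINT y. ps (\<alpha> *\<^sub>R y + \<beta> *\<^sub>R x) * w y)"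

lemma tf_measurable: "test_function E ps ==> ps : bmeas"
 by (rule borel_measurable_continuous_onI[OF tf_continuous])

lemma L1_bounded_mult:
 fixes w f :: "'a => real"
 assumes w: "integrable M w" and "f : borel_measurable M" and B: "!!x. \<bar>f x\<bar> <= B"
 shows "integrable M (%x. f x * w x)"
proof (rule Bochner_Integration.integrable_bound[OF integrable_mult_right[OF w, of B]])
 show "AE x in M. norm (f x * w x) <= norm (B * w x)"
  using B by (intro AE_I2) (simp add: abs_mult mult_right_mono[OF order_trans[OF B abs_ge_self]])
qed (use assms in auto)

lemma integrable_kernel:
 assumes ps: "test_function E ps" and w: "L1 w"
 shows "L1 (%y. ps (\<alpha> *\<^sub>R y + c) * w y)"
proof -
 obtain B where B: "!!x. \<bar>ps x\<bar> <= B" using tf_bounded[OF ps] by metis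
 have [measurable]: "ps : bmeas" by (rule tf_measurable[OF ps])
 show ?thesis by (rule L1_bounded_mult[OF w]) (use B in auto)
qed

text \<open>The second order remainder of the kernel is uniform, so integrating it against |w|
  leaves an error quadratic in y - x.\<close>

lemma kernel_integral_has_derivative:
 assumes ps: "test_function E ps" and w: "L1 w"
 shows "(kint \<alpha> \<beta> ps w has_derivative
  (%v. SUM i:UNIV. v $ i * (\<beta> * kint \<alpha> \<beta> (pd i ps) w x))) (at x)"
proof -
 obtain M where M: "0 <= M"
   "!!a k. \<bar>ps (a + k) - ps a - (SUM i:UNIV. k $ i * pd i ps a)\<bar> <= M * (norm k)^2"
  using second_order_remainder[OF ps] by metis
 define C where "C = M * \<beta>\<^sup>2 * (LBINT y. \<bar>w y\<bar>)"
 note int = integrable_kernel[OF ps w] integrable_kernel[OF tf_partial[OF ps] w]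
 let ?d = "%v. SUM i:UNIV. v $ i * (\<beta> * kint \<alpha> \<beta> (pd i ps) w x)"
 have main: "\<bar>kint \<alpha> \<beta> ps w y - kint \<alpha> \<beta> ps w x - ?d (y - x)\<bar> <= C * (norm (y - x))^2" for y
 proof -
  let ?k = "\<beta> *\<^sub>R (y - x)"
  let ?r = "%z. (ps (\<alpha> *\<^sub>R z + \<beta> *\<^sub>R y) - ps (\<alpha> *\<^sub>R z + \<beta> *\<^sub>R x)
    - (SUM i:UNIV. ?k $ i * pd i ps (\<alpha> *\<^sub>R z + \<beta> *\<^sub>R x)))"
  have eq: "?d (y - x) = (SUM i:UNIV. LBINT z. ?k $ i * (pd i ps (\<alpha> *\<^sub>R z + \<beta> *\<^sub>R x) * w z))"
   by (simp add: kint_def mult_ac) (simp only: mult.left_commute[of _ "y $ _ - x $ _"] integral_mult_right_zero)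
  have "kint \<alpha> \<beta> ps w y - kint \<alpha> \<beta> ps w x - ?d (y - x) = (LBINT z. ?r z * w z)"
  proof -
   have "(LBINT z. ?r z * w z) = (LBINT z. (ps (\<alpha> *\<^sub>R z + \<beta> *\<^sub>R y) * w z - ps (\<alpha> *\<^sub>R z + \<beta> *\<^sub>R x) * w z)
     - (SUM i:UNIV. ?k $ i * (pd i ps (\<alpha> *\<^sub>R z + \<beta> *\<^sub>R x) * w z)))"
    by (intro Bochner_Integration.integral_cong) (auto simp: algebra_simps sum_distrib_left)
   also have "... = kint \<alpha> \<beta> ps w y - kint \<alpha> \<beta> ps w x - ?d (y - x)" unfolding eq kint_def
    by ((subst Bochner_Integration.integral_diff Bochner_Integration.integral_sum;
      (intro int Bochner_Integration.integrable_diff Bochner_Integration.integrable_sum integrable_mult_right)?)+,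
      simp, simp add: mult_ac)
   finally show ?thesis by simp
  qed
  also have "\<bar>...\<bar> <= (LBINT z. M * (norm ?k)^2 * \<bar>w z\<bar>)"
  proof (rule order_trans[OF integral_abs_bound], rule integral_mono')
   show "L1 (%z. M * (norm ?k)^2 * \<bar>w z\<bar>)" using w by auto
   show "\<bar>?r z * w z\<bar> <= M * (norm ?k)^2 * \<bar>w z\<bar>" for z
    using M(2)[of "\<alpha> *\<^sub>R z + \<beta> *\<^sub>R x" ?k] unfolding abs_mult
    by (intro mult_right_mono) (auto simp: algebra_simps)
  qed (use M(1) in auto)
  also have "... = C * (norm (y - x))^2" by (simp add: C_def power_mult_distrib)
  finally show ?thesis .
 qed
 show ?thesis
 proof (rule has_derivativeI_sandwich[where e=1 and H="%y. C * norm (y - x)"])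
  show "bounded_linear ?d"
   by (intro bounded_linear_sum bounded_linear_mult_left[THEN bounded_linear_compose, OF bounded_linear_vec_nth]
     bounded_linear_compose[OF bounded_linear_mult_left bounded_linear_vec_nth])
  show "norm (kint \<alpha> \<beta> ps w y - kint \<alpha> \<beta> ps w x - ?d (y - x)) / norm (y - x) <= C * norm (y - x)"
   if "y ~= x" for y
   using main[of y] that by (simp add: field_simps power2_eq_square)
  show "((%y. C * norm (y - x)) \<longlongrightarrow> 0) (at x)" by (auto intro!: tendsto_eq_intros)
 qed simp
qed

lemma partial_deriv_kernel_integral:
 assumes "test_function E ps" "L1 w"
 shows "pd i (kint \<alpha> \<beta> ps w) x = \<beta> * kint \<alpha> \<beta> (pd i ps) w x"
proof -
 have "pd i (kint \<alpha> \<beta> ps w) x =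
   (SUM j:UNIV. axis i 1 $ j * (\<beta> * kint \<alpha> \<beta> (pd j ps) w x))"
  by (rule partial_deriv_eq[OF kernel_integral_has_derivative[OF assms]])
 also have "... = (SUM j:UNIV. if j = i then \<beta> * kint \<alpha> \<beta> (pd j ps) w x else 0)"
  by (intro sum.cong) (auto simp: axis_def)
 finally show ?thesis by simp
qed

lemma C_k_kernel_integral:
 assumes "test_function E ps" "L1 w"
 shows "C_k k (kint \<alpha> \<beta> ps w)"
 using assms
proof (induction k arbitrary: ps)
 case 0
 have "kint \<alpha> \<beta> ps w differentiable (at x)" for x
  using kernel_integral_has_derivative[OF 0] differentiable_def by blast
 thus ?case
  by (simp add: differentiable_imp_continuous_within continuous_on_eq_continuous_within)
next
 case (Suc k)
 have d: "kint \<alpha> \<beta> ps w differentiable (at x)" for x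
  using kernel_integral_has_derivative[OF Suc.prems] differentiable_def by blast
 have p: "pd i (kint \<alpha> \<beta> ps w) = (%x. \<beta> * kint \<alpha> \<beta> (pd i ps) w x)" for i
  using partial_deriv_kernel_integral[OF Suc.prems] by blast
 have "C_k k (%x. \<beta> * kint \<alpha> \<beta> (pd i ps) w x)" for i
  by (intro C_k_mult C_k_const Suc.IH tf_partial[OF Suc.prems(1)] Suc.prems(2))
 thus ?case using d by (simp add: p)
qed

lemma lborel_integral_affine:
 fixes f :: "'a::euclidean_space => real"
 assumes "f : bmeas" "c ~= 0"
 shows "\<bar>c\<bar> ^ DIM('a) * (LBINT z. f (t + c *\<^sub>R z)) = (LBINT y. f y)"
proof -
 have "(LBINT y. f y) = (LINT y|density (distr lborel borel (%x. t + c *\<^sub>R x)) (%_. \<bar>c\<bar> ^ DIM('a)). f y)"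
  using lborel_affine[OF assms(2), of t] by simp
 also have "... = (LINT y|distr lborel borel (%x. t + c *\<^sub>R x). \<bar>c\<bar> ^ DIM('a) * f y)"
  using assms by (subst integral_density) auto
 also have "... = (LBINT z. \<bar>c\<bar> ^ DIM('a) * f (t + c *\<^sub>R z))" using assms by (subst integral_distr) auto
 finally show ?thesis by simp
qed

lemma lborel_nn_integral_affine:
 fixes f :: "'a::euclidean_space => ennreal"
 assumes "f : bmeas" "c ~= 0"
 shows "ennreal (\<bar>c\<bar> ^ DIM('a)) * NI (%z. f (t + c *\<^sub>R z)) = NI (%y. f y)"
proof -
 have "NI (%y. f y) = (\<integral>\<^sup>+ y. f y \<partial>density (distr lborel borel (%x. t + c *\<^sub>R x)) (%_. \<bar>c\<bar> ^ DIM('a)))"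
  using lborel_affine[OF assms(2), of t] by simp
 also have "... = (\<integral>\<^sup>+ y. ennreal (\<bar>c\<bar> ^ DIM('a)) * f y \<partial>distr lborel borel (%x. t + c *\<^sub>R x))"
  using assms by (subst nn_integral_density) auto
 also have "... = NI (%z. ennreal (\<bar>c\<bar> ^ DIM('a)) * f (t + c *\<^sub>R z))"
  using assms by (subst nn_integral_distr) auto
 finally show ?thesis using assms by (simp add: nn_integral_cmult)
qed

text \<open>For \<open>dl > 0\<close> this only uses values of \<open>w\<close> in the convex hull of \<open>x\<close> and the support of \<open>et\<close>;
 for \<open>dl < 0\<close> it shrinks the support of \<open>w\<close> towards the support of \<open>et\<close>.\<close>

definition mollify :: "(real^2 => real) => real => (real^2 => real) => real^2 => real" where
 "mollify et dl w x = (LBINT z. et z * w ((1 - dl) *\<^sub>R x + dl *\<^sub>R z))"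

text \<open>Substituting y = (1 - dl) x + dl z moves \<open>x\<close> from the rough function to the
  test function; 1/dl^2 is the Jacobian in the plane.\<close>

lemma mollify_eq_kernel_integral:
 assumes et: "test_function E et" and [measurable]: "w : bmeas" and dl: "dl ~= 0"
 shows "mollify et dl w x = 1 / dl\<^sup>2 * kint (1 / dl) (- (1 - dl) / dl) et w x"
proof -
 have [measurable]: "et : bmeas" by (rule tf_measurable[OF et])
 have "\<bar>dl\<bar> ^ DIM(real^2) * (LBINT z. et ((1 / dl) *\<^sub>R ((1 - dl) *\<^sub>R x + dl *\<^sub>R z) + (- (1 - dl) / dl) *\<^sub>R x) * w ((1 - dl) *\<^sub>R x + dl *\<^sub>R z))
   = kint (1 / dl) (- (1 - dl) / dl) et w x"
  unfolding kint_def
  by (rule lborel_integral_affine[where f="%y. et ((1 / dl) *\<^sub>R y + (- (1 - dl) / dl) *\<^sub>R x) * w y"]) (use dl in auto)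
 moreover have "(1 / dl) *\<^sub>R ((1 - dl) *\<^sub>R x + dl *\<^sub>R z) + (- (1 - dl) / dl) *\<^sub>R x = z" for z
  using dl by (simp add: scaleR_add_right scaleR_add_left[symmetric] diff_divide_distrib)
 ultimately have eq: "dl\<^sup>2 * mollify et dl w x = kint (1 / dl) (- (1 - dl) / dl) et w x"
  by (simp only: mollify_def) simp
 show ?thesis unfolding eq[symmetric] using dl by simp
qed

lemma C_k_mollify:
 assumes "test_function E et" "L1 w" "dl ~= 0"
 shows "C_k k (mollify et dl w)"
proof -
 have "mollify et dl w = (%x. 1 / dl\<^sup>2 * kint (1 / dl) (- (1 - dl) / dl) et w x)"
  using assms by (intro ext mollify_eq_kernel_integral) auto
 thus ?thesis by (simp only:) (intro C_k_mult C_k_const C_k_kernel_integral[OF assms(1,2)])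
qed

text \<open>Differentiating the kernel gives -(1 - dl)/dl, and undoing the derivative by parts gives
  -dl; the product is the factor 1 - dl, which tends to 1. Integration by parts is available for
  test functions in \<open>E\<close>, hence the condition that the points (1 - dl) x + dl z lie
  there.\<close>

lemma partial_deriv_mollify:
 assumes et: "test_function S et" and w: "L1 w" and g: "g : bmeas" and dl: "dl ~= 0"
  and ibp: "!!ph. test_function E ph ==> (LBINT y. w y * pd i ph y) = - (LBINT y. g y * ph y)"
  and sub: "!!z. z : S ==> (1 - dl) *\<^sub>R x + dl *\<^sub>R z : E"
 shows "pd i (mollify et dl w) x = (1 - dl) * mollify et dl g x"
proof -
 let ?\<alpha> = "1 / dl" and ?\<beta> = "- (1 - dl) / dl"
 define ph where "ph y = et (?\<alpha> *\<^sub>R y + ?\<beta> *\<^sub>R x)" for y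
 have ph: "test_function E ph"
 proof -
  obtain K where K: "compact K" "K \<subseteq> S" "ALL x. x \<notin> K --> et x = 0"
   using test_functionE[OF et] by metis
  show ?thesis
  proof (rule test_functionI)
   show "C_k k ph" for k unfolding ph_def by (intro C_k_reparam tf_C_k[OF et])
   show "compact ((%z. (1 - dl) *\<^sub>R x + dl *\<^sub>R z) ` K)" by (intro compact_continuous_image K continuous_intros)
   show "(%z. (1 - dl) *\<^sub>R x + dl *\<^sub>R z) ` K \<subseteq> E" using K sub by auto
   fix y assume y: "y \<notin> (%z. (1 - dl) *\<^sub>R x + dl *\<^sub>R z) ` K"
   have "dl *\<^sub>R (?\<alpha> *\<^sub>R y + ?\<beta> *\<^sub>R x) = y - (1 - dl) *\<^sub>R x"
    using dl by (simp add: scaleR_add_right) (simp add: scaleR_left_diff_distrib)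
   hence "(1 - dl) *\<^sub>R x + dl *\<^sub>R (?\<alpha> *\<^sub>R y + ?\<beta> *\<^sub>R x) = y" by simp
   hence "?\<alpha> *\<^sub>R y + ?\<beta> *\<^sub>R x \<notin> K" using y by (metis imageI)
   thus "ph y = 0" using K by (simp add: ph_def)
  qed
 qed
 have pd: "pd i ph = (%y. ?\<alpha> * pd i et (?\<alpha> *\<^sub>R y + ?\<beta> *\<^sub>R x))"
  unfolding ph_def[abs_def] by (rule partial_deriv_reparam) (use tf_differentiable[OF et] in auto)
 have moll_eq: "mollify et dl w = (%x. 1 / dl\<^sup>2 * kint ?\<alpha> ?\<beta> et w x)"
  using w dl by (intro ext mollify_eq_kernel_integral[OF et]) auto
 have diff: "ALL x. kint ?\<alpha> ?\<beta> et w differentiable (at x)"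
  using kernel_integral_has_derivative[OF et w] differentiable_def by blast
 have "pd i (mollify et dl w) x = 1 / dl\<^sup>2 * (?\<beta> * kint ?\<alpha> ?\<beta> (pd i et) w x)" unfolding moll_eq
  by (subst partial_deriv_mult) (use diff in \<open>auto simp: partial_deriv_const partial_deriv_kernel_integral[OF et w]\<close>)
 also have "kint ?\<alpha> ?\<beta> (pd i et) w x = dl * (LBINT y. w y * pd i ph y)"
  unfolding kint_def pd using dl by (subst integral_mult_right_zero[symmetric]) (simp add: mult_ac)
 also have "... = - dl * (LBINT y. g y * ph y)" using ibp[OF ph] by simp
 also have "(LBINT y. g y * ph y) = kint ?\<alpha> ?\<beta> et g x" by (simp add: kint_def ph_def mult.commute)
 also have "... = dl\<^sup>2 * mollify et dl g x" using mollify_eq_kernel_integral[OF et g dl, of x] dl by simp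
 finally have "pd i (mollify et dl w) x =
   1 / dl\<^sup>2 * (- (1 - dl) / dl * (- dl * (dl\<^sup>2 * mollify et dl g x)))" .
 also have "... = ((1 / dl\<^sup>2) * dl\<^sup>2) * (((1 - dl) / dl * dl) * mollify et dl g x)" by algebra
 also have "... = (1 - dl) * mollify et dl g x" using dl by simp
 finally show ?thesis .
qed

lemma mollifier_exists:
 assumes "open S" "S ~= {}"
 obtains et where "test_function S et" "!!x. 0 <= et x" "integrable lborel et" "(LBINT x. et x) = 1"
proof -
 obtain x where "x : S" using assms by blast
 then obtain a b where ab: "cbox a b \<subseteq> S" "x : box a b" using open_contains_cbox[of S x] assms by metis
 let ?f = "box_bump a b 1"
 have tf: "test_function S ?f" using ab by (intro test_function_box_bump) auto
 have [measurable]: "?f : bmeas" by (rule tf_measurable[OF tf])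
 have nz: "?f x ~= 0 \<longleftrightarrow> x : box a b" for x using box_bump_nonzero[of 1 a b x] by simp
 have int: "integrable lborel ?f"
 proof (rule Bochner_Integration.integrable_bound)
  show "L1 (%x. ind (cbox a b) x :: real)"
   by (rule integrable_real_indicator) (use emeasure_bounded_finite[OF bounded_cbox[of a b]] in auto)
  show "AE x in lborel. norm (?f x) <= norm (ind (cbox a b) x :: real)"
  proof (intro AE_I2)
   fix x
   show "norm (?f x) <= norm (ind (cbox a b) x :: real)"
    using box_bump_bounds[of a b 1 x] nz[of x] box_subset_cbox[of a b] by (cases "?f x = 0") (auto simp: indicator_def)
  qed
 qed measurable
 have "(LBINT x. ?f x) ~= 0"
 proof
  assume "(LBINT x. ?f x) = 0"
  hence "AE x in lborel. ?f x = 0"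
   using int box_bump_bounds by (subst (asm) integral_nonneg_eq_0_iff_AE) auto
  hence "AE x in lborel. x \<notin> box a b" using nz by auto
  hence "emeasure lborel (box a b) = 0"
   by (subst (asm) AE_iff_measurable[of "box a b"]) auto
  moreover have "0 < emeasure lborel (box a b)"
   using ab(2) by (subst emeasure_lborel_box) (auto simp: mem_box inner_diff_left intro!: prod_pos dest: less_trans intro: less_imp_le)
  ultimately show False by simp
 qed
 moreover have "0 <= (LBINT x. ?f x)" using box_bump_bounds by (intro Bochner_Integration.integral_nonneg) auto
 ultimately have pos: "0 < (LBINT x. ?f x)" by simp
 show ?thesis
 proof (rule that)
  show "test_function S (%x. 1 / (LBINT x. ?f x) * ?f x)" by (rule tf_cmult[OF tf])
  show "0 <= 1 / (LBINT x. ?f x) * ?f x" for x using pos box_bump_bounds[of a b 1 x] by simp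
  show "L1 (%x. 1 / (LBINT x. ?f x) * ?f x)" using int by (rule integrable_mult_right)
  show "(LBINT x. 1 / (LBINT x. ?f x) * ?f x) = 1" using pos by simp
 qed
qed


section \<open>Mollification converges in mean square\<close>

text \<open>Jensen's inequality in the form that a variance is nonnegative. If the square is not
  integrable, the right side is infinite.\<close>

lemma (in prob_space) square_mean_le:
 fixes f :: "'a => real"
 assumes [measurable]: "f : borel_measurable M"
 shows "ennreal ((LINT x|M. f x)^2) <= (\<integral>\<^sup>+ x. ennreal ((f x)^2) \<partial>M)"
proof (cases "integrable M (%x. (f x)^2)")
 case True
 hence int: "integrable M f" by (rule square_integrable_imp_integrable[rotated]) simp
 have "(LINT x|M. f x)^2 <= (LINT x|M. (f x)^2)" using variance_eq[OF int True] variance_positive[of f] by simp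
 also have "ennreal ... = (\<integral>\<^sup>+ x. ennreal ((f x)^2) \<partial>M)"
  by (rule nn_integral_eq_integral[symmetric, OF True]) simp
 finally show ?thesis by (simp add: ennreal_leI)
next
 case False
 hence "(\<integral>\<^sup>+ x. ennreal ((f x)^2) \<partial>M) = \<infinity>"
  using assms by (simp add: integrable_iff_bounded not_less top_unique)
 thus ?thesis by simp
qed

text \<open>With \<open>et\<close> as a probability density this is again Jensen's
  inequality.\<close>

lemma weighted_square_mean_le:
 fixes et f :: "'a => real"
 assumes et: "integrable M et" "!!x. 0 <= et x" "(LINT x|M. et x) = 1"
  and [measurable]: "f : borel_measurable M"
 shows "ennreal ((LINT x|M. et x * f x)^2) <= (\<integral>\<^sup>+ x. ennreal (et x * (f x)^2) \<partial>M)"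
proof -
 have [measurable]: "et : borel_measurable M" using et by auto
 have "(\<integral>\<^sup>+ x. ennreal (et x) \<partial>M) = 1" using et by (subst nn_integral_eq_integral) auto
 then interpret prob_space "density M (%x. ennreal (et x))"
  by (intro prob_spaceI) (simp add: emeasure_density cong: nn_integral_cong)
 have "(LINT x|M. et x * f x) = (LINT x|density M (%x. ennreal (et x)). f x)" using et by (subst integral_density) auto
 moreover have "(\<integral>\<^sup>+ x. ennreal (et x * (f x)^2) \<partial>M) = (\<integral>\<^sup>+ x. ennreal ((f x)^2) \<partial>density M (%x. ennreal (et x)))"
  using et by (subst nn_integral_density) (auto simp: ennreal_mult)
 ultimately show ?thesis using square_mean_le[of f] by simp
qed

text \<open>Square integrable functions as everywhere defined Borel functions extended by zero, so
  that integrals, substitutions and exchanges of integrals take place on the whole plane.\<close>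

definition L2_on :: "(real^2) set => (real^2 => real) => bool" where
 "L2_on D w \<longleftrightarrow> w : bmeas & (ALL x. x \<notin> D --> w x = 0) & L1 (%x. (w x)^2)"

lemma L2_onD:
 assumes "L2_on D w"
 shows "w : bmeas" "!!x. x \<notin> D ==> w x = 0" "L1 (%x. (w x)^2)"
 using assms by (auto simp: L2_on_def)

lemma integrable_ind:
 fixes D :: "'a::euclidean_space set"
 assumes "D : sets borel" "bounded D"
 shows "L1 (ind D :: 'a => real)"
 using assms emeasure_bounded_finite by (intro integrable_real_indicator) (auto simp: top.not_eq_extremum)

lemma L2_L1:
 assumes w: "L2_on D w" and D: "open D" "bounded D"
 shows "L1 w"
proof (rule Bochner_Integration.integrable_bound)
 show "L1 (%x. ind D x + (w x)^2)" using L2_onD[OF w] integrable_ind[of D] D by auto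
 show "AE x in lborel. norm (w x) <= norm (ind D x + (w x)^2)"
 proof (intro AE_I2)
  fix x
  have "2 * \<bar>w x\<bar> <= 1 + (w x)^2" using sum_squares_bound[of 1 "\<bar>w x\<bar>"] by (simp add: power2_eq_square)
  thus "norm (w x) <= norm (ind D x + (w x)^2)"
   using L2_onD(2)[OF w, of x] by (cases "x : D") auto
 qed
qed (use L2_onD[OF w] in auto)

lemma power2_sum_le: "((a::real) + b)^2 <= 2 * a^2 + 2 * b^2"
 using zero_le_power2[of "a - b"] by (simp add: power2_eq_square algebra_simps)

lemma L2_on_add_cmult:
 assumes "L2_on D v" "L2_on D w"
 shows "L2_on D (%x. a * v x + b * w x)"
proof -
 have [measurable]: "v : bmeas" "w : bmeas" using assms by (auto simp: L2_on_def)
 have "L1 (%x. (a * v x + b * w x)^2)"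
 proof (rule Bochner_Integration.integrable_bound)
  show "L1 (%x. 2 * a^2 * (v x)^2 + 2 * b^2 * (w x)^2)" using assms by (auto simp: L2_on_def)
  show "AE x in lborel. norm ((a * v x + b * w x)^2) <= norm (2 * a^2 * (v x)^2 + 2 * b^2 * (w x)^2)"
  proof (intro AE_I2)
   fix x
   show "norm ((a * v x + b * w x)^2) <= norm (2 * a^2 * (v x)^2 + 2 * b^2 * (w x)^2)"
    using power2_sum_le[of "a * v x" "b * w x"] by (simp add: power_mult_distrib mult.assoc)
  qed
 qed measurable
 thus ?thesis using assms by (auto simp: L2_on_def)
qed

lemma tendsto_real_clamp: "((%n. max (- real n) (min (real n) a)) \<longlongrightarrow> a) sequentially"
proof (rule tendsto_eventually, rule eventually_mono[OF eventually_ge_at_top[of "nat \<lceil>\<bar>a\<bar>\<rceil>"]])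
 fix n assume "nat \<lceil>\<bar>a\<bar>\<rceil> <= n"
 hence "\<bar>a\<bar> <= real n" by linarith
 thus "max (- real n) (min (real n) a) = a" by linarith
qed

text \<open>Continuous functions converge to \<open>w\<close> off a null set, but without a
  dominating function. Truncating \<open>w\<close> and the approximants at the same height makes
  everything bounded on the bounded set \<open>D\<close>.\<close>

lemma continuous_dense_L2:
 assumes w: "L2_on D w" and D: "open D" "bounded D" and e: "0 < e"
 obtains c where "continuous_on UNIV c" "(LBINT x. ind D x * (w x - c x)^2) < e"
  "L1 (%x. ind D x * (w x - c x)^2)"
proof -
 have [measurable]: "w : bmeas" "D : sets borel" using L2_onD[OF w] D by auto
 define cl where "cl n a = max (- real n) (min (real n) a)" for n a
 have cl_le: "\<bar>cl n a\<bar> <= real n" "\<bar>a - cl n a\<bar> <= \<bar>a\<bar>" for n a by (auto simp: cl_def)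
 have "(%n. LBINT x. (w x - cl n (w x))^2) \<longlonglongrightarrow> (LBINT x. (w x - w x)^2)"
 proof (rule integral_dominated_convergence[where w="%x. (w x)^2"])
  show "AE x in lborel. (%n. (w x - cl n (w x))^2) \<longlonglongrightarrow> (w x - w x)^2"
   unfolding cl_def by (intro AE_I2 tendsto_intros tendsto_real_clamp)
  show "AE x in lborel. norm ((w x - cl n (w x))^2) <= (w x)^2" for n
   using cl_le(2) by (intro AE_I2) (simp add: abs_le_square_iff[symmetric])
 qed (use L2_onD[OF w] in \<open>auto simp: cl_def\<close>)
 hence "(%n. LBINT x. (w x - cl n (w x))^2) \<longlonglongrightarrow> 0" by simp
 \<comment> \<open>Two errors below e/4, each doubled when the square of a sum is split, add up to
   less than e.\<close>
 from order_tendstoD(2)[OF this, of "e / 4"] e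
 have "\<forall>\<^sub>F n in sequentially. (LBINT x. (w x - cl n (w x))^2) < e / 4" by simp
 then obtain N where N: "(LBINT x. (w x - cl N (w x))^2) < e / 4" using eventually_happens trivial_limit_sequentially by blast
 have "w : borel_measurable lebesgue" by (rule measurable_completion) simp
 hence "w measurable_on UNIV"
  using lebesgue_measurable_imp_measurable_on[of w UNIV] by (simp add: lebesgue_on_UNIV_eq)
 then obtain Ng g where g: "negligible Ng" "!!n. continuous_on UNIV (g n)"
   "!!x. x \<notin> Ng ==> (%n. g n x) \<longlonglongrightarrow> w x"
  unfolding measurable_on_def by auto
 have [measurable]: "g n : bmeas" for n
  using g(2) by (rule borel_measurable_continuous_onI)
 define c where "c n x = cl N (g n x)" for n x
 have c_cont: "continuous_on UNIV (c n)" for n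
  unfolding c_def cl_def by (intro continuous_intros g)
 have [measurable]: "c n : bmeas" for n
  using c_cont by (rule borel_measurable_continuous_onI)
 have "(%n. LINT x|lebesgue. ind D x * (cl N (w x) - c n x)^2) \<longlonglongrightarrow>
   (LINT x|lebesgue. ind D x * (cl N (w x) - cl N (w x))^2)"
 proof (rule integral_dominated_convergence[where w="%x. ind D x * (2 * real N)^2"])
  have "AE x in lebesgue. x \<notin> Ng" using g(1) by (intro AE_not_in) (simp add: negligible_iff_null_sets)
  thus "AE x in lebesgue. (%n. ind D x * (cl N (w x) - c n x)^2) \<longlonglongrightarrow> ind D x * (cl N (w x) - cl N (w x))^2"
  proof eventually_elim
   fix x assume "x \<notin> Ng"
   from g(3)[OF this] show "(%n. ind D x * (cl N (w x) - c n x)^2) \<longlonglongrightarrow> ind D x * (cl N (w x) - cl N (w x))^2"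
    unfolding c_def cl_def by (intro tendsto_intros)
  qed
  show "AE x in lebesgue. norm (ind D x * (cl N (w x) - c n x)^2) <= ind D x * (2 * real N)^2" for n
  proof (intro AE_I2)
   fix x
   have "\<bar>cl N (w x) - c n x\<bar> <= \<bar>2 * real N\<bar>"
    using cl_le(1)[of N "w x"] cl_le(1)[of N "g n x"] unfolding c_def by linarith
   hence "(cl N (w x) - c n x)^2 <= (2 * real N)^2" by (simp only: abs_le_square_iff)
   thus "norm (ind D x * (cl N (w x) - c n x)^2) <= ind D x * (2 * real N)^2"
    by (simp add: indicator_def)
  qed
  show "integrable lebesgue (%x. ind D x * (2 * real N)^2)" using integrable_ind[of D] D by (subst integrable_completion) auto
  show "(%x. ind D x * (cl N (w x) - cl N (w x))^2) : borel_measurable lebesgue" by simp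
  show "(%x. ind D x * (cl N (w x) - c n x)^2) : borel_measurable lebesgue" for n
   by (rule measurable_completion) (simp add: cl_def)
 qed
 hence "(%n. LBINT x. ind D x * (cl N (w x) - c n x)^2) \<longlonglongrightarrow> 0"
  by (subst (asm) integral_completion) (auto simp: cl_def)
 from order_tendstoD(2)[OF this, of "e / 4"] e
 have "\<forall>\<^sub>F n in sequentially. (LBINT x. ind D x * (cl N (w x) - c n x)^2) < e / 4" by simp
 then obtain m where m: "(LBINT x. ind D x * (cl N (w x) - c m x)^2) < e / 4"
  using eventually_happens trivial_limit_sequentially by blast
 have i1: "L1 (%x. (w x - cl N (w x))^2)" by (rule Bochner_Integration.integrable_bound[OF L2_onD(3)[OF w]])
   (use cl_le(2) in \<open>auto simp: abs_le_square_iff[symmetric] cl_def\<close>)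
 have i2: "L1 (%x. ind D x * (cl N (w x) - c m x)^2)"
 proof (rule Bochner_Integration.integrable_bound)
  show "L1 (%x. ind D x * (2 * real N)^2)" using integrable_ind[of D] D by auto
  show "AE x in lborel. norm (ind D x * (cl N (w x) - c m x)^2) <= norm (ind D x * (2 * real N)^2)"
  proof (intro AE_I2)
   fix x
   have "\<bar>cl N (w x) - c m x\<bar> <= \<bar>2 * real N\<bar>"
    using cl_le(1)[of N "w x"] cl_le(1)[of N "g m x"] unfolding c_def by linarith
   hence "(cl N (w x) - c m x)^2 <= (2 * real N)^2" by (simp only: abs_le_square_iff)
   thus "norm (ind D x * (cl N (w x) - c m x)^2) <= norm (ind D x * (2 * real N)^2)"
    by (simp add: indicator_def)
  qed
 qed (simp add: cl_def)
 have le: "ind D x * (w x - c m x)^2 <= 2 * (w x - cl N (w x))^2 + 2 * (ind D x * (cl N (w x) - c m x)^2)" for x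
  using power2_sum_le[of "w x - cl N (w x)" "cl N (w x) - c m x"] by (auto simp: indicator_def)
 have i3: "L1 (%x. 2 * (w x - cl N (w x))^2 + 2 * (ind D x * (cl N (w x) - c m x)^2))" using i1 i2 by auto
 have i4: "L1 (%x. ind D x * (w x - c m x)^2)"
  by (rule Bochner_Integration.integrable_bound[OF i3]) (use le in \<open>auto intro!: AE_I2 order_trans[OF le abs_ge_self]\<close>)
 have "(LBINT x. ind D x * (w x - c m x)^2) <=
   (LBINT x. 2 * (w x - cl N (w x))^2 + 2 * (ind D x * (cl N (w x) - c m x)^2))"
  by (rule integral_mono[OF i4 i3 le])
 also have "... = 2 * (LBINT x. (w x - cl N (w x))^2) + 2 * (LBINT x. ind D x * (cl N (w x) - c m x)^2)"
  using i1 i2 by (subst Bochner_Integration.integral_add) auto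
 also have "... < e" using N m by simp
 finally show ?thesis using that c_cont i4 by blast
qed

lemma mollify_measurable:
 assumes "test_function E et" "L1 w" "dl ~= 0"
 shows "mollify et dl w : bmeas"
 by (rule borel_measurable_continuous_onI[OF C_k_imp_continuous[OF C_k_mollify[OF assms, of 0]]])

lemma mollify_diff:
 assumes et: "test_function E et" and "L1 v" "L1 w" "dl ~= 0"
 shows "mollify et dl (%x. v x - w x) x = mollify et dl v x - mollify et dl w x"
proof -
 note int = integrable_kernel[OF et assms(2)] integrable_kernel[OF et assms(3)]
 show ?thesis
  using assms by (simp add: mollify_eq_kernel_integral[OF et] kint_def right_diff_distrib
    Bochner_Integration.integral_diff[OF int] diff_divide_distrib)
qed

text \<open>Jensen's inequality for the density \<open>et\<close> and an exchange of integrals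
  reduce this to the dilations x -> (1 - dl) x + dl z; their Jacobian is at least 1/4, whence the
  factor 4.\<close>

lemma mollify_L2_bound:
 assumes et: "test_function E et" "!!x. 0 <= et x" "integrable lborel et" "(LBINT x. et x) = 1"
  and [measurable]: "w : bmeas" and dl: "\<bar>dl\<bar> <= 1 / 2"
 shows "NI (%x. ennreal ((mollify et dl w x)^2)) <= 4 * NI (%x. ennreal ((w x)^2))"
proof -
 have [measurable]: "et : bmeas" by (rule tf_measurable[OF et(1)])
 let ?W = "\<integral>\<^sup>+ x. ennreal ((w x)^2) \<partial>lborel"
 have shift: "NI (%x. ennreal ((w ((1 - dl) *\<^sub>R x + dl *\<^sub>R z))^2)) <= 4 * ?W" for z
 proof -
  have "ennreal (1 / 4) * NI (%x. ennreal ((w (dl *\<^sub>R z + (1 - dl) *\<^sub>R x))^2)) <=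
    ennreal (\<bar>1 - dl\<bar> ^ DIM(real^2)) * NI (%x. ennreal ((w (dl *\<^sub>R z + (1 - dl) *\<^sub>R x))^2))"
   using dl power_mono[of "1/2" "1 - dl" 2] by (intro mult_right_mono ennreal_leI) (auto simp: power2_eq_square)
  also have "... = ?W" using dl by (intro lborel_nn_integral_affine) auto
  finally have "4 * (ennreal (1 / 4) * NI (%x. ennreal ((w (dl *\<^sub>R z + (1 - dl) *\<^sub>R x))^2))) <= 4 * ?W"
   by (rule mult_left_mono) simp
  moreover have "4 * ennreal (1 / 4) = 1"
   by (metis ennreal_numeral ennreal_mult ennreal_1 mult.commute nonzero_divide_eq_eq zero_le_numeral zero_neq_numeral
     divide_nonneg_nonneg zero_le_one)
  ultimately show ?thesis by (simp add: mult.assoc[symmetric] add.commute)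
 qed
 have "NI (%x. ennreal ((mollify et dl w x)^2)) <=
   NI (%x. (NI (%z. ennreal (et z * (w ((1 - dl) *\<^sub>R x + dl *\<^sub>R z))^2))))"
  unfolding mollify_def by (intro nn_integral_mono weighted_square_mean_le[OF et(3,2,4)]) measurable
 also have "... = NI (%z. (NI (%x. ennreal (et z * (w ((1 - dl) *\<^sub>R x + dl *\<^sub>R z))^2))))"
  by (rule lborel_pair.Fubini') measurable
 also have "... = NI (%z. ennreal (et z) * NI (%x. ennreal ((w ((1 - dl) *\<^sub>R x + dl *\<^sub>R z))^2)))"
  using et(2) by (intro nn_integral_cong) (simp add: ennreal_mult nn_integral_cmult)
 also have "... <= NI (%z. ennreal (et z) * (4 * ?W))" by (intro nn_integral_mono mult_left_mono shift) simp
 also have "... = NI (%z. ennreal (et z)) * (4 * ?W)" by (rule nn_integral_multc) simp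
 also have "NI (%z. ennreal (et z)) = 1" using et by (subst nn_integral_eq_integral) auto
 finally show ?thesis by simp
qed

lemma mollify_continuous_close:
 assumes et: "test_function D et" "!!x. 0 <= et x" "integrable lborel et" "(LBINT x. et x) = 1"
  and R: "0 < R" "!!x. x : D ==> norm x <= R" and c: "continuous_on UNIV c" and kp: "0 < kp"
 obtains d where "0 < d" "!!dl x. \<bar>dl\<bar> < d ==> \<bar>dl\<bar> <= 1 / 2 ==> x : D ==>
  \<bar>mollify et dl (%y. ind (ball 0 (3 * R)) y * c y) x - c x\<bar> <= kp"
proof -
 let ?D = "ball 0 (3 * R) :: (real^2) set"
 have [measurable]: "et : bmeas" "c : bmeas" "?D : sets borel"
  using tf_measurable[OF et(1)] borel_measurable_continuous_onI[OF c] by auto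
 have "uniformly_continuous_on (cball 0 (3 * R)) c" using c continuous_on_subset by (intro compact_uniformly_continuous) auto
 then obtain r where r: "0 < r" "!!x y. x : cball 0 (3 * R) ==> y : cball 0 (3 * R) ==> dist x y < r ==> dist (c x) (c y) < kp"
  using kp unfolding uniformly_continuous_on_def by (metis dist_commute)
 show ?thesis
 \<comment> \<open>The point (1 - dl) x + dl z differs from x by at most |dl| 2 R, which is below r.
   With |dl| at most 1/2 it stays within distance 2 R of the origin, so the cut at radius 3 R is
   never felt.\<close>
 proof (rule that[of "r / (2 * R)"])
  show "0 < r / (2 * R)" using r R by simp
  fix dl x assume dl: "\<bar>dl\<bar> < r / (2 * R)" "\<bar>dl\<bar> <= 1 / 2" and x: "x : D"
  define a where "a z = ind ?D ((1 - dl) *\<^sub>R x + dl *\<^sub>R z) * c ((1 - dl) *\<^sub>R x + dl *\<^sub>R z)" for z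
  have [measurable]: "a : bmeas" unfolding a_def by measurable
  have near: "\<bar>et z * (a z - c x)\<bar> <= kp * et z" for z
  proof (cases "z : D")
   case False
   hence "et z = 0" using test_functionE[OF et(1)] by (metis subsetD)
   thus ?thesis by simp
  next
   case True
   have zx: "norm (z - x) <= 2 * R" using R(2)[OF x] R(2)[OF True] norm_triangle_ineq4[of z x] by simp
   have "norm (x + dl *\<^sub>R (z - x)) <= norm x + \<bar>dl\<bar> * norm (z - x)" using norm_triangle_ineq[of x "dl *\<^sub>R (z - x)"] by simp
   also have "... <= R + 1 / 2 * (2 * R)" using R(2)[OF x] zx dl by (intro add_mono mult_mono) auto
   finally have y: "(1 - dl) *\<^sub>R x + dl *\<^sub>R z : ?D" using R(1) by (simp add: algebra_simps)
   have "dist ((1 - dl) *\<^sub>R x + dl *\<^sub>R z) x = norm (dl *\<^sub>R (z - x))" by (simp add: dist_norm algebra_simps)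
   also have "... <= \<bar>dl\<bar> * (2 * R)" using zx by (simp add: mult_left_mono)
   also have "... < r" using dl R by (simp add: field_simps)
   finally have "dist (c ((1 - dl) *\<^sub>R x + dl *\<^sub>R z)) (c x) < kp" using R(1) R(2)[OF x] y by (intro r) auto
   hence "\<bar>a z - c x\<bar> <= kp" using y by (simp add: a_def dist_real_def)
   thus ?thesis using mult_left_mono[OF _ et(2)[of z]] et(2)[of z] by (simp add: abs_mult mult.commute[of kp])
  qed
  have i1: "L1 (%z. et z * (a z - c x))"
   by (rule Bochner_Integration.integrable_bound[OF integrable_mult_right[OF et(3), of kp]])
    (use near kp in \<open>auto intro!: AE_I2 order_trans[OF near abs_ge_self]\<close>)
  have "mollify et dl (%y. ind ?D y * c y) x = (LBINT z. et z * (a z - c x) + c x * et z)"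
   by (simp add: mollify_def a_def algebra_simps)
  also have "... = (LBINT z. et z * (a z - c x)) + c x" using i1 et by (subst Bochner_Integration.integral_add) auto
  finally have "\<bar>mollify et dl (%y. ind ?D y * c y) x - c x\<bar> <= (LBINT z. \<bar>et z * (a z - c x)\<bar>)"
   by (simp add: integral_abs_bound)
  also have "... <= (LBINT z. kp * et z)" using i1 et near by (intro integral_mono) auto
  also have "... = kp" using et by simp
  finally show "\<bar>mollify et dl (%y. ind ?D y * c y) x - c x\<bar> <= kp" .
 qed
qed

lemma ennreal_power2_sum3_le:
 "ennreal ((a + b + c)^2) <= 3 * ennreal (a^2) + 3 * ennreal (b^2) + 3 * ennreal ((c::real)^2)"
proof -
 have "(a + b + c)^2 <= 3 * a^2 + 3 * b^2 + 3 * c^2"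
  using zero_le_power2[of "a - b"] zero_le_power2[of "a - c"] zero_le_power2[of "b - c"]
  by (simp add: power2_eq_square algebra_simps)
 hence "ennreal ((a + b + c)^2) <= ennreal (3 * a^2 + 3 * b^2 + 3 * c^2)" by (rule ennreal_leI)
 also have "... = 3 * ennreal (a^2) + 3 * ennreal (b^2) + 3 * ennreal (c^2)" by (simp add: ennreal_plus ennreal_mult)
 finally show ?thesis .
qed

text \<open>A three-term argument: \<open>w\<close> is replaced by a continuous function, whose
  mollifications converge uniformly on \<open>D\<close>, and the uniform bound on mollifications
  controls the exchange.\<close>

lemma mollify_tendsto_L2:
 assumes et: "test_function D et" "!!x. 0 <= et x" "integrable lborel et" "(LBINT x. et x) = 1"
  and D: "open D" "bounded D" and w: "L2_on D w" and e: "0 < e"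
 obtains d where "0 < d" "!!dl. dl ~= 0 ==> \<bar>dl\<bar> < d ==>
  (NI (%x. ennreal (ind D x * (mollify et dl w x - w x)^2))) <= ennreal e"
proof -
 have [measurable]: "w : bmeas" "D : sets borel" using L2_onD[OF w] D by auto
 obtain R where R: "0 < R" "!!x. x : D ==> norm x <= R" using D(2) bounded_pos by blast
 let ?E = "ball 0 (3 * R) :: (real^2) set"
 have DE: "x : ?E" if "x : D" for x using R(1) R(2)[OF that] by simp
 have [measurable]: "?E : sets borel" by simp
 have wE: "L2_on ?E w" using w DE by (auto simp: L2_on_def)
 \<comment> \<open>The three terms will carry the factors 12, 3 and 3, so e/30 leaves room.\<close>
 obtain c where c: "continuous_on UNIV c" "(LBINT x. ind ?E x * (w x - c x)^2) < e / 30"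
   "L1 (%x. ind ?E x * (w x - c x)^2)"
  by (rule continuous_dense_L2[OF wE, of "e / 30"]) (use e in auto)
 have [measurable]: "c : bmeas" using c(1) by (rule borel_measurable_continuous_onI)
 define v where "v x = ind ?E x * c x" for x
 have [measurable]: "v : bmeas" unfolding v_def by measurable
 have wv: "NI (%x. ennreal ((w x - v x)^2)) <= ennreal (e / 30)"
 proof -
  have "NI (%x. ennreal ((w x - v x)^2)) = NI (%x. ennreal (ind ?E x * (w x - c x)^2))"
   using L2_onD(2)[OF wE] by (intro nn_integral_cong) (auto simp: v_def indicator_def)
  also have "... = ennreal (LBINT x. ind ?E x * (w x - c x)^2)" by (rule nn_integral_eq_integral[OF c(3)]) simp
  finally show ?thesis using c(2) by (simp add: ennreal_leI)
 qed
 have "L2_on ?E (%x. w x - v x)" unfolding L2_on_def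
 proof (intro conjI allI impI)
  show "L1 (%x. (w x - v x)^2)" using le_less_trans[OF wv ennreal_less_top] by (intro integrableI_bounded) auto
 qed (use L2_onD(2)[OF wE] in \<open>auto simp: v_def\<close>)
 from L2_L1[OF this open_ball bounded_ball] have int_wv: "L1 (%x. w x - v x)" .
 have int_w: "L1 w" by (rule L2_L1[OF w D(1,2)])
 from Bochner_Integration.integrable_diff[OF int_w int_wv] have int_v: "L1 v" by simp
 define A where "A = measure lborel D"
 have A: "emeasure lborel D = ennreal A" "0 <= A"
  using emeasure_bounded_finite[OF D(2)] by (auto simp: A_def emeasure_eq_ennreal_measure top.not_eq_extremum)
 define kp where "kp = sqrt (e / (30 * (A + 1)))"
 have kp: "0 < kp" "kp\<^sup>2 * A <= e / 30" using e A(2) by (auto simp: kp_def divide_simps)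
 obtain d where d: "0 < d" "!!dl x. \<bar>dl\<bar> < d ==> \<bar>dl\<bar> <= 1 / 2 ==> x : D ==> \<bar>mollify et dl v x - c x\<bar> <= kp"
  using mollify_continuous_close[OF et R c(1) kp(1)] unfolding v_def[abs_def] by metis
 show ?thesis
 proof (rule that[of "min d (1 / 2)"])
  show "0 < min d (1 / 2)" using d(1) by simp
  fix dl :: real assume dl: "dl ~= 0" "\<bar>dl\<bar> < min d (1 / 2)"
  have [measurable]: "mollify et dl (%x. w x - v x) : bmeas" "mollify et dl v : bmeas"
   using dl int_v int_wv by (auto intro!: mollify_measurable[OF et(1)])
  have split: "mollify et dl w x - w x = mollify et dl (%x. w x - v x) x + (mollify et dl v x - c x) + (c x - w x)" for x
   using mollify_diff[OF et(1) int_w int_v, of dl x] dl by simp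
  have "ennreal (ind D x * (mollify et dl w x - w x)^2) <=
    3 * ennreal ((mollify et dl (%x. w x - v x) x)^2) + 3 * (ennreal (kp\<^sup>2) * ind D x) + 3 * ennreal ((w x - v x)^2)" for x
  proof (cases "x : D")
   case True
   have "(mollify et dl v x - c x)^2 <= kp\<^sup>2"
    using d(2)[OF _ _ True, of dl] dl kp(1) by (intro abs_le_square_iff[THEN iffD1]) auto
   hence step: "3 * ennreal ((mollify et dl (%x. w x - v x) x)^2) + 3 * ennreal ((mollify et dl v x - c x)^2) + 3 * ennreal ((c x - w x)^2)
     <= 3 * ennreal ((mollify et dl (%x. w x - v x) x)^2) + 3 * ennreal (kp\<^sup>2) + 3 * ennreal ((c x - w x)^2)"
    by (intro add_mono mult_left_mono ennreal_leI order_refl) auto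
   have "(mollify et dl w x - w x)^2 = ind D x * (mollify et dl w x - w x)^2"
     "(c x - w x)^2 = (w x - v x)^2" "ennreal (kp\<^sup>2) = ennreal (kp\<^sup>2) * ind D x"
    using True DE by (auto simp: v_def power2_commute[of "c x"])
   thus ?thesis
    using order_trans[OF ennreal_power2_sum3_le step] unfolding split[symmetric] by metis
  qed simp
  hence "NI (%x. ennreal (ind D x * (mollify et dl w x - w x)^2)) <=
    NI (%x. 3 * ennreal ((mollify et dl (%x. w x - v x) x)^2) + 3 * (ennreal (kp\<^sup>2) * ind D x)
     + 3 * ennreal ((w x - v x)^2))"
   by (intro nn_integral_mono)
  also have "... = 3 * NI (%x. ennreal ((mollify et dl (%x. w x - v x) x)^2)) + 3 * (ennreal (kp\<^sup>2) * ennreal A)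
     + 3 * NI (%x. ennreal ((w x - v x)^2))"
   by (simp add: nn_integral_add nn_integral_cmult A(1))
  also have "... <= 3 * (4 * ennreal (e / 30)) + 3 * ennreal (e / 30) + 3 * ennreal (e / 30)"
  proof (intro add_mono mult_left_mono)
   show "NI (%x. ennreal ((mollify et dl (%x. w x - v x) x)^2)) <= 4 * ennreal (e / 30)"
    using mollify_L2_bound[OF et, of "%x. w x - v x" dl] dl mult_left_mono[OF wv, of 4] by (auto intro: order_trans)
   show "ennreal (kp\<^sup>2) * ennreal A <= ennreal (e / 30)"
    using kp A(2) by (simp add: ennreal_mult[symmetric] ennreal_leI)
  qed (use wv in auto)
  also have "... = ennreal (3 * (4 * (e / 30)) + 3 * (e / 30) + 3 * (e / 30))"
   using e by (simp add: ennreal_plus[symmetric] ennreal_mult[symmetric] ennreal_numeral[symmetric] del: ennreal_plus ennreal_numeral)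
  also have "... <= ennreal e" using e by (intro ennreal_leI) simp
  finally show "NI (%x. ennreal (ind D x * (mollify et dl w x - w x)^2)) <= ennreal e" .
 qed
qed


section \<open>Averaging along segments\<close>

lemma nn_ftc:
 fixes F f :: "real => real"
 assumes "!!t. 0 <= t ==> t <= 1 ==> (F has_real_derivative f t) (at t)"
  and "!!t. 0 <= t ==> t <= 1 ==> isCont f t"
 shows "ennreal \<bar>F 1 - F 0\<bar> <= NI (%t. ennreal \<bar>f t\<bar> * ind {0..1} t)"
proof -
 have "has_bochner_integral lborel (%t. f t * ind {0..1} t) (F 1 - F 0)"
  using assms by (intro has_bochner_integral_FTC_Icc_real) auto
 hence "L1 (%t. f t * ind {0..1} t)"
   "(LINT t|lborel. f t * ind {0..1} t) = F 1 - F 0"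
  by (auto simp: has_bochner_integral_iff)
 from integral_norm_bound_ennreal[OF this(1)] this(2)
 have "ennreal \<bar>F 1 - F 0\<bar> <= NI (%t. ennreal (norm (f t * ind {0..1} t)))" by simp
 also have "... = NI (%t. ennreal \<bar>f t\<bar> * ind {0..1} t)" by (intro nn_integral_cong) (auto simp: indicator_def)
 finally show ?thesis .
qed

lemma nn_integral_powr_01:
 fixes kp :: real
 assumes "kp < 1"
 shows "nnI {0..1} (%t. t powr (- kp)) = ennreal (1 / (1 - kp))"
 using nn_integral_has_integral_lebesgue'[OF _ has_integral_powr_from_0[of "- kp" 1]] assms by simp

text \<open>The weight t powr kp will absorb a singularity at t = 0: in the weighted Sobolev
  inequality the bound for the segments blows up like a negative power of t, and the two powers
  together stay integrable.\<close>

lemma weighted_Cauchy_Schwarz_01: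
 fixes m :: "real => real" and kp :: real
 assumes kp: "kp < 1" and [measurable]: "m : bmeas" and m0: "!!t. 0 <= m t"
 shows "nnI {0..1} (%t. m t)^2 <= ennreal (1 / (1 - kp)) * nnI {0..1} (%t. t powr kp * (m t)^2)"
proof -
 let ?f = "%t. ennreal (t powr (- (kp / 2))) * ind {0..1} t"
 let ?g = "%t. ennreal (t powr (kp / 2) * m t) * ind {0..1} t"
 have eq: "nnI {0..1} (%t. m t) = NI (%t. ?f t * ?g t)"
 proof (rule nn_integral_cong_AE)
  have "AE t in lborel. t ~= (0::real)" by (rule AE_lborel_singleton)
  thus "AE t in lborel. ennreal (m t) * ind {0..1} t = ?f t * ?g t"
  proof eventually_elim
   fix t :: real assume "t ~= 0"
   hence "t powr (- (kp / 2)) * (t powr (kp / 2) * m t) = m t" if "0 <= t"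
    using that by (simp add: powr_minus)
   thus "ennreal (m t) * ind {0..1} t = ?f t * ?g t"
    using m0 by (auto simp: indicator_def ennreal_mult[symmetric])
  qed
 qed
 have CS: "NI (%t. ?f t * ?g t)^2 <= NI (%t. (?f t)^2) * NI (%t. (?g t)^2)" by (rule Cauchy_Schwarz_nn_integral) measurable
 have "NI (%t. (?f t)^2) = nnI {0..1} (%t. t powr (- kp))" by (intro nn_integral_cong)
   (auto simp: indicator_def power2_eq_square ennreal_mult[symmetric] powr_add[symmetric])
 also have "... = ennreal (1 / (1 - kp))" by (rule nn_integral_powr_01[OF kp])
 finally have f2: "NI (%t. (?f t)^2) = ennreal (1 / (1 - kp))" .
 have g2: "NI (%t. (?g t)^2) = nnI {0..1} (%t. t powr kp * (m t)^2)"
 proof (intro nn_integral_cong)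
  fix t :: real
  have "(t powr (kp / 2) * m t)^2 = t powr kp * (m t)^2"
   by (simp add: power_mult_distrib power2_eq_square[of "t powr _"] powr_add[symmetric])
  thus "(?g t)^2 = ennreal (t powr kp * (m t)^2) * ind {0..1} t"
   using m0 by (auto simp: indicator_def ennreal_power)
 qed
 show ?thesis using CS unfolding eq f2 g2 .
qed

lemma C1_gradient_continuous:
 assumes "C_k (Suc 0) G"
 shows "continuous_on A (gradient G)"
proof -
 have "continuous_on UNIV (gradient G)" unfolding gradient_def[abs_def] using assms by (intro continuous_on_vec_lambda) auto
 thus ?thesis using continuous_on_subset by blast
qed

lemma C1_line_derivative:
 assumes "C_k (Suc 0) G"
 shows "((%t. G (x + t *\<^sub>R v)) has_real_derivative gradient G (x + t *\<^sub>R v) \<bullet> v) (at t)"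
proof -
 have diff: "(G has_derivative frechet_derivative G (at z)) (at z)" for z
  using assms by (simp add: frechet_derivative_works)
 have "((%t. G (x + t *\<^sub>R v)) has_derivative (%s. frechet_derivative G (at (x + t *\<^sub>R v)) (s *\<^sub>R v))) (at t)"
  by (rule has_derivative_compose[where f="%t. x + t *\<^sub>R v" and g=G and f'="%t. t *\<^sub>R v" and
    g'="frechet_derivative G (at (x + t *\<^sub>R v))"]) (auto intro!: derivative_eq_intros diff)
 moreover have "(%s. frechet_derivative G (at (x + t *\<^sub>R v)) (s *\<^sub>R v)) = times (gradient G (x + t *\<^sub>R v) \<bullet> v)"
  by (auto simp: has_derivative_gradient[OF diff])
 ultimately show ?thesis by (simp add: has_field_derivative_def)
qed

lemma segment_square_bound:
 assumes G: "C_k (Suc 0) G" and kp: "kp < 1"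
 shows "ennreal ((G y - G x)^2) <= ennreal ((norm (y - x))^2 / (1 - kp)) *
  nnI {0..1} (%t. t powr kp * (norm (gradient G (x + t *\<^sub>R (y - x))))^2)"
proof -
 let ?v = "y - x"
 let ?m = "%t. norm (gradient G (x + t *\<^sub>R ?v))"
 have [measurable]: "gradient G : bmeas" using C1_gradient_continuous[OF G] by (rule borel_measurable_continuous_onI)
 have cont: "isCont (%t. gradient G (x + t *\<^sub>R ?v) \<bullet> ?v) t" for t
 proof -
  have "continuous_on UNIV (%t. gradient G (x + t *\<^sub>R ?v) \<bullet> ?v)"
   by (intro continuous_on_compose2[OF C1_gradient_continuous[OF G, of UNIV]] continuous_intros) auto
  thus ?thesis by (simp add: continuous_on_eq_continuous_at)
 qed
 have "ennreal \<bar>G (x + 1 *\<^sub>R ?v) - G (x + 0 *\<^sub>R ?v)\<bar> <=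
   NI (%t. ennreal \<bar>gradient G (x + t *\<^sub>R ?v) \<bullet> ?v\<bar> * ind {0..1} t)"
  by (rule nn_ftc[OF C1_line_derivative[OF G] cont])
 also have "... <= NI (%t. ennreal (norm ?v) * (ennreal (?m t) * ind {0..1} t))"
 proof (intro nn_integral_mono)
  fix t :: real
  have "\<bar>gradient G (x + t *\<^sub>R ?v) \<bullet> ?v\<bar> <= norm ?v * ?m t"
   using Cauchy_Schwarz_ineq2[of "gradient G (x + t *\<^sub>R ?v)" ?v] by (simp add: mult.commute)
  thus "ennreal \<bar>gradient G (x + t *\<^sub>R ?v) \<bullet> ?v\<bar> * ind {0..1} t <= ennreal (norm ?v) * (ennreal (?m t) * ind {0..1} t)"
   by (auto simp: indicator_def ennreal_mult[symmetric] intro: ennreal_leI)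
 qed
 also have "... = ennreal (norm ?v) * nnI {0..1} (%t. ?m t)" by (rule nn_integral_cmult) measurable
 finally have "(ennreal \<bar>G y - G x\<bar>)^2 <= (ennreal (norm ?v) * nnI {0..1} (%t. ?m t))^2" by (intro power_mono) auto
 also have "... = ennreal ((norm ?v)^2) * nnI {0..1} (%t. ?m t)^2" by (simp add: power_mult_distrib ennreal_power)
 also have "... <= ennreal ((norm ?v)^2) * (ennreal (1 / (1 - kp)) *
   nnI {0..1} (%t. t powr kp * (?m t)^2))"
  by (intro mult_left_mono weighted_Cauchy_Schwarz_01[OF kp]) auto
 also have "... = ennreal ((norm ?v)^2 / (1 - kp)) * nnI {0..1} (%t. t powr kp * (?m t)^2)"
  using kp by (simp add: mult.assoc[symmetric] ennreal_mult[symmetric])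
 also have "(ennreal \<bar>G y - G x\<bar>)^2 = ennreal ((G y - G x)^2)" by (simp add: ennreal_power)
 finally show ?thesis .
qed

text \<open>For fixed \<open>t\<close> the substitution z = x + t (y - x) costs 1/t^2 and stays in
  \<open>S\<close> by convexity. What remains for fixed z is an integral over those x whose partner
  y = (z - (1 - t) x)/t also lies in \<open>S\<close>; the factor t^2 in its bound cancels the
  cost.\<close>

lemma segment_tonelli:
 fixes V N :: "real^2 => ennreal"
 assumes [measurable]: "V : bmeas" "N : bmeas" "S : sets borel"
  and S: "convex S" and t: "0 < t" "t < 1"
  and B: "!!z. z : S ==> (NI (%x. V x * ind S x * ind S ((1 / t) *\<^sub>R z + (- (1 - t) / t) *\<^sub>R x)))
   <= ennreal (t^2) * B"
 shows "NI (%x. (NI (%y. V x * N (x + t *\<^sub>R (y - x)) * ind S x * ind S y))) <= B * NI (%z. N z * ind S z)"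
proof -
 let ?h = "%x z. V x * N z * ind S x * ind S ((1 / t) *\<^sub>R z + (- (1 - t) / t) *\<^sub>R x) * ind S z"
 have inner: "ennreal (t^2) * NI (%y. V x * N (x + t *\<^sub>R (y - x)) * ind S x * ind S y) = NI (%z. ?h x z)" for x
 proof -
  have "V x * N (x + t *\<^sub>R (y - x)) * ind S x * ind S y = ?h x ((1 - t) *\<^sub>R x + t *\<^sub>R y)" for y
  proof -
   have "x + t *\<^sub>R (y - x) = (1 - t) *\<^sub>R x + t *\<^sub>R y" by (simp add: algebra_simps)
   moreover have "(1 / t) *\<^sub>R ((1 - t) *\<^sub>R x + t *\<^sub>R y) + (- (1 - t) / t) *\<^sub>R x = y"
    using t by (simp add: scaleR_add_right scaleR_add_left[symmetric] add.commute add_divide_distrib diff_divide_distrib)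
   moreover have "(1 - t) *\<^sub>R x + t *\<^sub>R y : S" if "x : S" "y : S" using S that t by (simp add: convex_alt)
   ultimately show ?thesis by (auto simp: indicator_def)
  qed
  hence "ennreal (t^2) * NI (%y. V x * N (x + t *\<^sub>R (y - x)) * ind S x * ind S y) =
    ennreal (\<bar>t\<bar> ^ DIM(real^2)) * NI (%y. ?h x ((1 - t) *\<^sub>R x + t *\<^sub>R y))" by simp
  also have "... = NI (%z. ?h x z)" by (rule lborel_nn_integral_affine[where f="?h x"]) (use t in auto)
  finally show ?thesis .
 qed
 have "ennreal (t^2) * NI (%x. (NI (%y. V x * N (x + t *\<^sub>R (y - x)) * ind S x * ind S y)))
   = NI (%x. ennreal (t^2) * NI (%y. V x * N (x + t *\<^sub>R (y - x)) * ind S x * ind S y))"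
  by (rule nn_integral_cmult[symmetric]) measurable
 also have "... = NI (%x. (NI (%z. ?h x z)))" by (simp only: inner)
 also have "... = NI (%z. (NI (%x. ?h x z)))" by (rule lborel_pair.Fubini') measurable
 also have "... = NI (%z. N z * ind S z *
   NI (%x. V x * ind S x * ind S ((1 / t) *\<^sub>R z + (- (1 - t) / t) *\<^sub>R x)))"
  by (subst nn_integral_cmult[symmetric]) (auto intro!: nn_integral_cong simp: mult_ac)
 also have "... <= NI (%z. (ennreal (t^2) * B) * (N z * ind S z))"
 proof (intro nn_integral_mono)
  fix z
  show "N z * ind S z * NI (%x. V x * ind S x * ind S ((1 / t) *\<^sub>R z + (- (1 - t) / t) *\<^sub>R x))
    <= (ennreal (t^2) * B) * (N z * ind S z)"
  proof (cases "z : S")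
   case True
   thus ?thesis using mult_left_mono[OF B[OF True], of "N z"] by (simp add: mult_ac)
  qed simp
 qed
 also have "... = ennreal (t^2) * (B * NI (%z. N z * ind S z))" by (subst nn_integral_cmult) (auto simp: mult.assoc)
 finally show ?thesis using t by (subst (asm) ennreal_mult_le_mult_iff) auto
qed

text \<open>The set of such \<open>x\<close> lies in \<open>S\<close> and also in a copy of
  \<open>S\<close> scaled by t/(1 - t). The first bound is used for t at least 1/2, the second
  otherwise; both are within 4 t^2 times the area.\<close>

lemma segment_area:
 fixes S :: "(real^2) set"
 assumes [measurable]: "S : sets borel" and t: "0 < t" "t < 1"
 shows "NI (%x. ind S x * ind S ((1 / t) *\<^sub>R z + (- (1 - t) / t) *\<^sub>R x))
  <= ennreal (t^2) * (4 * emeasure lborel S)" (is "?I <= _")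
proof (cases "1 / 2 <= t")
 case True
 have "?I <= NI (%x. ind S x)" by (intro nn_integral_mono) (auto simp: indicator_def)
 also have "... = 1 * emeasure lborel S" by simp
 also have "... <= ennreal (t^2 * 4) * emeasure lborel S"
  using power_mono[OF True, of 2] by (intro mult_right_mono) (auto simp: power2_eq_square)
 finally show ?thesis by (simp add: ennreal_mult mult.assoc)
next
 case False
 let ?c = "- (1 - t) / t"
 have c: "?c ~= 0" using t by simp
 have "1 / (4 * t^2) <= ?c^2" using power_mono[of "1/2" "1 - t" 2] False t
  by (simp add: power_divide power2_commute[of 1 t] divide_simps)
 hence "ennreal (1 / (4 * t^2)) * ?I <= ennreal (\<bar>?c\<bar> ^ DIM(real^2)) * ?I"
  by (intro mult_right_mono ennreal_leI) (auto simp: power_divide)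
 also have "... <= ennreal (\<bar>?c\<bar> ^ DIM(real^2)) * NI (%x. ind S ((1 / t) *\<^sub>R z + ?c *\<^sub>R x))"
  by (intro mult_left_mono nn_integral_mono) (auto simp: indicator_def)
 also have "... = emeasure lborel S" using lborel_nn_integral_affine[of "ind S" ?c "(1 / t) *\<^sub>R z"] c by simp
 finally have "ennreal (4 * t^2) * (ennreal (1 / (4 * t^2)) * ?I) <= ennreal (4 * t^2) * emeasure lborel S"
  by (rule mult_left_mono) simp
 moreover have "ennreal (4 * t^2) * ennreal (1 / (4 * t^2)) = 1" using t by (simp add: ennreal_mult[symmetric])
 ultimately show ?thesis by (simp add: mult.assoc[symmetric] ennreal_mult) (simp add: mult_ac)
qed

text \<open>Common source of the Poincare inequality (weight 1, exponent 0) and of the weighted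
  Sobolev inequality (exponent 1/p): the difference is integrated along the segment, and Tonelli
  moves the gradient to the intermediate point.\<close>

lemma segment_energy:
 fixes V :: "real^2 => ennreal" and B :: "real => ennreal"
 assumes V [measurable]: "V : bmeas" and S_meas [measurable]: "S : sets borel"
  and [measurable]: "B : bmeas" and S: "convex S" and kp: "kp < 1" and G: "C_k (Suc 0) G"
  and d: "!!x y. x : S ==> y : S ==> norm (y - x) <= d"
  and B: "!!z t. 0 < t ==> t < 1 ==> z : S ==>
   (NI (%x. V x * ind S x * ind S ((1 / t) *\<^sub>R z + (- (1 - t) / t) *\<^sub>R x))) <= ennreal (t^2) * B t"
 shows "NI (%x. (NI (%y. V x * ennreal ((G y - G x)^2) * ind S x * ind S y)))
  <= ennreal (d^2 / (1 - kp)) * NI (%t. ennreal (t powr kp) * B t * ind {0..1} t) *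
   nnI S (%z. (norm (gradient G z))^2)"
proof -
 have [measurable]: "gradient G : bmeas" using C1_gradient_continuous[OF G] by (rule borel_measurable_continuous_onI)
 let ?N = "%z. ennreal ((norm (gradient G z))^2)"
 let ?w = "%t::real. ennreal (t powr kp) * ind {0..1} t"
 let ?K = "%t x y. V x * ?N (x + t *\<^sub>R (y - x)) * ind S x * ind S y"
 have "NI (%x. (NI (%y. V x * ennreal ((G y - G x)^2) * ind S x * ind S y)))
   <= NI (%x. (NI (%y. (NI (%t. ennreal (d^2 / (1 - kp)) * (?w t * ?K t x y))))))"
 proof (intro nn_integral_mono)
  fix x y :: "real^2"
  show "V x * ennreal ((G y - G x)^2) * ind S x * ind S y <=
    NI (%t. ennreal (d^2 / (1 - kp)) * (?w t * ?K t x y))"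
  proof (cases "x : S & y : S")
   case True
   have "ennreal ((G y - G x)^2) <= ennreal ((norm (y - x))^2 / (1 - kp)) *
     nnI {0..1} (%t. t powr kp * (norm (gradient G (x + t *\<^sub>R (y - x))))^2)"
    by (rule segment_square_bound[OF G kp])
   also have "... <= ennreal (d^2 / (1 - kp)) *
     nnI {0..1} (%t. t powr kp * (norm (gradient G (x + t *\<^sub>R (y - x))))^2)"
    using d[of x y] True kp by (intro mult_right_mono ennreal_leI divide_right_mono power_mono) auto
   also have "nnI {0..1} (%t. t powr kp * (norm (gradient G (x + t *\<^sub>R (y - x))))^2) =
     NI (%t. ?w t * ?N (x + t *\<^sub>R (y - x)))"
    by (intro nn_integral_cong) (auto simp: indicator_def ennreal_mult)
   finally have "V x * ennreal ((G y - G x)^2) <= V x * (ennreal (d^2 / (1 - kp)) * NI (%t. ?w t * ?N (x + t *\<^sub>R (y - x))))"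
    by (rule mult_left_mono) simp
   also have "... = NI (%t. V x * (ennreal (d^2 / (1 - kp)) * (?w t * ?N (x + t *\<^sub>R (y - x)))))"
    by (simp add: nn_integral_cmult)
   also have "... = NI (%t. ennreal (d^2 / (1 - kp)) * (?w t * ?K t x y))"
    using True by (intro nn_integral_cong) (simp add: mult_ac)
   finally show ?thesis using True by simp
  qed auto
 qed
 also have "... = NI (%x. (NI (%t. (NI (%y. ennreal (d^2 / (1 - kp)) * (?w t * ?K t x y))))))"
  by (intro nn_integral_cong lborel_pair.Fubini') measurable
 also have "... = NI (%t. (NI (%x. (NI (%y. ennreal (d^2 / (1 - kp)) * (?w t * ?K t x y))))))"
  by (rule lborel_pair.Fubini') measurable
 also have "... = NI (%t. ennreal (d^2 / (1 - kp)) * (?w t * NI (%x. (NI (%y. ?K t x y)))))" by (simp add: nn_integral_cmult)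
 also have "... <= NI (%t. ennreal (d^2 / (1 - kp)) * (?w t * (B t * NI (%z. ?N z * ind S z))))"
 proof (rule nn_integral_mono_AE)
  have "AE t in lborel. t ~= (0::real) & t ~= 1"
   using AE_lborel_singleton[of "0::real"] AE_lborel_singleton[of "1::real"] by eventually_elim auto
  thus "AE t in lborel. ennreal (d^2 / (1 - kp)) * (?w t * NI (%x. (NI (%y. ?K t x y)))) <=
    ennreal (d^2 / (1 - kp)) * (?w t * (B t * NI (%z. ?N z * ind S z)))"
  proof eventually_elim
   fix t :: real assume t: "t ~= 0 & t ~= 1"
   show "ennreal (d^2 / (1 - kp)) * (?w t * NI (%x. (NI (%y. ?K t x y)))) <=
    ennreal (d^2 / (1 - kp)) * (?w t * (B t * NI (%z. ?N z * ind S z)))"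
   proof (cases "t : {0..1}")
    case True
    hence t01: "0 < t" "t < 1" using t by auto
    have "NI (%x. (NI (%y. ?K t x y))) <= B t * NI (%z. ?N z * ind S z)"
     by (rule segment_tonelli[OF V _ S_meas S t01 B[OF t01]]) auto
    thus ?thesis by (intro mult_left_mono) auto
   qed simp
  qed
 qed
 also have "... = NI (%t. ennreal (d^2 / (1 - kp)) * (ennreal (t powr kp) * B t * ind {0..1} t)
   * NI (%z. ?N z * ind S z))"
  by (intro nn_integral_cong) (simp add: mult_ac)
 also have "... = ennreal (d^2 / (1 - kp)) * NI (%t. ennreal (t powr kp) * B t * ind {0..1} t)
   * NI (%z. ?N z * ind S z)"
  by (simp add: nn_integral_cmult nn_integral_multc)
 finally show ?thesis .
qed

lemma Poincare_double_integral:
 assumes S [measurable]: "S : sets borel" "convex S" and G: "C_k (Suc 0) G"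
  and d: "!!x y. x : S ==> y : S ==> norm (y - x) <= d"
 shows "NI (%x. (NI (%y. ennreal ((G y - G x)^2) * ind S x * ind S y)))
  <= ennreal (d^2) * (4 * emeasure lborel S) * nnI S (%z. (norm (gradient G z))^2)"
proof -
 have "NI (%x. (NI (%y. 1 * ennreal ((G y - G x)^2) * ind S x * ind S y)))
  <= ennreal (d^2 / (1 - 0)) * NI (%t. ennreal (t powr 0) * (4 * emeasure lborel S) * ind {0..1} t) *
   nnI S (%z. (norm (gradient G z))^2)"
  by (rule segment_energy[OF _ S(1) _ S(2) _ G d]) (use segment_area[OF S(1)] in auto)
 moreover have "NI (%t. ennreal (t powr 0) * (4 * emeasure lborel S) * ind {0..1::real} t) = 4 * emeasure lborel S"
 proof -
  have "NI (%t. ennreal (t powr 0) * (4 * emeasure lborel S) * ind {0..1::real} t) =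
   NI (%t. (4 * emeasure lborel S) * (ennreal (t powr - 0) * ind {0..1::real} t))"
   by (intro nn_integral_cong) (simp add: mult_ac)
  also have "... = 4 * emeasure lborel S" using nn_integral_powr_01[of 0] by (subst nn_integral_cmult) auto
  finally show ?thesis .
 qed
 ultimately show ?thesis by simp
qed


section \<open>A weighted Sobolev inequality\<close>

text \<open>A substitute for Hoelder's inequality: \<open>V\<close> is split at the level \<open>M\<close>.\<close>

lemma nn_integral_split_level:
 fixes V :: "'a::euclidean_space => real" and e :: "'a => ennreal"
 assumes [measurable]: "V : bmeas" "S : sets borel" "e : bmeas"
  and V: "!!x. 0 <= V x" and p: "1 < p" and M: "0 < M" and A: "0 <= A" and E: "0 <= E"
  and VA: "nnI S (%x. V x powr p) <= ennreal A"
  and e: "!!x. e x <= 1" "NI (%x. ind S x * e x) <= ennreal E"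
 shows "NI (%x. ennreal (V x) * ind S x * e x) <= ennreal (M powr (1 - p) * A + M * E)"
proof -
 have pw: "V x <= M powr (1 - p) * V x powr p + M" for x
 proof (cases "V x <= M")
  case True
  thus ?thesis by (simp add: add_increasing)
 next
  case False
  hence "V x powr (1 - p) <= M powr (1 - p)"
   using M p by (intro powr_mono2') auto
  hence "V x powr (1 - p) * V x powr p <= M powr (1 - p) * V x powr p"
   by (intro mult_right_mono) auto
  moreover have "V x powr (1 - p) * V x powr p = V x" using False M by (simp add: powr_add[symmetric])
  ultimately show ?thesis using M by linarith
 qed
 have "NI (%x. ennreal (V x) * ind S x * e x) <=
   NI (%x. ennreal (M powr (1 - p)) * (ennreal (V x powr p) * ind S x) + ennreal M * (ind S x * e x))"
 proof (intro nn_integral_mono)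
  fix x
  have "ennreal (V x) <= ennreal (M powr (1 - p) * V x powr p + M)" using pw by (rule ennreal_leI)
  also have "... = ennreal (M powr (1 - p)) * ennreal (V x powr p) + ennreal M"
   using M by (simp add: ennreal_plus ennreal_mult)
  finally have "ennreal (V x) * (ind S x * e x) <=
    (ennreal (M powr (1 - p)) * ennreal (V x powr p) + ennreal M) * (ind S x * e x)"
   by (rule mult_right_mono) simp
  also have "... = (ennreal (M powr (1 - p)) * ennreal (V x powr p) * ind S x) * e x + ennreal M * (ind S x * e x)"
   by (simp only: distrib_right mult.assoc)
  also have "... <= (ennreal (M powr (1 - p)) * ennreal (V x powr p) * ind S x) * 1 + ennreal M * (ind S x * e x)"
   by (intro add_mono mult_left_mono e) auto
  finally show "ennreal (V x) * ind S x * e x <=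
    ennreal (M powr (1 - p)) * (ennreal (V x powr p) * ind S x) + ennreal M * (ind S x * e x)"
   by (simp add: mult_ac)
 qed
 also have "... = ennreal (M powr (1 - p)) * nnI S (%x. V x powr p) + ennreal M * NI (%x. ind S x * e x)"
  by (simp add: nn_integral_add nn_integral_cmult)
 also have "... <= ennreal (M powr (1 - p)) * ennreal A + ennreal M * ennreal E" by (intro add_mono mult_left_mono VA e) auto
 also have "... = ennreal (M powr (1 - p) * A + M * E)" using M A E by (simp add: ennreal_plus ennreal_mult)
 finally show ?thesis .
qed

text \<open>Integrating (G x)^2 <= 2 (G y)^2 + 2 (G y - G x)^2 against V x over both variables
  separates the mass of \<open>V\<close> from the square norm of \<open>G\<close>; the difference
  term is a segment energy. Its bound splits \<open>V\<close> at a level that depends on the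
  parameter t of the segment.\<close>

lemma weighted_Sobolev:
 fixes V G :: "real^2 => real"
 assumes V_meas [measurable]: "V : bmeas" and S_meas [measurable]: "S : sets borel" and S: "convex S"
  and A0: "emeasure lborel S = ennreal A0" "0 < A0"
  and d: "!!x y. x : S ==> y : S ==> norm (y - x) <= d"
  and V: "!!x. 0 <= V x" and p: "1 < p" and A: "0 < A"
  and VA: "nnI S (%x. V x powr p) <= ennreal A"
  and G: "C_k (Suc 0) G"
 shows "nnI S (%x. V x * (G x)^2) <= ennreal ((A / A0) powr (1 / p)) * (4 * nnI S (%x. (G x)^2) +
  ennreal (10 * d^2 / (1 - 1 / p)^2) * nnI S (%x. (norm (gradient G x))^2))"
proof -
 have [measurable]: "G : bmeas" using C_k_imp_continuous[OF G] by (rule borel_measurable_continuous_onI)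
 define Q where "Q = (A / A0) powr (1 / p)"
 have Q: "0 < Q" using A A0 by (simp add: Q_def)
 have Qp: "Q powr (1 - p) * A = Q * A0"
 proof -
  have "Q powr (1 - p) = Q * Q powr (- p)" using Q powr_add[of Q 1 "- p"] by simp
  also have "Q powr (- p) = (A / A0) powr (- 1)" using p A A0 by (simp add: Q_def powr_powr)
  also have "... = A0 / A" using A A0 by (simp add: powr_minus)
  finally show ?thesis using A by simp
 qed
 let ?I = "\<integral>\<^sup>+ x. ennreal ((norm (gradient G x))^2) * ind S x \<partial>lborel"
 let ?J = "\<integral>\<^sup>+ x. ennreal ((G x)^2) * ind S x \<partial>lborel"
 let ?L = "\<integral>\<^sup>+ x. ennreal (V x * (G x)^2) * ind S x \<partial>lborel"
 define B where "B t = ennreal (5 * A0 * (Q * t powr (- (2 / p))))" for t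
 \<comment> \<open>The exponent 1/p leaves t powr (- 1/p) after multiplication with the bound of
   order t powr (- 2/p), and this is integrable since p > 1; exponent 0 would fail for p <=
   2.\<close>
 have "NI (%x. (NI (%y. ennreal (V x) * ennreal ((G y - G x)^2) * ind S x * ind S y)))
  <= ennreal (d^2 / (1 - 1 / p)) * NI (%t. ennreal (t powr (1 / p)) * B t * ind {0..1} t) * ?I"
 proof (rule segment_energy[OF _ S_meas _ S _ G d])
  fix z :: "real^2" and t :: real assume t: "0 < t" "t < 1" and z: "z : S"
  \<comment> \<open>This level balances the two parts of the split: M powr (1 - p) * A equals M t^2
    A0, and together with the area bound 4 t^2 A0 the sum is 5 M t^2 A0.\<close>
  let ?M = "Q * t powr (- (2 / p))"
  have M: "0 < ?M" using Q t by simp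
  have "?M powr (1 - p) * A = Q powr (1 - p) * A * (t powr (- (2 / p))) powr (1 - p)" using Q t by (simp add: powr_mult)
  also have "... = Q * A0 * (t powr (- (2 / p)) * t powr 2)"
   unfolding Qp powr_powr powr_add[symmetric] using p by (simp add: right_diff_distrib)
  finally have Mp: "?M powr (1 - p) * A = ?M * (t^2 * A0)" using t by (simp add: powr_numeral)
  have "NI (%x. ennreal (V x) * ind S x * ind S ((1 / t) *\<^sub>R z + (- (1 - t) / t) *\<^sub>R x))
    <= ennreal (?M powr (1 - p) * A + ?M * (t^2 * (4 * A0)))"
  proof (rule nn_integral_split_level[OF V_meas S_meas _ V p M _ _ VA])
   show "NI (%x. ind S x * ind S ((1 / t) *\<^sub>R z + (- (1 - t) / t) *\<^sub>R x)) <= ennreal (t^2 * (4 * A0))"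
    using segment_area[OF S_meas t, of z] A0 by (simp add: ennreal_mult)
  qed (use A A0 in \<open>auto simp: indicator_def\<close>)
  also have "?M powr (1 - p) * A + ?M * (t^2 * (4 * A0)) = t^2 * (5 * A0 * ?M)" unfolding Mp by (simp add: algebra_simps)
  finally show "NI (%x. ennreal (V x) * ind S x * ind S ((1 / t) *\<^sub>R z + (- (1 - t) / t) *\<^sub>R x))
    <= ennreal (t^2) * B t"
   by (simp add: B_def ennreal_mult')
 qed (use p in \<open>auto simp: B_def\<close>)
 also have "NI (%t. ennreal (t powr (1 / p)) * B t * ind {0..1} t) =
   NI (%t. ennreal (5 * A0 * Q) * (ennreal (t powr (- (1 / p))) * ind {0..1} t))"
 proof (intro nn_integral_cong)
  fix t :: real
  have "t powr (1 / p) * (5 * A0 * (Q * t powr (- (2 / p)))) = 5 * A0 * Q * (t powr (1 / p) * t powr (- (2 / p)))"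
   by (simp add: mult_ac)
  also have "t powr (1 / p) * t powr (- (2 / p)) = t powr (- (1 / p))" by (simp add: powr_add[symmetric])
  finally have eq: "t powr (1 / p) * (5 * A0 * (Q * t powr (- (2 / p)))) = 5 * A0 * Q * t powr (- (1 / p))" .
  have "ennreal (t powr (1 / p)) * B t = ennreal (5 * A0 * Q) * ennreal (t powr (- (1 / p)))"
   unfolding B_def using A0 Q by (simp only: ennreal_mult[symmetric] powr_ge_zero eq mult_nonneg_nonneg less_imp_le zero_le_numeral)
  thus "ennreal (t powr (1 / p)) * B t * ind {0..1} t =
    ennreal (5 * A0 * Q) * (ennreal (t powr (- (1 / p))) * ind {0..1} t)"
   by (simp add: mult.assoc)
 qed
 also have "... = ennreal (5 * A0 * Q) * ennreal (1 / (1 - 1 / p))"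
  using nn_integral_powr_01[of "1 / p"] p by (subst nn_integral_cmult) auto
 finally have energy: "NI (%x. (NI (%y. ennreal (V x) * ennreal ((G y - G x)^2) * ind S x * ind S y)))
  <= ennreal (d^2 / (1 - 1 / p)) * (ennreal (5 * A0 * Q) * ennreal (1 / (1 - 1 / p))) * ?I" .
 have "NI (%x. ennreal (V x) * ind S x * 1) <= ennreal (Q powr (1 - p) * A + Q * A0)"
  by (rule nn_integral_split_level[OF V_meas S_meas _ V p Q _ _ VA]) (use A A0 in auto)
 hence intV: "nnI S (%x. V x) <= ennreal (2 * A0 * Q)"
  unfolding Qp by (simp add: mult_ac)
 have "ennreal A0 * ?L = NI (%x. (NI (%y. ennreal (V x * (G x)^2) * ind S x * ind S y)))"
  by (simp add: nn_integral_cmult nn_integral_multc A0(1) mult.commute)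
 also have "... <= NI (%x. (NI (%y. 2 * ((ennreal (V x) * ind S x) * (ennreal ((G y)^2) * ind S y)) +
   2 * (ennreal (V x) * ennreal ((G y - G x)^2) * ind S x * ind S y))))"
 proof (intro nn_integral_mono)
  fix x y
  have "V x * (G x)^2 <= 2 * (V x * (G y)^2) + 2 * (V x * (G y - G x)^2)"
   using mult_left_mono[OF power2_sum_le[of "G y" "G x - G y"] V[of x]]
   by (simp add: distrib_left power2_commute[of "G x"] mult.left_commute)
  hence "ennreal (V x * (G x)^2) <= ennreal (2 * (V x * (G y)^2) + 2 * (V x * (G y - G x)^2))"
   by (rule ennreal_leI)
  also have "... = 2 * (ennreal (V x) * ennreal ((G y)^2)) + 2 * (ennreal (V x) * ennreal ((G y - G x)^2))"
   using V[of x] by (simp add: ennreal_plus ennreal_mult)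
  finally show "ennreal (V x * (G x)^2) * ind S x * ind S y <=
    2 * ((ennreal (V x) * ind S x) * (ennreal ((G y)^2) * ind S y)) +
    2 * (ennreal (V x) * ennreal ((G y - G x)^2) * ind S x * ind S y)"
   by (auto simp: indicator_def)
 qed
 also have "... = 2 * (nnI S (%x. V x) * ?J) +
   2 * NI (%x. (NI (%y. ennreal (V x) * ennreal ((G y - G x)^2) * ind S x * ind S y)))"
  by (simp add: nn_integral_add nn_integral_cmult nn_integral_multc)
 also have "... <= 2 * (ennreal (2 * A0 * Q) * ?J) +
   2 * (ennreal (d^2 / (1 - 1 / p)) * (ennreal (5 * A0 * Q) * ennreal (1 / (1 - 1 / p))) * ?I)"
  by (intro add_mono mult_left_mono mult_right_mono intV energy) auto
 also have "... = ennreal A0 * (ennreal Q * (4 * ?J + ennreal (10 * d^2 / (1 - 1 / p)^2) * ?I))"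
 proof -
  have "2 * ennreal (2 * A0 * Q) = ennreal A0 * (ennreal Q * 4)"
   using A0 Q by (simp add: ennreal_mult[symmetric] ennreal_numeral[symmetric] del: ennreal_numeral)
  moreover have "2 * (ennreal (d^2 / (1 - 1 / p)) * (ennreal (5 * A0 * Q) * ennreal (1 / (1 - 1 / p)))) =
    ennreal A0 * (ennreal Q * ennreal (10 * d^2 / (1 - 1 / p)^2))"
  proof -
   have nn: "0 <= d^2 / (1 - 1 / p)" "0 <= 5 * A0 * Q" "0 <= 1 / (1 - 1 / p)" "0 <= 10 * d^2 / (1 - 1 / p)^2" "0 <= A0" "0 <= Q"
    using p A0 Q by auto
   have "2 * (d^2 / (1 - 1 / p) * (5 * A0 * Q * (1 / (1 - 1 / p)))) = A0 * (Q * (10 * d^2 / (1 - 1 / p)^2))"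
    by (simp add: power2_eq_square)
   thus ?thesis
    by (simp only: ennreal_mult[symmetric] nn mult_nonneg_nonneg ennreal_numeral[symmetric] zero_le_numeral)
  qed
  ultimately show ?thesis by (simp add: distrib_left mult.assoc[symmetric])
 qed
 finally show ?thesis using A0(2) unfolding Q_def by (subst (asm) ennreal_mult_le_mult_iff) auto
qed

section \<open>Mean values and Taylor polynomials\<close>

lemma integrable_continuous_bounded:
 fixes f :: "'a::euclidean_space => real"
 assumes "continuous_on UNIV f" "S : sets borel" "bounded S"
 shows "L1 (%x. ind S x * f x)"
proof -
 have "set_integrable lborel (closure S) f" using assms continuous_on_subset unfolding set_integrable_def
  by (intro borel_integrable_compact) (auto simp: compact_closure)
 from set_integrable_subset[OF this, of S] assms closure_subset[of S]
 show ?thesis by (simp add: set_integrable_def)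
qed

lemma mean_square_le:
 fixes f :: "real^2 => real"
 assumes [measurable]: "f : bmeas" "S : sets borel" and A0: "emeasure lborel S = ennreal A0" "0 < A0"
 shows "ennreal (((LBINT x. ind S x * f x) / A0)^2) <= ennreal (1 / A0) * nnI S (%x. (f x)^2)"
proof -
 have i: "L1 (%x. ind S x / A0)" using A0 by (intro integrable_divide integrable_real_indicator) auto
 have one: "(LBINT x. ind S x / A0) = 1" using A0 by (simp add: measure_def)
 have "ennreal ((LBINT x. ind S x / A0 * f x)^2) <= NI (%x. ennreal (ind S x / A0 * (f x)^2))"
  using A0 by (intro weighted_square_mean_le[OF i _ one]) auto
 also have "... = NI (%x. ennreal (1 / A0) * (ennreal ((f x)^2) * ind S x))"
  using A0 by (intro nn_integral_cong) (auto simp: indicator_def ennreal_mult[symmetric])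
 also have "... = ennreal (1 / A0) * nnI S (%x. (f x)^2)" by (rule nn_integral_cmult) measurable
 finally show ?thesis by simp
qed

lemma mean_deviation_le:
 fixes f :: "real^2 => real"
 assumes [measurable]: "f : bmeas" "S : sets borel" and A0: "emeasure lborel S = ennreal A0" "0 < A0"
  and int: "L1 (%x. ind S x * f x)"
 shows "nnI S (%x. (f x - (LBINT y. ind S y * f y) / A0)^2) <=
  ennreal (1 / A0) * NI (%x. (NI (%y. ennreal ((f y - f x)^2) * ind S x * ind S y)))"
proof -
 have i: "L1 (ind S :: real^2 => real)" using A0 by (intro integrable_real_indicator) auto
 have "nnI S (%x. (f x - (LBINT y. ind S y * f y) / A0)^2) <=
   NI (%x. ennreal (1 / A0) * NI (%y. ennreal ((f y - f x)^2) * ind S x * ind S y))"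
 proof (intro nn_integral_mono)
  fix x
  have "(LBINT y. ind S y * (f y - f x)) = (LBINT y. ind S y * f y) - f x * (LBINT y. ind S y)"
   unfolding right_diff_distrib using i int by (subst Bochner_Integration.integral_diff) (auto simp: mult.commute)
  also have "(LBINT y. ind S y :: real) = A0" using A0 by (simp add: measure_def)
  finally have "(f x - (LBINT y. ind S y * f y) / A0)^2 = ((LBINT y. ind S y * (f y - f x)) / A0)^2"
   using A0 by (simp add: diff_divide_distrib power2_commute)
  hence "ennreal ((f x - (LBINT y. ind S y * f y) / A0)^2) <= ennreal (1 / A0) * nnI S (%y. (f y - f x)^2)"
   using mean_square_le[of "%y. f y - f x" S A0] A0 by simp
  thus "ennreal ((f x - (LBINT y. ind S y * f y) / A0)^2) * ind S x <=
    ennreal (1 / A0) * NI (%y. ennreal ((f y - f x)^2) * ind S x * ind S y)"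
   by (cases "x : S") auto
 qed
 also have "... = ennreal (1 / A0) * NI (%x. (NI (%y. ennreal ((f y - f x)^2) * ind S x * ind S y)))"
  by (rule nn_integral_cmult) measurable
 finally show ?thesis .
qed

lemma Poincare_mean:
 assumes S: "S : sets borel" "convex S" "bounded S" and A0: "emeasure lborel S = ennreal A0" "0 < A0"
  and d: "!!x y. x : S ==> y : S ==> norm (y - x) <= d" and G: "C_k (Suc 0) G"
 shows "nnI S (%x. (G x - (LBINT y. ind S y * G y) / A0)^2) <=
  ennreal (4 * d^2) * nnI S (%z. (norm (gradient G z))^2)"
proof -
 have cont: "continuous_on UNIV G" by (rule C_k_imp_continuous[OF G])
 have "nnI S (%x. (G x - (LBINT y. ind S y * G y) / A0)^2) <=
   ennreal (1 / A0) * NI (%x. (NI (%y. ennreal ((G y - G x)^2) * ind S x * ind S y)))"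
  using S A0 by (intro mean_deviation_le borel_measurable_continuous_onI[OF cont] integrable_continuous_bounded[OF cont]) auto
 also have "... <= ennreal (1 / A0) * (ennreal (d^2) * (4 * emeasure lborel S) *
   nnI S (%z. (norm (gradient G z))^2))"
  by (intro mult_left_mono Poincare_double_integral S G d) auto
 also have "... = (ennreal (1 / A0) * (ennreal (d^2) * (4 * ennreal A0))) * nnI S (%z. (norm (gradient G z))^2)"
  unfolding A0(1) by (simp add: mult.assoc)
 also have "ennreal (1 / A0) * (ennreal (d^2) * (4 * ennreal A0)) = ennreal (4 * d^2)"
  using A0 by (simp add: ennreal_mult[symmetric] ennreal_numeral[symmetric] del: ennreal_numeral)
 finally show ?thesis .
qed

definition hess_sq :: "(real^2 => real) => real^2 => real" where
 "hess_sq G z = (SUM i:UNIV. (norm (gradient (pd i G) z))^2)"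

lemma hessian_square_nonneg: "0 <= hess_sq G z"
 by (auto simp: hess_sq_def intro: sum_nonneg)

lemma hessian_square_continuous:
 assumes "C_k (Suc (Suc 0)) G"
 shows "continuous_on UNIV (hess_sq G)"
 unfolding hess_sq_def
 using assms by (intro continuous_intros C1_gradient_continuous) auto

lemma Taylor_remainder_square:
 assumes G: "C_k (Suc (Suc 0)) G" and v: "norm (a - x) <= d"
 shows "ennreal ((G a - (G x + gradient G x \<bullet> (a - x)))^2) <=
  ennreal (d ^ 4) * nnI {0..1} (%t. (1 - t)^2 * hess_sq G (x + t *\<^sub>R (a - x)))"
proof -
 have G1: "C_k (Suc 0) G" using G by (rule C_k_Suc_imp)
 have Gi: "C_k (Suc 0) (pd i G)" for i using G by simp
 define v where "v = a - x"
 have vd: "norm v <= d" using v by (simp add: v_def)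
 define m where "m t = (1 - t) * (SUM i:UNIV. v $ i * (gradient (pd i G) (x + t *\<^sub>R v) \<bullet> v))" for t
 have m_cont: "continuous_on UNIV m"
  unfolding m_def by (intro continuous_intros continuous_on_compose2[OF C1_gradient_continuous[OF Gi, of UNIV]]) auto
 have [measurable]: "m : bmeas" using m_cont by (rule borel_measurable_continuous_onI)
 have [measurable]: "hess_sq G : bmeas" using hessian_square_continuous[OF G] by (rule borel_measurable_continuous_onI)
 have grad: "gradient G z \<bullet> v = (SUM i:UNIV. v $ i * pd i G z)" for z
  by (simp add: inner_vec_def gradient_def mult.commute)
 \<comment> \<open>For t = 0 this function is the first order Taylor polynomial at \<open>x\<close>,
   evaluated at \<open>a\<close>, and for t = 1 it is G a. The first order terms of its derivative
   cancel, so only second derivatives remain.\<close>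
 have deriv: "((%t. G (x + t *\<^sub>R v) + (1 - t) * (gradient G (x + t *\<^sub>R v) \<bullet> v)) has_real_derivative m t) (at t)" for t
 proof -
  have "((%t. gradient G (x + t *\<^sub>R v) \<bullet> v) has_real_derivative
    (SUM i:UNIV. v $ i * (gradient (pd i G) (x + t *\<^sub>R v) \<bullet> v))) (at t)"
   unfolding grad by (intro DERIV_sum DERIV_cmult C1_line_derivative[OF Gi])
  moreover have "((%t. 1 - t) has_real_derivative - 1) (at t)" by (auto intro!: derivative_eq_intros)
  ultimately have "((%t. (1 - t) * (gradient G (x + t *\<^sub>R v) \<bullet> v)) has_real_derivative
    - 1 * (gradient G (x + t *\<^sub>R v) \<bullet> v) + (SUM i:UNIV. v $ i * (gradient (pd i G) (x + t *\<^sub>R v) \<bullet> v)) * (1 - t)) (at t)"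
   by (rule DERIV_mult[rotated])
  from DERIV_add[OF C1_line_derivative[OF G1, of x v t] this] show ?thesis
   by (simp add: m_def mult.commute)
 qed
 have "ennreal \<bar>(G (x + 1 *\<^sub>R v) + (1 - 1) * (gradient G (x + 1 *\<^sub>R v) \<bullet> v)) - (G (x + 0 *\<^sub>R v) + (1 - 0) * (gradient G (x + 0 *\<^sub>R v) \<bullet> v))\<bar>
   <= NI (%t. ennreal \<bar>m t\<bar> * ind {0..1} t)"
  by (rule nn_ftc[OF deriv]) (use m_cont in \<open>simp add: continuous_on_eq_continuous_at\<close>)
 hence "ennreal \<bar>G a - (G x + gradient G x \<bullet> (a - x))\<bar> <= NI (%t. ennreal \<bar>m t\<bar> * ind {0..1} t)"
  by (simp add: v_def)
 hence "(ennreal \<bar>G a - (G x + gradient G x \<bullet> (a - x))\<bar>)^2 <= NI (%t. ennreal \<bar>m t\<bar> * ind {0..1} t)^2"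
  by (intro power_mono) auto
 also have "... <= ennreal (1 / (1 - 0)) * nnI {0..1} (%t. t powr 0 * \<bar>m t\<bar>\<^sup>2)"
  by (rule weighted_Cauchy_Schwarz_01) auto
 also have "... <= NI (%t. ennreal (d ^ 4) * (ennreal ((1 - t)^2 * hess_sq G (x + t *\<^sub>R v)) * ind {0..1} t))"
 proof -
  have "ennreal (t powr 0 * \<bar>m t\<bar>\<^sup>2) <= ennreal (d ^ 4) * ennreal ((1 - t)^2 * hess_sq G (x + t *\<^sub>R v))" for t
  proof -
   define w :: "real^2" where "w = (\<chi> i. gradient (pd i G) (x + t *\<^sub>R v) \<bullet> v)"
   have "(norm w)^2 = (SUM i:UNIV. (gradient (pd i G) (x + t *\<^sub>R v) \<bullet> v)^2)"
    by (simp add: norm_eq_sqrt_inner inner_vec_def w_def power2_eq_square sum_nonneg)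
   also have "... <= (SUM i:UNIV. (norm (gradient (pd i G) (x + t *\<^sub>R v)))^2 * (norm v)^2)"
    by (intro sum_mono) (simp add: power_mult_distrib[symmetric] abs_le_square_iff[symmetric] Cauchy_Schwarz_ineq2)
   also have "... = hess_sq G (x + t *\<^sub>R v) * (norm v)^2" by (simp add: hess_sq_def sum_distrib_right)
   finally have w: "(norm w)^2 <= hess_sq G (x + t *\<^sub>R v) * (norm v)^2" .
   have "(SUM i:UNIV. v $ i * (gradient (pd i G) (x + t *\<^sub>R v) \<bullet> v))^2 = (v \<bullet> w)^2"
    by (simp add: inner_vec_def w_def)
   also have "... <= (norm v)^2 * (norm w)^2" using Cauchy_Schwarz_ineq[of v w] by (simp add: power2_norm_eq_inner)
   also have "... <= (norm v)^2 * (hess_sq G (x + t *\<^sub>R v) * (norm v)^2)" by (intro mult_left_mono w) auto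
   also have "... = (norm v) ^ 4 * hess_sq G (x + t *\<^sub>R v)" by (simp add: power2_eq_square power4_eq_xxxx)
   also have "... <= d ^ 4 * hess_sq G (x + t *\<^sub>R v)"
    by (intro mult_right_mono power_mono vd hessian_square_nonneg) auto
   finally have "(1 - t)^2 * (SUM i:UNIV. v $ i * (gradient (pd i G) (x + t *\<^sub>R v) \<bullet> v))^2 <=
     (1 - t)^2 * (d ^ 4 * hess_sq G (x + t *\<^sub>R v))" by (rule mult_left_mono) simp
   hence "\<bar>m t\<bar>\<^sup>2 <= d ^ 4 * ((1 - t)^2 * hess_sq G (x + t *\<^sub>R v))"
    by (simp add: m_def power_mult_distrib mult_ac)
   moreover have "t powr 0 * \<bar>m t\<bar>\<^sup>2 <= \<bar>m t\<bar>\<^sup>2" by simp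
   ultimately have "t powr 0 * \<bar>m t\<bar>\<^sup>2 <= d ^ 4 * ((1 - t)^2 * hess_sq G (x + t *\<^sub>R v))" by linarith
   thus ?thesis using hessian_square_nonneg by (simp add: ennreal_mult[symmetric] ennreal_leI)
  qed
  hence "ennreal (t powr 0 * \<bar>m t\<bar>\<^sup>2) * ind {0..1} t <=
    ennreal (d ^ 4) * (ennreal ((1 - t)^2 * hess_sq G (x + t *\<^sub>R v)) * ind {0..1} t)" for t
   unfolding mult.assoc[symmetric] by (rule mult_right_mono) simp
  thus ?thesis unfolding diff_zero div_by_1 ennreal_1 mult_1 by (rule nn_integral_mono)
 qed
 also have "... = ennreal (d ^ 4) * nnI {0..1} (%t. (1 - t)^2 * hess_sq G (x + t *\<^sub>R v))"
  by (rule nn_integral_cmult) measurable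
 finally show ?thesis by (simp add: v_def ennreal_power)
qed

text \<open>The remainder carries the factor (1 - t)^2, and the substitution z = x + t (a - x) has
  exactly this Jacobian. Hence square integrable second derivatives control the value at a single
  point, even one on the boundary of \<open>S\<close>.\<close>

lemma Taylor_mean_at_vertex:
 assumes S: "open S" "convex S" "bounded S" and A0: "emeasure lborel S = ennreal A0" "0 < A0"
  and a: "a : closure S" and d: "!!x. x : S ==> norm (a - x) <= d" and G: "C_k (Suc (Suc 0)) G"
 shows "ennreal ((G a - (LBINT x. ind S x * (G x + gradient G x \<bullet> (a - x))) / A0)^2) <=
  ennreal (d ^ 4 / A0) * nnI S (%z. hess_sq G z)"
proof -
 have G1: "C_k (Suc 0) G" using G by (rule C_k_Suc_imp)
 have S_meas [measurable]: "S : sets borel" using S by simp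
 let ?L = "%x. G x + gradient G x \<bullet> (a - x)"
 have L_cont: "continuous_on UNIV ?L" by (intro continuous_intros C_k_imp_continuous[OF G] C1_gradient_continuous[OF G1])
 have [measurable]: "?L : bmeas" using L_cont by (rule borel_measurable_continuous_onI)
 have [measurable]: "hess_sq G : bmeas" using hessian_square_continuous[OF G] by (rule borel_measurable_continuous_onI)
 have i: "L1 (ind S :: real^2 => real)" using A0 by (intro integrable_real_indicator) auto
 have "(LBINT x. ind S x * (G a - ?L x)) = G a * (LBINT x. ind S x) - (LBINT x. ind S x * ?L x)"
  unfolding right_diff_distrib[of "ind S _"] using i integrable_continuous_bounded[OF L_cont S_meas S(3)]
  by (subst Bochner_Integration.integral_diff) (auto simp: mult.commute)
 also have "(LBINT x. ind S x :: real) = A0" using A0 by (simp add: measure_def)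
 finally have eq: "G a - (LBINT x. ind S x * ?L x) / A0 = (LBINT x. ind S x * (G a - ?L x)) / A0"
  using A0 by (simp add: diff_divide_distrib)
 let ?K = "%t x. ennreal ((1 - t)^2 * hess_sq G (x + t *\<^sub>R (a - x))) * ind {0..1} t"
 have "ennreal ((G a - (LBINT x. ind S x * ?L x) / A0)^2) <= ennreal (1 / A0) * nnI S (%x. (G a - ?L x)^2)"
  unfolding eq by (rule mean_square_le[OF _ _ A0]) measurable
 also have "... <= ennreal (1 / A0) * NI (%x. ennreal (d ^ 4) * NI (%t. ?K t x * ind S x))"
 proof (intro mult_left_mono nn_integral_mono)
  fix x
  show "ennreal ((G a - ?L x)^2) * ind S x <= ennreal (d ^ 4) * NI (%t. ?K t x * ind S x)"
   using Taylor_remainder_square[OF G d, of x] by (cases "x : S") auto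
 qed simp
 also have "... = ennreal (1 / A0) * (ennreal (d ^ 4) * NI (%x. (NI (%t. ?K t x * ind S x))))"
  by (subst nn_integral_cmult) auto
 also have "NI (%x. (NI (%t. ?K t x * ind S x))) = NI (%t. (NI (%x. ?K t x * ind S x)))"
  by (rule lborel_pair.Fubini') measurable
 also have "... <= (\<integral>\<^sup>+ t. (nnI S (%z. hess_sq G z)) * ind {0..1} t \<partial>(lborel::real measure))"
 proof (rule nn_integral_mono_AE)
  have "AE t in lborel. t ~= (1::real)" by (rule AE_lborel_singleton)
  thus "AE t in lborel. (NI (%x. ?K t x * ind S x)) <= nnI S (%z. hess_sq G z) * ind {0..1::real} t"
  proof eventually_elim
   fix t :: real assume "t ~= 1"
   show "NI (%x. ?K t x * ind S x) <= nnI S (%z. hess_sq G z) * ind {0..1::real} t"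
   proof (cases "t : {0..1}")
    case True
    hence t: "0 <= t" "t < 1" using \<open>t \<noteq> 1\<close> by auto
    have pt: "x + t *\<^sub>R (a - x) : S" if "x : S" for x
     using mem_interior_closure_convex_shrink[OF S(2), of x a "1 - t"] that a t S(1)
     by (simp add: interior_open algebra_simps)
    have "NI (%x. ?K t x * ind S x) <=
      NI (%x. ennreal ((1 - t)^2) * (ennreal (hess_sq G (t *\<^sub>R a + (1 - t) *\<^sub>R x)) * ind S (t *\<^sub>R a + (1 - t) *\<^sub>R x)))"
    proof (intro nn_integral_mono)
     fix x
     have "x + t *\<^sub>R (a - x) = t *\<^sub>R a + (1 - t) *\<^sub>R x" by (simp add: algebra_simps)
     thus "?K t x * ind S x <=
       ennreal ((1 - t)^2) * (ennreal (hess_sq G (t *\<^sub>R a + (1 - t) *\<^sub>R x)) * ind S (t *\<^sub>R a + (1 - t) *\<^sub>R x))"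
      using pt[of x] True hessian_square_nonneg by (auto simp: indicator_def ennreal_mult)
    qed
    also have "... = ennreal (\<bar>1 - t\<bar> ^ DIM(real^2)) *
      NI (%x. ennreal (hess_sq G (t *\<^sub>R a + (1 - t) *\<^sub>R x)) * ind S (t *\<^sub>R a + (1 - t) *\<^sub>R x))"
     by (subst nn_integral_cmult) auto
    also have "... = nnI S (%z. hess_sq G z)"
     by (rule lborel_nn_integral_affine[where f="%z. ennreal (hess_sq G z) * ind S z"]) (use t in auto)
    finally show ?thesis using True by simp
   qed simp
  qed
 qed
 also have "... = nnI S (%z. hess_sq G z)" by (subst nn_integral_cmult) auto
 finally have "ennreal ((G a - (LBINT x. ind S x * ?L x) / A0)^2) <=
   ennreal (1 / A0) * (ennreal (d ^ 4) * nnI S (%z. hess_sq G z))"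
  by (simp add: mult_left_mono)
 also have "... = ennreal (d ^ 4 / A0) * nnI S (%z. hess_sq G z)"
  using A0 by (simp add: mult.assoc[symmetric] ennreal_mult[symmetric])
 finally show ?thesis .
qed


section \<open>Smooth approximation up to the boundary\<close>

locale convex_domain =
 fixes D :: "(real^2) set"
 assumes D: "open D" "bounded D" "convex D" "D ~= {}"
begin

lemma D_measurable [measurable]: "D : sets borel"
 using D by simp

lemma diam_bound:
 obtains d where "0 < d" "!!x y. x : closure D ==> y : closure D ==> norm (y - x) <= d"
proof -
 have "bounded (closure D)" using D(2) by (rule bounded_closure)
 then obtain R where R: "0 < R" "!!x. x : closure D ==> norm x <= R" using bounded_pos by blast
 have "norm (y - x) <= 2 * R" if "x : closure D" "y : closure D" for x y
  using norm_triangle_ineq4[of y x] R(2)[OF that(1)] R(2)[OF that(2)] by simp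
 thus ?thesis using that[of "2 * R"] R(1) by simp
qed

lemma area:
 obtains A0 where "emeasure lborel D = ennreal A0" "0 < A0"
proof
 have fin: "emeasure lborel D < \<infinity>" by (rule emeasure_bounded_finite[OF D(2)])
 obtain x where x: "x : D" using D by blast
 then obtain a b where ab: "cbox a b \<subseteq> D" "x : box a b" using open_contains_cbox[of D x] D(1) by metis
 have "0 < emeasure lborel (box a b)"
  using ab(2) by (subst emeasure_lborel_box) (auto simp: mem_box inner_diff_left intro!: prod_pos dest: less_trans intro: less_imp_le)
 also have "... <= emeasure lborel D" using ab(1) box_subset_cbox[of a b] by (intro emeasure_mono) auto
 finally show "0 < measure lborel D" using fin by (simp add: measure_def enn2real_positive_iff)
 show "emeasure lborel D = ennreal (measure lborel D)"
  using fin by (simp add: emeasure_eq_ennreal_measure top.not_eq_extremum)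
qed

end

lemma ennreal_power2_sum_le:
 "ennreal ((a + b)^2) <= 2 * ennreal (a^2) + 2 * ennreal ((b::real)^2)"
proof -
 have "ennreal ((a + b)^2) <= ennreal (2 * a^2 + 2 * b^2)" using power2_sum_le by (rule ennreal_leI)
 also have "... = 2 * ennreal (a^2) + 2 * ennreal (b^2)" by (simp add: ennreal_plus ennreal_mult)
 finally show ?thesis .
qed

lemma nn_integral_power2_sum_le:
 fixes f g V :: "'a::euclidean_space => real"
 assumes [measurable]: "f : bmeas" "g : bmeas" "S : sets borel"
 shows "nnI S (%x. (f x + g x)^2) <= 2 * nnI S (%x. (f x)^2) + 2 * nnI S (%x. (g x)^2)"
proof -
 have "nnI S (%x. (f x + g x)^2) <= NI (%x. 2 * (ennreal ((f x)^2) * ind S x) + 2 * (ennreal ((g x)^2) * ind S x))"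
  by (intro nn_integral_mono) (auto simp: indicator_def ennreal_power2_sum_le)
 also have "... = 2 * nnI S (%x. (f x)^2) + 2 * nnI S (%x. (g x)^2)" by (simp add: nn_integral_add nn_integral_cmult)
 finally show ?thesis .
qed

lemma L2_on_nn_integral:
 assumes "L2_on D w"
 obtains W where "0 <= W" "NI (%x. ennreal ((w x)^2)) = ennreal W"
 using nn_integral_eq_integral[OF L2_onD(3)[OF assms]] that[of "LBINT x. (w x)^2"] by simp

lemma mollify_factor_tendsto_L2:
 assumes et: "test_function D et" "!!x. 0 <= et x" "integrable lborel et" "(LBINT x. et x) = 1"
  and D: "open D" "bounded D" and w: "L2_on D w" and e: "0 < e" and s: "(s \<longlongrightarrow> 1) (at (0::real))"
 shows "\<forall>\<^sub>F dl in at 0.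
  (nnI D (%x. (s dl * mollify et dl w x - w x)^2)) <= ennreal e"
proof -
 have [measurable]: "w : bmeas" "D : sets borel" using L2_onD[OF w] D by auto
 \<comment> \<open>Splitting the square doubles both terms, and s^2 is at most 4; with e/16 for the
   mollification and e/4 for the factor the total is e.\<close>
 obtain d where d: "0 < d" "!!dl. dl ~= 0 ==> \<bar>dl\<bar> < d ==>
   (NI (%x. ennreal (ind D x * (mollify et dl w x - w x)^2))) <= ennreal (e / 16)"
  by (rule mollify_tendsto_L2[OF et D w, of "e / 16"]) (use e in auto)
 obtain W where W: "0 <= W" "NI (%x. ennreal ((w x)^2)) = ennreal W" by (rule L2_on_nn_integral[OF w]) auto
 have "((%dl. (s dl - 1)^2 * W) \<longlongrightarrow> (1 - 1)^2 * W) (at 0)" by (intro tendsto_intros s)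
 from order_tendstoD(2)[OF this, of "e / 4"] e
 have s_small: "\<forall>\<^sub>F dl in at 0. (s dl - 1)^2 * W < e / 4" by simp
 have "\<forall>\<^sub>F dl in at 0. dl ~= 0 & \<bar>dl\<bar> < d" using d(1) by (auto simp: eventually_at dist_real_def)
 moreover have "\<forall>\<^sub>F dl in at 0. \<bar>s dl\<bar> <= 2"
  using order_tendstoD(2)[OF tendsto_rabs[OF s], of 2] by (auto elim!: eventually_mono)
 ultimately show ?thesis using s_small
 proof eventually_elim
  fix dl assume dl: "dl ~= 0 & \<bar>dl\<bar> < d" and s1: "\<bar>s dl\<bar> <= 2" and sW: "(s dl - 1)^2 * W < e / 4"
  have [measurable]: "mollify et dl w : bmeas" using dl by (intro mollify_measurable[OF et(1) L2_L1[OF w D(1,2)]]) auto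
  have "nnI D (%x. (s dl * mollify et dl w x - w x)^2) =
    nnI D (%x. (s dl * (mollify et dl w x - w x) + (s dl - 1) * w x)^2)"
   by (simp add: algebra_simps)
  also have "... <= 2 * nnI D (%x. (s dl * (mollify et dl w x - w x))^2) +
    2 * nnI D (%x. ((s dl - 1) * w x)^2)"
   by (rule nn_integral_power2_sum_le) measurable
  also have "... <= 2 * ennreal (e / 4) + 2 * ennreal (e / 4)"
  proof (intro add_mono mult_left_mono)
   have "nnI D (%x. (s dl * (mollify et dl w x - w x))^2) <=
     NI (%x. 4 * ennreal (ind D x * (mollify et dl w x - w x)^2))"
   proof (intro nn_integral_mono)
    fix x
    have "(s dl)^2 <= 4" using power_mono[OF s1, of 2] by simp
    hence "(s dl)^2 * (mollify et dl w x - w x)^2 <= 4 * (mollify et dl w x - w x)^2" by (intro mult_right_mono) auto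
    from ennreal_leI[OF this] show "ennreal ((s dl * (mollify et dl w x - w x))^2) * ind D x <=
      4 * ennreal (ind D x * (mollify et dl w x - w x)^2)"
     by (auto simp: indicator_def power_mult_distrib ennreal_mult)
   qed
   also have "... <= 4 * ennreal (e / 16)" using d(2)[of dl] dl by (subst nn_integral_cmult) (auto intro: mult_left_mono)
   also have "... = ennreal (e / 4)" using e by (simp add: ennreal_mult[symmetric] ennreal_numeral[symmetric] del: ennreal_numeral)
   finally show "nnI D (%x. (s dl * (mollify et dl w x - w x))^2) <= ennreal (e / 4)" .
   have "nnI D (%x. ((s dl - 1) * w x)^2) <= NI (%x. ennreal ((s dl - 1)^2) * ennreal ((w x)^2))"
    by (intro nn_integral_mono) (auto simp: indicator_def power_mult_distrib ennreal_mult)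
   also have "... = ennreal ((s dl - 1)^2 * W)" using W by (subst nn_integral_cmult) (auto simp: ennreal_mult)
   finally show "nnI D (%x. ((s dl - 1) * w x)^2) <= ennreal (e / 4)"
    using ennreal_leI[OF less_imp_le[OF sW]] by (rule order_trans)
  qed auto
  also have "... = ennreal (2 * (e / 4) + 2 * (e / 4))"
   using e by (simp add: ennreal_plus[symmetric] ennreal_mult[symmetric] ennreal_numeral[symmetric] del: ennreal_plus ennreal_numeral)
  finally show "nnI D (%x. (s dl * mollify et dl w x - w x)^2) <= ennreal e" by simp
 qed
qed

lemma partial_deriv_local:
 assumes "open S" "x : S" "!!y. y : S ==> f y = h y" "h differentiable (at x)"
 shows "pd i f x = pd i h x"
proof -
 have h: "(h has_derivative frechet_derivative h (at x)) (at x)" using assms(4) by (simp add: frechet_derivative_works)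
 hence "(f has_derivative frechet_derivative h (at x)) (at x)"
  by (rule has_derivative_transform_within_open[OF _ assms(1,2)]) (use assms(3) in auto)
 from partial_deriv_eq[OF this] show ?thesis by (simp add: partial_deriv_def)
qed

lemma partial_deriv_cmult:
 assumes "ALL x. f differentiable (at x)"
 shows "pd i (%x. c * f x) = (%x. c * pd i f x)"
 using partial_deriv_mult[OF _ assms, of "%x. c"] by (simp add: partial_deriv_const)

text \<open>Written with \<open>lborel\<close> on the plane: for functions vanishing outside
  \<open>D\<close> this agrees with the integrals over \<open>D\<close>, and it also makes sense
  when the test functions range over the whole plane.\<close>

definition weak_partial :: "(real^2) set => 2 => (real^2 => real) => (real^2 => real) => bool" where
 "weak_partial D i v g \<longleftrightarrow> (ALL ph. test_function D ph -->
  (LBINT x. v x * pd i ph x) = - (LBINT x. g x * ph x))"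

text \<open>The gradient is carried along as explicit Borel functions, which keeps the choice hidden
  in \<open>weak_deriv\<close> out of the estimates.\<close>

locale H1_data = convex_domain +
 fixes u :: "real^2 => real" and g :: "2 => real^2 => real"
 assumes u: "L2_on D u" and g: "!!i. L2_on D (g i)" and u_g: "!!i. weak_partial D i u (g i)"
begin

lemma measurable_ug [measurable]: "u : bmeas" "g i : bmeas"
 using u g by (auto simp: L2_on_def)

end

text \<open>For 0 < dl <= 1 the point (1 - dl) x + dl z stays in \<open>D\<close> by convexity, so
  the kernel seen from \<open>x\<close> is a test function of \<open>D\<close>, however close to the
  boundary \<open>x\<close> is.\<close>

lemma (in convex_domain) partial_deriv_mollify_D:
 assumes et: "test_function D et" and w: "L2_on D w" and k: "L2_on D k" and wk: "weak_partial D i w k"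
  and dl: "0 < dl" "dl <= 1" and x: "x : D"
 shows "pd i (mollify et dl w) x = (1 - dl) * mollify et dl k x"
proof (rule partial_deriv_mollify[OF et L2_L1[OF w D(1,2)] L2_onD(1)[OF k]])
 show "(LBINT y. w y * pd i ph y) = - (LBINT y. k y * ph y)" if "test_function D ph" for ph
  using wk that by (simp add: weak_partial_def)
 show "(1 - dl) *\<^sub>R x + dl *\<^sub>R z : D" if "z : D" for z
  using D(3) x that dl by (simp add: convex_alt)
qed (use dl in auto)

lemma eventually_at_right_01: "\<forall>\<^sub>F dl::real in at_right 0. 0 < dl & dl < 1"
 by (auto simp: eventually_at_right_field intro: exI[of _ 1])

lemma tendsto_one_minus_power: "((%dl::real. (1 - dl) ^ m) \<longlongrightarrow> 1) (at 0)"
proof -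
 have "((%dl::real. (1 - dl) ^ m) \<longlongrightarrow> (1 - 0) ^ m) (at 0)" by (intro tendsto_intros)
 thus ?thesis by simp
qed

lemma (in convex_domain) mollify_eventually:
 assumes et: "test_function D et" "!!x. 0 <= et x" "integrable lborel et" "(LBINT x. et x) = 1"
  and w: "L2_on D w" and e: "0 < e"
 shows "\<forall>\<^sub>F dl in at 0 within S.
  (nnI D (%x. ((1 - dl) ^ m * mollify et dl w x - w x)^2)) <= ennreal e"
 by (rule filter_leD[OF at_le[OF subset_UNIV] mollify_factor_tendsto_L2[OF et D(1,2) w e tendsto_one_minus_power]])

text \<open>The contraction towards the support of \<open>et\<close> gives approximations that are
  smooth on the whole plane and converge up to the boundary of \<open>D\<close>.\<close>

lemma (in H1_data) smooth_approx_H1: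
 assumes e: "0 < e"
 obtains G where "!!k. C_k k G"
  "nnI D (%x. (G x - u x)^2) <= ennreal e"
  "!!i. (nnI D (%x. (pd i G x - g i x)^2)) <= ennreal e"
proof -
 obtain et where et: "test_function D et" "!!x. 0 <= et x" "integrable lborel et" "(LBINT x. et x) = 1"
  using mollifier_exists[OF D(1,4)] by metis
 have "\<forall>\<^sub>F dl in at_right 0. ALL i:UNIV.
  (nnI D (%x. ((1 - dl) ^ 1 * mollify et dl (g i) x - g i x)^2)) <= ennreal e"
  by (intro eventually_ball_finite) (auto intro: mollify_eventually[OF et g e, of 1, simplified])
 with mollify_eventually[OF et u e, of 0] eventually_at_right_01
 have "\<forall>\<^sub>F dl in at_right 0. 0 < dl & dl < 1 &
   (nnI D (%x. ((1 - dl) ^ 0 * mollify et dl u x - u x)^2)) <= ennreal e &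
   (ALL i:UNIV. (nnI D (%x. ((1 - dl) ^ 1 * mollify et dl (g i) x - g i x)^2)) <= ennreal e)"
  by eventually_elim auto
 then obtain dl where dl: "0 < dl" "dl < 1"
   "nnI D (%x. ((1 - dl) ^ 0 * mollify et dl u x - u x)^2) <= ennreal e"
   "!!i. (nnI D (%x. ((1 - dl) ^ 1 * mollify et dl (g i) x - g i x)^2)) <= ennreal e"
  using eventually_happens'[OF trivial_limit_at_right_real] by blast
 show ?thesis
 proof (rule that[of "mollify et dl u"])
  show "C_k k (mollify et dl u)" for k
   using dl by (intro C_k_mollify[OF et(1) L2_L1[OF u D(1,2)]]) auto
  show "nnI D (%x. (mollify et dl u x - u x)^2) <= ennreal e" using dl(3) by simp
  fix i
  have "nnI D (%x. (pd i (mollify et dl u) x - g i x)^2) =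
    nnI D (%x. ((1 - dl) ^ 1 * mollify et dl (g i) x - g i x)^2)"
   using partial_deriv_mollify_D[OF et(1) u g u_g, of dl] dl by (intro nn_integral_cong) (auto simp: indicator_def)
  thus "nnI D (%x. (pd i (mollify et dl u) x - g i x)^2) <= ennreal e"
   using dl(4)[of i] by simp
 qed
qed

locale H2_data = H1_data +
 fixes k :: "2 => 2 => real^2 => real"
 assumes k: "!!i j. L2_on D (k i j)" and g_k: "!!i j. weak_partial D j (g i) (k i j)"
begin

lemma measurable_k [measurable]: "k i j : bmeas"
 using k by (auto simp: L2_on_def)

text \<open>Every derivative contributes a factor 1 - dl, and a single \<open>dl\<close> must serve
  all orders at once; hence the conjunction of statements that hold eventually.\<close>

lemma smooth_approx_H2:
 assumes e: "0 < e"
 obtains G where "!!k. C_k k G"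
  "nnI D (%x. (G x - u x)^2) <= ennreal e"
  "!!i. (nnI D (%x. (pd i G x - g i x)^2)) <= ennreal e"
  "!!i j. (nnI D (%x. (pd j (pd i G) x - k i j x)^2)) <= ennreal e"
proof -
 obtain et where et: "test_function D et" "!!x. 0 <= et x" "integrable lborel et" "(LBINT x. et x) = 1"
  using mollifier_exists[OF D(1,4)] by metis
 have "\<forall>\<^sub>F dl in at_right 0. ALL i:UNIV.
  (nnI D (%x. ((1 - dl) ^ 1 * mollify et dl (g i) x - g i x)^2)) <= ennreal e"
  by (intro eventually_ball_finite) (auto intro: mollify_eventually[OF et g e, of 1, simplified])
 moreover have "\<forall>\<^sub>F dl in at_right 0. ALL i:UNIV. ALL j:UNIV.
  (nnI D (%x. ((1 - dl) ^ 2 * mollify et dl (k i j) x - k i j x)^2)) <= ennreal e"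
  by (intro eventually_ball_finite ballI) (auto intro: mollify_eventually[OF et k e])
 ultimately
 have "\<forall>\<^sub>F dl in at_right 0. 0 < dl & dl < 1 &
   (nnI D (%x. ((1 - dl) ^ 0 * mollify et dl u x - u x)^2)) <= ennreal e &
   (ALL i:UNIV. (nnI D (%x. ((1 - dl) ^ 1 * mollify et dl (g i) x - g i x)^2)) <= ennreal e) &
   (ALL i:UNIV. ALL j:UNIV. (nnI D (%x. ((1 - dl) ^ 2 * mollify et dl (k i j) x - k i j x)^2)) <= ennreal e)"
  using mollify_eventually[OF et u e, of 0] eventually_at_right_01 by eventually_elim auto
 then obtain dl where dl: "0 < dl" "dl < 1"
   "nnI D (%x. ((1 - dl) ^ 0 * mollify et dl u x - u x)^2) <= ennreal e"
   "!!i. (nnI D (%x. ((1 - dl) ^ 1 * mollify et dl (g i) x - g i x)^2)) <= ennreal e"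
   "!!i j. (nnI D (%x. ((1 - dl) ^ 2 * mollify et dl (k i j) x - k i j x)^2)) <= ennreal e"
  using eventually_happens'[OF trivial_limit_at_right_real] by blast
 have 1: "pd i (mollify et dl u) x = (1 - dl) * mollify et dl (g i) x" if "x : D" for x i
  using partial_deriv_mollify_D[OF et(1) u g u_g _ _ that] dl by simp
 have diff: "ALL x. mollify et dl (g i) differentiable (at x)" for i
  using C_k_mollify[OF et(1) L2_L1[OF g D(1,2)], of dl "Suc 0" i] dl by simp
 have 2: "pd j (pd i (mollify et dl u)) x = (1 - dl) ^ 2 * mollify et dl (k i j) x" if x: "x : D" for x i j
 proof -
  have "pd j (pd i (mollify et dl u)) x = pd j (%x. (1 - dl) * mollify et dl (g i) x) x"
   by (rule partial_deriv_local[OF D(1) x 1]) (use diff in auto)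
  also have "... = (1 - dl) * pd j (mollify et dl (g i)) x" by (simp add: partial_deriv_cmult[OF diff])
  also have "... = (1 - dl) * ((1 - dl) * mollify et dl (k i j) x)"
   using partial_deriv_mollify_D[OF et(1) g k g_k _ _ x] dl by simp
  finally show ?thesis by (simp add: power2_eq_square)
 qed
 show ?thesis
 proof (rule that[of "mollify et dl u"])
  show "C_k k (mollify et dl u)" for k
   using dl by (intro C_k_mollify[OF et(1) L2_L1[OF u D(1,2)]]) auto
  show "nnI D (%x. (mollify et dl u x - u x)^2) <= ennreal e" using dl(3) by simp
  fix i
  have "nnI D (%x. (pd i (mollify et dl u) x - g i x)^2) =
    nnI D (%x. ((1 - dl) ^ 1 * mollify et dl (g i) x - g i x)^2)"
   using 1 by (intro nn_integral_cong) (auto simp: indicator_def)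
  thus "nnI D (%x. (pd i (mollify et dl u) x - g i x)^2) <= ennreal e"
   using dl(4)[of i] by simp
  fix j
  have "nnI D (%x. (pd j (pd i (mollify et dl u)) x - k i j x)^2) =
    nnI D (%x. ((1 - dl) ^ 2 * mollify et dl (k i j) x - k i j x)^2)"
   using 2 by (intro nn_integral_cong) (auto simp: indicator_def)
  thus "nnI D (%x. (pd j (pd i (mollify et dl u)) x - k i j x)^2) <= ennreal e"
   using dl(5)[of i j] by simp
 qed
qed

end


section \<open>Estimates carried over from smooth to weakly differentiable functions\<close>

definition nsq :: "(real^2) set => (real^2 => real) => real" where
 "nsq S w = (LBINT x. ind S x * (w x)^2)"

lemma nsq_nonneg: "0 <= nsq S w"
 unfolding nsq_def by (intro Bochner_Integration.integral_nonneg) auto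

lemma L2_square:
 assumes w: "L2_on D w" and [measurable]: "S : sets borel"
 shows "L1 (%x. ind S x * (w x)^2)"
 using integrable_real_mult_indicator[of S lborel "%x. (w x)^2"] L2_onD(3)[OF w] by (simp add: mult.commute)

lemma nn_integral_nsq:
 assumes w: "L2_on D w" and [measurable]: "S : sets borel"
 shows "nnI S (%x. (w x)^2) = ennreal (nsq S w)"
proof -
 have "nnI S (%x. (w x)^2) = NI (%x. ennreal (ind S x * (w x)^2))" by (intro nn_integral_cong) (auto simp: indicator_def)
 also have "... = ennreal (nsq S w)" unfolding nsq_def by (rule nn_integral_eq_integral[OF L2_square[OF assms]]) simp
 finally show ?thesis .
qed

lemma nsq_mono:
 assumes w: "L2_on D w" and "S : sets borel" "S' : sets borel" "S \<subseteq> S'"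
 shows "nsq S w <= nsq S' w"
 unfolding nsq_def using assms(4) by (intro integral_mono L2_square[OF w] assms) (auto simp: indicator_def)

text \<open>Lets the error of a smooth approximation tend to zero inside an \<open>ennreal\<close>
  inequality.\<close>

lemma ennreal_le_real_limit:
 assumes "!!e. 0 < e ==> X <= ennreal (y + c * e)" and "0 <= c"
 shows "X <= ennreal y"
proof (rule ennreal_le_epsilon)
 fix e :: real assume e: "0 < e"
 have "X <= ennreal (y + c * (e / (c + 1)))" using e assms(2) by (intro assms(1)) auto
 also have "... <= ennreal (y + e)"
  using e assms(2) by (intro ennreal_leI add_left_mono) (simp add: divide_simps distrib_left)
 also have "... <= ennreal y + ennreal e" using e by (cases "0 <= y") (auto simp: ennreal_neg intro: ennreal_leI)
 finally show "X <= ennreal y + ennreal e" .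
qed

lemma norm_square_2: "(norm (v::real^2))^2 = (SUM i:UNIV. (v $ i)^2)"
 by (simp add: norm_eq_sqrt_inner inner_vec_def power2_eq_square sum_nonneg)

lemma C_k_2: "(!!k. C_k k G) ==> C_k (Suc (Suc 0)) G"
 by blast

lemma (in convex_domain) nn_integral_close_le:
 assumes w: "L2_on D w" and [measurable]: "F : bmeas" "S : sets borel"
  and S: "S \<subseteq> D" and e: "0 <= e"
  and F: "nnI D (%x. (F x - w x)^2) <= ennreal e"
 shows "nnI S (%x. (F x)^2) <= ennreal (2 * nsq S w + 2 * e)"
proof -
 have [measurable]: "w : bmeas" using L2_onD[OF w] by simp
 have "nnI S (%x. (F x)^2) = nnI S (%x. (w x + (F x - w x))^2)" by simp
 also have "... <= 2 * nnI S (%x. (w x)^2) + 2 * nnI S (%x. (F x - w x)^2)" by (rule nn_integral_power2_sum_le) measurable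
 also have "... <= 2 * ennreal (nsq S w) + 2 * ennreal e"
 proof (intro add_mono mult_left_mono)
  have "nnI S (%x. (F x - w x)^2) <= nnI D (%x. (F x - w x)^2)" using S by (intro nn_integral_mono) (auto simp: indicator_def)
  thus "nnI S (%x. (F x - w x)^2) <= ennreal e" using F by (rule order_trans)
 qed (use nn_integral_nsq[OF w, of S] in auto)
 also have "... = ennreal (2 * nsq S w + 2 * e)" using e nsq_nonneg[of S w] by (simp add: ennreal_plus ennreal_mult)
 finally show ?thesis .
qed

context H1_data
begin

lemma grad_close_le:
 assumes G: "C_k (Suc 0) G" and [measurable]: "S : sets borel" and S: "S \<subseteq> D" and e: "0 <= e"
  and F: "!!i. (nnI D (%x. (pd i G x - g i x)^2)) <= ennreal e"
 shows "nnI S (%x. (norm (gradient G x))^2) <= ennreal (2 * (SUM i:UNIV. nsq S (g i)) + 4 * e)"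
proof -
 have [measurable]: "pd i G : bmeas" for i
  using G by (intro borel_measurable_continuous_onI) auto
 have "nnI S (%x. (norm (gradient G x))^2) = NI (%x. (SUM i:UNIV. ennreal ((pd i G x)^2) * ind S x))"
  by (intro nn_integral_cong) (simp add: norm_square_2 gradient_def sum_distrib_right[symmetric])
 also have "... = (SUM i:UNIV. \<integral>\<^sup>+ x. ennreal ((pd i G x)^2) * ind S x \<partial>lborel)"
  by (rule nn_integral_sum) measurable
 also have "... <= (SUM i:UNIV. ennreal (2 * nsq S (g i) + 2 * e))"
  by (intro sum_mono nn_integral_close_le[OF g _ _ S e F]) auto
 also have "... = ennreal (SUM i:UNIV. 2 * nsq S (g i) + 2 * e)" using e nsq_nonneg by (intro sum_ennreal) auto
 also have "(SUM i:UNIV. 2 * nsq S (g i) + 2 * e) = 2 * (SUM i:UNIV. nsq S (g i)) + 4 * e"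
  by (simp add: sum.distrib sum_distrib_left)
 finally show ?thesis .
qed

text \<open>The constant \<open>c\<close> is the mean of a smooth approximation and varies with
  \<open>e\<close>; it is exchanged later for the mean of \<open>u\<close>, which is the best
  constant.\<close>

lemma Poincare_H1:
 assumes T: "T : sets borel" "convex T" "T \<subseteq> D" and A0: "emeasure lborel T = ennreal A0" "0 < A0"
  and d: "!!x y. x : T ==> y : T ==> norm (y - x) <= d"
  and e: "0 < e"
 obtains c where "nnI T (%x. (u x - c)^2) <= ennreal (16 * d^2 * (SUM i:UNIV. nsq T (g i)) + (2 + 32 * d^2) * e)"
proof -
 have [measurable]: "T : sets borel" by fact
 have bT: "bounded T" using T(3) D(2) bounded_subset by blast
 obtain G where G: "!!k. C_k k G"
  "nnI D (%x. (G x - u x)^2) <= ennreal e"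
  "!!i. (nnI D (%x. (pd i G x - g i x)^2)) <= ennreal e"
  using smooth_approx_H1[OF e] by blast
 have [measurable]: "G : bmeas" using C_k_imp_continuous[OF G(1)] by (rule borel_measurable_continuous_onI)
 define c where "c = (LBINT y. ind T y * G y) / A0"
 have "nnI T (%x. (u x - c)^2) = nnI T (%x. ((G x - c) + (u x - G x))^2)" by simp
 also have "... <= 2 * nnI T (%x. (G x - c)^2) + 2 * nnI T (%x. (u x - G x)^2)" by (rule nn_integral_power2_sum_le) measurable
 also have "... <= 2 * (ennreal (4 * d^2) * ennreal (2 * (SUM i:UNIV. nsq T (g i)) + 4 * e)) + 2 * ennreal e"
 proof (intro add_mono mult_left_mono)
  have "nnI T (%x. (G x - c)^2) <= ennreal (4 * d^2) * nnI T (%z. (norm (gradient G z))^2)"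
   unfolding c_def by (rule Poincare_mean[OF T(1,2) bT A0 d G(1)])
  also have "... <= ennreal (4 * d^2) * ennreal (2 * (SUM i:UNIV. nsq T (g i)) + 4 * e)"
   using e by (intro mult_left_mono grad_close_le[OF G(1) T(1,3) _ G(3)]) auto
  finally show "nnI T (%x. (G x - c)^2) <= ennreal (4 * d^2) * ennreal (2 * (SUM i:UNIV. nsq T (g i)) + 4 * e)" .
  have "nnI T (%x. (u x - G x)^2) <= nnI D (%x. (G x - u x)^2)"
   using T(3) by (intro nn_integral_mono) (auto simp: indicator_def power2_commute)
  thus "nnI T (%x. (u x - G x)^2) <= ennreal e" using G(2) by (rule order_trans)
 qed auto
 also have "... = ennreal (2 * (4 * d^2 * (2 * (SUM i:UNIV. nsq T (g i)) + 4 * e)) + 2 * e)"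
 proof -
  have "0 <= 4 * d^2" "0 <= 2 * (SUM i:UNIV. nsq T (g i)) + 4 * e" "0 <= e"
   using e by (auto intro!: add_nonneg_nonneg sum_nonneg nsq_nonneg)
  thus ?thesis by (simp only: ennreal_mult[symmetric] ennreal_plus[symmetric] ennreal_numeral[symmetric]
     mult_nonneg_nonneg zero_le_numeral)
 qed
 also have "2 * (4 * d^2 * (2 * (SUM i:UNIV. nsq T (g i)) + 4 * e)) + 2 * e =
   16 * d^2 * (SUM i:UNIV. nsq T (g i)) + (2 + 32 * d^2) * e"
  by (simp add: algebra_simps)
 finally show ?thesis by (rule that)
qed

text \<open>Boundedness of \<open>V\<close> serves to pass to the limit: the approximation error is
  multiplied by \<open>K\<close> and then disappears, so \<open>K\<close> does not enter the
  estimate.\<close>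

lemma weighted_Sobolev_H1:
 fixes V :: "real^2 => real"
 assumes V_meas [measurable]: "V : bmeas" and V: "!!x. 0 <= V x" "!!x. V x <= K"
  and A0: "emeasure lborel D = ennreal A0" "0 < A0"
  and d: "!!x y. x : D ==> y : D ==> norm (y - x) <= d"
  and p: "1 < p" and A: "0 < A"
  and VA: "nnI D (%x. V x powr p) <= ennreal A"
 shows "nnI D (%x. V x * (u x)^2) <=
  ennreal ((A / A0) powr (1 / p) * (16 + 40 * d^2 / (1 - 1 / p)^2) * (nsq D u + (SUM i:UNIV. nsq D (g i))))"
proof -
 define Q where "Q = (A / A0) powr (1 / p)"
 define R where "R = 10 * d^2 / (1 - 1 / p)^2"
 have Q: "0 <= Q" and R: "0 <= R" using p by (auto simp: Q_def R_def)
 have K: "0 <= K" using V order_trans by blast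
 define gg where "gg = (SUM i:UNIV. nsq D (g i))"
 have gg: "0 <= gg" unfolding gg_def by (intro sum_nonneg nsq_nonneg)
 have "nnI D (%x. V x * (u x)^2) <= ennreal (2 * (Q * (4 * (2 * nsq D u) + R * (2 * gg))))"
 proof (rule ennreal_le_real_limit[where c="2 * (Q * (8 + 4 * R) + K)"])
  fix e :: real assume e: "0 < e"
  obtain G where G: "!!k. C_k k G"
   "nnI D (%x. (G x - u x)^2) <= ennreal e"
   "!!i. (nnI D (%x. (pd i G x - g i x)^2)) <= ennreal e"
   using smooth_approx_H1[OF e] by blast
  have [measurable]: "G : bmeas" using C_k_imp_continuous[OF G(1)] by (rule borel_measurable_continuous_onI)
  have "nnI D (%x. V x * (u x)^2) <=
    NI (%x. 2 * (ennreal (V x * (G x)^2) * ind D x) + 2 * (ennreal K * (ennreal ((G x - u x)^2) * ind D x)))"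
  proof (intro nn_integral_mono)
   fix x
   have "V x * (u x)^2 <= V x * (2 * (G x)^2 + 2 * (u x - G x)^2)"
    using power2_sum_le[of "G x" "u x - G x"] V by (intro mult_left_mono) auto
   also have "... = 2 * (V x * (G x)^2) + 2 * (V x * (G x - u x)^2)" by (simp add: distrib_left power2_commute)
   also have "... <= 2 * (V x * (G x)^2) + 2 * (K * (G x - u x)^2)"
    using V by (intro add_mono mult_left_mono mult_right_mono) auto
   finally have "ennreal (V x * (u x)^2) <= ennreal (2 * (V x * (G x)^2) + 2 * (K * (G x - u x)^2))" by (rule ennreal_leI)
   also have "... = 2 * ennreal (V x * (G x)^2) + 2 * (ennreal K * ennreal ((G x - u x)^2))"
    using V[of x] K by (simp add: ennreal_plus ennreal_mult)
   finally show "ennreal (V x * (u x)^2) * ind D x <=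
     2 * (ennreal (V x * (G x)^2) * ind D x) + 2 * (ennreal K * (ennreal ((G x - u x)^2) * ind D x))"
    by (auto simp: indicator_def)
  qed
  also have "... = 2 * nnI D (%x. V x * (G x)^2) + 2 * (ennreal K * nnI D (%x. (G x - u x)^2))"
   by (simp add: nn_integral_add nn_integral_cmult)
  also have "... <= 2 * (ennreal Q * (4 * ennreal (2 * nsq D u + 2 * e) + ennreal R * ennreal (2 * gg + 4 * e))) + 2 * (ennreal K * ennreal e)"
  proof (intro add_mono mult_left_mono G(2))
   have "nnI D (%x. V x * (G x)^2) <= ennreal Q * (4 * nnI D (%x. (G x)^2) +
     ennreal R * nnI D (%x. (norm (gradient G x))^2))"
    unfolding Q_def R_def by (rule weighted_Sobolev[OF V_meas D_measurable D(3) A0 d V(1) p A VA G(1)])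
   also have "... <= ennreal Q * (4 * ennreal (2 * nsq D u + 2 * e) + ennreal R * ennreal (2 * gg + 4 * e))"
    unfolding gg_def using e
    by (intro mult_left_mono add_mono nn_integral_close_le[OF u _ _ _ _ G(2)] grad_close_le[OF G(1) _ _ _ G(3)]) auto
   finally show "nnI D (%x. V x * (G x)^2) <=
     ennreal Q * (4 * ennreal (2 * nsq D u + 2 * e) + ennreal R * ennreal (2 * gg + 4 * e))" .
  qed auto
  also have "... = ennreal (2 * (Q * (4 * (2 * nsq D u + 2 * e) + R * (2 * gg + 4 * e))) + 2 * (K * e))"
  proof -
   have "0 <= 2 * nsq D u + 2 * e" "0 <= 2 * gg + 4 * e" "0 <= e" using e gg nsq_nonneg[of D u] by auto
   thus ?thesis using Q R K
    by (simp only: ennreal_mult[symmetric] ennreal_plus[symmetric] ennreal_numeral[symmetric]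
      mult_nonneg_nonneg add_nonneg_nonneg zero_le_numeral)
  qed
  also have "2 * (Q * (4 * (2 * nsq D u + 2 * e) + R * (2 * gg + 4 * e))) + 2 * (K * e) =
    2 * (Q * (4 * (2 * nsq D u) + R * (2 * gg))) + 2 * (Q * (8 + 4 * R) + K) * e"
   by (simp add: algebra_simps)
  finally show "nnI D (%x. V x * (u x)^2) <=
   ennreal (2 * (Q * (4 * (2 * nsq D u) + R * (2 * gg))) + 2 * (Q * (8 + 4 * R) + K) * e)" .
 qed (use Q R K in auto)
 also have "... <= ennreal (Q * (16 + 4 * R) * (nsq D u + gg))"
 proof (rule ennreal_leI)
  have "2 * (Q * (4 * (2 * nsq D u) + R * (2 * gg))) = Q * (16 * nsq D u + 4 * R * gg)" by (simp add: algebra_simps)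
  also have "... <= Q * ((16 + 4 * R) * (nsq D u + gg))"
   using gg R Q nsq_nonneg[of D u] by (intro mult_left_mono) (auto simp: algebra_simps intro!: add_nonneg_nonneg mult_nonneg_nonneg)
  finally show "2 * (Q * (4 * (2 * nsq D u) + R * (2 * gg))) <= Q * (16 + 4 * R) * (nsq D u + gg)" by (simp add: mult.assoc)
 qed
 finally show ?thesis by (simp add: Q_def R_def gg_def)
qed

end

section \<open>Point values of functions with second derivatives\<close>

text \<open>A homothety with centre \<open>a\<close>. Area scales with ta^2 and distances to
  \<open>a\<close> with ta, so the quotient d^4 / A0 in the Taylor bounds gains a factor
  ta^2.\<close>

lemma (in convex_domain) shrink_to_point:
 assumes a: "a : closure D" and ta: "0 < ta" "ta <= 1"
  and A0: "emeasure lborel D = ennreal A0" and R: "!!x. x : D ==> norm (a - x) <= R"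
 obtains T where "open T" "convex T" "T \<subseteq> D" "a : closure T" "emeasure lborel T = ennreal (ta\<^sup>2 * A0)"
  "!!x. x : T ==> norm (a - x) <= ta * R"
proof
 let ?f = "%x. (1 - ta) *\<^sub>R a + ta *\<^sub>R x"
 let ?T = "?f ` D"
 have im: "?T = (%x. (1 - ta) *\<^sub>R a + x) ` ((%x. ta *\<^sub>R x) ` D)" by (auto simp: image_image)
 show op: "open ?T" unfolding im using ta D(1) by (intro open_translation open_scaling) auto
 show "convex ?T" unfolding im by (intro convex_translation convex_scaling D)
 show "?T \<subseteq> D"
 proof safe
  fix x assume x: "x : D"
  have "a - ta *\<^sub>R (a - x) : interior D"
   using x ta D(1) by (intro mem_interior_closure_convex_shrink[OF D(3) _ a]) (auto simp: interior_open)
  thus "?f x : D" using D(1) by (simp add: interior_open algebra_simps)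
 qed
 have "?f a : ?f ` closure D" using a by (rule imageI)
 also have "?f ` closure D \<subseteq> closure ?T" by (intro continuous_image_closure_subset[of UNIV] continuous_intros) auto
 finally show "a : closure ?T" by (simp add: scaleR_left_diff_distrib)
 have "emeasure lborel ?T = NI (%x. ind ?T x)" using op by simp
 also have "... = ennreal (\<bar>ta\<bar> ^ DIM(real^2)) * NI (%x. ind ?T (?f x))"
  using ta op by (intro lborel_nn_integral_affine[symmetric]) auto
 also have "NI (%x. ind ?T (?f x)) = NI (%x. ind D x)" using ta by (intro nn_integral_cong) (auto simp: indicator_def)
 finally show "emeasure lborel ?T = ennreal (ta\<^sup>2 * A0)" using A0 by (simp add: ennreal_mult')
 fix x assume "x : ?T"
 then obtain y where y: "y : D" "x = ?f y" by blast
 have "a - x = ta *\<^sub>R (a - y)" using y by (simp add: algebra_simps)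
 thus "norm (a - x) <= ta * R" using R[OF y(1)] ta by (simp add: mult_left_mono)
qed

context H2_data
begin

text \<open>The mean over \<open>T\<close> of first order Taylor polynomials, evaluated at
  \<open>a\<close>. It is affine in \<open>a\<close>, its gradient is the mean of \<open>g\<close>,
  and it needs no point values of \<open>u\<close>.\<close>

definition Taylor_mean :: "(real^2) set => real => real^2 => real" where
 "Taylor_mean T A0 a = (LBINT x. ind T x * (u x + (SUM i:UNIV. g i x * (a $ i - x $ i)))) / A0"

definition hess :: "(real^2) set => real" where
 "hess T = (SUM i:UNIV. SUM j:UNIV. nsq T (k i j))"

lemma hess_nonneg: "0 <= hess T"
 unfolding hess_def by (intro sum_nonneg nsq_nonneg)

lemma hess_mono: "T : sets borel ==> T' : sets borel ==> T \<subseteq> T' ==> hess T <= hess T'"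
 unfolding hess_def by (intro sum_mono nsq_mono[OF k]) auto

lemma sum_UNIV_2_square_le:
 fixes v :: "real^2"
 shows "(SUM i:UNIV. f i * v $ i)^2 <= (norm v)^2 * (SUM i:UNIV. (f i)^2)"
proof -
 have "(SUM i:UNIV. f i * v $ i)^2 = ((\<chi> i. f i) \<bullet> v)^2" by (simp add: inner_vec_def)
 also have "... <= (norm (\<chi> i. f i))^2 * (norm v)^2"
  using Cauchy_Schwarz_ineq[of "\<chi> i. f i" v] by (simp add: power2_norm_eq_inner)
 finally show ?thesis by (simp add: norm_square_2[of "\<chi> i. f i"] mult.commute)
qed

text \<open>\<open>G a\<close> is compared with the averaged Taylor polynomial of \<open>G\<close>,
  and this one with that of \<open>u\<close> in square mean. The terms with \<open>e\<close>
  disappear in the limit.\<close>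

lemma smooth_near_Taylor_mean:
 assumes T: "open T" "convex T" "T \<subseteq> D" and A0: "emeasure lborel T = ennreal A0" "0 < A0"
  and a: "a : closure T" and d: "!!x. x : T ==> norm (a - x) <= d" and e: "0 <= e"
  and G: "!!k. C_k k G"
  "nnI D (%x. (G x - u x)^2) <= ennreal e"
  "!!i. (nnI D (%x. (pd i G x - g i x)^2)) <= ennreal e"
  "!!i j. (nnI D (%x. (pd j (pd i G) x - k i j x)^2)) <= ennreal e"
 shows "(G a - Taylor_mean T A0 a)^2 <= 4 * d ^ 4 / A0 * hess T + (16 * d ^ 4 / A0 + 4 / A0 * (1 + 2 * d^2)) * e"
proof -
 have T_meas [measurable]: "T : sets borel" using T by simp
 have bT: "bounded T" using T(3) D(2) bounded_subset by blast
 have [measurable]: "G : bmeas" "pd i G : bmeas" for i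
  using C_k_imp_continuous[OF G(1)] G(1)[of "Suc 0"] by (auto intro!: borel_measurable_continuous_onI)
 have Gi: "C_k (Suc 0) (pd i G)" for i using G(1)[of "Suc (Suc 0)"] by simp
 have [measurable]: "gradient (pd i G) : bmeas" for i
  by (rule borel_measurable_continuous_onI[OF C1_gradient_continuous[OF Gi]])
 let ?LG = "%x. G x + gradient G x \<bullet> (a - x)"
 let ?Lu = "%x. u x + (SUM i:UNIV. g i x * (a $ i - x $ i))"
 let ?q = "(LBINT x. ind T x * ?LG x) / A0"
 have LG_eq: "?LG x = G x + (SUM i:UNIV. pd i G x * (a $ i - x $ i))" for x
  by (simp add: gradient_def inner_vec_def)
 have [measurable]: "?LG : bmeas" unfolding LG_eq by measurable
 have "nnI T (%z. hess_sq G z) = NI (%z. (SUM i:UNIV. ennreal ((norm (gradient (pd i G) z))^2) * ind T z))"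
  by (intro nn_integral_cong) (simp add: hess_sq_def sum_distrib_right[symmetric])
 also have "... = (SUM i:UNIV. \<integral>\<^sup>+ z. ennreal ((norm (gradient (pd i G) z))^2) * ind T z \<partial>lborel)"
  by (rule nn_integral_sum) measurable
 also have "... <= (SUM i:UNIV. ennreal (2 * (SUM j:UNIV. nsq T (k i j)) + 4 * e))"
 proof (intro sum_mono)
  fix i
  \<comment> \<open>The first derivatives have a weak gradient themselves, so the estimate for
    gradients applies one order up.\<close>
  interpret H1_data D "g i" "k i" by unfold_locales (rule g k g_k)+
  show "nnI T (%z. (norm (gradient (pd i G) z))^2) <= ennreal (2 * (SUM j:UNIV. nsq T (k i j)) + 4 * e)"
   by (rule grad_close_le[OF Gi T_meas T(3) e G(4)])
 qed
 also have "... = ennreal (SUM i:UNIV. 2 * (SUM j:UNIV. nsq T (k i j)) + 4 * e)"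
  using e by (intro sum_ennreal) (auto intro!: add_nonneg_nonneg sum_nonneg nsq_nonneg)
 also have "(SUM i:UNIV. 2 * (SUM j:UNIV. nsq T (k i j)) + 4 * e) = 2 * hess T + 8 * e"
  by (simp add: hess_def sum.distrib sum_distrib_left)
 finally have hessG: "nnI T (%z. hess_sq G z) <= ennreal (2 * hess T + 8 * e)" .
 have "ennreal ((G a - ?q)^2) <= ennreal (d ^ 4 / A0) * nnI T (%z. hess_sq G z)"
  by (rule Taylor_mean_at_vertex[OF T(1,2) bT A0 a d C_k_2[OF G(1)]])
 also have "... <= ennreal (d ^ 4 / A0) * ennreal (2 * hess T + 8 * e)" by (intro mult_left_mono hessG) auto
 also have "... = ennreal (d ^ 4 / A0 * (2 * hess T + 8 * e))"
  using A0 e hess_nonneg[of T] by (subst ennreal_mult[symmetric]) auto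
 finally have 1: "(G a - ?q)^2 <= d ^ 4 / A0 * (2 * hess T + 8 * e)"
  using A0 e hess_nonneg[of T] by (subst (asm) ennreal_le_iff) auto
 have int_u: "L1 (%x. ind T x * ?Lu x)"
 proof -
  obtain R where R: "0 < R" "!!x. x : T ==> norm x <= R" using bT bounded_pos by blast
  have "L1 (%x. (ind T x * (a $ i - x $ i)) * g i x)" for i
  proof (rule L1_bounded_mult[OF L2_L1[OF g D(1,2)]])
   show "\<bar>ind T x * (a $ i - x $ i)\<bar> <= \<bar>d\<bar>" for x
    using d[of x] component_le_norm_cart[of "a - x" i] by (auto simp: indicator_def)
  qed measurable
  moreover have "L1 (%x. ind T x * u x)" by (rule L1_bounded_mult[OF L2_L1[OF u D(1,2)], of _ 1]) (auto simp: indicator_def)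
  ultimately have "L1 (%x. ind T x * u x + (SUM i:UNIV. (ind T x * (a $ i - x $ i)) * g i x))"
   by (intro Bochner_Integration.integrable_add Bochner_Integration.integrable_sum) auto
  moreover have "(%x. ind T x * u x + (SUM i:UNIV. (ind T x * (a $ i - x $ i)) * g i x)) = (%x. ind T x * ?Lu x)"
   by (auto simp: fun_eq_iff distrib_left sum_distrib_left mult_ac)
  ultimately show ?thesis by simp
 qed
 have int_G: "L1 (%x. ind T x * ?LG x)"
  by (intro integrable_continuous_bounded T_meas bT continuous_intros C_k_imp_continuous[OF G(1)]
    C1_gradient_continuous[OF G(1)])
 have "?q - Taylor_mean T A0 a = (LBINT x. ind T x * (?LG x - ?Lu x)) / A0"
  unfolding Taylor_mean_def right_diff_distrib[of "ind T _"] Bochner_Integration.integral_diff[OF int_G int_u]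
  by (rule diff_divide_distrib[symmetric])
 hence "ennreal ((?q - Taylor_mean T A0 a)^2) <= ennreal (1 / A0) * nnI T (%x. (?LG x - ?Lu x)^2)"
  using mean_square_le[of "%x. ?LG x - ?Lu x" T A0] A0 by simp
 also have "... <= ennreal (1 / A0) * NI (%x. 2 * (ennreal ((G x - u x)^2) * ind D x) +
   ennreal (2 * d^2) * (SUM i:UNIV. ennreal ((pd i G x - g i x)^2) * ind D x))"
 proof (intro mult_left_mono nn_integral_mono)
  fix x
  show "ennreal ((?LG x - ?Lu x)^2) * ind T x <= 2 * (ennreal ((G x - u x)^2) * ind D x) +
   ennreal (2 * d^2) * (SUM i:UNIV. ennreal ((pd i G x - g i x)^2) * ind D x)"
  proof (cases "x : T")
   case True
   have eq: "?LG x - ?Lu x = (G x - u x) + (SUM i:UNIV. (pd i G x - g i x) * (a - x) $ i)"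
    unfolding LG_eq by (simp add: left_diff_distrib sum_subtractf)
   have "(?LG x - ?Lu x)^2 <= 2 * (G x - u x)^2 + 2 * (SUM i:UNIV. (pd i G x - g i x) * (a - x) $ i)^2"
    unfolding eq by (rule power2_sum_le)
   also have "... <= 2 * (G x - u x)^2 + 2 * ((norm (a - x))^2 * (SUM i:UNIV. (pd i G x - g i x)^2))"
    by (intro add_left_mono mult_left_mono sum_UNIV_2_square_le) auto
   also have "... <= 2 * (G x - u x)^2 + 2 * (d^2 * (SUM i:UNIV. (pd i G x - g i x)^2))"
    by (intro add_left_mono mult_left_mono mult_right_mono power_mono d[OF True] sum_nonneg) auto
   finally have "ennreal ((?LG x - ?Lu x)^2) <= ennreal (2 * (G x - u x)^2 + 2 * d^2 * (SUM i:UNIV. (pd i G x - g i x)^2))"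
    by (intro ennreal_leI) (simp add: mult.assoc)
   also have "... = 2 * ennreal ((G x - u x)^2) + ennreal (2 * d^2) * (SUM i:UNIV. ennreal ((pd i G x - g i x)^2))"
    by (simp add: ennreal_plus ennreal_mult sum_nonneg)
   finally show ?thesis using True T(3) by (simp add: subset_eq)
  qed simp
 qed auto
 also have "... = ennreal (1 / A0) * (2 * nnI D (%x. (G x - u x)^2) +
   ennreal (2 * d^2) * (SUM i:UNIV. \<integral>\<^sup>+ x. ennreal ((pd i G x - g i x)^2) * ind D x \<partial>lborel))"
 proof -
  have sp: "NI (%x. 2 * p x + c * (SUM i:UNIV. q i x)) =
    2 * NI (%x. p x) + c * (SUM i:UNIV. \<integral>\<^sup>+ x. q i x \<partial>lborel)"
   if [measurable]: "p : bmeas" "!!i. q i : bmeas"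
   for p :: "real^2 => ennreal" and q :: "2 => real^2 => ennreal" and c
   by (simp add: nn_integral_add nn_integral_cmult nn_integral_sum)
  show ?thesis by (intro arg_cong2[where f=times] refl sp) measurable
 qed
 also have "... <= ennreal (1 / A0) * (2 * ennreal e + ennreal (2 * d^2) * (SUM i:(UNIV::2 set). ennreal e))"
  by (intro mult_left_mono add_mono sum_mono G) auto
 also have "... = ennreal (1 / A0 * (2 * e + 2 * d^2 * (2 * e)))"
 proof -
  have "(SUM i:(UNIV::2 set). ennreal e) = 2 * ennreal e" by simp
  moreover have "0 <= 1 / A0" "0 <= 2 * d^2" using A0 by auto
  ultimately show ?thesis using e
   by (simp only: ennreal_mult[symmetric] ennreal_plus[symmetric] ennreal_numeral[symmetric]
      mult_nonneg_nonneg add_nonneg_nonneg zero_le_numeral)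
 qed
 finally have 2: "(?q - Taylor_mean T A0 a)^2 <= 1 / A0 * (2 * e + 2 * d^2 * (2 * e))"
  using A0 e by (subst (asm) ennreal_le_iff) auto
 have "(G a - Taylor_mean T A0 a)^2 <= 2 * (G a - ?q)^2 + 2 * (?q - Taylor_mean T A0 a)^2"
  using power2_sum_le[of "G a - ?q" "?q - Taylor_mean T A0 a"] by simp
 also have "... <= 2 * (d ^ 4 / A0 * (2 * hess T + 8 * e)) + 2 * (1 / A0 * (2 * e + 2 * d^2 * (2 * e)))"
  by (intro add_mono mult_left_mono 1 2) auto
 also have "... = 4 * d ^ 4 / A0 * hess T + (16 * d ^ 4 / A0 + 4 / A0 * (1 + 2 * d^2)) * e"
  by (simp add: distrib_left distrib_right add_divide_distrib mult_ac)
 finally show ?thesis .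
qed

text \<open>A substitute for the embedding of \<open>H2\<close> into the continuous functions. The
  values of smooth approximations converge at every point of the closure, and the limit obeys the
  Taylor bound on all convex pieces at once, in particular on all triangles sharing a
  vertex.\<close>

lemma nodal_values:
 obtains U where "!!T A0 a d. open T ==> convex T ==> T \<subseteq> D ==> emeasure lborel T = ennreal A0 ==> 0 < A0 ==>
  a : closure T ==> (!!x. x : T ==> norm (a - x) <= d) ==> (U a - Taylor_mean T A0 a)^2 <= 4 * d ^ 4 / A0 * hess T"
proof -
 define e where "e n = 1 / real (Suc n)" for n
 have e0: "0 < e n" for n by (simp add: e_def)
 have e_lim: "e \<longlonglongrightarrow> 0" unfolding e_def by (rule LIMSEQ_Suc[OF lim_1_over_n])
 define good where "good n G \<longleftrightarrow> (ALL k. C_k k G) & (nnI D (%x. (G x - u x)^2)) <= ennreal (e n) &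
  (ALL i. (nnI D (%x. (pd i G x - g i x)^2)) <= ennreal (e n)) &
  (ALL i j. (nnI D (%x. (pd j (pd i G) x - k i j x)^2)) <= ennreal (e n))"
  for n and G :: "real^2 => real"
 have "EX G. good n G" for n
  by (rule smooth_approx_H2[OF e0[of n]]) (auto simp: good_def)
 then obtain G where G: "!!n. good n (G n)" by metis
 have near: "(G n a - Taylor_mean T A0 a)^2 <= 4 * d ^ 4 / A0 * hess T + (16 * d ^ 4 / A0 + 4 / A0 * (1 + 2 * d^2)) * e n"
  if "open T" "convex T" "T \<subseteq> D" "emeasure lborel T = ennreal A0" "0 < A0" "a : closure T"
   "!!x. x : T ==> norm (a - x) <= d" for T A0 a d n
  using G[of n] e0[of n] unfolding good_def by (intro smooth_near_Taylor_mean that) auto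
 have conv: "convergent (%n. G n a)" if a: "a : closure D" for a
 proof -
  obtain A0 where A0: "emeasure lborel D = ennreal A0" "0 < A0" using area by blast
  obtain R where R: "0 < R" "!!x y. x : closure D ==> y : closure D ==> norm (y - x) <= R"
   using diam_bound by blast
  have Ra: "norm (a - x) <= R" if "x : D" for x using R(2)[of x a] a that closure_subset by blast
  have "Cauchy (%n. G n a)"
  proof (rule CauchyI)
   fix r :: real assume r: "0 < r"
   define H where "H = 4 * R ^ 4 / A0 * hess D"
   have H: "0 <= H" using A0 R hess_nonneg by (simp add: H_def)
   \<comment> \<open>The Taylor bound on the copy of \<open>D\<close> scaled by ta is at most ta^2
     H; this choice makes it at most r^2/16, and another r^2/16 is left for the approximation
     error.\<close>
   define ta where "ta = min 1 (r / (4 * sqrt (H + 1)))"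
   have ta: "0 < ta" "ta <= 1" using r H by (auto simp: ta_def)
   have "ta\<^sup>2 * H <= (r / (4 * sqrt (H + 1)))^2 * H"
    using ta H by (intro mult_right_mono power_mono) (auto simp: ta_def)
   also have "... = r^2 / 16 * (H / (H + 1))" using H by (simp add: power_divide power_mult_distrib)
   also have "... <= r^2 / 16 * 1" using H by (intro mult_left_mono) auto
   finally have taH: "ta\<^sup>2 * H <= r^2 / 16" by simp
   obtain T where T: "open T" "convex T" "T \<subseteq> D" "a : closure T" "emeasure lborel T = ennreal (ta\<^sup>2 * A0)"
     "!!x. x : T ==> norm (a - x) <= ta * R"
    using shrink_to_point[OF a ta A0(1) Ra] by metis
   define M where "M = 16 * (ta * R) ^ 4 / (ta\<^sup>2 * A0) + 4 / (ta\<^sup>2 * A0) * (1 + 2 * (ta * R)^2)"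
   have "(%n. M * e n) \<longlonglongrightarrow> M * 0" by (intro tendsto_intros e_lim)
   from order_tendstoD(2)[OF this, of "r^2 / 16"] r
   obtain N where N: "!!n. N <= n ==> M * e n < r^2 / 16" by (auto simp: eventually_sequentially)
   have close: "\<bar>G n a - Taylor_mean T (ta\<^sup>2 * A0) a\<bar> < r / 2" if n: "N <= n" for n
   proof -
    have "4 * (ta * R) ^ 4 / (ta\<^sup>2 * A0) * hess T <= 4 * (ta * R) ^ 4 / (ta\<^sup>2 * A0) * hess D"
     using T(1,3) A0 ta R by (intro mult_left_mono hess_mono) auto
    also have "... = ta\<^sup>2 * H" using ta A0 by (simp add: H_def power_mult_distrib power4_eq_xxxx power2_eq_square)
    finally have "(G n a - Taylor_mean T (ta\<^sup>2 * A0) a)^2 <= ta\<^sup>2 * H + M * e n"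
     using near[OF T(1,2,3,5) _ T(4,6), of n] ta A0 unfolding M_def by (simp add: add_mono)
    also have "... < r^2 / 4" using taH N[OF n] zero_less_power[OF r, of 2] by linarith
    also have "... = (r / 2)^2" by (simp add: power_divide)
    finally show ?thesis using r abs_le_square_iff[of "r / 2" "G n a - Taylor_mean T (ta\<^sup>2 * A0) a"] by linarith
   qed
   have "norm (G m a - G n a) < r" if "N <= m" "N <= n" for m n
    using close[OF that(1)] close[OF that(2)] unfolding real_norm_def by linarith
   thus "EX M. ALL m>=M. ALL n>=M. norm (G m a - G n a) < r" by blast
  qed
  thus ?thesis by (simp add: Cauchy_convergent_iff)
 qed
 show ?thesis
 proof (rule that[of "%a. lim (%n. G n a)"])
  fix T A0 a d
  assume T: "open T" "convex T" "T \<subseteq> D" "emeasure lborel T = ennreal A0" "0 < A0" "a : closure T"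
   "!!x. x : T ==> norm (a - x) <= d"
  have "a : closure D" using T closure_mono by blast
  hence "(%n. G n a) \<longlonglongrightarrow> lim (%n. G n a)" using conv convergent_LIMSEQ_iff by blast
  hence "(%n. (G n a - Taylor_mean T A0 a)^2) \<longlonglongrightarrow> (lim (%n. G n a) - Taylor_mean T A0 a)^2"
   by (intro tendsto_intros)
  moreover have "(%n. 4 * d ^ 4 / A0 * hess T + (16 * d ^ 4 / A0 + 4 / A0 * (1 + 2 * d^2)) * e n) \<longlonglongrightarrow>
    4 * d ^ 4 / A0 * hess T + (16 * d ^ 4 / A0 + 4 / A0 * (1 + 2 * d^2)) * 0"
   by (intro tendsto_intros e_lim)
  ultimately have "(lim (%n. G n a) - Taylor_mean T A0 a)^2 <=
    4 * d ^ 4 / A0 * hess T + (16 * d ^ 4 / A0 + 4 / A0 * (1 + 2 * d^2)) * 0"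
   by (rule LIMSEQ_le) (use near[OF T] in blast)
  thus "(lim (%n. G n a) - Taylor_mean T A0 a)^2 <= 4 * d ^ 4 / A0 * hess T" by simp
 qed
qed

end


section \<open>Boundary values\<close>

text \<open>\<open>b\<close> is an inner normal of a supporting line at \<open>a\<close>; its
  negative leads out of \<open>D\<close>.\<close>

lemma (in convex_domain) outward_direction:
 assumes a: "a : frontier D"
 obtains b where "b ~= 0" "!!y. y : closure D ==> b \<bullet> a <= b \<bullet> y" "!!y. y : D ==> b \<bullet> a < b \<bullet> y"
proof -
 have ri: "rel_interior D = D" using D by (simp add: rel_interior_open)
 have "a : closure D" "a \<notin> rel_interior D" using a D(1) by (auto simp: frontier_def interior_open ri)
 from supporting_hyperplane_relative_frontier[OF D(3) this] show ?thesis using that ri by metis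
qed

text \<open>Shifting the ball by its radius along the outer normal takes it out of \<open>D\<close>,
  where the test function vanishes. Integrating along the shift avoids straightening the
  boundary.\<close>

lemma (in convex_domain) boundary_Poincare:
 assumes a: "a : frontier D" and l: "0 < l" and ph: "test_function D ph"
 shows "nnI (ball a l) (%x. (ph x)^2) <= ennreal (l^2) * nnI (ball a (2 * l)) (%x. (norm (gradient ph x))^2)"
proof -
 obtain b where b: "b ~= 0" "!!y. y : closure D ==> b \<bullet> a <= b \<bullet> y" using outward_direction[OF a] by metis
 have [measurable]: "ball a r : sets borel" for r by simp
 define n where "n = (- (l / norm b)) *\<^sub>R b"
 have n: "norm n = l" unfolding n_def norm_scaleR using b(1) l by simp
 have ph1: "C_k (Suc 0) ph" by (rule tf_C_k[OF ph])
 have [measurable]: "gradient ph : bmeas" "ph : bmeas"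
  using C1_gradient_continuous[OF ph1] tf_continuous[OF ph] by (auto intro!: borel_measurable_continuous_onI)
 have zero: "ph (x + n) = 0" if x: "x : ball a l" for x
 proof -
  have "b \<bullet> (x - a) <= norm b * norm (x - a)" by (rule norm_cauchy_schwarz)
  also have "... < norm b * l" using x b(1) by (simp add: dist_norm norm_minus_commute)
  also have "... = - (b \<bullet> n)" using b(1) by (simp add: n_def power2_norm_eq_inner[symmetric] power2_eq_square)
  finally have "b \<bullet> (x + n) < b \<bullet> a" by (simp add: inner_right_distrib inner_diff_right)
  hence "x + n \<notin> D" using b(2) closure_subset by (meson not_le subsetD)
  thus ?thesis using test_functionE[OF ph] by (metis subsetD)
 qed
 let ?N = "%x. ennreal ((norm (gradient ph x))^2)"
 let ?B = "ind (ball a l) :: real^2 => ennreal"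
 let ?B2 = "ind (ball a (2 * l)) :: real^2 => ennreal"
 let ?J = "ind {0..1} :: real => ennreal"
 have "NI (%x. ennreal ((ph x)^2) * ?B x) <=
   NI (%x. ennreal (l^2) * NI (%t. ?N (x + t *\<^sub>R n) * ?J t * ?B x))"
 proof (intro nn_integral_mono)
  fix x
  show "ennreal ((ph x)^2) * ?B x <= ennreal (l^2) * NI (%t. ?N (x + t *\<^sub>R n) * ?J t * ?B x)"
  proof (cases "x : ball a l")
   case True
   have "ennreal ((ph (x + n) - ph x)^2) <= ennreal ((norm (x + n - x))^2 / (1 - 0)) *
     NI (%t. ennreal (t powr 0 * (norm (gradient ph (x + t *\<^sub>R (x + n - x))))^2) * ?J t)"
    by (rule segment_square_bound[OF ph1]) simp
   also have "NI (%t. ennreal (t powr 0 * (norm (gradient ph (x + t *\<^sub>R (x + n - x))))^2) * ?J t)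
     <= NI (%t. ?N (x + t *\<^sub>R n) * ?J t)"
   proof (intro nn_integral_mono)
    fix t :: real
    have "t powr 0 * (norm (gradient ph (x + t *\<^sub>R n)))^2 <= (norm (gradient ph (x + t *\<^sub>R n)))^2" by simp
    thus "ennreal (t powr 0 * (norm (gradient ph (x + t *\<^sub>R (x + n - x))))^2) * ?J t <= ?N (x + t *\<^sub>R n) * ?J t"
     by (intro mult_right_mono ennreal_leI) auto
   qed
   finally show ?thesis using zero[OF True] True n by (simp add: mult_left_mono)
  qed simp
 qed
 also have "... = ennreal (l^2) * NI (%x. (NI (%t. ?N (x + t *\<^sub>R n) * ?J t * ?B x)))"
  by (rule nn_integral_cmult) measurable
 also have "NI (%x. (NI (%t. ?N (x + t *\<^sub>R n) * ?J t * ?B x))) =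
   NI (%t. (NI (%x. ?N (x + t *\<^sub>R n) * ?J t * ?B x)))"
  by (rule lborel_pair.Fubini') measurable
 also have "... <= NI (%t. (NI (%x. ?N x * ?B2 x)) * ?J t)"
 proof (intro nn_integral_mono)
  fix t :: real
  show "NI (%x. ?N (x + t *\<^sub>R n) * ?J t * ?B x) <= NI (%x. ?N x * ?B2 x) * ?J t"
  proof (cases "t : {0..1}")
   case True
   have "NI (%x. ?N (x + t *\<^sub>R n) * ?J t * ?B x) <= NI (%x. ?N (t *\<^sub>R n + 1 *\<^sub>R x) * ?B2 (t *\<^sub>R n + 1 *\<^sub>R x))"
   proof (intro nn_integral_mono)
    fix x
    have "t *\<^sub>R n + x : ball a (2 * l)" if "x : ball a l"
    proof -
     have "dist a (t *\<^sub>R n + x) <= norm (a - x) + norm (t *\<^sub>R n)"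
      using norm_triangle_ineq4[of "a - x" "t *\<^sub>R n"] by (simp add: dist_norm algebra_simps)
     also have "norm (t *\<^sub>R n) <= l" using True n l by (simp add: mult_left_le_one_le)
     finally show ?thesis using that by (simp add: dist_norm)
    qed
    thus "?N (x + t *\<^sub>R n) * ?J t * ?B x <= ?N (t *\<^sub>R n + 1 *\<^sub>R x) * ?B2 (t *\<^sub>R n + 1 *\<^sub>R x)"
     using True by (auto simp: indicator_def add.commute)
   qed
   also have "... = NI (%x. ?N x * ?B2 x)"
   proof -
    have "(%x. ?N x * ?B2 x) : bmeas" by measurable
    from lborel_nn_integral_affine[OF this, of 1 "t *\<^sub>R n"] show ?thesis by simp
   qed
   finally show ?thesis using True by simp
  qed simp
 qed
 also have "... = NI (%x. ?N x * ?B2 x)" by (subst nn_integral_cmult) auto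
 finally show ?thesis by (simp add: mult_left_mono)
qed

context H1_data
begin

text \<open>Zero boundary values as approximability by test functions, with the function and each
  derivative measured separately by \<open>ennreal\<close> integrals; the link to
  \<open>H10_space\<close> is made at the end.\<close>

definition H10_limit :: bool where
 "H10_limit \<longleftrightarrow> (ALL e>0. EX ph. test_function D ph &
  (nnI D (%x. (ph x - u x)^2)) <= ennreal e & (ALL i. (nnI D (%x. (pd i ph x - g i x)^2)) <= ennreal e))"

lemma boundary_L2:
 assumes u0: H10_limit and a: "a : frontier D" and l: "0 < l"
 shows "nsq (D \<inter> ball a l) u <= 4 * l^2 * (SUM i:UNIV. nsq (D \<inter> ball a (2 * l)) (g i))"
proof -
 let ?S = "SUM i:UNIV. nsq (D \<inter> ball a (2 * l)) (g i)"
 have S0: "0 <= ?S" by (intro sum_nonneg nsq_nonneg)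
 have "ennreal (nsq (D \<inter> ball a l) u) <= ennreal (4 * l^2 * ?S)"
 proof (rule ennreal_le_real_limit[where c="8 * l^2 + 2"])
  fix e :: real assume e: "0 < e"
  obtain ph where ph: "test_function D ph" and
   phu: "nnI D (%x. (ph x - u x)^2) <= ennreal e" and
   phg: "!!i. (nnI D (%x. (pd i ph x - g i x)^2)) <= ennreal e"
   using u0 e unfolding H10_limit_def by blast
  have [measurable]: "ph : bmeas" by (rule tf_measurable[OF ph])
  have "ennreal (nsq (D \<inter> ball a l) u) = nnI (D \<inter> ball a l) (%x. (ph x + (u x - ph x))^2)"
   using nn_integral_nsq[OF u, of "D \<inter> ball a l"] by simp
  also have "... <= 2 * nnI (D \<inter> ball a l) (%x. (ph x)^2)
    + 2 * nnI (D \<inter> ball a l) (%x. (u x - ph x)^2)"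
   by (rule nn_integral_power2_sum_le) measurable
  also have "... <= 2 * (ennreal (l^2) * ennreal (2 * ?S + 4 * e)) + 2 * ennreal e"
  proof (intro add_mono mult_left_mono)
   have "nnI (D \<inter> ball a l) (%x. (u x - ph x)^2) <= nnI D (%x. (ph x - u x)^2)"
    by (intro nn_integral_mono) (auto simp: indicator_def power2_commute)
   thus "nnI (D \<inter> ball a l) (%x. (u x - ph x)^2) <= ennreal e"
    using phu by (rule order_trans)
   have gr0: "gradient ph x = 0" if "x \<notin> D" for x
   proof -
    have "pd i ph x = 0" for i
     using test_functionE[OF tf_partial[OF ph, of i]] that by (metis subsetD)
    thus ?thesis by (simp add: gradient_def vec_eq_iff)
   qed
   have "nnI (D \<inter> ball a l) (%x. (ph x)^2) <= nnI (ball a l) (%x. (ph x)^2)"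
    by (intro nn_integral_mono) (auto simp: indicator_def)
   also have "... <= ennreal (l^2) * nnI (ball a (2 * l)) (%x. (norm (gradient ph x))^2)"
    by (rule boundary_Poincare[OF a l ph])
   also have "nnI (ball a (2 * l)) (%x. (norm (gradient ph x))^2) =
     nnI (D \<inter> ball a (2 * l)) (%x. (norm (gradient ph x))^2)"
    using gr0 by (intro nn_integral_cong) (auto simp: indicator_def)
   also have "ennreal (l^2) * ... <= ennreal (l^2) * ennreal (2 * ?S + 4 * e)"
    using e by (intro mult_left_mono grad_close_le[OF tf_C_k[OF ph] _ _ _ phg]) auto
   finally show "nnI (D \<inter> ball a l) (%x. (ph x)^2) <= ennreal (l^2) * ennreal (2 * ?S + 4 * e)" .
  qed auto
  also have "... = ennreal (2 * (l^2 * (2 * ?S + 4 * e)) + 2 * e)"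
  proof -
   have "0 <= l^2" "0 <= 2 * ?S + 4 * e" "0 <= e" using e S0 by auto
   thus ?thesis by (simp only: ennreal_mult[symmetric] ennreal_plus[symmetric] ennreal_numeral[symmetric]
      mult_nonneg_nonneg zero_le_numeral)
  qed
  also have "2 * (l^2 * (2 * ?S + 4 * e)) + 2 * e = 4 * l^2 * ?S + (8 * l^2 + 2) * e" by (simp add: algebra_simps)
  finally show "ennreal (nsq (D \<inter> ball a l) u) <= ennreal (4 * l^2 * ?S + (8 * l^2 + 2) * e)" .
 qed auto
 thus ?thesis using S0 by (subst (asm) ennreal_le_iff) auto
qed

lemma nsq_shrinking_ball:
 assumes w: "L2_on D w" and r: "r \<longlonglongrightarrow> 0"
 shows "(%n. nsq (D \<inter> ball a (r n)) w) \<longlonglongrightarrow> 0"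
proof -
 have [measurable]: "w : bmeas" using L2_onD[OF w] by simp
 have [measurable]: "ball a r : sets borel" for r by simp
 have "(%n. LBINT x. ind (D \<inter> ball a (r n)) x * (w x)^2) \<longlonglongrightarrow> (LINT x|(lborel :: (real^2) measure). 0)"
 proof (rule integral_dominated_convergence[where w="%x. (w x)^2"])
  have "AE x in lborel. x ~= a" by (rule AE_lborel_singleton)
  thus "AE x in lborel. (%n. ind (D \<inter> ball a (r n)) x * (w x)^2) \<longlonglongrightarrow> 0"
  proof eventually_elim
   fix x assume "x ~= a"
   hence "\<forall>\<^sub>F n in sequentially. r n < dist a x" by (intro order_tendstoD(2)[OF r]) auto
   hence "\<forall>\<^sub>F n in sequentially. ind (D \<inter> ball a (r n)) x * (w x)^2 = 0"
    by eventually_elim (auto simp: indicator_def)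
   thus "(%n. ind (D \<inter> ball a (r n)) x * (w x)^2) \<longlonglongrightarrow> 0"
    by (rule tendsto_eventually)
  qed
  show "AE x in lborel. norm (ind (D \<inter> ball a (r n)) x * (w x)^2) <= (w x)^2" for n
   by (intro AE_I2) (auto simp: indicator_def)
  show "(%x. ind (D \<inter> ball a (r n)) x * (w x)^2) : borel_measurable lborel" for n by measurable
 qed (use L2_onD(3)[OF w] in auto)
 thus ?thesis by (simp add: nsq_def)
qed

end

context H2_data
begin

lemma Taylor_mean_square_le:
 assumes T: "open T" "T \<subseteq> D" and A0: "emeasure lborel T = ennreal A0" "0 < A0"
  and d: "!!x. x : T ==> norm (a - x) <= d"
 shows "(Taylor_mean T A0 a)^2 <= 1 / A0 * (2 * nsq T u + 2 * d^2 * (SUM i:UNIV. nsq T (g i)))"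
proof -
 have T_meas [measurable]: "T : sets borel" using T by simp
 let ?Lu = "%x. u x + (SUM i:UNIV. g i x * (a $ i - x $ i))"
 have S0: "0 <= 2 * nsq T u" "0 <= 2 * d^2 * (SUM i:UNIV. nsq T (g i))"
  by (auto intro!: nsq_nonneg sum_nonneg mult_nonneg_nonneg)
 have "ennreal ((Taylor_mean T A0 a)^2) <= ennreal (1 / A0) * nnI T (%x. (?Lu x)^2)"
  unfolding Taylor_mean_def by (rule mean_square_le[OF _ T_meas A0]) measurable
 also have "... <= ennreal (1 / A0) * NI (%x. 2 * (ennreal ((u x)^2) * ind T x) +
   ennreal (2 * d^2) * (SUM i:UNIV. ennreal ((g i x)^2) * ind T x))"
 proof (intro mult_left_mono nn_integral_mono)
  fix x
  show "ennreal ((?Lu x)^2) * ind T x <= 2 * (ennreal ((u x)^2) * ind T x) +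
   ennreal (2 * d^2) * (SUM i:UNIV. ennreal ((g i x)^2) * ind T x)"
  proof (cases "x : T")
   case True
   have "(?Lu x)^2 <= 2 * (u x)^2 + 2 * (SUM i:UNIV. g i x * (a - x) $ i)^2"
    using power2_sum_le[of "u x" "SUM i:UNIV. g i x * (a - x) $ i"] by simp
   also have "... <= 2 * (u x)^2 + 2 * ((norm (a - x))^2 * (SUM i:UNIV. (g i x)^2))"
    by (intro add_left_mono mult_left_mono sum_UNIV_2_square_le) auto
   also have "... <= 2 * (u x)^2 + 2 * (d^2 * (SUM i:UNIV. (g i x)^2))"
    by (intro add_left_mono mult_left_mono mult_right_mono power_mono d[OF True] sum_nonneg) auto
   finally have "ennreal ((?Lu x)^2) <= ennreal (2 * (u x)^2 + 2 * d^2 * (SUM i:UNIV. (g i x)^2))"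
    by (intro ennreal_leI) (simp add: mult.assoc)
   also have "... = 2 * ennreal ((u x)^2) + ennreal (2 * d^2) * (SUM i:UNIV. ennreal ((g i x)^2))"
    by (simp add: ennreal_plus ennreal_mult sum_nonneg)
   finally show ?thesis using True by simp
  qed simp
 qed auto
 also have "... = ennreal (1 / A0) * (2 * nnI T (%x. (u x)^2) +
   ennreal (2 * d^2) * (SUM i:UNIV. \<integral>\<^sup>+ x. ennreal ((g i x)^2) * ind T x \<partial>lborel))"
 proof -
  have sp: "NI (%x. 2 * p x + c * (SUM i:UNIV. q i x)) =
    2 * NI (%x. p x) + c * (SUM i:UNIV. \<integral>\<^sup>+ x. q i x \<partial>lborel)"
   if [measurable]: "p : bmeas" "!!i. q i : bmeas"
   for p :: "real^2 => ennreal" and q :: "2 => real^2 => ennreal" and c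
   by (simp add: nn_integral_add nn_integral_cmult nn_integral_sum)
  show ?thesis by (intro arg_cong2[where f=times] refl sp) measurable
 qed
 also have "... = ennreal (1 / A0) * (2 * ennreal (nsq T u) + ennreal (2 * d^2) * (SUM i:UNIV. ennreal (nsq T (g i))))"
  by (simp only: nn_integral_nsq[OF u T_meas] nn_integral_nsq[OF g T_meas])
 also have "... = ennreal (1 / A0 * (2 * nsq T u + 2 * d^2 * (SUM i:UNIV. nsq T (g i))))"
 proof -
  have "(SUM i:UNIV. ennreal (nsq T (g i))) = ennreal (SUM i:UNIV. nsq T (g i))" by (intro sum_ennreal nsq_nonneg)
  moreover have "0 <= (SUM i:UNIV. nsq T (g i))" "0 <= 1 / A0" "0 <= 2 * d^2" using A0 by (auto intro: sum_nonneg nsq_nonneg)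
  ultimately show ?thesis
   by (simp only: ennreal_mult[symmetric] ennreal_plus[symmetric] ennreal_numeral[symmetric]
      mult_nonneg_nonneg add_nonneg_nonneg zero_le_numeral nsq_nonneg)
 qed
 finally show ?thesis using A0 S0 by (subst (asm) ennreal_le_iff) auto
qed

text \<open>In the plane an \<open>H1\<close> function has no boundary point values, so second
  derivatives take part. On the copy of \<open>D\<close> of size ta the Taylor bound is of order
  ta^2, and the squared Taylor mean is bounded by the mean of u^2 + ta^2 |g|^2; the boundary
  estimate turns the latter into the integral of |g|^2 over a shrinking ball, which tends to
  0.\<close>

lemma nodal_value_zero:
 assumes U: "!!T A0 d. open T ==> convex T ==> T \<subseteq> D ==> emeasure lborel T = ennreal A0 ==> 0 < A0 ==>
  a : closure T ==> (!!x. x : T ==> norm (a - x) <= d) ==> (Ua - Taylor_mean T A0 a)^2 <= 4 * d ^ 4 / A0 * hess T"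
  and u0: H10_limit and a: "a : frontier D"
 shows "Ua = 0"
proof -
 have aD: "a : closure D" using a by (simp add: frontier_def)
 obtain A0 where A0: "emeasure lborel D = ennreal A0" "0 < A0" using area by blast
 obtain R where R: "0 < R" "!!x y. x : closure D ==> y : closure D ==> norm (y - x) <= R"
  using diam_bound by blast
 have Ra: "norm (a - x) <= R" if "x : D" for x using R(2)[of x a] aD that closure_subset by blast
 define ta where "ta n = 1 / real (Suc n)" for n
 have ta: "0 < ta n" "ta n <= 1" for n by (auto simp: ta_def)
 have ta_lim: "ta \<longlonglongrightarrow> 0" unfolding ta_def by (rule LIMSEQ_Suc[OF lim_1_over_n])
 \<comment> \<open>The copy of \<open>D\<close> lies in the open ball of radius 2 ta R, and the
   boundary estimate doubles the radius once more.\<close>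
 define S where "S n = (SUM i:UNIV. nsq (D \<inter> ball a (4 * ta n * R)) (g i))" for n
 have bound: "Ua^2 <= 8 * R ^ 4 / A0 * hess D * (ta n)^2 + 68 * R^2 / A0 * S n" for n
 proof -
  obtain T where T: "open T" "convex T" "T \<subseteq> D" "a : closure T" "emeasure lborel T = ennreal ((ta n)^2 * A0)"
    "!!x. x : T ==> norm (a - x) <= ta n * R"
   using shrink_to_point[OF aD ta A0(1) Ra] by metis
  have pos: "0 < (ta n)^2 * A0" using ta[of n] A0 by simp
  have TB: "T \<subseteq> D \<inter> ball a (2 * ta n * R)"
  proof
   fix x assume x: "x : T"
   have "0 < ta n * R" using ta[of n] R by simp
   hence "dist a x < 2 * ta n * R" using T(6)[OF x] by (simp add: dist_norm)
   thus "x : D \<inter> ball a (2 * ta n * R)" using T(3) x by auto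
  qed
  have sub: "D \<inter> ball a (2 * ta n * R) \<subseteq> D \<inter> ball a (4 * ta n * R)"
  proof -
   have "2 * ta n * R <= 4 * ta n * R" using ta[of n] R by simp
   thus ?thesis using subset_ball[of "2 * ta n * R" "4 * ta n * R" a] by blast
  qed
  have nu: "nsq T u <= 16 * (ta n * R)^2 * S n"
  proof -
   have "nsq T u <= nsq (D \<inter> ball a (2 * ta n * R)) u" using TB T(1) by (intro nsq_mono[OF u]) auto
   also have "... <= 4 * (2 * ta n * R)^2 * (SUM i:UNIV. nsq (D \<inter> ball a (2 * (2 * ta n * R))) (g i))"
    using ta[of n] R by (intro boundary_L2[OF u0 a]) auto
   also have "2 * (2 * ta n * R) = 4 * ta n * R" by simp
   also have "4 * (2 * ta n * R)^2 * (SUM i:UNIV. nsq (D \<inter> ball a (4 * ta n * R)) (g i)) = 16 * (ta n * R)^2 * S n"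
    by (simp add: S_def power_mult_distrib)
   finally show ?thesis .
  qed
  have ng: "(SUM i:UNIV. nsq T (g i)) <= S n" unfolding S_def using TB sub T(1) by (intro sum_mono nsq_mono[OF g]) auto
  have "(Taylor_mean T ((ta n)^2 * A0) a)^2 <= 1 / ((ta n)^2 * A0) * (2 * nsq T u + 2 * (ta n * R)^2 * (SUM i:UNIV. nsq T (g i)))"
   by (rule Taylor_mean_square_le[OF T(1,3,5) pos T(6)])
  also have "... <= 1 / ((ta n)^2 * A0) * (2 * (16 * (ta n * R)^2 * S n) + 2 * (ta n * R)^2 * S n)"
   using pos by (intro mult_left_mono add_mono nu ng) auto
  also have "... = 34 * R^2 / A0 * S n" using ta[of n] A0 by (simp add: field_simps)
  finally have q: "(Taylor_mean T ((ta n)^2 * A0) a)^2 <= 34 * R^2 / A0 * S n" .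
  have "(Ua - Taylor_mean T ((ta n)^2 * A0) a)^2 <= 4 * (ta n * R) ^ 4 / ((ta n)^2 * A0) * hess T"
   by (rule U[OF T(1,2,3,5) pos T(4,6)])
  also have "... <= 4 * (ta n * R) ^ 4 / ((ta n)^2 * A0) * hess D"
   using T pos ta[of n] R by (intro mult_left_mono hess_mono) auto
  also have "... = 4 * R ^ 4 / A0 * hess D * (ta n)^2"
   using ta[of n] A0 by (simp add: power_mult_distrib power4_eq_xxxx power2_eq_square)
  finally have p: "(Ua - Taylor_mean T ((ta n)^2 * A0) a)^2 <= 4 * R ^ 4 / A0 * hess D * (ta n)^2" .
  have "Ua^2 <= 2 * (Ua - Taylor_mean T ((ta n)^2 * A0) a)^2 + 2 * (Taylor_mean T ((ta n)^2 * A0) a)^2"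
   using power2_sum_le[of "Ua - Taylor_mean T ((ta n)^2 * A0) a" "Taylor_mean T ((ta n)^2 * A0) a"] by simp
  also have "... <= 2 * (4 * R ^ 4 / A0 * hess D * (ta n)^2) + 2 * (34 * R^2 / A0 * S n)" using p q by linarith
  finally show ?thesis by simp
 qed
 have "(%n. 4 * ta n * R) \<longlonglongrightarrow> 4 * 0 * R" by (intro tendsto_intros ta_lim)
 hence r: "(%n. 4 * ta n * R) \<longlonglongrightarrow> 0" by simp
 have "S \<longlonglongrightarrow> (SUM i:(UNIV::2 set). 0)" unfolding S_def by (intro tendsto_sum nsq_shrinking_ball[OF g r])
 hence "(%n. 8 * R ^ 4 / A0 * hess D * (ta n)^2 + 68 * R^2 / A0 * S n) \<longlonglongrightarrow>
   8 * R ^ 4 / A0 * hess D * 0^2 + 68 * R^2 / A0 * (SUM i:(UNIV::2 set). 0)"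
  by (intro tendsto_intros ta_lim)
 hence "Ua^2 <= 8 * R ^ 4 / A0 * hess D * 0^2 + 68 * R^2 / A0 * (SUM i:(UNIV::2 set). 0)"
  by (rule LIMSEQ_le_const) (use bound in blast)
 thus ?thesis by simp
qed

end


section \<open>Triangles\<close>

definition rot :: "real^2 => real^2" where "rot q = vector [q $ 2, - q $ 1]"

lemma rot_nth [simp]: "rot q $ 1 = q $ 2" "rot q $ 2 = - q $ 1"
 by (auto simp: rot_def)

lemma norm_rot [simp]: "norm (rot q) = norm q"
 by (simp add: norm_eq_sqrt_inner inner_vec_def sum_2 add.commute)

lemma perp_parallel:
 fixes g p q :: "real^2"
 assumes g: "g ~= 0" and p: "g \<bullet> p = 0" "p ~= 0" and q: "g \<bullet> q = 0"
 obtains \<mu> where "q = \<mu> *\<^sub>R p"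
proof -
 have par: "EX s. r = s *\<^sub>R rot g" if "g \<bullet> r = 0" for r
 proof
  have gg: "g $ 1 * g $ 1 + g $ 2 * g $ 2 ~= 0" using g by (simp add: vec_eq_iff forall_2 add_nonneg_eq_0_iff)
  have r: "g $ 1 * r $ 1 + g $ 2 * r $ 2 = 0" using that by (simp add: inner_vec_def sum_2)
  have "r $ 1 * (g $ 1 * g $ 1 + g $ 2 * g $ 2) = (r $ 1 * g $ 2 - r $ 2 * g $ 1) * g $ 2"
    "r $ 2 * (g $ 1 * g $ 1 + g $ 2 * g $ 2) = - (r $ 1 * g $ 2 - r $ 2 * g $ 1) * g $ 1"
   using r by algebra+
  thus "r = ((r $ 1 * g $ 2 - r $ 2 * g $ 1) / (g $ 1 * g $ 1 + g $ 2 * g $ 2)) *\<^sub>R rot g"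
   using gg by (simp add: vec_eq_iff forall_2 eq_divide_eq) (simp add: algebra_simps)
 qed
 obtain s where s: "p = s *\<^sub>R rot g" using par[OF p(1)] by blast
 obtain t where t: "q = t *\<^sub>R rot g" using par[OF q] by blast
 have "s ~= 0" using s p(2) by auto
 hence "q = (t / s) *\<^sub>R p" by (simp add: s t)
 thus ?thesis by (rule that)
qed

text \<open>Twice the area up to sign. It is affine in each vertex, and quotients of such areas are
  the barycentric coordinates.\<close>

definition det3 :: "real^2 => real^2 => real^2 => real" where
 "det3 a b c = (c $ 1 - a $ 1) * (b $ 2 - a $ 2) - (b $ 1 - a $ 1) * (c $ 2 - a $ 2)"

lemma convex_hull_3_barycentric:
 assumes d: "det3 a b c ~= 0"
 shows "x = (1 - det3 a x c / det3 a b c - det3 a b x / det3 a b c) *\<^sub>R a +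
  (det3 a x c / det3 a b c) *\<^sub>R b + (det3 a b x / det3 a b c) *\<^sub>R c" (is "_ = ?r")
proof -
 have "det3 a b c * x $ i = det3 a b c * ?r $ i" if "i = 1 \<or> i = 2" for i
 proof -
  have "det3 a b c * ?r $ i = (det3 a b c - det3 a x c - det3 a b x) * a $ i + det3 a x c * b $ i + det3 a b x * c $ i"
   using d by (simp add: algebra_simps)
  also have "... = det3 a b c * x $ i" using that by (auto simp: det3_def algebra_simps)
  finally show ?thesis by (rule sym)
 qed
 hence "x $ i = ?r $ i" if "i = 1 \<or> i = 2" for i using that mult_left_cancel[OF d] by blast
 thus ?thesis by (simp only: vec_eq_iff forall_2) blast
qed

lemma det3_affine:
 "det3 a (u *\<^sub>R a + v *\<^sub>R b + w *\<^sub>R c) c = v * det3 a b c"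
 "det3 a b (u *\<^sub>R a + v *\<^sub>R b + w *\<^sub>R c) = w * det3 a b c" if "u + v + w = 1"
proof -
 have u: "u = 1 - v - w" using that by simp
 show "det3 a (u *\<^sub>R a + v *\<^sub>R b + w *\<^sub>R c) c = v * det3 a b c"
   "det3 a b (u *\<^sub>R a + v *\<^sub>R b + w *\<^sub>R c) = w * det3 a b c"
  unfolding u by (simp_all add: det3_def algebra_simps)
qed

text \<open>Barycentric coordinates indexed by the vertices themselves, so that no ordering of the
  vertices enters; \<open>gl v\<close> is the gradient of \<open>lam v\<close>.\<close>

definition triangle_coords ::
 "(real^2) set => real => (real^2 => real^2 => real) => (real^2 => real^2) => bool" where
 "triangle_coords T M lam gl \<longleftrightarrow> finite (vertices T) & card (vertices T) = 3 &
  (ALL x. (SUM v:vertices T. lam v x) = 1) & (ALL x. (SUM v:vertices T. lam v x *\<^sub>R v) = x) &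
  closure T = {x. ALL v:vertices T. 0 <= lam v x} & T = {x. ALL v:vertices T. 0 < lam v x} &
  (ALL v:vertices T. ALL x y. lam v y - lam v x = gl v \<bullet> (y - x)) & (ALL v:vertices T. norm (gl v) <= M) &
  (ALL v:vertices T. ALL w:vertices T. lam v w = (if v = w then 1 else 0)) & closure T = convex hull (vertices T)"

lemma triangle_coordsD:
 assumes "triangle_coords T M lam gl"
 shows "finite (vertices T)"
  "card (vertices T) = 3"
  "!!x. (SUM v:vertices T. lam v x) = 1"
  "!!x. (SUM v:vertices T. lam v x *\<^sub>R v) = x"
  "closure T = {x. ALL v:vertices T. 0 <= lam v x}"
  "T = {x. ALL v:vertices T. 0 < lam v x}"
  "!!v x y. v : vertices T ==> lam v y - lam v x = gl v \<bullet> (y - x)"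
  "!!v. v : vertices T ==> norm (gl v) <= M"
  "!!v w. v : vertices T ==> w : vertices T ==> lam v w = (if v = w then 1 else 0)"
  "closure T = convex hull (vertices T)"
proof -
 note A = assms[unfolded triangle_coords_def, THEN conjunct2]
 show "finite (vertices T)" by (rule assms[unfolded triangle_coords_def, THEN conjunct1])
 show "card (vertices T) = 3" by (rule A[THEN conjunct1])
 note A = A[THEN conjunct2]
 show "(SUM v:vertices T. lam v x) = 1" for x by (rule A[THEN conjunct1, rule_format])
 note A = A[THEN conjunct2]
 show "(SUM v:vertices T. lam v x *\<^sub>R v) = x" for x by (rule A[THEN conjunct1, rule_format])
 note A = A[THEN conjunct2]
 show "closure T = {x. ALL v:vertices T. 0 <= lam v x}" by (rule A[THEN conjunct1])
 note A = A[THEN conjunct2]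
 show "T = {x. ALL v:vertices T. 0 < lam v x}" by (rule A[THEN conjunct1])
 note A = A[THEN conjunct2]
 show "lam v y - lam v x = gl v \<bullet> (y - x)" if "v : vertices T" for v x y by (rule A[THEN conjunct1, rule_format, OF that])
 note A = A[THEN conjunct2]
 show "norm (gl v) <= M" if "v : vertices T" for v by (rule A[THEN conjunct1, rule_format, OF that])
 note A = A[THEN conjunct2]
 show "lam v w = (if v = w then 1 else 0)" if "v : vertices T" "w : vertices T" for v w by (rule A[THEN conjunct1, rule_format, OF that])
 show "closure T = convex hull (vertices T)" by (rule A[THEN conjunct2])
qed

text \<open>The gradient of a barycentric coordinate is the opposite edge rotated by a right angle
  and divided by twice the area; edges of length at most \<open>h\<close> and area at least
  \<open>A\<close> give h/(2A).\<close>

lemma triangle_coords_exist: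
 assumes T: "open_triangle T" and A: "0 < A" "A <= area T"
  and edge: "!!v w. v : vertices T ==> w : vertices T ==> dist v w <= h"
 obtains lam gl where "triangle_coords T (h / (2 * A)) lam gl"
proof -
 obtain a b c where abc: "~ collinear {a, b, c}" and T_eq: "T = interior (convex hull {a, b, c})"
  using T by (auto simp: open_triangle_def)
 let ?H = "convex hull {a, b, c}"
 have bH: "bounded ?H" by (simp add: finite_imp_bounded_convex_hull)
 have clH: "closed ?H" by (intro compact_imp_closed finite_imp_compact_convex_hull) simp
 have "area T = area ?H" unfolding T_eq by (rule measure_interior[OF bH negligible_convex_frontier]) simp
 hence "area T = \<bar>det3 a b c\<bar> / 2"
  using content_triangle[of a b c] measure_completion[of ?H lborel] borel_closed[OF clH] by (simp add: det3_def)
 hence dA: "2 * A <= \<bar>det3 a b c\<bar>" using A by simp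
 hence d: "det3 a b c ~= 0" using A by auto
 have T_ne: "interior ?H ~= {}" using A T_eq by auto
 have clT: "closure T = ?H" unfolding T_eq using convex_closure_interior[OF convex_convex_hull T_ne] clH by simp
 have dist3: "a ~= b" "a ~= c" "b ~= c" using d by (auto simp: det3_def)
 have "~ affine_dependent {a, b, c}" using abc collinear_3_eq_affine_dependent[of a b c] by blast
 hence V: "vertices T = {a, b, c}"
  unfolding vertices_def clT by (auto simp: extreme_point_of_convex_hull_affine_independent)
 define lb where "lb x = det3 a x c / det3 a b c" for x
 define lc where "lc x = det3 a b x / det3 a b c" for x
 define la where "la x = 1 - lb x - lc x" for x
 have repr: "x = la x *\<^sub>R a + lb x *\<^sub>R b + lc x *\<^sub>R c" for x
  unfolding la_def lb_def lc_def by (rule convex_hull_3_barycentric[OF d])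
 have coord: "la (u *\<^sub>R a + v *\<^sub>R b + w *\<^sub>R c) = u" "lb (u *\<^sub>R a + v *\<^sub>R b + w *\<^sub>R c) = v"
   "lc (u *\<^sub>R a + v *\<^sub>R b + w *\<^sub>R c) = w" if "u + v + w = 1" for u v w
  using det3_affine[OF that, of a b c] d that by (auto simp: la_def lb_def lc_def)
 have H_iff: "x : ?H \<longleftrightarrow> 0 <= la x & 0 <= lb x & 0 <= lc x" for x
 proof
  assume "x : ?H"
  then obtain u v w where "0 <= u" "0 <= v" "0 <= w" "u + v + w = 1" "x = u *\<^sub>R a + v *\<^sub>R b + w *\<^sub>R c"
   unfolding convex_hull_3 by blast
  thus "0 <= la x & 0 <= lb x & 0 <= lc x" using coord by simp
 next
  assume "0 <= la x & 0 <= lb x & 0 <= lc x"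
  moreover have "la x + lb x + lc x = 1" by (simp add: la_def)
  ultimately show "x : ?H" unfolding convex_hull_3 using repr[of x] by blast
 qed
 define gb where "gb = (- 1 / det3 a b c) *\<^sub>R rot (c - a)"
 define gc where "gc = (1 / det3 a b c) *\<^sub>R rot (b - a)"
 have gb: "lb y - lb x = gb \<bullet> (y - x)" and gc: "lc y - lc x = gc \<bullet> (y - x)" for x y
 proof -
  have "det3 a y c - det3 a x c = - (rot (c - a) \<bullet> (y - x))" "det3 a b y - det3 a b x = rot (b - a) \<bullet> (y - x)"
   by (simp_all add: det3_def inner_vec_def sum_2 algebra_simps)
  thus "lb y - lb x = gb \<bullet> (y - x)" "lc y - lc x = gc \<bullet> (y - x)"
   by (simp_all add: lb_def lc_def gb_def gc_def diff_divide_distrib[symmetric])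
 qed
 define ga where "ga = - gb - gc"
 have ga: "la y - la x = ga \<bullet> (y - x)" for x y
  using gb[of y x] gc[of y x] by (simp add: la_def ga_def inner_diff_left)
 have ga_eq: "ga = (1 / det3 a b c) *\<^sub>R rot (c - b)"
  by (simp add: ga_def gb_def gc_def vec_eq_iff forall_2 diff_divide_distrib)
 have bound: "norm ((s / det3 a b c) *\<^sub>R rot (v - w)) <= h / (2 * A)"
  if "v : {a, b, c}" "w : {a, b, c}" "\<bar>s\<bar> = 1" for v w s
 proof -
  have "norm ((s / det3 a b c) *\<^sub>R rot (v - w)) = dist v w / \<bar>det3 a b c\<bar>"
   using that(3) by (simp add: dist_norm)
  also have "... <= h / (2 * A)"
   using edge[of v w] that(1,2) V dA A by (intro frac_le) (auto intro: order_trans[OF zero_le_dist])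
  finally show ?thesis .
 qed
 have T_iff: "x : T \<longleftrightarrow> 0 < la x & 0 < lb x & 0 < lc x" for x
 proof
  assume x: "x : T"
  then obtain e where e: "0 < e" "ball x e \<subseteq> ?H" unfolding T_eq by (meson mem_interior)
  \<comment> \<open>Stepping from an inner point against a direction in which \<open>l\<close> grows
    stays in the triangle, where \<open>l\<close> is nonnegative; so \<open>l x\<close> is at least
    the size of the step.\<close>
  have pos: "0 < l x" if l: "!!y. l y - l x = gr \<bullet> (y - x)" and lH: "!!y. y : ?H ==> 0 <= l y" and gv: "gr \<bullet> v = 1"
   for l :: "real^2 => real" and gr v
  proof -
   define s where "s = e / (2 * (norm v + 1))"
   have s: "0 < s" using e by (simp add: s_def add_nonneg_pos)
   have "s * norm v <= e / 2" using e by (simp add: s_def divide_simps add_nonneg_pos)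
   hence "x - s *\<^sub>R v : ball x e" using e s by (simp add: dist_norm)
   hence "0 <= l (x - s *\<^sub>R v)" using e(2) lH by blast
   thus ?thesis using l[of "x - s *\<^sub>R v"] gv s by simp
  qed
  have "lb b - lb a = 1" "lc c - lc a = 1" "la a - la b = 1" using coord[of 1 0 0] coord[of 0 1 0] coord[of 0 0 1] by auto
  hence "gb \<bullet> (b - a) = 1" "gc \<bullet> (c - a) = 1" "ga \<bullet> (a - b) = 1" using ga gb gc by auto
  thus "0 < la x & 0 < lb x & 0 < lc x"
   using pos[of la ga "a - b", OF ga] pos[of lb gb "b - a", OF gb] pos[of lc gc "c - a", OF gc] H_iff by auto
 next
  assume x: "0 < la x & 0 < lb x & 0 < lc x"
  have "open {x. 0 < l x}" if l: "!!x y. l y - l x = gr \<bullet> (y - x)" for l :: "real^2 => real" and gr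
  proof -
   have "l y = l 0 + gr \<bullet> y" for y using l[of 0 y] by simp
   hence eq: "l = (%y. l 0 + gr \<bullet> y)" by (rule ext)
   have "continuous_on UNIV l" by (subst eq) (intro continuous_intros)
   thus ?thesis by (rule open_Collect_less[OF continuous_on_const])
  qed
  from open_Int[OF open_Int[OF this[OF ga] this[OF gb]] this[OF gc]]
  have "open ({x. 0 < la x} \<inter> {x. 0 < lb x} \<inter> {x. 0 < lc x})" .
  moreover have "{x. 0 < la x} \<inter> {x. 0 < lb x} \<inter> {x. 0 < lc x} \<subseteq> ?H"
  proof
   fix y assume "y : {x. 0 < la x} \<inter> {x. 0 < lb x} \<inter> {x. 0 < lc x}"
   thus "y : ?H" unfolding H_iff[of y] by auto
  qed
  ultimately have "{x. 0 < la x} \<inter> {x. 0 < lb x} \<inter> {x. 0 < lc x} \<subseteq> interior ?H" by (intro interior_maximal)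
  thus "x : T" unfolding T_eq using x by auto
 qed
 define lam where "lam v = (if v = a then la else if v = b then lb else lc)" for v
 define gl where "gl v = (if v = a then ga else if v = b then gb else gc)" for v
 have "triangle_coords T (h / (2 * A)) lam gl" unfolding triangle_coords_def V
 proof (intro conjI allI ballI)
  show "card {a, b, c} = 3" using dist3 by simp
  show "(SUM v:{a, b, c}. lam v x) = 1" for x using dist3 by (simp add: lam_def la_def)
  show "(SUM v:{a, b, c}. lam v x *\<^sub>R v) = x" for x
   using dist3 repr[of x] by (simp add: lam_def add.assoc)
  show "closure T = {x. ALL v:{a, b, c}. 0 <= lam v x}" unfolding clT using H_iff dist3 by (auto simp: lam_def)
  show "T = {x. ALL v:{a, b, c}. 0 < lam v x}" using T_iff dist3 by (auto simp: lam_def)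
  show "lam v y - lam v x = gl v \<bullet> (y - x)" if "v : {a, b, c}" for v x y
   using that ga gb gc by (auto simp: lam_def gl_def)
  show "norm (gl v) <= h / (2 * A)" if "v : {a, b, c}" for v
   using that bound[of c b 1] bound[of c a "-1"] bound[of b a 1] by (auto simp: gl_def ga_eq gb_def gc_def)
  show "lam v w = (if v = w then 1 else 0)" if "v : {a, b, c}" "w : {a, b, c}" for v w
   using that coord[of 1 0 0] coord[of 0 1 0] coord[of 0 0 1] dist3 by (auto simp: lam_def)
  show "closure T = convex hull {a, b, c}" by (rule clT)
 qed simp
 thus ?thesis by (rule that)
qed

section \<open>Conforming meshes\<close>

text \<open>Used with barycentric coordinates: a boundary point moved slightly along
  \<open>v\<close> enters the open triangle as soon as the coordinates vanishing at it increase
  along \<open>v\<close>.\<close>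

lemma positive_affine_nearby:
 fixes x v :: "real^2" and l gr :: "'i => _"
 assumes "finite V" "!!w y. w : V ==> l w y - l w x = gr w \<bullet> (y - x)"
  "!!w. w : V ==> 0 < l w x \<or> (l w x = 0 & 0 < gr w \<bullet> v)"
 shows "\<forall>\<^sub>F e in at_right (0::real). ALL w:V. 0 < l w (x + e *\<^sub>R v)"
proof (rule eventually_ball_finite[OF assms(1)], rule ballI)
 fix w assume w: "w : V"
 have eq: "l w (x + e *\<^sub>R v) = l w x + e * (gr w \<bullet> v)" for e using assms(2)[OF w, of "x + e *\<^sub>R v"] by simp
 from assms(3)[OF w] show "\<forall>\<^sub>F e in at_right (0::real). 0 < l w (x + e *\<^sub>R v)"
 proof
  assume "0 < l w x"
  moreover have "((%e. l w x + e * (gr w \<bullet> v)) \<longlongrightarrow> l w x + 0 * (gr w \<bullet> v)) (at_right 0)"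
   by (intro tendsto_intros)
  ultimately show ?thesis unfolding eq by (intro order_tendstoD(1)) auto
 next
  assume "l w x = 0 & 0 < gr w \<bullet> v"
  thus ?thesis unfolding eq using eventually_at_right_less[of 0] by (auto elim: eventually_mono)
 qed
qed

text \<open>No direction may point into both triangles at \<open>x\<close>, since they are disjoint.
  This forces the inner normals of the two edges to be opposite, so the edges lie on one line;
  absence of hanging nodes then excludes every overlap except equality.\<close>

lemma open_triangles_share_edge:
 assumes c: "triangle_coords T M lam gl" "triangle_coords T' M' lam' gl'" and disj: "T \<inter> T' = {}"
  and V: "vertices T = {a, b, c}" "vertices T' = {a', b', c'}"
  and ab: "a ~= b" "a ~= c" "b ~= c" and ab': "a' ~= b'" "a' ~= c'" "b' ~= c'"
  and x: "lam c x = 0" "0 < lam a x" "0 < lam b x" and x': "lam' c' x = 0" "0 < lam' a' x" "0 < lam' b' x"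
  and conf: "a \<notin> open_segment a' b'" "b \<notin> open_segment a' b'" "a' \<notin> open_segment a b" "b' \<notin> open_segment a b"
 shows "{a, b} = {a', b'}"
proof -
 note gr = triangle_coordsD(7)[OF c(1), unfolded V] and gr' = triangle_coordsD(7)[OF c(2), unfolded V]
  and T = triangle_coordsD(6)[OF c(1), unfolded V] and T' = triangle_coordsD(6)[OF c(2), unfolded V]
  and kr = triangle_coordsD(9)[OF c(1), unfolded V] and kr' = triangle_coordsD(9)[OF c(2), unfolded V]
  and sm = triangle_coordsD(3)[OF c(1), unfolded V, of x] triangle_coordsD(3)[OF c(2), unfolded V, of x]
  and rp = triangle_coordsD(4)[OF c(1), unfolded V, of x] triangle_coordsD(4)[OF c(2), unfolded V, of x]
 have no: "~ (0 < gl c \<bullet> v & 0 < gl' c' \<bullet> v)" for v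
 proof
  assume v: "0 < gl c \<bullet> v & 0 < gl' c' \<bullet> v"
  have "\<forall>\<^sub>F e in at_right (0::real). ALL w:{a, b, c}. 0 < lam w (x + e *\<^sub>R v)"
   by (rule positive_affine_nearby[where gr=gl]) (use gr x v in auto)
  moreover have "\<forall>\<^sub>F e in at_right (0::real). ALL w:{a', b', c'}. 0 < lam' w (x + e *\<^sub>R v)"
   by (rule positive_affine_nearby[where gr=gl']) (use gr' x' v in auto)
  ultimately have "\<forall>\<^sub>F e in at_right (0::real). x + e *\<^sub>R v : T \<inter> T'"
   by eventually_elim (subst T, subst T', blast)
  thus False using disj by (simp add: trivial_limit_at_right_real)
 qed
 let ?n = "gl c" and ?n' = "gl' c'"
 have n0: "?n ~= 0" using gr[of c c a] kr ab by auto
 have n0': "?n' ~= 0" using gr'[of c' c' a'] kr' ab' by auto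
 \<comment> \<open>The bisector of the two normals, weighted by their lengths: it points into both
   triangles unless the normals are opposite.\<close>
 have "~ (0 < ?n \<bullet> (norm ?n' *\<^sub>R ?n + norm ?n *\<^sub>R ?n') & 0 < ?n' \<bullet> (norm ?n' *\<^sub>R ?n + norm ?n *\<^sub>R ?n'))"
  by (rule no)
 moreover have "?n \<bullet> (norm ?n' *\<^sub>R ?n + norm ?n *\<^sub>R ?n') = norm ?n * (norm ?n * norm ?n' + ?n \<bullet> ?n')"
  by (simp add: inner_add_right power2_norm_eq_inner[symmetric] power2_eq_square algebra_simps)
 moreover have "?n' \<bullet> (norm ?n' *\<^sub>R ?n + norm ?n *\<^sub>R ?n') = norm ?n' * (norm ?n * norm ?n' + ?n \<bullet> ?n')"
  by (simp add: inner_add_right power2_norm_eq_inner[symmetric] power2_eq_square algebra_simps inner_commute)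
 ultimately have "norm ?n * norm ?n' + ?n \<bullet> ?n' <= 0" using n0 n0' by (auto simp: zero_less_mult_iff)
 hence "(- ?n) \<bullet> ?n' = norm (- ?n) * norm ?n'"
  using norm_cauchy_schwarz[of "- ?n" ?n'] by simp
 hence eq: "norm ?n *\<^sub>R ?n' = - (norm ?n' *\<^sub>R ?n)"
  using norm_cauchy_schwarz_eq[of "- ?n" ?n'] by simp
 have pe: "?n \<bullet> (b - a) = 0" using gr[of c b a] kr ab by auto
 have "?n' \<bullet> (b' - a') = 0" using gr'[of c' b' a'] kr' ab' by auto
 hence "norm ?n' * (?n \<bullet> (b' - a')) = 0"
  using arg_cong[OF eq, of "%z. z \<bullet> (b' - a')"] by simp
 hence pe': "?n \<bullet> (b' - a') = 0" using n0' by simp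
 obtain \<mu> where \<mu>: "b' - a' = \<mu> *\<^sub>R (b - a)" using perp_parallel[OF n0 pe _ pe'] ab by auto
 have \<mu>0: "\<mu> ~= 0" using \<mu> ab' by auto
 define t where "t = lam b x"
 have la: "lam a x = 1 - t" using sm(1) ab x by (simp add: t_def)
 have xa: "x = a + t *\<^sub>R (b - a)" using rp(1) ab x la by (simp add: t_def[symmetric] algebra_simps)
 have t: "0 < t" "t < 1" using x la by (auto simp: t_def)
 define t' where "t' = lam' b' x"
 have la': "lam' a' x = 1 - t'" using sm(2) ab' x' by (simp add: t'_def)
 have xa': "x = a' + t' *\<^sub>R (b' - a')" using rp(2) ab' x' la' by (simp add: t'_def[symmetric] algebra_simps)
 have t': "0 < t'" "t' < 1" using x' la' by (auto simp: t'_def)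
 let ?e = "b - a"
 have e0: "?e ~= 0" using ab by simp
 \<comment> \<open>In the coordinate on the common line in which \<open>a\<close> is 0 and
   \<open>b\<close> is 1, the points \<open>a'\<close>, \<open>b'\<close> and \<open>x\<close> sit
   at p, q and t.\<close>
 define p where "p = t - t' * \<mu>"
 define q where "q = t + (1 - t') * \<mu>"
 have a': "a' = a + p *\<^sub>R ?e" using xa xa' unfolding \<mu> p_def by (simp add: algebra_simps)
 have b': "b' = a + q *\<^sub>R ?e"
 proof -
  have "b' = a' + \<mu> *\<^sub>R ?e" using \<mu> by (simp add: algebra_simps)
  thus ?thesis unfolding a' p_def q_def by (simp add: algebra_simps)
 qed
 have seg: "z : open_segment y w \<longleftrightarrow> y ~= w & (EX s. 0 < s & s < 1 & z = (1 - s) *\<^sub>R y + s *\<^sub>R w)" for z y w :: "real^2"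
  by (rule in_segment)
 have p_out: "~ (0 < p & p < 1)"
 proof
  assume "0 < p & p < 1"
  moreover have "a' = (1 - p) *\<^sub>R a + p *\<^sub>R b" unfolding a' by (simp add: algebra_simps)
  ultimately show False using conf(3) ab unfolding seg by blast
 qed
 have q_out: "~ (0 < q & q < 1)"
 proof
  assume "0 < q & q < 1"
  moreover have "b' = (1 - q) *\<^sub>R a + q *\<^sub>R b" unfolding b' by (simp add: algebra_simps)
  ultimately show False using conf(4) ab unfolding seg by blast
 qed
 have qp: "q - p = \<mu>" by (simp add: p_def q_def algebra_simps)
 have inner: "z : open_segment a' b'" if "z = a + s *\<^sub>R ?e" "0 < (s - p) / \<mu>" "(s - p) / \<mu> < 1" for z s
 proof -
  have "(1 - (s - p) / \<mu>) *\<^sub>R a' + ((s - p) / \<mu>) *\<^sub>R b' = a' + ((s - p) / \<mu>) *\<^sub>R (b' - a')"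
   by (simp add: algebra_simps)
  also have "((s - p) / \<mu>) *\<^sub>R (b' - a') = (s - p) *\<^sub>R ?e" using \<mu>0 by (simp add: \<mu>)
  also have "a' + (s - p) *\<^sub>R ?e = a + s *\<^sub>R ?e" unfolding a' by (simp add: algebra_simps)
  finally show ?thesis using that ab'(1) unfolding seg by metis
 qed
 have a_out: "~ (0 < (0 - p) / \<mu> & (0 - p) / \<mu> < 1)" using inner[of a 0] conf(1) by auto
 have b_out: "~ (0 < (1 - p) / \<mu> & (1 - p) / \<mu> < 1)" using inner[of b 1] conf(2) by auto
 have pt: "(t - p) / \<mu> = t'" using \<mu>0 by (simp add: p_def)
 show ?thesis
 proof (cases "0 < \<mu>")
  case True
  have "p < t" "t < q" using t' True by (auto simp: p_def q_def)
  hence "p <= 0" "1 <= q" using p_out q_out t by auto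
  moreover have "~ (p < 0 & 0 < q)" using a_out True qp by (auto simp: field_simps)
  moreover have "~ (p < 1 & 1 < q)" using b_out True qp by (auto simp: field_simps)
  ultimately have "p = 0" "q = 1" by auto
  thus ?thesis using a' b' by simp
 next
  case False
  hence neg: "\<mu> < 0" using \<mu>0 by simp
  have "t < p" "q < t" using t' neg by (auto simp: p_def q_def mult_less_0_iff zero_less_mult_iff mult_pos_neg)
  hence "1 <= p" "q <= 0" using p_out q_out t by auto
  moreover have "~ (q < 0 & 0 < p)" using a_out neg qp by (auto simp: field_simps)
  moreover have "~ (q < 1 & 1 < p)" using b_out neg qp by (auto simp: field_simps)
  ultimately have "p = 1" "q = 0" by auto
  thus ?thesis using a' b' by auto
 qed
qed


section \<open>Meshes with barycentric coordinates\<close>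

locale triangulation = convex_domain +
 fixes \<T> :: "(real^2) set set" and h c :: real
 assumes adm: "admissible_triangulation D \<T>" and mesh: "mesh_size \<T> = h" and h: "0 < h" and c: "0 < c"
  and area_ge: "!!T. T : \<T> ==> c * h^2 <= area T"
begin

lemma finite_T [simp]: "finite \<T>"
 and open_tri: "T : \<T> ==> open_triangle T"
 and T_sub: "T : \<T> ==> T \<subseteq> D"
 and T_cover: "(UN T:\<T>. closure T) = closure D"
 using adm by (auto simp: admissible_triangulation_def)

lemma T_disj: "T : \<T> ==> T' : \<T> ==> T ~= T' ==> T \<inter> T' = {}"
 using adm by (auto simp: admissible_triangulation_def pairwise_def disjnt_def)

lemma no_hanging_node: "T : \<T> ==> T' : \<T> ==> x : vertices T ==> a : vertices T' ==> b : vertices T' ==>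
  x \<notin> open_segment a b"
proof (cases "T = T'")
 case True
 assume "T : \<T>" "T' : \<T>" "x : vertices T" "a : vertices T'" "b : vertices T'"
 thus ?thesis using True by (auto simp: vertices_def extreme_point_of_def)
next
 case False
 assume "T : \<T>" "T' : \<T>" "x : vertices T" "a : vertices T'" "b : vertices T'"
 thus ?thesis using adm False by (auto simp: admissible_triangulation_def)
qed

lemma T_open: "T : \<T> ==> open T"
 and T_convex: "T : \<T> ==> convex T"
 using open_tri by (auto simp: open_triangle_def intro: convex_interior convex_convex_hull)

lemma T_borel [measurable]: "T : \<T> ==> T : sets borel"
 using T_open by simp

lemma T_bounded: "T : \<T> ==> bounded T"
 using T_sub D(2) bounded_subset by blast

lemma finite_vertices: "T : \<T> ==> finite (vertices T)"
proof -
 assume "T : \<T>"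
 then obtain a b c where "T = interior (convex hull {a, b, c})" using open_tri unfolding open_triangle_def by blast
 moreover have "closure (interior (convex hull {a, b, c})) = convex hull {a, b, c} \<or> interior (convex hull {a, b, c}) = {}"
  using convex_closure_interior[of "convex hull {a, b, c}"] by (auto simp: compact_imp_closed finite_imp_compact_convex_hull)
 ultimately show ?thesis
  unfolding vertices_def
  using extreme_points_of_convex_hull[of "{a, b, c}"] finite_subset[of _ "{a, b, c}"] by (auto simp: extreme_point_of_empty)
qed

lemma edge_le: "T : \<T> ==> v : vertices T ==> w : vertices T ==> dist v w <= h"
proof -
 assume T: "T : \<T>" "v : vertices T" "w : vertices T"
 let ?E = "{dist a b | T a b. T : \<T> & a : vertices T & b : vertices T}"
 have "?E = (UN T:\<T>. (%(a, b). dist a b) ` (vertices T \<times> vertices T))" by auto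
 hence "finite ?E" using finite_vertices by auto
 hence "dist v w <= Max ?E" using T by (intro Max_ge) auto
 thus ?thesis using mesh by (simp add: mesh_size_def)
qed

definition M where "M = 1 / (2 * c * h)"

lemma M_pos: "0 < M"
 using c h by (simp add: M_def)

lemma coords_exist: "T : \<T> ==> EX p. triangle_coords T M (fst p) (snd p)"
proof -
 assume T: "T : \<T>"
 have "0 < c * h^2" using c h by simp
 from triangle_coords_exist[OF open_tri[OF T] this area_ge[OF T] edge_le[OF T]]
 obtain lam gl where "triangle_coords T (h / (2 * (c * h^2))) lam gl" by blast
 moreover have "h / (2 * (c * h^2)) = M" using c h by (simp add: M_def power2_eq_square)
 ultimately show ?thesis by (intro exI[of _ "(lam, gl)"]) simp
qed

definition lam where "lam T = fst (SOME p. triangle_coords T M (fst p) (snd p))"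
definition gl where "gl T = snd (SOME p. triangle_coords T M (fst p) (snd p))"

lemma coords: "T : \<T> ==> triangle_coords T M (lam T) (gl T)"
 unfolding lam_def gl_def by (rule someI_ex[OF coords_exist])

lemmas coordsD = triangle_coordsD[OF coords]

lemma lam_nonneg_iff: "T : \<T> ==> x : closure T \<longleftrightarrow> (ALL v:vertices T. 0 <= lam T v x)"
 using coordsD(5) by blast

lemma lam_pos_iff: "T : \<T> ==> x : T \<longleftrightarrow> (ALL v:vertices T. 0 < lam T v x)"
 using coordsD(6) by blast

lemma T_diam: "T : \<T> ==> x : closure T ==> y : closure T ==> norm (y - x) <= h"
proof -
 assume T: "T : \<T>" "x : closure T" "y : closure T"
 have 1: "closure T \<subseteq> cball w r" if "!!v. v : vertices T ==> dist w v <= r" for w r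
  unfolding coordsD(10)[OF T(1)] using that by (intro hull_minimal) auto
 have "dist w v <= h" if "w : vertices T" "v : closure T" for w v
  using 1[of w h] edge_le[OF T(1)] that by auto
 hence "closure T \<subseteq> cball x h" using T(2) by (intro 1) (simp add: dist_commute)
 thus ?thesis using T(3) by (auto simp: dist_norm norm_minus_commute)
qed

lemma vertices_closure: "T : \<T> ==> v : vertices T ==> v : closure T"
 by (simp add: vertices_def extreme_point_of_def)

lemma T_area: "T : \<T> ==> emeasure lborel T = ennreal (area T)"
 and T_area_pos: "T : \<T> ==> 0 < area T"
proof -
 assume T: "T : \<T>"
 have "emeasure lborel T < \<infinity>" by (rule emeasure_bounded_finite[OF T_bounded[OF T]])
 thus "emeasure lborel T = ennreal (area T)"
  using T_borel[OF T] by (simp add: emeasure_eq_ennreal_measure top.not_eq_extremum)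
 show "0 < area T" using c h by (intro less_le_trans[OF _ area_ge[OF T]]) simp
qed

lemma T_nonempty: "T : \<T> ==> T ~= {}"
 using T_area_pos by force

text \<open>The open triangles miss the edges, and these are null as parts of boundaries of convex
  sets.\<close>

lemma AE_in_some_T: "AE x in lborel. x : D --> (EX T:\<T>. x : T)"
proof -
 have "AE x in lborel. x \<notin> frontier T" if "T : \<T>" for T
 proof -
  have "frontier T : null_sets lebesgue"
   using negligible_convex_frontier[OF T_convex[OF that]] by (simp add: negligible_iff_null_sets)
  hence "AE x in lebesgue. x \<notin> frontier T" by (rule AE_not_in)
  thus ?thesis by (simp add: AE_completion_iff)
 qed
 hence "AE x in lborel. ALL T:\<T>. x \<notin> frontier T" by (intro AE_finite_allI) auto
 thus ?thesis
 proof eventually_elim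
  fix x assume x: "ALL T:\<T>. x \<notin> frontier T"
  show "x : D --> (EX T:\<T>. x : T)"
  proof
   assume "x : D"
   then obtain T where "T : \<T>" "x : closure T" using T_cover closure_subset by blast
   thus "EX T:\<T>. x : T" using x T_open by (auto simp: frontier_def interior_open)
  qed
 qed
qed

lemma AE_not_frontier_D: "AE x in lborel. x \<notin> frontier D"
proof -
 have "frontier D : null_sets lebesgue" using negligible_convex_frontier[OF D(3)] by (simp add: negligible_iff_null_sets)
 hence "AE x in lebesgue. x \<notin> frontier D" by (rule AE_not_in)
 thus ?thesis by (simp add: AE_completion_iff)
qed

lemma sum_indicator_T: "AE x in lborel. (SUM T:\<T>. ind T x :: real) = ind D x"
 using AE_in_some_T
proof eventually_elim
 fix x assume x: "x : D --> (EX T:\<T>. x : T)"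
 show "(SUM T:\<T>. ind T x :: real) = ind D x"
 proof (cases "x : D")
  case True
  then obtain T where T: "T : \<T>" "x : T" using x by blast
  have "(SUM T':\<T>. ind T' x :: real) = (SUM T':\<T>. if T' = T then 1 else 0)"
   using T T_disj by (intro sum.cong) (auto simp: indicator_def)
  thus ?thesis using T True by simp
 next
  case False
  thus ?thesis using T_sub by (auto simp: indicator_def intro!: sum.neutral)
 qed
qed

lemma sum_T_at: "T : \<T> ==> x : T ==> (SUM T':\<T>. ind T' x * (f T' :: real)) = f T"
proof -
 assume T: "T : \<T>" "x : T"
 have "(SUM T':\<T>. ind T' x * f T') = (SUM T':\<T>. if T' = T then f T else 0)"
  using T T_disj by (intro sum.cong) (auto simp: indicator_def)
 thus ?thesis using T by simp
qed

section \<open>Finite element functions\<close>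

text \<open>The gradient at an arbitrary point of \<open>T\<close>; for finite element functions it
  is the constant gradient on \<open>T\<close>.\<close>

definition slope :: "(real^2 => real) => (real^2) set => real^2" where
 "slope v T = gradient v (SOME x. x : T)"

lemma gradient_affine_on:
 assumes "open T" "x : T" "!!y. y : T ==> v y = \<alpha> + \<beta> \<bullet> y"
 shows "gradient v x = \<beta>" "(v has_derivative (%y. \<beta> \<bullet> y)) (at x)"
proof -
 have "((%y. \<alpha> + \<beta> \<bullet> y) has_derivative (%y. \<beta> \<bullet> y)) (at x)" by (auto intro!: derivative_eq_intros)
 thus d: "(v has_derivative (%y. \<beta> \<bullet> y)) (at x)"
  by (rule has_derivative_transform_within_open[OF _ assms(1,2)]) (use assms(3) in auto)
 show "gradient v x = \<beta>" using partial_deriv_eq[OF d] by (simp add: gradient_def vec_eq_iff inner_axis)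
qed

text \<open>Membership in \<open>fe_space\<close> speaks of the open triangle; the affine formula
  extends to the closure by continuity.\<close>

lemma fe_affine:
 assumes v: "v : fe_space D \<T>" and T: "T : \<T>"
 obtains \<alpha> where "!!x. x : closure T ==> v x = \<alpha> + slope v T \<bullet> x" "!!x. x : T ==> gradient v x = slope v T"
proof -
 obtain \<alpha> \<beta> where ab: "ALL x:T. v x = \<alpha> + \<beta> \<bullet> x" using v T unfolding fe_space_def by blast
 have gr: "gradient v x = \<beta>" if "x : T" for x
  using gradient_affine_on(1)[OF T_open[OF T] that] ab by blast
 have sl: "slope v T = \<beta>" unfolding slope_def using T_nonempty[OF T] by (intro gr) (auto intro: someI)
 have "continuous_on (closure D) v" using v by (simp add: fe_space_def)
 hence cont: "continuous_on (closure T) v"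
  by (rule continuous_on_subset[OF _ closure_mono[OF T_sub[OF T]]])
 have "v x = \<alpha> + \<beta> \<bullet> x" if "x : closure T" for x
 proof -
  have "continuous_on (closure T) (%x. v x - (\<alpha> + \<beta> \<bullet> x))" by (intro continuous_intros cont)
  from continuous_constant_on_closure[OF this _ that, of 0] show ?thesis using ab by simp
 qed
 thus ?thesis using that sl gr by blast
qed

lemma slope_eqI:
 assumes T: "T : \<T>" and "!!x. x : T ==> v x = \<alpha> + \<beta> \<bullet> x"
 shows "slope v T = \<beta>"
 unfolding slope_def using T_nonempty[OF T] assms by (intro gradient_affine_on(1)[OF T_open[OF T]]) (auto intro: someI)

lemma fe_diff:
 assumes v: "v : fe_space D \<T>" and w: "w : fe_space D \<T>"
 shows "(%x. v x - w x) : fe_space D \<T>" "T : \<T> ==> slope (%x. v x - w x) T = slope v T - slope w T"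
proof -
 have aff: "EX \<alpha>. ALL x:T. v x - w x = \<alpha> + (slope v T - slope w T) \<bullet> x" if T: "T : \<T>" for T
 proof -
  obtain \<alpha> where a: "!!x. x : closure T ==> v x = \<alpha> + slope v T \<bullet> x" using fe_affine[OF v T] by metis
  obtain \<alpha>' where b: "!!x. x : closure T ==> w x = \<alpha>' + slope w T \<bullet> x" using fe_affine[OF w T] by metis
  have "ALL x:T. v x - w x = (\<alpha> - \<alpha>') + (slope v T - slope w T) \<bullet> x"
   using a b closure_subset[of T] by (auto simp: inner_diff_left)
  thus ?thesis by blast
 qed
 show "(%x. v x - w x) : fe_space D \<T>" using v w aff unfolding fe_space_def by (auto intro!: continuous_on_diff) blast
 assume T: "T : \<T>"
 obtain \<alpha> where "ALL x:T. v x - w x = \<alpha> + (slope v T - slope w T) \<bullet> x" using aff[OF T] by blast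
 thus "slope (%x. v x - w x) T = slope v T - slope w T" by (intro slope_eqI[OF T]) auto
qed

text \<open>For finite element functions this extension by zero is Lipschitz on the whole plane, so
  it can be integrated by parts without boundary terms.\<close>

definition ext :: "(real^2 => real) => real^2 => real" where
 "ext v x = (if x : D then v x else 0)"

definition pgrad :: "(real^2 => real) => 2 => real^2 => real" where
 "pgrad v i x = (SUM T:\<T>. ind T x * slope v T $ i)"

definition slope_bound :: "(real^2 => real) => real" where
 "slope_bound v = (SUM T:\<T>. norm (slope v T))"

lemma slope_le: "T : \<T> ==> norm (slope v T) <= slope_bound v"
 unfolding slope_bound_def by (intro member_le_sum) auto

lemma slope_bound_nonneg: "0 <= slope_bound v"
 unfolding slope_bound_def by (intro sum_nonneg) auto

lemma pgrad_at: "T : \<T> ==> x : T ==> pgrad v i x = slope v T $ i"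
 unfolding pgrad_def by (rule sum_T_at)

lemma pgrad_outside: "ALL T:\<T>. x \<notin> T ==> pgrad v i x = 0"
 unfolding pgrad_def by (auto intro!: sum.neutral)

lemma pgrad_bound: "\<bar>pgrad v i x\<bar> <= slope_bound v"
proof (cases "EX T:\<T>. x : T")
 case True
 then obtain T where T: "T : \<T>" "x : T" by blast
 hence "\<bar>pgrad v i x\<bar> <= norm (slope v T)" using component_le_norm_cart[of "slope v T" i] by (simp add: pgrad_at)
 thus ?thesis using slope_le[OF T(1), of v] by linarith
next
 case False
 thus ?thesis using slope_bound_nonneg by (simp add: pgrad_outside)
qed

lemma pgrad_measurable [measurable]: "pgrad v i : bmeas"
 unfolding pgrad_def[abs_def] by (intro borel_measurable_sum borel_measurable_times) auto

text \<open>The segment from \<open>x\<close> to \<open>y\<close> is covered by finitely many closed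
  sets on which the function is affine with slope at most \<open>slope_bound v\<close>; Lipschitz
  bounds glue over such a cover.\<close>

lemma fe_lipschitz_closure:
 assumes v: "v : fe_space D \<T>" and xy: "x : closure D" "y : closure D"
 shows "\<bar>v y - v x\<bar> <= slope_bound v * norm (y - x)"
proof -
 let ?p = "%t::real. x + t *\<^sub>R (y - x)"
 let ?U = "%T. {t. ?p t : closure T}"
 have "(slope_bound v * norm (y - x))-lipschitz_on {0..1} (%t. v (?p t))"
 proof (rule lipschitz_on_closed_Union)
  show "(slope_bound v * norm (y - x))-lipschitz_on (?U T) (%t. v (?p t))" if T: "T : \<T>" for T
  proof (rule lipschitz_onI)
   obtain \<alpha> where a: "!!x. x : closure T ==> v x = \<alpha> + slope v T \<bullet> x" using fe_affine[OF v T] by metis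
   fix s t assume st: "s : ?U T" "t : ?U T"
   have "v (?p s) - v (?p t) = (s - t) * (slope v T \<bullet> (y - x))"
    using a st by (simp add: inner_add_right inner_diff_right algebra_simps)
   hence "dist (v (?p s)) (v (?p t)) = \<bar>s - t\<bar> * \<bar>slope v T \<bullet> (y - x)\<bar>" by (simp add: dist_real_def abs_mult)
   also have "... <= \<bar>s - t\<bar> * (slope_bound v * norm (y - x))"
    using order_trans[OF Cauchy_Schwarz_ineq2[of "slope v T" "y - x"] mult_right_mono[OF slope_le[OF T, of v] norm_ge_zero]]
    by (intro mult_left_mono) auto
   finally show "dist (v (?p s)) (v (?p t)) <= slope_bound v * norm (y - x) * dist s t"
    by (simp add: dist_real_def mult.commute)
  qed (use slope_bound_nonneg in auto)
  show "closed (?U T)" if "T : \<T>" for T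
   by (intro continuous_closed_vimage[unfolded vimage_def] closed_closure continuous_intros)
  have "?p t : closure D" if "t : {0..1}" for t
  proof -
   have "(1 - t) *\<^sub>R x + t *\<^sub>R y : closure D" using that xy convex_closure[OF D(3)] by (auto simp: convex_alt)
   thus ?thesis by (simp add: algebra_simps)
  qed
  thus "{0..1} \<subseteq> (UN T:\<T>. ?U T)" using T_cover by blast
 qed (use slope_bound_nonneg in auto)
 from lipschitz_onD[OF this, of 1 0] show ?thesis by (simp add: dist_real_def)
qed

lemma frontier_between:
 assumes "x : D" "y \<notin> D"
 obtains z where "z : frontier D" "norm (x - z) <= norm (x - y)"
proof -
 have "closed_segment x y \<inter> frontier D ~= {}" using assms by (intro connected_Int_frontier convex_connected) auto
 then obtain z where z: "z : closed_segment x y" "z : frontier D" by blast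
 thus ?thesis using that segment_bound(1)[OF z(1)] by (simp add: norm_minus_commute)
qed

text \<open>On a segment leaving \<open>D\<close> the function vanishes where the boundary is
  crossed, so the bound up to that point suffices.\<close>

lemma ext_lipschitz:
 assumes v: "v : fe_space D \<T>"
 shows "\<bar>ext v x - ext v y\<bar> <= slope_bound v * norm (x - y)"
proof -
 have one: "\<bar>v x\<bar> <= slope_bound v * norm (x - y)" if "x : D" "y \<notin> D" for x y
 proof -
  obtain z where z: "z : frontier D" "norm (x - z) <= norm (x - y)"
   by (rule frontier_between[OF \<open>x \<in> D\<close> \<open>y \<notin> D\<close>]) blast
  hence "v z = 0" "z : closure D" using v by (auto simp: fe_space_def frontier_def)
  hence "\<bar>v x\<bar> <= slope_bound v * norm (x - z)"
   using fe_lipschitz_closure[OF v, of z x] that closure_subset by force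
  also have "... <= slope_bound v * norm (x - y)" using z slope_bound_nonneg by (intro mult_left_mono) auto
  finally show ?thesis .
 qed
 consider "x : D" "y : D" | "x : D" "y \<notin> D" | "x \<notin> D" "y : D" | "x \<notin> D" "y \<notin> D" by blast
 thus ?thesis
 proof cases
  case 1
  thus ?thesis using fe_lipschitz_closure[OF v, of y x] closure_subset by (force simp: ext_def)
 next
  case 2
  thus ?thesis using one by (simp add: ext_def)
 next
  case 3
  thus ?thesis using one[of y x] by (simp add: ext_def norm_minus_commute)
 next
  case 4
  thus ?thesis using slope_bound_nonneg by (simp add: ext_def)
 qed
qed

lemma ext_measurable: "v : fe_space D \<T> ==> ext v : bmeas"
 by (rule borel_measurable_continuous_onI[OF lipschitz_imp_continuous[OF ext_lipschitz]])

lemma ext_bounded: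
 assumes v: "v : fe_space D \<T>"
 obtains B where "!!x. \<bar>ext v x\<bar> <= B"
proof -
 have "D ~= UNIV" using D(2) not_bounded_UNIV by metis
 then obtain y where y: "y \<notin> D" by blast
 obtain R where R: "0 < R" "!!x. x : D ==> norm x <= R" using D(2) bounded_pos by blast
 have "\<bar>ext v x\<bar> <= slope_bound v * (R + norm y)" for x
 proof (cases "x : D")
  case True
  have "\<bar>ext v x\<bar> <= slope_bound v * norm (x - y)" using ext_lipschitz[OF v, of x y] y by (simp add: ext_def)
  also have "... <= slope_bound v * (R + norm y)"
   using R(2)[OF True] norm_triangle_ineq4[of x y] slope_bound_nonneg by (intro mult_left_mono) auto
  finally show ?thesis .
 next
  case False
  thus ?thesis using slope_bound_nonneg[of v] R by (simp add: ext_def)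
 qed
 thus ?thesis by (rule that)
qed

lemma ext_difference_quotient:
 assumes v: "v : fe_space D \<T>"
 shows "AE x in lborel. ((%t. (ext v (x + t *\<^sub>R axis i 1) - ext v x) / t) \<longlongrightarrow> pgrad v i x) (at 0)"
 using AE_in_some_T AE_not_frontier_D
proof eventually_elim
 fix x assume x: "x : D --> (EX T:\<T>. x : T)" "x \<notin> frontier D"
 show "((%t. (ext v (x + t *\<^sub>R axis i 1) - ext v x) / t) \<longlongrightarrow> pgrad v i x) (at 0)"
 proof (cases "x : D")
  case True
  then obtain T where T: "T : \<T>" "x : T" using x by blast
  obtain \<alpha> where a: "!!x. x : closure T ==> v x = \<alpha> + slope v T \<bullet> x" using fe_affine[OF v T(1)] by metis
  have "ext v y = \<alpha> + slope v T \<bullet> y" if "y : T" for y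
   using a[of y] that T_sub[OF T(1)] closure_subset[of T] by (auto simp: ext_def)
  from gradient_affine_on(2)[OF T_open[OF T(1)] T(2) this]
  have "(ext v has_derivative (%y. slope v T \<bullet> y)) (at x)" .
  from difference_quotient_limit[OF this, of "axis i 1"]
  show ?thesis using T by (simp add: pgrad_at inner_axis)
 next
  case False
  hence xc: "x : - closure D" using x(2) D(1) by (auto simp: frontier_def interior_open)
  have "((%y. 0) has_derivative (%y. 0 :: real)) (at x)" by simp
  hence "(ext v has_derivative (%y. 0)) (at x)"
   by (rule has_derivative_transform_within_open[OF _ _ xc]) (use closure_subset[of D] in \<open>auto simp: ext_def\<close>)
  from difference_quotient_limit[OF this, of "axis i 1"]
  show ?thesis using False T_sub by (subst pgrad_outside) auto
 qed
qed

lemma ext_weak_partial: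
 assumes v: "v : fe_space D \<T>"
 shows "weak_partial E i (ext v) (pgrad v i)"
 unfolding weak_partial_def
proof (intro allI impI)
 fix ph assume ph: "test_function E ph"
 obtain B where "!!x. \<bar>ext v x\<bar> <= B" using ext_bounded[OF v] by metis
 from lipschitz_integration_by_parts_test_function[OF ext_lipschitz[OF v] this pgrad_measurable ext_difference_quotient[OF v] ph]
 show "(LBINT x. ext v x * pd i ph x) = - (LBINT x. pgrad v i x * ph x)" .
qed

lemma L2_on_bounded:
 assumes [measurable]: "f : bmeas" and "!!x. x \<notin> D ==> f x = 0" "!!x. \<bar>f x\<bar> <= B"
 shows "L2_on D f"
 unfolding L2_on_def
proof (intro conjI allI impI)
 show "L1 (%x. (f x)^2)"
 proof (rule Bochner_Integration.integrable_bound)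
  show "L1 (%x. ind D x * B^2)" using integrable_ind[OF D_measurable D(2)] by auto
  show "AE x in lborel. norm ((f x)^2) <= norm (ind D x * B^2)"
  proof (intro AE_I2)
   fix x
   have "\<bar>f x\<bar> <= \<bar>B\<bar>" using assms(3)[of x] by linarith
   thus "norm ((f x)^2) <= norm (ind D x * B^2)"
    using assms(2)[of x] by (cases "x : D") (auto simp: abs_le_square_iff)
  qed
 qed measurable
qed (use assms in auto)

lemma pgrad_zero: "x \<notin> D ==> pgrad v i x = 0"
 using T_sub by (intro pgrad_outside) auto

lemma fe_H1_data:
 assumes v: "v : fe_space D \<T>"
 shows "H1_data D (ext v) (pgrad v)"
proof
 obtain B where B: "!!x. \<bar>ext v x\<bar> <= B" using ext_bounded[OF v] by metis
 show "L2_on D (ext v)" by (rule L2_on_bounded[OF ext_measurable[OF v] _ B]) (simp add: ext_def)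
 show "L2_on D (pgrad v i)" for i
  by (rule L2_on_bounded[OF pgrad_measurable _ pgrad_bound]) (rule pgrad_zero)
 show "weak_partial D i (ext v) (pgrad v i)" for i by (rule ext_weak_partial[OF v])
qed

text \<open>With a negative parameter the argument of \<open>w\<close> is pushed outwards. Where the
  integrand is nonzero, \<open>x\<close> is a convex combination, with fixed positive weights, of a
  point of the closure of \<open>D\<close> and a point of the support of \<open>et\<close>; such
  points form a compact subset of \<open>D\<close>.\<close>

lemma tf_mollify_neg:
 assumes et: "test_function D et" and w: "L1 w" "!!x. x \<notin> D ==> w x = 0" and dl: "0 < dl"
 shows "test_function D (mollify et (- dl) w)"
proof -
 obtain K where K: "compact K" "K \<subseteq> D" "ALL x. x \<notin> K --> et x = 0" using test_functionE[OF et] by metis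
 let ?f = "%(y, z). y - (dl / (1 + dl)) *\<^sub>R (y - z)"
 show ?thesis
 proof (rule test_functionI)
  show "C_k k (mollify et (- dl) w)" for k using dl by (intro C_k_mollify[OF et w(1)]) auto
  show "compact (?f ` (closure D \<times> K))" using D(2) K(1) by (intro compact_continuous_image compact_Times)
    (auto simp: compact_closure case_prod_unfold intro!: continuous_intros)
  show "?f ` (closure D \<times> K) \<subseteq> D"
  proof safe
   fix y z assume "y : closure D" "z : K"
   hence "y - (dl / (1 + dl)) *\<^sub>R (y - z) : interior D"
    using K(2) D(1) dl by (intro mem_interior_closure_convex_shrink[OF D(3)]) (auto simp: interior_open)
   thus "y - (dl / (1 + dl)) *\<^sub>R (y - z) : D" using D(1) by (simp add: interior_open)
  qed
  fix x assume x: "x \<notin> ?f ` (closure D \<times> K)"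
  have zero: "et z * w ((1 - - dl) *\<^sub>R x + (- dl) *\<^sub>R z) = 0" for z
  proof (cases "z : K")
   case True
   let ?y = "(1 + dl) *\<^sub>R x - dl *\<^sub>R z"
   have "?y - (dl / (1 + dl)) *\<^sub>R (?y - z) = x"
   proof -
    have "?y - z = (1 + dl) *\<^sub>R (x - z)" by (simp add: algebra_simps)
    hence "(dl / (1 + dl)) *\<^sub>R (?y - z) = dl *\<^sub>R (x - z)" using dl by simp
    thus ?thesis by (simp add: algebra_simps)
   qed
   hence "x = ?f (?y, z)" by simp
   hence "?y \<notin> closure D" using x True by blast
   hence "?y \<notin> D" using closure_subset by blast
   thus ?thesis using w(2)[of ?y] by simp
  qed (use K in simp)
  show "mollify et (- dl) w x = 0" unfolding mollify_def by (simp only: zero Bochner_Integration.integral_zero)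
 qed
qed

text \<open>Mollification with a negative parameter produces test functions. The zero extension has
  its weak gradient on the whole plane, so the derivative formula applies although the arguments
  leave \<open>D\<close>.\<close>

lemma fe_H10:
 assumes v: "v : fe_space D \<T>"
 shows "H1_data.H10_limit D (ext v) (pgrad v)"
proof -
 interpret H1_data D "ext v" "pgrad v" by (rule fe_H1_data[OF v])
 obtain et where et: "test_function D et" "!!x. 0 <= et x" "integrable lborel et" "(LBINT x. et x) = 1"
  using mollifier_exists[OF D(1,4)] by metis
 have int_u: "L1 (ext v)" by (rule L2_L1[OF u D(1,2)])
 show ?thesis unfolding H10_limit_def
 proof (intro allI impI)
  fix e :: real assume e: "0 < e"
  have "\<forall>\<^sub>F dl in at_left 0. ALL i:UNIV.
   (nnI D (%x. ((1 - dl) ^ 1 * mollify et dl (pgrad v i) x - pgrad v i x)^2)) <= ennreal e"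
   by (intro eventually_ball_finite ballI mollify_eventually[OF et g e]) simp
  moreover have "\<forall>\<^sub>F dl in at_left 0. dl < (0::real)" by (simp add: eventually_at_filter)
  ultimately have "\<forall>\<^sub>F dl in at_left 0. dl < 0 &
   (nnI D (%x. ((1 - dl) ^ 0 * mollify et dl (ext v) x - ext v x)^2)) <= ennreal e &
   (ALL i. (nnI D (%x. ((1 - dl) ^ 1 * mollify et dl (pgrad v i) x - pgrad v i x)^2)) <= ennreal e)"
   using mollify_eventually[OF et u e, of 0] by eventually_elim auto
  from eventually_happens'[OF trivial_limit_at_left_real this]
  obtain dl where dl: "dl < 0"
   "nnI D (%x. ((1 - dl) ^ 0 * mollify et dl (ext v) x - ext v x)^2) <= ennreal e"
   "!!i. (nnI D (%x. ((1 - dl) ^ 1 * mollify et dl (pgrad v i) x - pgrad v i x)^2)) <= ennreal e"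
   by blast
  have "test_function D (mollify et dl (ext v))" using tf_mollify_neg[OF et(1) int_u, of "- dl"] dl(1) by (simp add: ext_def)
  moreover have "pd i (mollify et dl (ext v)) x = (1 - dl) ^ 1 * mollify et dl (pgrad v i) x" for i x
   using partial_deriv_mollify[OF et(1) int_u pgrad_measurable, where dl=dl and E=UNIV and i=i and x=x]
    ext_weak_partial[OF v, of UNIV i] dl(1) by (simp add: weak_partial_def)
  ultimately show "EX ph. test_function D ph & (nnI D (%x. (ph x - ext v x)^2)) <= ennreal e &
  (ALL i. (nnI D (%x. (pd i ph x - pgrad v i x)^2)) <= ennreal e)"
   using dl(2,3) by (intro exI[of _ "mollify et dl (ext v)"]) simp
 qed
qed

end


section \<open>Nodal interpolation\<close>

context triangulation
begin

text \<open>A boundary point of a triangle has a vanishing coordinate; a second one makes it a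
  vertex, otherwise it is interior to an edge.\<close>

lemma closure_point_cases:
 assumes T: "T : \<T>" and x: "x : closure T" "x \<notin> T"
 shows "x : vertices T \<or> (EX a b d. vertices T = {a, b, d} & a ~= b & a ~= d & b ~= d &
  lam T d x = 0 & 0 < lam T a x & 0 < lam T b x)"
proof -
 obtain a b d where V: "vertices T = {a, b, d}" "a ~= b" "a ~= d" "b ~= d"
  using coordsD(2)[OF T] by (auto simp: card_3_iff)
 have ge: "0 <= lam T a x" "0 <= lam T b x" "0 <= lam T d x" using x(1) lam_nonneg_iff[OF T] V by auto
 have s: "lam T a x + lam T b x + lam T d x = 1" using coordsD(3)[OF T, of x] V by (simp add: add.assoc)
 have r: "lam T a x *\<^sub>R a + lam T b x *\<^sub>R b + lam T d x *\<^sub>R d = x" using coordsD(4)[OF T, of x] V by (simp add: add.assoc)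
 have "lam T a x = 0 \<or> lam T b x = 0 \<or> lam T d x = 0"
  using x(2) lam_pos_iff[OF T] V ge by (metis insert_iff less_eq_real_def singletonD)
 then consider "lam T a x = 0" "lam T b x = 0" | "lam T a x = 0" "lam T d x = 0" | "lam T b x = 0" "lam T d x = 0"
  | "lam T a x = 0" "0 < lam T b x" "0 < lam T d x" | "lam T b x = 0" "0 < lam T a x" "0 < lam T d x"
  | "lam T d x = 0" "0 < lam T a x" "0 < lam T b x"
  using ge by (metis less_eq_real_def)
 thus ?thesis
 proof cases
  case 1 thus ?thesis using r s V by simp
 next
  case 2 thus ?thesis using r s V by simp
 next
  case 3 thus ?thesis using r s V by simp
 next
  case 4
  have "vertices T = {b, d, a}" using V by auto
  thus ?thesis using 4 V by blast
 next
  case 5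
  have "vertices T = {a, d, b}" using V by auto
  thus ?thesis using 5 V by blast
 next
  case 6
  thus ?thesis using V by blast
 qed
qed

definition interp :: "(real^2 => real) => (real^2) set => real^2 => real" where
 "interp U T x = (SUM w:vertices T. U w * lam T w x)"

lemma interp_vertex:
 assumes T: "T : \<T>" and x: "x : vertices T"
 shows "interp U T x = U x"
proof -
 have "interp U T x = (SUM w:vertices T. if w = x then U x else 0)"
  unfolding interp_def using coordsD(9)[OF T _ x] by (intro sum.cong) auto
 thus ?thesis using x coordsD(1)[OF T] by simp
qed

lemma edge_point:
 assumes T: "T : \<T>" and V: "vertices T = {a, b, d}" "a ~= b" "a ~= d" "b ~= d"
  and x: "lam T d x = 0" "0 < lam T a x" "0 < lam T b x"
 shows "interp U T x = U a + lam T b x * (U b - U a)" "x = a + lam T b x *\<^sub>R (b - a)" "lam T b x < 1"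
  "x : open_segment a b"
proof -
 have s: "lam T a x = 1 - lam T b x" using coordsD(3)[OF T, of x] V x by simp
 show "interp U T x = U a + lam T b x * (U b - U a)" using V x by (simp add: interp_def s algebra_simps)
 show e: "x = a + lam T b x *\<^sub>R (b - a)" using coordsD(4)[OF T, of x] V x by (simp add: s algebra_simps)
 show l: "lam T b x < 1" using x s by simp
 show "x : open_segment a b" unfolding in_segment
  using V(2) x l e by (intro conjI exI[of _ "lam T b x"]) (auto simp: algebra_simps)
qed

text \<open>Distinct triangles meet only in boundary points. There, absence of hanging nodes means a
  common vertex or a common edge, and on an edge the interpolant depends only on the two end
  values.\<close>

lemma interp_consistent:
 assumes T: "T : \<T>" "x : closure T" and T': "T' : \<T>" "x : closure T'"
 shows "interp U T x = interp U T' x"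
proof (cases "T = T'")
 case False
 hence disj: "T \<inter> T' = {}" using T_disj T T' by blast
 have xT: "x \<notin> T" using open_Int_closure_eq_empty[OF T_open[OF T(1)], of T'] disj T' by blast
 have xT': "x \<notin> T'" using open_Int_closure_eq_empty[OF T_open[OF T'(1)], of T] disj T by blast
 note cT = closure_point_cases[OF T xT] and cT' = closure_point_cases[OF T' xT']
 have hang: "y \<notin> open_segment a b" if "y : vertices T \<or> y : vertices T'" "{a, b} \<subseteq> vertices T \<or> {a, b} \<subseteq> vertices T'" for y a b
  using that no_hanging_node T T' by blast
 show ?thesis
 proof (cases "x : vertices T")
  case True
  have "x : vertices T'"
  proof (rule ccontr)
   assume "x \<notin> vertices T'"
   then obtain a b d where V': "vertices T' = {a, b, d}" "a ~= b" "a ~= d" "b ~= d"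
    "lam T' d x = 0" "0 < lam T' a x" "0 < lam T' b x" using cT' by blast
   from edge_point(4)[OF T'(1) this] hang[of x a b] True V' show False by simp
  qed
  thus ?thesis using True interp_vertex T(1) T'(1) by simp
 next
  case False
  then obtain a b d where V: "vertices T = {a, b, d}" "a ~= b" "a ~= d" "b ~= d"
    and lT: "lam T d x = 0" "0 < lam T a x" "0 < lam T b x" using cT by blast
  note ep = edge_point[OF T(1) V lT]
  have "x \<notin> vertices T'" using ep(4) hang[of x a b] V by auto
  then obtain a' b' d' where V': "vertices T' = {a', b', d'}" "a' ~= b'" "a' ~= d'" "b' ~= d'"
    and lT': "lam T' d' x = 0" "0 < lam T' a' x" "0 < lam T' b' x" using cT' by blast
  note ep' = edge_point[OF T'(1) V' lT']
  have "{a, b} = {a', b'}"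
   by (rule open_triangles_share_edge[OF coords[OF T(1)] coords[OF T'(1)] disj V(1) V'(1) V(2,3,4) V'(2,3,4) lT lT'])
    (use hang V V' in auto)
  then consider "a' = a" "b' = b" | "a' = b" "b' = a" by (auto simp: doubleton_eq_iff)
  thus ?thesis
  proof cases
   case 1
   have "a + lam T b x *\<^sub>R (b - a) = a + lam T' b x *\<^sub>R (b - a)"
    using ep(2) ep'(2) unfolding 1 by (rule trans[OF sym])
   hence "lam T b x = lam T' b x" using V(2) by simp
   thus ?thesis using ep(1) ep'(1) 1 by simp
  next
   case 2
   have "a + lam T b x *\<^sub>R (b - a) = b + lam T' a x *\<^sub>R (a - b)"
    using ep(2) ep'(2) unfolding 2 by (rule trans[OF sym])
   also have "... = a + (1 - lam T' a x) *\<^sub>R (b - a)" by (simp add: algebra_simps)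
   finally have e: "lam T b x = 1 - lam T' a x" using V(2) by simp
   show ?thesis unfolding ep(1)[of U] ep'(1)[of U, unfolded 2] e by (simp add: algebra_simps)
  qed
 qed
qed simp

lemma interp_affine:
 assumes T: "T : \<T>"
 shows "interp U T y = interp U T 0 + (SUM w:vertices T. U w *\<^sub>R gl T w) \<bullet> y"
proof -
 have "interp U T y = (SUM w:vertices T. U w * (lam T w 0 + gl T w \<bullet> y))"
  unfolding interp_def using coordsD(7)[OF T, of _ y 0] by (intro sum.cong) (auto simp: algebra_simps)
 also have "... = interp U T 0 + (SUM w:vertices T. U w *\<^sub>R gl T w) \<bullet> y"
  by (simp add: interp_def inner_sum_left distrib_left sum.distrib)
 finally show ?thesis .
qed

lemma interpolant_exists:
 assumes U0: "!!a. a : frontier D ==> U a = 0"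
 obtains v where "v : fe_space D \<T>" "!!T. T : \<T> ==> slope v T = (SUM w:vertices T. U w *\<^sub>R gl T w)"
proof
 define v where "v x = interp U (SOME T. T : \<T> & x : closure T) x" for x
 have v: "v x = interp U T x" if T: "T : \<T>" "x : closure T" for T x
 proof -
  have "(SOME T. T : \<T> & x : closure T) : \<T> & x : closure (SOME T. T : \<T> & x : closure T)"
   by (rule someI[of _ T]) (use T in blast)
  thus ?thesis unfolding v_def using interp_consistent T by blast
 qed
 have aff: "v x = interp U T 0 + (SUM w:vertices T. U w *\<^sub>R gl T w) \<bullet> x" if "T : \<T>" "x : closure T" for T x
  unfolding v[OF that] by (rule interp_affine[OF that(1)])
 have aff': "v x = interp U T 0 + (SUM w:vertices T. U w *\<^sub>R gl T w) \<bullet> x" if "T : \<T>" "x : T" for T x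
  by (rule aff[OF that(1)]) (use that closure_subset in blast)
 show "slope v T = (SUM w:vertices T. U w *\<^sub>R gl T w)" if T: "T : \<T>" for T
  by (rule slope_eqI[OF T aff'[OF T]])
 have "continuous_on (closure T) v" if T: "T : \<T>" for T
 proof -
  have "continuous_on (closure T) (%y. interp U T 0 + (SUM w:vertices T. U w *\<^sub>R gl T w) \<bullet> y)"
   by (intro continuous_intros)
  thus ?thesis
   by (rule continuous_on_eq) (rule aff[OF T, symmetric])
 qed
 hence "continuous_on (UN T:\<T>. closure T) v"
  by (intro continuous_on_closed_Union) auto
 hence cont: "continuous_on (closure D) v" by (simp add: T_cover)
 have zero: "v x = 0" if x: "x : frontier D" for x
 proof -
  have xD: "x : closure D" "x \<notin> D" using x D(1) by (auto simp: frontier_def interior_open)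
  then obtain T where T: "T : \<T>" "x : closure T" using T_cover by blast
  have xT: "x \<notin> T" using xD T_sub[OF T(1)] by blast
  have "interp U T x = 0"
  proof (cases "x : vertices T")
   case True
   thus ?thesis using interp_vertex[OF T(1) True] U0[OF x] by simp
  next
   case False
   then obtain a b d where V: "vertices T = {a, b, d}" "a ~= b" "a ~= d" "b ~= d"
    and lT: "lam T d x = 0" "0 < lam T a x" "0 < lam T b x" using closure_point_cases[OF T xT] by blast
   note ep = edge_point[OF T(1) V lT]
   \<comment> \<open>The supporting linear function is smallest at \<open>x\<close>, and
     \<open>x\<close> is a proper convex combination of the end points of its edge; so the function
     is constant on the edge and both ends are boundary points, where \<open>U\<close>
     vanishes.\<close>
   obtain n where n: "!!y. y : closure D ==> n \<bullet> x <= n \<bullet> y" "!!y. y : D ==> n \<bullet> x < n \<bullet> y"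
    using outward_direction[OF x] by metis
   have cl: "a : closure D" "b : closure D" using vertices_closure[OF T(1)] V closure_mono[OF T_sub[OF T(1)]] by auto
   define t where "t = lam T b x"
   have t: "0 < t" "t < 1" using lT ep(3) by (auto simp: t_def)
   have "n \<bullet> x = n \<bullet> (a + t *\<^sub>R (b - a))" using ep(2) by (simp add: t_def)
   also have "... = (1 - t) * (n \<bullet> a) + t * (n \<bullet> b)" by (simp add: inner_add_right inner_diff_right algebra_simps)
   finally have nx: "(1 - t) * (n \<bullet> a - n \<bullet> x) + t * (n \<bullet> b - n \<bullet> x) = 0" by (simp add: algebra_simps)
   have ge: "0 <= n \<bullet> a - n \<bullet> x" "0 <= n \<bullet> b - n \<bullet> x" using n(1) cl by auto
   have "0 <= (1 - t) * (n \<bullet> a - n \<bullet> x)" "0 <= t * (n \<bullet> b - n \<bullet> x)"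
    using ge t by (intro mult_nonneg_nonneg; simp)+
   hence "(1 - t) * (n \<bullet> a - n \<bullet> x) = 0" "t * (n \<bullet> b - n \<bullet> x) = 0" using nx by linarith+
   hence "n \<bullet> a = n \<bullet> x" "n \<bullet> b = n \<bullet> x" using t by auto
   hence "a \<notin> D" "b \<notin> D" using n(2) by force+
   hence "a : frontier D" "b : frontier D" using cl D(1) by (auto simp: frontier_def interior_open)
   thus ?thesis using ep(1)[of U] U0 by simp
  qed
  thus ?thesis using v[OF T] by simp
 qed
 show "v : fe_space D \<T>" unfolding fe_space_def
 proof (intro CollectI conjI ballI)
  show "EX \<alpha> \<beta>. ALL x:T. v x = \<alpha> + \<beta> \<bullet> x" if T: "T : \<T>" for T
   using aff'[OF T] by blast
 qed (use cont zero in auto)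
qed

end

text \<open>The second moment about \<open>a\<close> is a quadratic polynomial in \<open>a\<close>
  with its minimum at the mean.\<close>

lemma nsq_mean_le:
 assumes w: "L2_on D w" and D: "open D" "bounded D" and S: "S : sets borel" "S \<subseteq> D"
  and A0: "emeasure lborel S = ennreal A0" "0 < A0"
 shows "(LBINT x. ind S x * (w x - (LBINT x. ind S x * w x) / A0)^2) <= (LBINT x. ind S x * (w x - a)^2)" "L1 (%x. ind S x * (w x - a)^2)"
proof -
 have [measurable]: "w : bmeas" "S : sets borel" using L2_onD[OF w] S by auto
 have iw: "L1 (%x. ind S x * w x)"
  using integrable_real_mult_indicator[of S lborel w] L2_L1[OF w D] by (simp add: mult.commute)
 have iS: "L1 (ind S :: real^2 => real)" using A0 by (intro integrable_real_indicator) auto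
 have mS: "measure lborel S = A0" using A0 by (simp add: measure_def)
 note iw2 = L2_square[OF w S(1)]
 have int: "L1 (%x. ind S x * (w x - a)^2)" and
  val: "(LBINT x. ind S x * (w x - a)^2) = nsq S w - 2 * a * (LBINT x. ind S x * w x) + a^2 * A0" for a
 proof -
  have eq: "(%x. ind S x * (w x - a)^2) = (%x. (ind S x * (w x)^2 - 2 * a * (ind S x * w x)) + a^2 * ind S x)"
   by (auto simp: fun_eq_iff power2_eq_square algebra_simps)
  show "L1 (%x. ind S x * (w x - a)^2)" unfolding eq using iw2 iw iS by auto
  show "(LBINT x. ind S x * (w x - a)^2) = nsq S w - 2 * a * (LBINT x. ind S x * w x) + a^2 * A0"
   unfolding eq nsq_def using iw2 iw iS
   by (subst Bochner_Integration.integral_add, simp, simp, subst Bochner_Integration.integral_diff) (auto simp: mS)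
 qed
 show "L1 (%x. ind S x * (w x - a)^2)" by (rule int)
 define I where "I = (LBINT x. ind S x * w x)"
 have "0 <= A0 * (a - I / A0)^2" using A0 by simp
 also have "... = a^2 * A0 - 2 * a * I + I^2 / A0" using A0 by (simp add: power2_eq_square field_simps)
 finally show "(LBINT x. ind S x * (w x - (LBINT x. ind S x * w x) / A0)^2) <= (LBINT x. ind S x * (w x - a)^2)"
  unfolding val I_def[symmetric] using A0 by (simp add: power2_eq_square field_simps)
qed

lemma (in H1_data) Poincare_mean_H1:
 assumes T: "T : sets borel" "convex T" "T \<subseteq> D" and A0: "emeasure lborel T = ennreal A0" "0 < A0"
  and d: "!!x y. x : T ==> y : T ==> norm (y - x) <= d"
 shows "(LBINT x. ind T x * (u x - (LBINT x. ind T x * u x) / A0)^2) <= 16 * d^2 * (SUM i:UNIV. nsq T (g i))" (is "?L <= ?R")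
proof -
 have R0: "0 <= ?R" by (auto intro!: mult_nonneg_nonneg sum_nonneg nsq_nonneg)
 have "ennreal ?L <= ennreal ?R"
 proof (rule ennreal_le_real_limit[where c="2 + 32 * d^2"])
  fix e :: real assume e: "0 < e"
  obtain a where a: "nnI T (%x. (u x - a)^2) <= ennreal (?R + (2 + 32 * d^2) * e)"
   using Poincare_H1[OF T A0 d e] by metis
  have "ennreal ?L <= ennreal (LBINT x. ind T x * (u x - a)^2)" by (intro ennreal_leI nsq_mean_le(1)[OF u D(1,2) T(1,3) A0])
  also have "... = NI (%x. ennreal (ind T x * (u x - a)^2))"
   by (rule nn_integral_eq_integral[symmetric, OF nsq_mean_le(2)[OF u D(1,2) T(1,3) A0]]) simp
  also have "... = nnI T (%x. (u x - a)^2)" by (intro nn_integral_cong) (auto simp: indicator_def)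
  finally show "ennreal ?L <= ennreal (?R + (2 + 32 * d^2) * e)" using a by (rule order_trans)
 qed simp
 thus ?thesis using R0 by (subst (asm) ennreal_le_iff) auto
qed

locale fem_H2 = triangulation D \<T> h c + H2_data D u g k
 for D \<T> h c u g k
begin

text \<open>The averaged Taylor polynomial is affine on \<open>T\<close> with gradient
  \<open>m\<close>, and nodal interpolation reproduces it. Hence the slope minus \<open>m\<close> is
  a sum over the three vertices of nodal deviations times coordinate gradients, while
  \<open>g\<close> minus \<open>m\<close> is a Poincare term.\<close>

lemma interpolation_error:
 assumes u0: H10_limit
 obtains v where "v : fe_space D \<T>"
  "(SUM T:\<T>. SUM i:UNIV. LBINT x. ind T x * (g i x - slope v T $ i)^2) <= (32 + 18 / c^2) * h^2 * hess D"
proof -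
 obtain U where U: "!!T A0 a d. open T ==> convex T ==> T \<subseteq> D ==> emeasure lborel T = ennreal A0 ==> 0 < A0 ==>
  a : closure T ==> (!!x. x : T ==> norm (a - x) <= d) ==> (U a - Taylor_mean T A0 a)^2 <= 4 * d ^ 4 / A0 * hess T"
  using nodal_values by blast
 have U0: "U a = 0" if "a : frontier D" for a
  by (rule nodal_value_zero[OF _ u0 that]) (rule U; blast)
 obtain v where v: "v : fe_space D \<T>"
  and sl: "!!T. T : \<T> ==> slope v T = (SUM w:vertices T. U w *\<^sub>R gl T w)"
  by (rule interpolant_exists[of U, OF U0]) (auto intro: that)
 have local: "(SUM i:UNIV. LBINT x. ind T x * (g i x - slope v T $ i)^2) <= (32 + 18 / c^2) * h^2 * hess T"
  if T: "T : \<T>" for T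
 proof -
  define A where "A = area T"
  have A: "emeasure lborel T = ennreal A" "0 < A" "c * h^2 <= A"
   using T_area[OF T] T_area_pos[OF T] area_ge[OF T] by (auto simp: A_def)
  have dT: "norm (y - x) <= h" if "x : T" "y : T" for x y
   using T_diam[OF T, of x y] that closure_subset[of T] by auto
  define m :: "real^2" where "m = (\<chi> i. (LBINT x. ind T x * g i x) / A)"
  have [measurable]: "T : sets borel" by (rule T_borel[OF T])
  have ig: "L1 (%x. ind T x * g i x)" for i
   using integrable_real_mult_indicator[of T lborel "g i"] L2_L1[OF g D(1,2)] by (simp add: mult.commute)
  have igx: "L1 (%x. ind T x * (g i x * (a $ i - x $ i)))" for i and a :: "real^2"
  proof -
   obtain R where R: "0 < R" "!!x. x : T ==> norm x <= R" using T_bounded[OF T] bounded_pos by blast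
   have "L1 (%x. (ind T x * (a $ i - x $ i)) * g i x)"
   proof (rule L1_bounded_mult[OF L2_L1[OF g D(1,2)]])
    show "\<bar>ind T x * (a $ i - x $ i)\<bar> <= norm a + R" for x
     using R(2)[of x] R(1) component_le_norm_cart[of a i] component_le_norm_cart[of x i] norm_ge_zero[of a]
     by (cases "x : T") auto
   qed measurable
   thus ?thesis by (simp add: mult_ac)
  qed
  have iu: "L1 (%x. ind T x * u x)"
   using integrable_real_mult_indicator[of T lborel u] L2_L1[OF u D(1,2)] by (simp add: mult.commute)
  define q0 where "q0 = Taylor_mean T A 0"
  have q: "Taylor_mean T A a = q0 + m \<bullet> a" for a
  proof -
   have split: "ind T x * (u x + (SUM i:UNIV. g i x * (a $ i - x $ i))) =
     ind T x * (u x + (SUM i:UNIV. g i x * (0 $ i - x $ i))) + (SUM i:UNIV. a $ i * (ind T x * g i x))" for x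
    by (simp add: sum_2 algebra_simps)
   have i0: "L1 (%x. ind T x * (u x + (SUM i:UNIV. g i x * (0 $ i - x $ i))))"
    unfolding distrib_left sum_distrib_left by (intro Bochner_Integration.integrable_add Bochner_Integration.integrable_sum iu igx)
   have "(LBINT x. ind T x * (u x + (SUM i:UNIV. g i x * (a $ i - x $ i)))) =
     (LBINT x. ind T x * (u x + (SUM i:UNIV. g i x * (0 $ i - x $ i)))) +
     (SUM i:UNIV. a $ i * (LBINT x. ind T x * g i x))"
    unfolding split using i0 ig by (subst Bochner_Integration.integral_add) (auto simp: Bochner_Integration.integral_sum)
   thus ?thesis
    by (simp add: Taylor_mean_def q0_def m_def inner_vec_def add_divide_distrib sum_divide_distrib mult.commute)
  qed
  define e where "e w = U w - Taylor_mean T A w" for w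
  have e2: "(e w)^2 <= 4 * h ^ 4 / A * hess T" if w: "w : vertices T" for w
   unfolding e_def
  proof (rule U[OF T_open[OF T] T_convex[OF T] T_sub[OF T] A(1,2) vertices_closure[OF T w]])
   show "norm (w - x) <= h" if "x : T" for x
    using T_diam[OF T, of x w] vertices_closure[OF T w] that closure_subset[of T] by auto
  qed
  have m_eq: "(SUM w:vertices T. Taylor_mean T A w *\<^sub>R gl T w) = m"
  proof -
   have "(SUM w:vertices T. Taylor_mean T A w *\<^sub>R gl T w) \<bullet> y = m \<bullet> y" for y
   proof -
    have "(SUM w:vertices T. Taylor_mean T A w *\<^sub>R gl T w) \<bullet> y = (SUM w:vertices T. (q0 + m \<bullet> w) * (lam T w y - lam T w 0))"
     unfolding inner_sum_left using coordsD(7)[OF T, of _ y 0] by (intro sum.cong) (auto simp: q)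
    also have "... = q0 * ((SUM w:vertices T. lam T w y) - (SUM w:vertices T. lam T w 0)) +
      m \<bullet> ((SUM w:vertices T. lam T w y *\<^sub>R w) - (SUM w:vertices T. lam T w 0 *\<^sub>R w))"
     by (simp add: inner_sum_right inner_diff_right sum_distrib_left sum.distrib sum_subtractf algebra_simps)
    also have "... = m \<bullet> y" by (simp add: coordsD(3,4)[OF T])
    finally show ?thesis .
   qed
   thus ?thesis using vector_eq_rdot by blast
  qed
  have "slope v T - m = (SUM w:vertices T. e w *\<^sub>R gl T w)"
   unfolding sl[OF T] m_eq[symmetric] e_def by (simp add: scaleR_diff_left sum_subtractf)
  hence "norm (slope v T - m) = norm (SUM w:vertices T. e w *\<^sub>R gl T w)" by simp
  also have "... <= (SUM w:vertices T. norm (e w *\<^sub>R gl T w))" by (rule norm_sum)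
  also have "... <= (SUM w:vertices T. sqrt (4 * h ^ 4 / A * hess T) * M)" unfolding norm_scaleR real_norm_def
  proof (intro sum_mono mult_mono)
   fix w assume w: "w : vertices T"
   show "\<bar>e w\<bar> <= sqrt (4 * h ^ 4 / A * hess T)" using e2[OF w] by (intro real_le_rsqrt) simp
   show "norm (gl T w) <= M" by (rule coordsD(8)[OF T w])
   show "0 <= sqrt (4 * h ^ 4 / A * hess T)" using A hess_nonneg[of T] by simp
  qed simp
  also have "... = 3 * (sqrt (4 * h ^ 4 / A * hess T) * M)" using coordsD(2)[OF T] by simp
  finally have "(norm (slope v T - m))^2 <= (3 * (sqrt (4 * h ^ 4 / A * hess T) * M))^2" by (intro power_mono) auto
  also have "... = 9 * (4 * h ^ 4 / A * hess T) * M^2"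
   using A hess_nonneg[of T] by (simp add: power_mult_distrib real_sqrt_pow2)
  \<comment> \<open>This is 36 h^4 / A times M^2, where M = 1/(2 c h).\<close>
  also have "... = 9 * h^2 / (A * c^2) * hess T"
   using c h by (simp add: M_def power_divide power_mult_distrib power4_eq_xxxx power2_eq_square field_simps)
  finally have sm: "A * (norm (slope v T - m))^2 <= 9 / c^2 * h^2 * hess T" using A c by (simp add: field_simps)
  have comp: "(LBINT x. ind T x * (g i x - slope v T $ i)^2) <=
    2 * (16 * h^2 * (SUM j:UNIV. nsq T (k i j))) + 2 * (A * ((slope v T - m) $ i)^2)" for i
  proof -
   interpret gi: H1_data D "g i" "k i" by unfold_locales (rule g k g_k)+
   have P: "(LBINT x. ind T x * (g i x - m $ i)^2) <= 16 * h^2 * (SUM j:UNIV. nsq T (k i j))"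
    using gi.Poincare_mean_H1[OF T_borel[OF T] T_convex[OF T] T_sub[OF T] A(1,2) dT] by (simp add: m_def)
   note int = nsq_mean_le(2)[OF g D(1,2) T_borel[OF T] T_sub[OF T] A(1,2)]
   have iT: "L1 (ind T :: real^2 => real)" using A by (intro integrable_real_indicator) auto
   have "(LBINT x. ind T x * (g i x - slope v T $ i)^2) <=
     (LBINT x. 2 * (ind T x * (g i x - m $ i)^2) + 2 * ((slope v T - m) $ i)^2 * ind T x)"
   proof (rule integral_mono[OF int])
    show "L1 (%x. 2 * (ind T x * (g i x - m $ i)^2) + 2 * ((slope v T - m) $ i)^2 * ind T x)" using int iT by auto
    show "ind T x * (g i x - slope v T $ i)^2 <=
      2 * (ind T x * (g i x - m $ i)^2) + 2 * ((slope v T - m) $ i)^2 * ind T x" for x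
     using power2_sum_le[of "g i x - m $ i" "m $ i - slope v T $ i"] by (auto simp: indicator_def power2_commute[of "m $ i"])
   qed
   also have "... = 2 * (LBINT x. ind T x * (g i x - m $ i)^2) + 2 * ((slope v T - m) $ i)^2 * A"
    using int iT A by (subst Bochner_Integration.integral_add) (auto simp: measure_def)
   finally show ?thesis using P by (simp add: mult_ac)
  qed
  have "(SUM i:UNIV. LBINT x. ind T x * (g i x - slope v T $ i)^2) <=
    (SUM i:UNIV. 2 * (16 * h^2 * (SUM j:UNIV. nsq T (k i j))) + 2 * (A * ((slope v T - m) $ i)^2))"
   by (intro sum_mono comp)
  also have "... = 32 * h^2 * hess T + 2 * (A * (norm (slope v T - m))^2)"
   unfolding norm_square_2 by (simp add: hess_def sum.distrib sum_distrib_left mult_ac)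
  also have "... <= 32 * h^2 * hess T + 2 * (9 / c^2 * h^2 * hess T)" using sm by simp
  also have "... = (32 + 18 / c^2) * h^2 * hess T" by (simp add: algebra_simps)
  finally show ?thesis .
 qed
 have "(SUM T:\<T>. nsq T w) = nsq D w" if w: "L2_on D w" for w
 proof -
  have "(SUM T:\<T>. nsq T w) = (LBINT x. (SUM T:\<T>. ind T x * (w x)^2))"
   unfolding nsq_def by (rule Bochner_Integration.integral_sum[symmetric]) (rule L2_square[OF w T_borel])
  also have "... = (LBINT x. ind D x * (w x)^2)"
  proof (rule integral_cong_AE)
   show "AE x in lborel. (SUM T:\<T>. ind T x * (w x)^2) = ind D x * (w x)^2"
    using sum_indicator_T by eventually_elim (simp add: sum_distrib_right[symmetric])
   have [measurable]: "w : bmeas" by (rule L2_onD(1)[OF w])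
   show "(%x. SUM T:\<T>. ind T x * (w x)^2) : borel_measurable lborel"
    by (intro borel_measurable_sum borel_measurable_times borel_measurable_power) (use T_borel L2_onD(1)[OF w] in auto)
   show "(%x. ind D x * (w x)^2) : borel_measurable lborel" by simp
  qed
  finally show ?thesis by (simp add: nsq_def)
 qed
 hence hs: "(SUM T:\<T>. hess T) = hess D"
  unfolding hess_def by (subst sum.swap) (subst sum.swap, simp add: k)
 have "(SUM T:\<T>. SUM i:UNIV. LBINT x. ind T x * (g i x - slope v T $ i)^2) <=
   (SUM T:\<T>. (32 + 18 / c^2) * h^2 * hess T)"
  by (intro sum_mono local)
 also have "... = (32 + 18 / c^2) * h^2 * hess D" by (simp add: sum_distrib_left[symmetric] hs)
 finally show ?thesis using that v by blast
qed

end


section \<open>A discrete Sobolev inequality\<close>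

text \<open>The field y/|y|^2, which is the gradient of log |y| and free of divergence off the
  origin, replaced by y/\<rho>^2 inside the ball of radius \<rho>. The truncated field is
  continuous; its divergence is 2/\<rho>^2 in that ball and 0 outside.\<close>

definition cutoff_kernel :: "real => 2 => real^2 => real" where
 "cutoff_kernel \<rho> i y = y $ i / (max \<rho> (norm y))^2"

text \<open>Only the diagonal partial derivatives, since the divergence is all that is used.\<close>

definition cutoff_kernel_deriv :: "real => 2 => real^2 => real" where
 "cutoff_kernel_deriv \<rho> i y = (if norm y < \<rho> then 1 / \<rho>\<^sup>2 else 1 / (norm y)^2 - 2 * (y $ i)^2 / (norm y) ^ 4)"

lemma cutoff_kernel_measurable [measurable]:
 "cutoff_kernel \<rho> i : bmeas" "cutoff_kernel_deriv \<rho> i : bmeas"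
 unfolding cutoff_kernel_def[abs_def] cutoff_kernel_deriv_def[abs_def] by measurable

lemma sum_cutoff_kernel_deriv:
 assumes "0 < \<rho>"
 shows "(SUM i:UNIV. cutoff_kernel_deriv \<rho> i y) = 2 / \<rho>\<^sup>2 * ind (ball 0 \<rho>) y"
proof (cases "norm y < \<rho>")
 case False
 hence n: "0 < norm y" using assms by linarith
 have "(y $ 1)^2 + (y $ 2)^2 = (norm y)^2" by (simp add: norm_square_2 sum_2)
 hence "2 * (y $ 1)^2 / (norm y) ^ 4 + 2 * (y $ 2)^2 / (norm y) ^ 4 = 2 * (norm y)^2 / (norm y) ^ 4"
  by (simp add: add_divide_distrib[symmetric] distrib_left[symmetric])
 also have "... = 2 / (norm y)^2" using n by (simp add: power4_eq_xxxx power2_eq_square)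
 finally show ?thesis using False by (simp add: cutoff_kernel_deriv_def sum_2)
qed (simp add: cutoff_kernel_deriv_def)

lemma cutoff_kernel_bound:
 assumes "0 < \<rho>"
 shows "\<bar>cutoff_kernel \<rho> i y\<bar> <= 1 / max \<rho> (norm y)" "\<bar>cutoff_kernel \<rho> i y\<bar> <= 1 / \<rho>"
proof -
 have m: "0 < max \<rho> (norm y)" using assms by simp
 have "\<bar>y $ i\<bar> <= max \<rho> (norm y)" using component_le_norm_cart[of y i] by simp
 hence "\<bar>cutoff_kernel \<rho> i y\<bar> <= max \<rho> (norm y) / (max \<rho> (norm y))^2"
  unfolding cutoff_kernel_def abs_divide using m by (simp add: divide_right_mono)
 also have "... = 1 / max \<rho> (norm y)" using m by (simp add: power2_eq_square)
 finally show *: "\<bar>cutoff_kernel \<rho> i y\<bar> <= 1 / max \<rho> (norm y)" .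
 also have "... <= 1 / \<rho>" using assms by (intro divide_left_mono) auto
 finally show "\<bar>cutoff_kernel \<rho> i y\<bar> <= 1 / \<rho>" .
qed

lemma cutoff_kernel_square:
 assumes "0 < \<rho>"
 shows "(SUM i:UNIV. (cutoff_kernel \<rho> i y)^2) <= 1 / (max \<rho> (norm y))^2"
proof -
 let ?m = "max \<rho> (norm y)"
 have m: "0 < ?m" using assms by simp
 have "(SUM i:UNIV. (cutoff_kernel \<rho> i y)^2) = (norm y)^2 / (?m^2)^2"
  by (simp add: cutoff_kernel_def norm_square_2 sum_2 power_divide add_divide_distrib)
 also have "... <= ?m^2 / (?m^2)^2" by (intro divide_right_mono power_mono) auto
 also have "... = 1 / ?m^2" using m by (simp add: power2_eq_square)
 finally show ?thesis .
qed

lemma cutoff_kernel_lipschitz: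
 assumes "0 < \<rho>"
 shows "\<bar>cutoff_kernel \<rho> i x - cutoff_kernel \<rho> i y\<bar> <= 3 / \<rho>\<^sup>2 * norm (x - y)"
proof -
 define a b where "a = max \<rho> (norm x)" and "b = max \<rho> (norm y)"
 have ab: "\<rho> <= a" "\<rho> <= b" "0 < a" "0 < b" using assms by (auto simp: a_def b_def)
 have yb: "\<bar>y $ i\<bar> <= b" using component_le_norm_cart[of y i] by (simp add: b_def)
 have xy: "\<bar>(x - y) $ i\<bar> <= norm (x - y)" by (rule component_le_norm_cart)
 have d: "\<bar>b - a\<bar> <= norm (x - y)" using norm_triangle_ineq3[of x y] by (auto simp: a_def b_def max_def)
 \<comment> \<open>The last term is y_i times 1/a^2 - 1/b^2, with the difference of squares
   factored; three terms of size at most |x - y|/\<rho>^2 result.\<close>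
 have "cutoff_kernel \<rho> i x - cutoff_kernel \<rho> i y = (x - y) $ i / a^2 + y $ i * ((b - a) * (b + a)) / (a^2 * b^2)"
  using ab unfolding cutoff_kernel_def a_def[symmetric] b_def[symmetric]
  by (simp add: divide_simps) (simp add: power2_eq_square algebra_simps)
 also have "\<bar>...\<bar> <= norm (x - y) / a^2 + b * (norm (x - y) * (b + a)) / (a^2 * b^2)" unfolding abs_divide abs_mult
  by (rule order_trans[OF abs_triangle_ineq], unfold abs_divide abs_mult)
   (intro add_mono divide_mono mult_mono; use xy yb d ab in simp)
 also have "b * (norm (x - y) * (b + a)) / (a^2 * b^2) = norm (x - y) / a^2 + norm (x - y) / (a * b)"
  using ab by (simp add: divide_simps) (simp add: power2_eq_square algebra_simps)
 also have "norm (x - y) / a^2 + (norm (x - y) / a^2 + norm (x - y) / (a * b)) <=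
   norm (x - y) / \<rho>\<^sup>2 + (norm (x - y) / \<rho>\<^sup>2 + norm (x - y) / \<rho>\<^sup>2)"
  unfolding power2_eq_square using ab assms by (intro add_mono divide_left_mono mult_mono mult_pos_pos) auto
 finally show ?thesis by simp
qed

lemma cutoff_kernel_difference_quotient:
 assumes r: "0 < \<rho>" and x: "norm (x - a) ~= \<rho>"
 shows "((%t. (cutoff_kernel \<rho> i (x + t *\<^sub>R axis i 1 - a) - cutoff_kernel \<rho> i (x - a)) / t) \<longlongrightarrow> cutoff_kernel_deriv \<rho> i (x - a)) (at 0)"
proof (cases "norm (x - a) < \<rho>")
 case True
 have "((%x. (x - a) $ i / \<rho>\<^sup>2) has_derivative (%y. (y - 0) $ i / \<rho>\<^sup>2)) (at x)"
  by (intro bounded_linear.has_derivative[OF bounded_linear_divide]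
   bounded_linear.has_derivative[OF bounded_linear_vec_nth] has_derivative_diff has_derivative_ident has_derivative_const)
 hence "((%x. cutoff_kernel \<rho> i (x - a)) has_derivative (%y. (y - 0) $ i / \<rho>\<^sup>2)) (at x)"
  by (rule has_derivative_transform_within_open[where s="ball a \<rho>"])
   (use True in \<open>auto simp: cutoff_kernel_def dist_norm norm_minus_commute\<close>)
 from difference_quotient_limit[OF this, of "axis i 1"] show ?thesis
  using True by (simp add: cutoff_kernel_deriv_def)
next
 case False
 hence g: "\<rho> < norm (x - a)" using x by simp
 hence n: "(x - a) \<bullet> (x - a) ~= 0" using r by auto
 have num: "((%x. (x - a) $ i) has_derivative (%y. (y - 0) $ i)) (at x)"
  by (intro bounded_linear.has_derivative[OF bounded_linear_vec_nth] has_derivative_diff has_derivative_ident has_derivative_const)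
 have "((%x. (x - a) \<bullet> (x - a)) has_derivative (%y. 2 * ((x - a) \<bullet> y))) (at x)"
  by (auto intro!: derivative_eq_intros simp: inner_commute)
 from has_derivative_divide'[OF num this n]
 have "((%x. (x - a) $ i / ((x - a) \<bullet> (x - a))) has_derivative
   (%y. (y $ i * ((x - a) \<bullet> (x - a)) - (x - a) $ i * (2 * ((x - a) \<bullet> y))) / ((x - a) \<bullet> (x - a))^2)) (at x)"
  by (simp add: power2_eq_square)
 hence d: "((%x. cutoff_kernel \<rho> i (x - a)) has_derivative
   (%y. (y $ i * ((x - a) \<bullet> (x - a)) - (x - a) $ i * (2 * ((x - a) \<bullet> y))) / ((x - a) \<bullet> (x - a))^2)) (at x)"
  by (rule has_derivative_transform_within_open[where s="- cball a \<rho>"])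
   (use g in \<open>auto simp: cutoff_kernel_def dist_norm norm_minus_commute power2_norm_eq_inner\<close>)
 have "(axis i 1 $ i * ((x - a) \<bullet> (x - a)) - (x - a) $ i * (2 * ((x - a) \<bullet> axis i 1))) / ((x - a) \<bullet> (x - a))^2 =
   cutoff_kernel_deriv \<rho> i (x - a)"
  using False n by (simp add: cutoff_kernel_deriv_def inner_axis power2_norm_eq_inner[symmetric] diff_divide_distrib)
   (simp add: power2_eq_square power4_eq_xxxx)
 with difference_quotient_limit[OF d, of "axis i 1"] show ?thesis by simp
qed

text \<open>Summing the integrations by parts over the components leaves the divergence of the
  kernel, a multiple of the indicator of a ball; so the gradient of \<open>w\<close> determines its
  ball means.\<close>

lemma cutoff_kernel_integration_by_parts:
 fixes w :: "real^2 => real" and w' :: "2 => real^2 => real"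
 assumes r: "0 < \<rho>"
  and w: "!!x y. \<bar>w x - w y\<bar> <= L * norm (x - y)"
  and supp: "!!x. R < norm x ==> w x = 0" and wB: "!!x. \<bar>w x\<bar> <= A"
  and w': "!!i. w' i : bmeas"
  and dw: "!!i. AE x in lborel. ((%t. (w (x + t *\<^sub>R axis i 1) - w x) / t) \<longlongrightarrow> w' i x) (at 0)"
 shows "(SUM i:UNIV. LBINT x. w' i x * cutoff_kernel \<rho> i (x - a)) =
  - (2 / \<rho>\<^sup>2) * (LBINT x. ind (ball a \<rho>) x * w x)"
proof -
 have "sphere a \<rho> : null_sets lebesgue" using negligible_sphere[of a \<rho>] by (simp add: negligible_iff_null_sets)
 hence "AE x in lebesgue. x \<notin> sphere a \<rho>" by (rule AE_not_in)
 hence ae: "AE x in lborel. norm (x - a) ~= \<rho>"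
  by (simp add: AE_completion_iff dist_norm norm_minus_commute)
 have dk: "AE x in lborel. ((%t. (cutoff_kernel \<rho> i (x + t *\<^sub>R axis i 1 - a) - cutoff_kernel \<rho> i (x - a)) / t) \<longlongrightarrow> cutoff_kernel_deriv \<rho> i (x - a)) (at 0)" for i
  using ae by eventually_elim (rule cutoff_kernel_difference_quotient[OF r])
 note ibp = lipschitz_integration_by_parts[where k="%x. cutoff_kernel \<rho> i (x - a)" and k'="%x. cutoff_kernel_deriv \<rho> i (x - a)"
   and e="axis i 1" and w=w and w'="w' i" and L=L and R=R and A=A and M="3 / \<rho>\<^sup>2" and B="1 / \<rho>" for i]
 have I: "L1 (%x. w x * cutoff_kernel_deriv \<rho> i (x - a))"
   "(LBINT x. w' i x * cutoff_kernel \<rho> i (x - a)) = - (LBINT x. w x * cutoff_kernel_deriv \<rho> i (x - a))" for i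
 proof -
  have l: "\<bar>cutoff_kernel \<rho> i (x - a) - cutoff_kernel \<rho> i (y - a)\<bar> <= 3 / \<rho>\<^sup>2 * norm (x - y)" for x y
   using cutoff_kernel_lipschitz[OF r, of i "x - a" "y - a"] by simp
  show "L1 (%x. w x * cutoff_kernel_deriv \<rho> i (x - a))"
   by (rule ibp(2)[OF w l supp wB cutoff_kernel_bound(2)[OF r] w' _ dw dk]) measurable
  show "(LBINT x. w' i x * cutoff_kernel \<rho> i (x - a)) = - (LBINT x. w x * cutoff_kernel_deriv \<rho> i (x - a))"
   by (rule ibp(3)[OF w l supp wB cutoff_kernel_bound(2)[OF r] w' _ dw dk]) measurable
 qed
 have "(SUM i:UNIV. LBINT x. w' i x * cutoff_kernel \<rho> i (x - a)) =
   - (LBINT x. (SUM i:UNIV. w x * cutoff_kernel_deriv \<rho> i (x - a)))"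
  using I by (simp add: Bochner_Integration.integral_sum sum_negf)
 also have "(LBINT x. (SUM i:UNIV. w x * cutoff_kernel_deriv \<rho> i (x - a))) =
   (LBINT x. 2 / \<rho>\<^sup>2 * (ind (ball a \<rho>) x * w x))"
  unfolding sum_distrib_left[symmetric] sum_cutoff_kernel_deriv[OF r]
  by (intro Bochner_Integration.integral_cong) (auto simp: indicator_def dist_norm norm_minus_commute)
 finally show ?thesis by simp
qed

text \<open>Where |x - a| is between 2^(j-1) \<rho> and 2^j \<rho> the squared kernel is at most
  4/(2^j \<rho>)^2, so each of the N + 1 dyadic pieces contributes at most 4 pi.\<close>

lemma cutoff_kernel_integral:
 assumes r: "0 < \<rho>" and D: "D : sets borel" "!!x. x : D ==> norm (x - a) <= 2 ^ N * \<rho>"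
 shows "nnI D (%x. SUM i:UNIV. (cutoff_kernel \<rho> i (x - a))^2) <= ennreal (4 * pi * (N + 1))"
proof -
 let ?f = "%j x. 4 / (4 ^ j * \<rho>\<^sup>2) * ind (cball a (2 ^ j * \<rho>)) x :: real"
 have pw: "(SUM i:UNIV. (cutoff_kernel \<rho> i (x - a))^2) <= (\<Sum>j\<le>N. ?f j x)" if x: "x : D" for x
 proof -
  define j where "j = (LEAST j. norm (x - a) <= 2 ^ j * \<rho>)"
  have j: "norm (x - a) <= 2 ^ j * \<rho>" "j <= N" unfolding j_def using D(2)[OF x] by (auto intro: LeastI Least_le)
  have lower: "2 ^ j * \<rho> / 2 <= max \<rho> (norm (x - a))"
  proof (cases j)
   case (Suc k)
   hence "~ norm (x - a) <= 2 ^ k * \<rho>" unfolding j_def using not_less_Least[of k] by (metis j_def lessI)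
   thus ?thesis using Suc by simp
  qed (use r in simp)
  have "(SUM i:UNIV. (cutoff_kernel \<rho> i (x - a))^2) <= 1 / (max \<rho> (norm (x - a)))^2" by (rule cutoff_kernel_square[OF r])
  also have "... <= 1 / (2 ^ j * \<rho> / 2)^2"
   using r by (intro divide_left_mono power_mono lower mult_pos_pos zero_less_power) auto
  also have "... = 4 / (4 ^ j * \<rho>\<^sup>2)" by (simp add: power_mult_distrib power_divide power_even_eq[symmetric] power2_eq_square mult.assoc power_mult_distrib[symmetric])
  also have "... = ?f j x" using j(1) by (simp add: dist_norm norm_minus_commute)
  also have "... <= (\<Sum>j\<le>N. ?f j x)" using r j(2) by (intro member_le_sum) auto
  finally show ?thesis .
 qed
 have "nnI D (%x. SUM i:UNIV. (cutoff_kernel \<rho> i (x - a))^2) <= NI (%x. (\<Sum>j\<le>N. ennreal (?f j x)))"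
 proof (intro nn_integral_mono)
  fix x show "ennreal (SUM i:UNIV. (cutoff_kernel \<rho> i (x - a))^2) * ind D x <= (\<Sum>j\<le>N. ennreal (?f j x))"
   using r pw[of x] by (cases "x : D") (auto simp: sum_ennreal intro!: ennreal_leI)
 qed
 also have "... = (\<Sum>j\<le>N. ennreal (4 / (4 ^ j * \<rho>\<^sup>2)) * emeasure lborel (cball a (2 ^ j * \<rho>)))"
 proof -
  have "NI (%x. ennreal (?f j x)) = ennreal (4 / (4 ^ j * \<rho>\<^sup>2)) * emeasure lborel (cball a (2 ^ j * \<rho>))" for j
   using r by (subst ennreal_mult) (auto simp: nn_integral_cmult_indicator ennreal_indicator)
  thus ?thesis by (subst nn_integral_sum) (auto intro!: borel_measurable_divide borel_measurable_times borel_measurable_indicator)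
 qed
 also have "... = (\<Sum>j\<le>N. ennreal (4 * pi))"
 proof (intro sum.cong refl)
  fix j
  have "4 / (4 ^ j * \<rho>\<^sup>2) * (pi * (2 ^ j * \<rho>)^2) = 4 * pi * ((2 ^ j)^2 / 4 ^ j)"
   using r by (simp add: power_mult_distrib)
  also have "(2 ^ j)^2 / 4 ^ j = (1::real)" by (simp add: power2_eq_square power_mult_distrib[symmetric])
  finally show "ennreal (4 / (4 ^ j * \<rho>\<^sup>2)) * emeasure lborel (cball a (2 ^ j * \<rho>)) = ennreal (4 * pi)"
   using r by (simp add: emeasure_cball unit_ball_vol_2 ennreal_mult[symmetric])
 qed
 also have "... = ennreal (\<Sum>j\<le>N. 4 * pi)" by (rule sum_ennreal) simp
 also have "(\<Sum>j\<le>N. 4 * pi) = 4 * pi * (N + 1)" by (simp add: algebra_simps)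
 finally show ?thesis .
qed

section \<open>Means over inscribed balls\<close>

context triangulation
begin

definition centre :: "(real^2) set => real^2" where "centre T = (1 / 3) *\<^sub>R (SUM w:vertices T. w)"

text \<open>Chosen so that M \<rho> = 1/3: at the centroid all coordinates equal 1/3, so the ball of
  this radius stays inside the triangle.\<close>

definition \<rho> where "\<rho> = 2 * c * h / 3"

lemma rho_pos: "0 < \<rho>" using c h by (simp add: \<rho>_def)

lemma ball_subset_T:
 assumes T: "T : \<T>"
 shows "ball (centre T) \<rho> \<subseteq> T"
proof
 fix x assume x: "x : ball (centre T) \<rho>"
 have "0 < lam T v x" if v: "v : vertices T" for v
 proof -
  have aff: "lam T v y = lam T v 0 + gl T v \<bullet> y" for y using coordsD(7)[OF T v, of y 0] by simp
  have "lam T v (centre T) = (1 / 3) * (SUM w:vertices T. lam T v 0 + gl T v \<bullet> w)"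
   unfolding aff[of "centre T"] using coordsD(1,2)[OF T] by (simp add: centre_def inner_sum_right sum.distrib)
  also have "(SUM w:vertices T. lam T v 0 + gl T v \<bullet> w) = (SUM w:vertices T. if v = w then 1 else 0)"
   unfolding aff[symmetric] by (intro sum.cong refl coordsD(9)[OF T v])
  finally have l: "lam T v (centre T) = 1 / 3" using coordsD(1)[OF T] v by simp
  have "\<bar>lam T v x - lam T v (centre T)\<bar> <= norm (gl T v) * norm (x - centre T)"
   unfolding coordsD(7)[OF T v] by (rule Cauchy_Schwarz_ineq2)
  also have "... <= M * norm (x - centre T)" using coordsD(8)[OF T v] by (rule mult_right_mono) simp
  also have "... < M * \<rho>" using x M_pos by (simp add: dist_norm norm_minus_commute)
  also have "... = 1 / 3" using c h by (simp add: M_def \<rho>_def)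
  finally show ?thesis unfolding l by linarith
 qed
 thus "x : T" using lam_pos_iff[OF T] by blast
qed

definition ball_mean :: "(real^2 => real) => (real^2) set => real" where
 "ball_mean v T = (LBINT x. ind (ball (centre T) \<rho>) x * ext v x) / (pi * \<rho>\<^sup>2)"

text \<open>The area pi \<rho>^2 of the ball turns the factor 2/\<rho>^2 of the divergence into 1/(2
  pi), the same for all triangles and meshes.\<close>

lemma ball_mean_eq:
 assumes v: "v : fe_space D \<T>"
 shows "ball_mean v T = - (1 / (2 * pi)) * (SUM i:UNIV. LBINT x. pgrad v i x * cutoff_kernel \<rho> i (x - centre T))"
proof -
 obtain B where B: "!!x. \<bar>ext v x\<bar> <= B" using ext_bounded[OF v] by metis
 obtain R where R: "!!x. x : D ==> norm x <= R" using D(2) unfolding bounded_iff by blast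
 have "ext v x = 0" if "R < norm x" for x using R[of x] that by (auto simp: ext_def)
 from cutoff_kernel_integration_by_parts[OF rho_pos ext_lipschitz[OF v] this B pgrad_measurable ext_difference_quotient[OF v], where a="centre T"]
 show ?thesis using rho_pos by (simp add: ball_mean_def field_simps)
qed

lemma ball_mean_close:
 assumes v: "v : fe_space D \<T>" and T: "T : \<T>" and x: "x : T"
 shows "\<bar>v x - ball_mean v T\<bar> <= h * norm (slope v T)"
proof -
 obtain \<alpha> where a: "!!x. x : closure T ==> v x = \<alpha> + slope v T \<bullet> x" using fe_affine[OF v T] by metis
 have d: "\<bar>v x - ext v y\<bar> <= h * norm (slope v T)" if y: "y : ball (centre T) \<rho>" for y
 proof -
  have yT: "y : T" using ball_subset_T[OF T] y by blast
  have "x : closure T" "y : closure T" "y : D" using yT x T_sub[OF T] closure_subset[of T] by blast+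
  hence "v x - ext v y = slope v T \<bullet> (x - y)"
   using a[of x] a[of y] by (simp add: ext_def inner_diff_right)
  also have "\<bar>...\<bar> <= norm (slope v T) * norm (x - y)" by (rule Cauchy_Schwarz_ineq2)
  also have "... <= norm (slope v T) * h" using T_diam[OF T, of y x] x yT closure_subset[of T] by (intro mult_left_mono) auto
  finally show ?thesis by (simp add: mult.commute)
 qed
 let ?B = "ball (centre T) \<rho>"
 have [measurable]: "ext v : bmeas" by (rule ext_measurable[OF v])
 have A: "measure lborel ?B = pi * \<rho>\<^sup>2" using rho_pos by (simp add: content_ball unit_ball_vol_2)
 have iB: "L1 (ind ?B :: real^2 => real)" by (rule integrable_ind) auto
 obtain B where B: "!!x. \<bar>ext v x\<bar> <= B" using ext_bounded[OF v] by metis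
 have iv: "L1 (%y. ext v y * ind ?B y)" by (rule L1_bounded_mult[OF iB _ B]) measurable
 have iv': "L1 (%y. ind ?B y * v x - ext v y * ind ?B y)" using iB iv by (intro Bochner_Integration.integrable_diff) auto
 have eq: "(%y. ind ?B y * (v x - ext v y)) = (%y. ind ?B y * v x - ext v y * ind ?B y)"
  by (simp add: fun_eq_iff algebra_simps)
 have e: "v x * (pi * \<rho>\<^sup>2) - (LBINT y. ind ?B y * ext v y) = (LBINT y. ind ?B y * (v x - ext v y))"
  unfolding eq using iB iv A by (subst Bochner_Integration.integral_diff) (auto simp: mult.commute)
 have "\<bar>LBINT y. ind ?B y * (v x - ext v y)\<bar> <= (LBINT y. ind ?B y * (h * norm (slope v T)))"
 proof (rule order_trans[OF integral_abs_bound integral_mono])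
  show "L1 (%y. \<bar>ind ?B y * (v x - ext v y)\<bar>)" using iv' unfolding eq[symmetric] by (rule integrable_abs)
  show "L1 (%y. ind ?B y * (h * norm (slope v T)))" using iB by simp
  show "\<bar>ind ?B y * (v x - ext v y)\<bar> <= ind ?B y * (h * norm (slope v T))" for y
   using d[of y] by (simp add: indicator_def)
 qed
 also have "... = (pi * \<rho>\<^sup>2) * (h * norm (slope v T))" using A by simp
 finally have "\<bar>v x * (pi * \<rho>\<^sup>2) - (LBINT y. ind ?B y * ext v y)\<bar> <= (pi * \<rho>\<^sup>2) * (h * norm (slope v T))"
  unfolding e .
 moreover have "v x * (pi * \<rho>\<^sup>2) - (LBINT y. ind ?B y * ext v y) = (pi * \<rho>\<^sup>2) * (v x - ball_mean v T)"
  using rho_pos by (simp add: ball_mean_def field_simps)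
 ultimately show ?thesis using rho_pos by (simp add: abs_mult)
qed

text \<open>About log_2 (R/\<rho>) dyadic annuli lead from a radius proportional to \<open>h\<close>
  to the diameter bound \<open>R\<close>; the factor max 1 (ln (1/h)) absorbs the additive
  constants.\<close>

lemma kernel_bound:
 assumes T: "T : \<T>" and R: "0 < R" "!!x y. x : closure D ==> y : closure D ==> norm (y - x) <= R"
 shows "nnI D (%x. SUM i:UNIV. (cutoff_kernel \<rho> i (x - centre T))^2) <=
  ennreal (4 * pi * (2 + (\<bar>ln (3 * R / (2 * c))\<bar> + 1) / ln 2) * max 1 (ln (1 / h)))"
proof -
 define N where "N = nat \<lceil>log 2 (R / \<rho>)\<rceil>"
 have "centre T : ball (centre T) \<rho>" using rho_pos by simp
 hence cD: "centre T : D" using ball_subset_T[OF T] T_sub[OF T] by blast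
 have "log 2 (R / \<rho>) <= N" unfolding N_def by linarith
 hence "R / \<rho> <= 2 powr N" using R(1) rho_pos by (simp add: log_le_iff)
 hence N: "R <= 2 ^ N * \<rho>" using rho_pos by (simp add: powr_realpow field_simps)
 have "nnI D (%x. SUM i:UNIV. (cutoff_kernel \<rho> i (x - centre T))^2) <= ennreal (4 * pi * (N + 1))"
 proof (rule cutoff_kernel_integral[OF rho_pos])
  show "norm (x - centre T) <= 2 ^ N * \<rho>" if "x : D" for x
   using R(2)[of "centre T" x] cD that closure_subset[of D] N by fastforce
 qed simp
 also have "real N + 1 <= (2 + (\<bar>ln (3 * R / (2 * c))\<bar> + 1) / ln 2) * max 1 (ln (1 / h))"
 proof -
  let ?l = "max 1 (ln (1 / h))" and ?X = "\<bar>ln (3 * R / (2 * c))\<bar>"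
  have e: "R / \<rho> = (3 * R / (2 * c)) * (1 / h)" by (simp add: \<rho>_def)
  have "ln (R / \<rho>) = ln (3 * R / (2 * c)) + ln (1 / h)" unfolding e using R(1) c h by (intro ln_mult_pos) auto
  also have "... <= ?X * ?l + 1 * ?l" using mult_left_mono[of 1 ?l ?X] by (intro add_mono) auto
  finally have "ln (R / \<rho>) / ln 2 <= (?X + 1) * ?l / ln 2" by (intro divide_right_mono) (auto simp: algebra_simps)
  moreover have "0 <= (?X + 1) * ?l / ln 2" by (intro divide_nonneg_nonneg mult_nonneg_nonneg) auto
  ultimately have "real N <= (?X + 1) * ?l / ln 2 + 1" unfolding N_def log_def by linarith
  thus ?thesis by (simp add: algebra_simps)
 qed
 hence "ennreal (4 * pi * (N + 1)) <= ennreal (4 * pi * (2 + (\<bar>ln (3 * R / (2 * c))\<bar> + 1) / ln 2) * max 1 (ln (1 / h)))"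
  unfolding mult.assoc by (intro ennreal_leI mult_left_mono) auto
 finally show ?thesis .
qed

end


section \<open>The variance of the coefficient on a triangle\<close>

text \<open>Jensen's inequality for t powr r. The tangent at the mean \<open>m\<close> lies below
  the power function, which is Young's inequality in disguise.\<close>

lemma powr_mean_le:
 fixes F :: "real^2 => real"
 assumes [measurable]: "F : bmeas" "S : sets borel" and F: "!!x. 0 <= F x"
  and A0: "emeasure lborel S = ennreal A0" "0 < A0" and r: "1 < r"
  and I: "nnI S (%x. F x) = ennreal I" "0 <= I"
 shows "ennreal (A0 * (I / A0) powr r) <= nnI S (%x. F x powr r)" (is "_ <= ?J")
proof (cases "?J = \<infinity> \<or> I = 0")
 case False
 define m where "m = I / A0"
 have m: "0 < m" using False I A0 by (simp add: m_def)
 obtain j where j: "?J = ennreal j" "0 <= j" using False by (cases ?J) auto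
 have young: "r * m powr (r - 1) * t <= t powr r + (r - 1) * m powr r" if t: "0 <= t" for t
 proof (cases "t = 0")
  case False
  hence t: "0 < t" using t by simp
  have "(t powr r) powr (1 / r) * (m powr r) powr (1 - 1 / r) <= (1 / r) * t powr r + (1 - 1 / r) * m powr r"
   using t m r by (intro Youngs_inequality_0) auto
  moreover have "(t powr r) powr (1 / r) * (m powr r) powr (1 - 1 / r) = t * m powr (r - 1)"
   using t m r by (simp add: powr_powr right_diff_distrib)
  ultimately have "r * (t * m powr (r - 1)) <= r * ((1 / r) * t powr r + (1 - 1 / r) * m powr r)"
   using r by (intro mult_left_mono) auto
  thus ?thesis using r by (simp add: algebra_simps)
 qed (use r in simp)
 have "ennreal (r * m powr (r - 1) * I) = nnI S (%x. r * m powr (r - 1) * F x)"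
  using F r I by (simp add: ennreal_mult nn_integral_cmult mult.assoc)
 also have "... <= NI (%x. ennreal (F x powr r) * ind S x + ennreal ((r - 1) * m powr r) * ind S x)"
  using young[OF F] r by (intro nn_integral_mono) (auto simp: indicator_def ennreal_plus[symmetric] simp del: ennreal_plus intro!: ennreal_leI)
 also have "... = ennreal (j + (r - 1) * m powr r * A0)"
  using j r A0 by (subst nn_integral_add) (auto simp: nn_integral_cmult ennreal_mult)
 finally have "r * m powr (r - 1) * I <= j + (r - 1) * m powr r * A0" using j r A0 by (subst (asm) ennreal_le_iff) auto
 moreover have "m powr (r - 1) * I = m powr r * A0"
 proof -
  have "m powr (r - 1) * I = m powr (r - 1) * m * A0" using A0 by (simp add: m_def)
  also have "m powr (r - 1) * m = m powr r" using m by (simp add: powr_diff)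
  finally show ?thesis .
 qed
 ultimately have "r * (m powr r * A0) <= j + (r - 1) * m powr r * A0" by (simp add: mult.assoc)
 hence "A0 * m powr r <= j" by (simp add: algebra_simps)
 thus ?thesis unfolding j m_def[symmetric] by (rule ennreal_leI)
qed auto

text \<open>A constant coefficient has vanishing seminorm, so \<open>A\<close> = 0 occurs; then
  \<open>V\<close> is zero almost everywhere on \<open>D\<close>.\<close>

lemma (in H1_data) weighted_Sobolev_nonneg:
 fixes V :: "real^2 => real"
 assumes V_meas [measurable]: "V : bmeas" and V: "!!x. 0 <= V x" "!!x. V x <= K"
  and A0: "emeasure lborel D = ennreal A0" "0 < A0"
  and d: "!!x y. x : D ==> y : D ==> norm (y - x) <= d"
  and p: "1 < p" and A: "0 <= A"
  and VA: "nnI D (%x. V x powr p) <= ennreal A"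
 shows "nnI D (%x. V x * (u x)^2) <=
  ennreal ((A / A0) powr (1 / p) * (16 + 40 * d^2 / (1 - 1 / p)^2) * (nsq D u + (SUM i:UNIV. nsq D (g i))))"
proof (cases "A = 0")
 case True
 hence "AE x in lborel. ennreal (V x powr p) * ind D x = 0"
  using VA by (subst nn_integral_0_iff_AE[symmetric]) auto
 hence "AE x in lborel. ennreal (V x * (u x)^2) * ind D x = 0"
  by eventually_elim (auto simp: indicator_def powr_eq_0_iff)
 hence "nnI D (%x. V x * (u x)^2) = 0"
  by (simp add: nn_integral_0_iff_AE)
 thus ?thesis by simp
qed (use A in \<open>intro weighted_Sobolev_H1[OF assms(1-7) _ VA]; simp\<close>)

context triangulation
begin

definition mean :: "(real^2 => real) => (real^2) set => real" where
 "mean w T = (LBINT x. ind T x * w x) / area T"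

definition var :: "(real^2 => real) => (real^2) set => real" where
 "var w T = (LBINT x. ind T x * (w x - mean w T)^2) / area T"

text \<open>The variances as a piecewise constant function; it is the weight \<open>V\<close> of the
  weighted Sobolev inequality.\<close>

definition var_at :: "(real^2 => real) => real^2 => real" where
 "var_at w x = (SUM T:\<T>. ind T x * var w T)"

lemma var_nonneg: "0 <= var w T"
 unfolding var_def by (intro divide_nonneg_nonneg Bochner_Integration.integral_nonneg) auto

lemma integrable_T: "T : \<T> ==> L1 (ind T :: real^2 => real)"
 by (rule integrable_ind[OF T_borel T_bounded])

lemma content_T: "T : \<T> ==> measure lborel T = area T"
 using T_area[of T] by (simp add: measure_def)

lemma var_le:
 assumes w: "L2_on D w" and B: "!!x. \<bar>w x\<bar> <= B" and T: "T : \<T>"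
 shows "var w T <= B^2"
proof -
 note mle = nsq_mean_le[OF w D(1,2) T_borel[OF T] T_sub[OF T] T_area[OF T] T_area_pos[OF T]]
 have "(LBINT x. ind T x * (w x - mean w T)^2) <= (LBINT x. ind T x * (w x - 0)^2)" unfolding mean_def by (rule mle(1))
 also have "... <= (LBINT x. ind T x * B^2)"
 proof (rule integral_mono[OF mle(2)])
  show "L1 (%x. ind T x * B^2)" using integrable_T[OF T] by simp
  have "(w x)^2 <= B^2" for x using B[of x] by (metis abs_ge_zero power2_abs power_mono)
  thus "ind T x * (w x - 0)^2 <= ind T x * B^2" for x by (simp add: indicator_def)
 qed
 also have "... = B^2 * area T" using content_T[OF T] by simp
 finally show ?thesis using T_area_pos[OF T] by (simp add: var_def divide_le_eq)
qed

lemma var_at_measurable [measurable]: "var_at w : bmeas"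
 unfolding var_at_def[abs_def] by (intro borel_measurable_sum borel_measurable_times borel_measurable_indicator) auto

lemma var_at_T: "T : \<T> ==> x : T ==> var_at w x = var w T"
 unfolding var_at_def by (rule sum_T_at)

lemma var_at_outside: "ALL T:\<T>. x \<notin> T ==> var_at w x = 0"
 unfolding var_at_def by (auto intro!: sum.neutral)

lemma var_at_nonneg: "0 <= var_at w x"
 unfolding var_at_def by (intro sum_nonneg mult_nonneg_nonneg var_nonneg) auto

lemma var_at_le:
 assumes "L2_on D w" "!!x. \<bar>w x\<bar> <= B"
 shows "var_at w x <= B^2"
proof (cases "EX T:\<T>. x : T")
 case True
 thus ?thesis using var_at_T var_le[OF assms] by metis
qed (simp add: var_at_outside)

lemma sum_T_le:
 fixes a :: "(real^2) set => ennreal"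
 assumes "!!T. T : \<T> ==> a T <= b"
 shows "(SUM T:\<T>. a T * ind T x) <= b * ind D x"
proof (cases "EX T:\<T>. x : T")
 case True
 then obtain T where T: "T : \<T>" "x : T" by blast
 have "(SUM T':\<T>. a T' * ind T' x) = (SUM T':\<T>. if T' = T then a T else 0)"
  using T T_disj by (intro sum.cong) (auto simp: indicator_def)
 thus ?thesis using T T_sub[OF T(1)] assms[OF T(1)] by (auto simp: indicator_def)
next
 case False
 hence "(SUM T:\<T>. a T * ind T x) = 0" by (auto intro!: sum.neutral)
 thus ?thesis by simp
qed

lemma var_at_powr_integral:
 assumes "0 < r"
 shows "nnI D (%x. var_at w x powr r) <= (SUM T:\<T>. ennreal (area T * var w T powr r))"
proof -
 have "nnI D (%x. var_at w x powr r) <= NI (%x. (SUM T:\<T>. ennreal (var w T powr r) * ind T x))"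
 proof (intro nn_integral_mono)
  fix x show "ennreal (var_at w x powr r) * ind D x <= (SUM T:\<T>. ennreal (var w T powr r) * ind T x)"
  proof (cases "EX T:\<T>. x : T")
   case True
   then obtain T where T: "T : \<T>" "x : T" by blast
   have "ennreal (var_at w x powr r) * ind D x <= ennreal (var w T powr r) * ind T x"
    using T T_sub[OF T(1)] by (auto simp: var_at_T)
   also have "... <= (SUM T:\<T>. ennreal (var w T powr r) * ind T x)" using T by (intro member_le_sum) auto
   finally show ?thesis .
  qed (use assms in \<open>simp add: var_at_outside\<close>)
 qed
 also have "... = (SUM T:\<T>. ennreal (var w T powr r) * emeasure lborel T)"
  by (subst nn_integral_sum) (auto simp: nn_integral_cmult_indicator)
 also have "... = (SUM T:\<T>. ennreal (area T * var w T powr r))"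
  by (intro sum.cong refl) (simp add: T_area ennreal_mult[symmetric] mult.commute)
 finally show ?thesis .
qed

lemma nn_integral_var:
 assumes w: "L2_on D w" and T: "T : \<T>"
 shows "nnI T (%x. (w x - a)^2) = ennreal (LBINT x. ind T x * (w x - a)^2)"
proof -
 note mle = nsq_mean_le[OF w D(1,2) T_borel[OF T] T_sub[OF T] T_area[OF T] T_area_pos[OF T]]
 have "nnI T (%x. (w x - a)^2) = NI (%x. ennreal (ind T x * (w x - a)^2))"
  by (intro nn_integral_cong) (auto simp: indicator_def)
 also have "... = ennreal (LBINT x. ind T x * (w x - a)^2)" by (rule nn_integral_eq_integral[OF mle(2)]) simp
 finally show ?thesis .
qed

text \<open>Jensen's inequality twice: for the variance as a mean of squares, and for the deviation
  from the mean as a mean over z. For x, z in \<open>T\<close> the distance is at most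
  \<open>h\<close>, which brings in h powr (2 + s q); division by the area, at least c h^2, leaves h
  powr (s q) / c.\<close>

lemma var_powr_slobodeckij:
 assumes w: "L2_on D w" and s: "0 < s" and q: "2 < q" and T: "T : \<T>"
 shows "ennreal (area T * var w T powr (q / 2)) <= ennreal (h powr (s * q) / c) *
  NI (%x. (nnI T (%z. \<bar>w x - w z\<bar> powr q / norm (x - z) powr (2 + s * q))) * ind T x)"
  (is "?L <= _ * ?R")
proof -
 define A where "A = area T"
 have A: "emeasure lborel T = ennreal A" "0 < A" "c * h^2 <= A" using T_area[OF T] T_area_pos[OF T] area_ge[OF T] by (auto simp: A_def)
 have [measurable]: "w : bmeas" "T : sets borel" using L2_onD[OF w] T by auto
 have iw: "L1 (%x. ind T x * w x)"
  using integrable_real_mult_indicator[of T lborel w] L2_L1[OF w D(1,2)] by (simp add: mult.commute)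
 have "?L <= nnI T (%x. ((w x - mean w T)^2) powr (q / 2))"
  unfolding var_def A_def[symmetric] using A q nn_integral_var[OF w T]
  by (intro powr_mean_le Bochner_Integration.integral_nonneg) auto
 also have "... = nnI T (%x. \<bar>w x - mean w T\<bar> powr q)"
 proof -
  have "((w x - mean w T)^2) powr (q / 2) = \<bar>w x - mean w T\<bar> powr q" for x
   using powr_powr[of "\<bar>w x - mean w T\<bar>" 2 "q / 2"] by simp
  thus ?thesis by simp
 qed
 finally have 1: "?L <= nnI T (%x. \<bar>w x - mean w T\<bar> powr q)" .
 have inner: "ennreal (A * \<bar>w x - mean w T\<bar> powr q) <= ennreal (h powr (2 + s * q)) *
   nnI T (%z. \<bar>w x - w z\<bar> powr q / norm (x - z) powr (2 + s * q))" if x: "x : T" for x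
 proof -
  have id: "L1 (%z. ind T z * (w x - w z))" using iw integrable_T[OF T] by (simp add: right_diff_distrib)
  have ia: "L1 (%z. ind T z * \<bar>w x - w z\<bar>)" using integrable_abs[OF id] by (simp add: abs_mult)
  define J where "J = (LBINT z. ind T z * \<bar>w x - w z\<bar>)"
  have "(LBINT z. ind T z * (w x - w z)) = A * w x - (LBINT z. ind T z * w z)"
   using iw integrable_T[OF T] content_T[OF T] by (simp add: right_diff_distrib A_def)
  also have "... = A * (w x - mean w T)" using A by (simp add: mean_def A_def[symmetric] field_simps)
  finally have "A * \<bar>w x - mean w T\<bar> = \<bar>LBINT z. ind T z * (w x - w z)\<bar>" using A by (simp add: abs_mult)
  also have "... <= J" unfolding J_def using integral_abs_bound[of lborel "%z. ind T z * (w x - w z)"] by (simp add: abs_mult)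
  finally have "\<bar>w x - mean w T\<bar> <= J / A" using A by (simp add: field_simps)
  hence "ennreal (A * \<bar>w x - mean w T\<bar> powr q) <= ennreal (A * (J / A) powr q)"
   using A q by (intro ennreal_leI mult_left_mono powr_mono2) auto
  also have "... <= nnI T (%z. \<bar>w x - w z\<bar> powr q)"
  proof (rule powr_mean_le[OF _ _ _ A(1,2)])
   have "NI (%z. ennreal \<bar>w x - w z\<bar> * ind T z) = NI (%z. ennreal (ind T z * \<bar>w x - w z\<bar>))"
    by (intro nn_integral_cong) (auto simp: indicator_def)
   thus "NI (%z. ennreal \<bar>w x - w z\<bar> * ind T z) = ennreal J"
    unfolding J_def by (subst (asm) nn_integral_eq_integral[OF ia]) auto
   show "0 <= J" unfolding J_def by (intro Bochner_Integration.integral_nonneg) auto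
  qed (use q in auto)
  also have "... <= NI (%z. ennreal (h powr (2 + s * q)) * (ennreal (\<bar>w x - w z\<bar> powr q / norm (x - z) powr (2 + s * q)) * ind T z))"
  proof (intro nn_integral_mono)
   fix z
   show "ennreal (\<bar>w x - w z\<bar> powr q) * ind T z <=
    ennreal (h powr (2 + s * q)) * (ennreal (\<bar>w x - w z\<bar> powr q / norm (x - z) powr (2 + s * q)) * ind T z)"
   proof (cases "z : T & x ~= z")
    case True
    hence n: "0 < norm (x - z)" "norm (x - z) <= h"
     using T_diam[OF T, of z x] x closure_subset[of T] by auto
    have "norm (x - z) powr (2 + s * q) <= h powr (2 + s * q)" using n s q by (intro powr_mono2) auto
    hence "\<bar>w x - w z\<bar> powr q * norm (x - z) powr (2 + s * q) <= \<bar>w x - w z\<bar> powr q * h powr (2 + s * q)"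
     by (intro mult_left_mono) auto
    hence "\<bar>w x - w z\<bar> powr q <= h powr (2 + s * q) * (\<bar>w x - w z\<bar> powr q / norm (x - z) powr (2 + s * q))"
     using n by (simp add: field_simps)
    thus ?thesis using True by (simp add: ennreal_mult[symmetric] ennreal_leI del: times_divide_eq_right)
   qed (use q in auto)
  qed
  also have "... = ennreal (h powr (2 + s * q)) *
    nnI T (%z. \<bar>w x - w z\<bar> powr q / norm (x - z) powr (2 + s * q))"
   by (rule nn_integral_cmult) measurable
  finally show ?thesis .
 qed
 have "ennreal A * nnI T (%x. \<bar>w x - mean w T\<bar> powr q) = nnI T (%x. A * \<bar>w x - mean w T\<bar> powr q)"
  using A by (subst nn_integral_cmult[symmetric]) (auto simp: ennreal_mult mult.assoc)
 also have "... <= NI (%x. ennreal (h powr (2 + s * q)) *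
   (nnI T (%z. \<bar>w x - w z\<bar> powr q / norm (x - z) powr (2 + s * q)) * ind T x))"
  using inner by (intro nn_integral_mono) (auto simp: indicator_def)
 also have "... = ennreal (h powr (2 + s * q)) * ?R" by (rule nn_integral_cmult) measurable
 also have "h powr (2 + s * q) <= A * (h powr (s * q) / c)"
 proof -
  have "h powr (2 + s * q) = (c * h^2) * (h powr (s * q) / c)" using h c by (simp add: powr_add)
  also have "... <= A * (h powr (s * q) / c)" using A c by (intro mult_right_mono) auto
  finally show ?thesis .
 qed
 hence "ennreal (h powr (2 + s * q)) * ?R <= ennreal (A * (h powr (s * q) / c)) * ?R"
  by (intro mult_right_mono ennreal_leI) auto
 also have "... = ennreal A * (ennreal (h powr (s * q) / c) * ?R)"
  using A c by (simp add: ennreal_mult mult.assoc del: times_divide_eq_right)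
 finally have "nnI T (%x. \<bar>w x - mean w T\<bar> powr q) <= ennreal (h powr (s * q) / c) * ?R"
  using A by (subst (asm) ennreal_mult_le_mult_iff) auto
 thus ?thesis using 1 by (rule order_trans[rotated])
qed

text \<open>The products of each triangle with itself are disjoint subsets of the product of
  \<open>D\<close> with itself, so the local double integrals add up without overlap.\<close>

lemma var_at_slobodeckij:
 assumes w: "L2_on D w" and s: "0 < s" and q: "2 < q"
 shows "nnI D (%x. var_at w x powr (q / 2)) <= ennreal (h powr (s * q) / c) *
  NI (%x. (nnI D (%z. \<bar>w x - w z\<bar> powr q / norm (x - z) powr (2 + s * q))) * ind D x)"
proof -
 let ?Q = "%S x. (nnI S (%z. \<bar>w x - w z\<bar> powr q / norm (x - z) powr (2 + s * q)))"
 have [measurable]: "w : bmeas" using L2_onD[OF w] by auto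
 have "nnI D (%x. var_at w x powr (q / 2)) <= (SUM T:\<T>. ennreal (area T * var w T powr (q / 2)))"
  using q by (intro var_at_powr_integral) simp
 also have "... <= (SUM T:\<T>. ennreal (h powr (s * q) / c) * NI (%x. ?Q T x * ind T x))"
  by (intro sum_mono var_powr_slobodeckij[OF w s q])
 also have "... = ennreal (h powr (s * q) / c) * NI (%x. (SUM T:\<T>. ?Q T x * ind T x))"
 proof -
  have "NI (%x. (SUM T:\<T>. ?Q T x * ind T x)) = (SUM T:\<T>. \<integral>\<^sup>+ x. ?Q T x * ind T x \<partial>lborel)"
  proof (rule nn_integral_sum)
   fix T assume "T : \<T>"
   hence [measurable]: "T : sets borel" by simp
   show "(%x. ?Q T x * ind T x) : borel_measurable lborel" by measurable
  qed
  thus ?thesis by (simp add: sum_distrib_left)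
 qed
 also have "... <= ennreal (h powr (s * q) / c) * NI (%x. ?Q D x * ind D x)"
  using T_sub by (intro mult_left_mono nn_integral_mono sum_T_le) (auto simp: indicator_def)
 finally show ?thesis .
qed

text \<open>The case s = 1: the Poincare inequality bounds the variance on \<open>T\<close>, and
  Jensen's inequality with exponent q/2 passes from the mean of |grad w|^2 to the integral of q-th
  powers.\<close>

lemma var_at_H1:
 assumes "H1_data D w g" and q: "2 < q"
 shows "nnI D (%x. var_at w x powr (q / 2)) <=
  ennreal (32 powr (q / 2) * h powr q) * (SUM i:UNIV. \<integral>\<^sup>+ x. ennreal (\<bar>g i x\<bar> powr q) * ind D x \<partial>lborel)"
proof -
 interpret w: H1_data D w g by fact
 have [measurable]: "g i : bmeas" for i by (rule w.measurable_ug(2))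
 have local: "ennreal (area T * var w T powr (q / 2)) <=
   NI (%x. (SUM i:UNIV. ennreal (32 powr (q / 2) * h powr q * \<bar>g i x\<bar> powr q)) * ind T x)" if T: "T : \<T>" for T
 proof -
  define A where "A = area T"
  have A: "emeasure lborel T = ennreal A" "0 < A" using T_area[OF T] T_area_pos[OF T] by (auto simp: A_def)
  have [measurable]: "T : sets borel" using T by simp
  define I where "I = 16 * h^2 * (SUM i:UNIV. nsq T (g i))"
  have I0: "0 <= I" unfolding I_def by (intro mult_nonneg_nonneg sum_nonneg nsq_nonneg) auto
  have "(LBINT x. ind T x * (w x - mean w T)^2) <= I" unfolding mean_def I_def A_def[symmetric]
  proof (rule w.Poincare_mean_H1[OF T_borel[OF T] T_convex[OF T] T_sub[OF T] A])
   show "norm (y - x) <= h" if "x : T" "y : T" for x y using T_diam[OF T, of x y] that closure_subset[of T] by auto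
  qed
  hence "var w T <= I / A" unfolding var_def A_def[symmetric] using A by (intro divide_right_mono) auto
  hence "ennreal (A * var w T powr (q / 2)) <= ennreal (A * (I / A) powr (q / 2))"
   using A q var_nonneg by (intro ennreal_leI mult_left_mono powr_mono2) auto
  also have "... <= nnI T (%x. (16 * h^2 * (SUM i:UNIV. (g i x)^2)) powr (q / 2))"
  proof (rule powr_mean_le[OF _ _ _ A])
   have "nnI T (%x. 16 * h^2 * (SUM i:UNIV. (g i x)^2)) =
     NI (%x. ennreal (16 * h^2) * (SUM i:UNIV. ennreal ((g i x)^2) * ind T x))"
    by (intro nn_integral_cong) (simp add: sum_2 ennreal_mult distrib_right mult.assoc)
   also have "... = ennreal (16 * h^2) * (SUM i:UNIV. ennreal (nsq T (g i)))"
    using nn_integral_nsq[OF w.g T_borel[OF T]] by (simp add: nn_integral_cmult nn_integral_add sum_2)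
   also have "... = ennreal I" unfolding I_def by (simp add: nsq_nonneg sum_ennreal ennreal_mult sum_nonneg)
   finally show "nnI T (%x. 16 * h^2 * (SUM i:UNIV. (g i x)^2)) = ennreal I" .
  qed (use q I0 in \<open>auto intro!: mult_nonneg_nonneg sum_nonneg\<close>)
  also have "... <= NI (%x. (SUM i:UNIV. ennreal (32 powr (q / 2) * h powr q * \<bar>g i x\<bar> powr q)) * ind T x)"
  proof (intro nn_integral_mono mult_right_mono)
   fix x
   \<comment> \<open>The larger component replaces the sum of two squares at the cost of a factor 2,
     so 16 becomes 32; its q-th power is at most the sum of both q-th powers.\<close>
   define m where "m = max \<bar>g 1 x\<bar> \<bar>g 2 x\<bar>"
   have m0: "0 <= m" by (simp add: m_def)
   have "(g i x)^2 <= m^2" if "i = 1 \<or> i = 2" for i :: 2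
    using that by (metis abs_ge_zero m_def max.cobounded1 max.cobounded2 power2_abs power_mono)
   hence "(SUM i:UNIV. (g i x)^2) <= 2 * m^2" using add_mono[of "(g 1 x)^2" "m^2" "(g 2 x)^2" "m^2"] by (simp add: sum_2)
   hence "(16 * h^2 * (SUM i:UNIV. (g i x)^2)) powr (q / 2) <= (32 * (h * m)^2) powr (q / 2)"
    using q mult_left_mono[of "SUM i:UNIV. (g i x)^2" "2 * m^2" "16 * h^2"]
    by (intro powr_mono2 mult_nonneg_nonneg sum_nonneg) (auto simp: power_mult_distrib)
   also have "... = 32 powr (q / 2) * h powr q * m powr q"
   proof -
    have "((h * m)^2) powr (q / 2) = (h * m) powr q" using powr_powr[of "h * m" 2 "q / 2"] h m0 by simp
    thus ?thesis using h m0 by (simp add: powr_mult)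
   qed
   also have "... <= 32 powr (q / 2) * h powr q * (\<bar>g 1 x\<bar> powr q + \<bar>g 2 x\<bar> powr q)"
    unfolding m_def by (intro mult_left_mono) (auto simp: max_def)
   also have "... = (SUM i:UNIV. 32 powr (q / 2) * h powr q * \<bar>g i x\<bar> powr q)" by (simp add: sum_2 distrib_left)
   finally show "ennreal ((16 * h^2 * (SUM i:UNIV. (g i x)^2)) powr (q / 2)) <=
     (SUM i:UNIV. ennreal (32 powr (q / 2) * h powr q * \<bar>g i x\<bar> powr q))"
    by (subst sum_ennreal) (auto intro: ennreal_leI)
  qed simp
  finally show ?thesis by (simp add: A_def)
 qed
 have "nnI D (%x. var_at w x powr (q / 2)) <= (SUM T:\<T>. ennreal (area T * var w T powr (q / 2)))"
  using q by (intro var_at_powr_integral) simp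
 also have "... <= (SUM T:\<T>. \<integral>\<^sup>+ x. (SUM i:UNIV. ennreal (32 powr (q / 2) * h powr q * \<bar>g i x\<bar> powr q)) * ind T x \<partial>lborel)"
  by (intro sum_mono local)
 also have "... = NI (%x. (SUM T:\<T>. (SUM i:UNIV. ennreal (32 powr (q / 2) * h powr q * \<bar>g i x\<bar> powr q)) * ind T x))"
 proof (rule nn_integral_sum[symmetric])
  fix T assume "T : \<T>"
  hence [measurable]: "T : sets borel" by simp
  show "(%x. (SUM i:UNIV. ennreal (32 powr (q / 2) * h powr q * \<bar>g i x\<bar> powr q)) * ind T x) : borel_measurable lborel"
   by measurable
 qed
 also have "... <= NI (%x. (SUM i:UNIV. ennreal (32 powr (q / 2) * h powr q * \<bar>g i x\<bar> powr q)) * ind D x)"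
  by (intro nn_integral_mono sum_T_le) simp
 also have "... = NI (%x. ennreal (32 powr (q / 2) * h powr q) * (SUM i:UNIV. ennreal (\<bar>g i x\<bar> powr q) * ind D x))"
  by (intro nn_integral_cong) (simp add: sum_2 ennreal_mult distrib_right distrib_left mult.assoc)
 also have "... = ennreal (32 powr (q / 2) * h powr q) * (SUM i:UNIV. \<integral>\<^sup>+ x. ennreal (\<bar>g i x\<bar> powr q) * ind D x \<partial>lborel)"
  by (simp add: nn_integral_cmult nn_integral_add sum_2)
 finally show ?thesis .
qed

end

text \<open>The gradient of \<open>v\<close> is replaced by that of \<open>u\<close> at the cost of
  the interpolation error times the bound B^2 of the variances. The derivatives of \<open>u\<close>
  have weak derivatives themselves, so the weighted Sobolev inequality applies to them with weight
  \<open>var_at w\<close>.\<close>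

lemma (in fem_H2) variance_term:
 assumes w: "L2_on D w" "!!x. \<bar>w x\<bar> <= B"
  and A0: "emeasure lborel D = ennreal A0" "0 < A0"
  and d: "!!x y. x : D ==> y : D ==> norm (y - x) <= d"
  and q: "2 < q" and A: "0 <= A"
  and VA: "nnI D (%x. var_at w x powr (q / 2)) <= ennreal A"
 shows "(SUM T:\<T>. area T * (norm (slope v T))^2 * var w T) <=
  2 * B^2 * (SUM T:\<T>. SUM i:UNIV. LBINT x. ind T x * (g i x - slope v T $ i)^2) +
  2 * ((A / A0) powr (2 / q) * (16 + 40 * d^2 / (1 - 2 / q)^2) * ((SUM i:UNIV. nsq D (g i)) + hess D))"
proof -
 let ?E = "%T i. LBINT x. ind T x * (g i x - slope v T $ i)^2"
 let ?K = "(A / A0) powr (2 / q) * (16 + 40 * d^2 / (1 - 2 / q)^2)"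
 have V: "(SUM T:\<T>. nsq T (g i) * var w T) <= ?K * (nsq D (g i) + (SUM j:UNIV. nsq D (k i j)))" for i
 proof -
  interpret gi: H1_data D "g i" "k i" by unfold_locales (rule g k g_k)+
  have "ennreal (SUM T:\<T>. nsq T (g i) * var w T) = (SUM T:\<T>. ennreal (nsq T (g i)) * ennreal (var w T))"
   by (simp add: sum_ennreal[symmetric] nsq_nonneg var_nonneg ennreal_mult)
  also have "... = (SUM T:\<T>. \<integral>\<^sup>+ x. ennreal ((g i x)^2) * ind T x * ennreal (var w T) \<partial>lborel)"
   by (intro sum.cong refl) (simp add: nn_integral_nsq[OF g T_borel, symmetric] nn_integral_multc)
  also have "... = NI (%x. (SUM T:\<T>. ennreal ((g i x)^2) * ind T x * ennreal (var w T)))"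
   by (rule nn_integral_sum[symmetric]) (intro borel_measurable_times_ennreal borel_measurable_indicator measurable_compose[OF _ measurable_ennreal]; simp)
  also have "... <= nnI D (%x. var_at w x * (g i x)^2)"
  proof (intro nn_integral_mono)
   fix x
   have "(SUM T:\<T>. ennreal ((g i x)^2) * ind T x * ennreal (var w T)) =
     (SUM T:\<T>. ennreal ((g i x)^2 * (ind T x * var w T)) * ind D x)"
    using T_sub by (intro sum.cong) (auto simp: indicator_def ennreal_mult var_nonneg)
   also have "... = ennreal ((g i x)^2 * var_at w x) * ind D x"
    unfolding var_at_def sum_distrib_left sum_distrib_right[symmetric]
    by (subst sum_ennreal) (auto intro!: mult_nonneg_nonneg var_nonneg)
   finally show "(SUM T:\<T>. ennreal ((g i x)^2) * ind T x * ennreal (var w T)) <= ennreal (var_at w x * (g i x)^2) * ind D x"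
    by (simp add: mult.commute)
  qed
  also have "... <= ennreal (?K * (nsq D (g i) + (SUM j:UNIV. nsq D (k i j))))"
   using gi.weighted_Sobolev_nonneg[OF var_at_measurable var_at_nonneg var_at_le[OF w] A0 d _ A, where p="q / 2"] VA q by simp
  finally show ?thesis
   by (subst (asm) ennreal_le_iff) (intro mult_nonneg_nonneg add_nonneg_nonneg sum_nonneg nsq_nonneg; simp)
 qed
 have loc: "area T * (norm (slope v T))^2 <= (SUM i:UNIV. 2 * ?E T i + 2 * nsq T (g i))" if T: "T : \<T>" for T
 proof -
  note mle = nsq_mean_le(2)[OF g D(1,2) T_borel[OF T] T_sub[OF T] T_area[OF T] T_area_pos[OF T]]
  have "area T * (slope v T $ i)^2 <= 2 * ?E T i + 2 * nsq T (g i)" for i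
  proof -
   have "area T * (slope v T $ i)^2 = (LBINT x. ind T x * (slope v T $ i)^2)" using content_T[OF T] by simp
   also have "... <= (LBINT x. 2 * (ind T x * (g i x - slope v T $ i)^2) + 2 * (ind T x * (g i x)^2))"
   proof (rule integral_mono)
    show "ind T x * (slope v T $ i)^2 <= 2 * (ind T x * (g i x - slope v T $ i)^2) + 2 * (ind T x * (g i x)^2)" for x
     using power2_sum_le[of "slope v T $ i - g i x" "g i x"] by (simp add: indicator_def power2_commute)
   qed (use integrable_T[OF T] mle L2_square[OF g T_borel[OF T]] in auto)
   also have "... = 2 * ?E T i + 2 * nsq T (g i)" using mle L2_square[OF g T_borel[OF T]] by (simp add: nsq_def)
   finally show ?thesis .
  qed
  thus ?thesis unfolding norm_square_2 sum_distrib_left by (rule sum_mono)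
 qed
 have E0: "0 <= ?E T i" for T i by (intro Bochner_Integration.integral_nonneg) auto
 have "(SUM T:\<T>. area T * (norm (slope v T))^2 * var w T) <=
   (SUM T:\<T>. (SUM i:UNIV. 2 * ?E T i + 2 * nsq T (g i)) * var w T)"
  using loc var_nonneg by (intro sum_mono mult_right_mono) auto
 also have "... <= (SUM T:\<T>. 2 * B^2 * (SUM i:UNIV. ?E T i) + 2 * (SUM i:UNIV. nsq T (g i) * var w T))"
 proof (intro sum_mono)
  fix T assume T: "T : \<T>"
  have "(SUM i:UNIV. ?E T i) * var w T <= (SUM i:UNIV. ?E T i) * B^2"
   using var_le[OF w T] E0 by (intro mult_left_mono sum_nonneg) auto
  thus "(SUM i:UNIV. 2 * ?E T i + 2 * nsq T (g i)) * var w T <=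
    2 * B^2 * (SUM i:UNIV. ?E T i) + 2 * (SUM i:UNIV. nsq T (g i) * var w T)"
   by (simp add: sum.distrib sum_distrib_left[symmetric] sum_distrib_right[symmetric] algebra_simps)
 qed
 also have "... = 2 * B^2 * (SUM T:\<T>. SUM i:UNIV. ?E T i) + 2 * (SUM i:UNIV. SUM T:\<T>. nsq T (g i) * var w T)"
  by (subst (2) sum.swap) (simp add: sum.distrib sum_distrib_left[symmetric])
 also have "(SUM i:UNIV. SUM T:\<T>. nsq T (g i) * var w T) <= (SUM i:UNIV. ?K * (nsq D (g i) + (SUM j:UNIV. nsq D (k i j))))"
  by (intro sum_mono V)
 also have "... = ?K * ((SUM i:UNIV. nsq D (g i)) + hess D)" by (simp add: hess_def sum.distrib sum_distrib_left[symmetric])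
 finally show ?thesis by simp
qed


section \<open>The error for a fixed sample\<close>

lemma nsq_L2_on: "L2_on D w ==> nsq D w = (LBINT x. (w x)^2)"
 unfolding nsq_def using L2_onD(2)[of D w] by (intro Bochner_Integration.integral_cong) (auto simp: indicator_def)

lemma L2_Cauchy_Schwarz:
 assumes a: "L2_on D a" and b: "L2_on D b"
 shows "L1 (%x. a x * b x)" "\<bar>LBINT x. a x * b x\<bar> <= sqrt (nsq D a) * sqrt (nsq D b)"
proof -
 have [measurable]: "a : bmeas" "b : bmeas" using L2_onD(1) a b by auto
 note ia = L2_onD(3)[OF a] and ib = L2_onD(3)[OF b]
 show iab: "L1 (%x. a x * b x)"
 proof (rule Bochner_Integration.integrable_bound)
  show "L1 (%x. (a x)^2 + (b x)^2)" using ia ib by auto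
  show "AE x in lborel. norm (a x * b x) <= norm ((a x)^2 + (b x)^2)"
  proof (intro AE_I2)
   fix x
   have "2 * (\<bar>a x\<bar> * \<bar>b x\<bar>) <= (a x)^2 + (b x)^2"
    using sum_squares_bound[of "\<bar>a x\<bar>" "\<bar>b x\<bar>"] by (simp add: mult.assoc)
   thus "norm (a x * b x) <= norm ((a x)^2 + (b x)^2)"
    using mult_nonneg_nonneg[of "\<bar>a x\<bar>" "\<bar>b x\<bar>"] unfolding real_norm_def abs_mult by linarith
  qed
 qed measurable
 define I where "I = (LBINT x. a x * b x)"
 have quad: "0 <= nsq D a - 2 * t * I + t^2 * nsq D b" for t
 proof -
  have "0 <= (LBINT x. (a x - t * b x)^2)" by (intro Bochner_Integration.integral_nonneg) auto
  also have "(%x. (a x - t * b x)^2) = (%x. (a x)^2 - (2 * t * (a x * b x) - t^2 * (b x)^2))"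
   by (simp add: fun_eq_iff power2_eq_square algebra_simps)
  also have "(LBINT x. (a x)^2 - (2 * t * (a x * b x) - t^2 * (b x)^2)) = nsq D a - (2 * t * I - t^2 * nsq D b)"
   unfolding nsq_L2_on[OF a] nsq_L2_on[OF b] I_def using ia ib iab by (subst Bochner_Integration.integral_diff; simp)+
  finally show ?thesis by simp
 qed
 have "I^2 <= nsq D a * nsq D b"
 proof (cases "nsq D b = 0")
  case True
  have "I = 0"
  proof (rule ccontr)
   assume "I ~= 0"
   thus False using quad[of "(nsq D a + 1) / (2 * I)"] True by simp
  qed
  thus ?thesis using True by simp
 next
  case False
  hence b0: "0 < nsq D b" using nsq_nonneg[of D b] by simp
  have "0 <= nsq D a - I^2 / nsq D b" using quad[of "I / nsq D b"] b0 by (simp add: power2_eq_square field_simps)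
  thus ?thesis using b0 by (simp add: field_simps)
 qed
 thus "\<bar>LBINT x. a x * b x\<bar> <= sqrt (nsq D a) * sqrt (nsq D b)"
  unfolding I_def[symmetric] real_sqrt_mult[symmetric] by (intro real_le_rsqrt) simp
qed

lemma L2_on_mult_bounded:
 assumes w: "L2_on D w" and [measurable]: "b : bmeas" and B: "!!x. \<bar>b x\<bar> <= B"
 shows "L2_on D (%x. b x * w x)" "nsq D (%x. b x * w x) <= B^2 * nsq D w"
proof -
 have [measurable]: "w : bmeas" using L2_onD[OF w] by simp
 have b2: "(b x)^2 <= B^2" for x using B[of x] by (metis abs_ge_zero power2_abs power_mono)
 have i: "L1 (%x. (b x)^2 * (w x)^2)" by (rule L1_bounded_mult[OF L2_onD(3)[OF w], where B="B^2"]) (use b2 in auto)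
 show L: "L2_on D (%x. b x * w x)" using i L2_onD(2)[OF w] by (auto simp: L2_on_def power_mult_distrib)
 have "nsq D (%x. b x * w x) <= (LBINT x. B^2 * (w x)^2)"
  unfolding nsq_L2_on[OF L] power_mult_distrib using i L2_onD(3)[OF w] b2
  by (intro integral_mono) (auto intro: mult_right_mono)
 thus "nsq D (%x. b x * w x) <= B^2 * nsq D w" by (simp add: nsq_L2_on[OF w])
qed

lemma L2_on_mult_indicator_bounded:
 assumes D: "D : sets borel" "bounded D" and b: "b : bmeas" and B: "!!x. \<bar>b x\<bar> <= B"
 shows "L2_on D (%x. b x * ind D x)"
proof -
 have "L2_on D (ind D)"
  using D integrable_ind[OF D] by (auto simp: L2_on_def power2_eq_square indicator_inter_arith[symmetric])
 thus ?thesis by (rule L2_on_mult_bounded(1)[OF _ b B])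
qed

lemma L2_on_sum:
 assumes "finite I" "!!i. i : I ==> L2_on D (w i)"
 shows "L2_on D (%x. SUM i:I. w i x)"
 using assms
proof (induction I rule: finite_induct)
 case empty
 thus ?case by (simp add: L2_on_def)
next
 case (insert i I)
 thus ?case using L2_on_add_cmult[of D "w i" "%x. SUM i:I. w i x" 1 1] by simp
qed

lemma sum_sqrt_mult_le:
 fixes a b :: "'i => real"
 assumes "!!i. i : I ==> 0 <= a i" "!!i. i : I ==> 0 <= b i"
 shows "(SUM i:I. sqrt (a i) * sqrt (b i)) <= sqrt (SUM i:I. a i) * sqrt (SUM i:I. b i)"
 using L2_set_mult_ineq[of "%i. sqrt (a i)" "%i. sqrt (b i)" I] assms by (simp add: L2_set_def cong: sum.cong)

context triangulation
begin

text \<open>Piecewise constant functions on the mesh, zero on the edges and outside.\<close>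

definition pc :: "((real^2) set => real) => real^2 => real" where
 "pc ph x = (SUM T:\<T>. ind T x * ph T)"

lemma pc_at: "T : \<T> ==> x : T ==> pc ph x = ph T"
 unfolding pc_def by (rule sum_T_at)

lemma pc_outside: "ALL T:\<T>. x \<notin> T ==> pc ph x = 0"
 unfolding pc_def by (auto intro!: sum.neutral)

lemma pc_comp: "F 0 0 = 0 ==> F (pc ph x) (pc ps x) = pc (%T. F (ph T) (ps T)) x"
 by (cases "EX T:\<T>. x : T") (auto simp: pc_at pc_outside)

lemma pc_L2 [simp]: "L2_on D (pc ph)"
proof (rule L2_on_bounded[where B="SUM T:\<T>. \<bar>ph T\<bar>"])
 show "pc ph : bmeas"
  unfolding pc_def[abs_def] by (intro borel_measurable_sum borel_measurable_times borel_measurable_indicator) auto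
 show "pc ph x = 0" if "x \<notin> D" for x using that T_sub by (intro pc_outside) auto
 show "\<bar>pc ph x\<bar> <= (SUM T:\<T>. \<bar>ph T\<bar>)" for x
 proof (cases "EX T:\<T>. x : T")
  case True
  then obtain T where "T : \<T>" "x : T" by blast
  thus ?thesis by (simp add: pc_at) (rule member_le_sum; simp)
 qed (simp add: pc_outside sum_nonneg)
qed

lemma integral_mult_pc:
 assumes "integrable lborel F"
 shows "(LBINT x. F x * pc ph x) = (SUM T:\<T>. ph T * (LBINT x. ind T x * F x))"
proof -
 have "(LBINT x. F x * pc ph x) = (LBINT x. (SUM T:\<T>. ph T * (ind T x * F x)))"
  unfolding pc_def sum_distrib_left by (simp add: mult_ac)
 also have "... = (SUM T:\<T>. LBINT x. ph T * (ind T x * F x))"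
  using integrable_real_mult_indicator[OF _ assms] by (intro Bochner_Integration.integral_sum) (simp add: mult.commute)
 finally show ?thesis by simp
qed

lemma nsq_pc: "nsq D (pc ph) = (SUM T:\<T>. area T * (ph T)^2)"
proof -
 have "nsq D (pc ph) = (LBINT x. ind D x * pc (%T. (ph T)^2) x)"
  unfolding nsq_def using pc_comp[of "%a b. a^2" ph _ ph] by simp
 also have "... = (SUM T:\<T>. (ph T)^2 * (LBINT x. ind T x * ind D x))"
  by (rule integral_mult_pc[OF integrable_ind[OF D_measurable D(2)]])
 also have "... = (SUM T:\<T>. area T * (ph T)^2)"
 proof (intro sum.cong refl)
  fix T assume T: "T : \<T>"
  have "(%x. ind T x * ind D x :: real) = ind T" using T_sub[OF T] by (auto simp: indicator_def fun_eq_iff)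
  thus "(ph T)^2 * (LBINT x. ind T x * ind D x) = area T * (ph T)^2"
   using content_T[OF T] by simp
 qed
 finally show ?thesis .
qed

lemma pgrad_pc: "pgrad v i = pc (%T. slope v T $ i)"
 by (simp add: fun_eq_iff pgrad_def pc_def)

lemma nsq_pgrad: "(SUM i:UNIV. nsq D (pgrad v i)) = (SUM T:\<T>. area T * (norm (slope v T))^2)"
 unfolding pgrad_pc nsq_pc norm_square_2 sum_distrib_left by (rule sum.swap)

end

lemma (in fem_H2) gradient_error_eq:
 "(SUM T:\<T>. SUM i:UNIV. LBINT x. ind T x * (g i x - slope v T $ i)^2) =
  (SUM i:UNIV. nsq D (%x. g i x - pgrad v i x))"
proof -
 have "(SUM T:\<T>. LBINT x. ind T x * (g i x - slope v T $ i)^2) = nsq D (%x. g i x - pgrad v i x)" for i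
 proof -
  have L: "L2_on D (%x. g i x - pgrad v i x)"
   using L2_on_add_cmult[OF g[of i] pc_L2[of "%T. slope v T $ i"], of 1 "-1"] by (simp add: pgrad_pc)
  have eq: "ind T x * (g i x - slope v T $ i)^2 = ind T x * (g i x - pgrad v i x)^2" if "T : \<T>" for T x
   using pgrad_at[OF that, of x v i] by (auto simp: indicator_def)
  have "(SUM T:\<T>. LBINT x. ind T x * (g i x - slope v T $ i)^2) =
    (LBINT x. (g i x - pgrad v i x)^2 * pc (%T. 1) x)"
   unfolding integral_mult_pc[OF L2_onD(3)[OF L]] by (intro sum.cong) (simp_all add: eq)
  also have "... = (LBINT x. ind D x * (g i x - pgrad v i x)^2)"
  proof (rule integral_cong_AE)
   show "AE x in lborel. (g i x - pgrad v i x)^2 * pc (%T. 1) x = ind D x * (g i x - pgrad v i x)^2"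
    using sum_indicator_T by eventually_elim (simp add: pc_def)
   have [measurable]: "pc (%T. 1) : bmeas" using L2_onD(1)[OF pc_L2] .
   show "(%x. (g i x - pgrad v i x)^2 * pc (%T. 1) x) : borel_measurable lborel" by measurable
  qed measurable
  finally show ?thesis by (simp add: nsq_def)
 qed
 thus ?thesis by (subst sum.swap) simp
qed

text \<open>The weak equation enters through finite element test functions, written with their zero
  extensions and piecewise gradients.\<close>

locale sampled_fem = fem_H2 D \<T> h c u g k
 for D \<T> h c u g k +
 fixes \<sigma> f :: "real^2 => real" and B \<sigma>\<^sub>0 :: real
 assumes sg: "L2_on D \<sigma>" "!!x. \<bar>\<sigma> x\<bar> <= B" and f: "L2_on D f" and \<sigma>\<^sub>0: "0 < \<sigma>\<^sub>0"
  and weak: "!!w. w : fe_space D \<T> ==>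
   (LBINT x. \<sigma> x * (SUM i:UNIV. g i x * pgrad w i x)) = (LBINT x. f x * ext w x)"
begin

definition grad_err :: "(real^2 => real) => real" where
 "grad_err v = (SUM i:UNIV. nsq D (%x. g i x - pgrad v i x))"

definition load_dev :: "((real^2) set => real^2) => (real^2) set => real" where
 "load_dev z T = area T * f (z T) - (LBINT x. ind T x * f x)"

text \<open>The Gram matrix of the truncated kernels over \<open>D\<close>. It makes squared norms
  of combinations explicit double sums, whose expectation is taken term by term.\<close>

definition gram :: "(real^2) set => (real^2) set => real" where
 "gram T T' = (SUM i:UNIV. LBINT x. ind D x * (cutoff_kernel \<rho> i (x - centre T) * cutoff_kernel \<rho> i (x - centre T')))"

definition sq_load :: "((real^2) set => real^2) => real" where
 "sq_load z = (SUM T:\<T>. area T * (f (z T))^2)"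

definition sq_dev :: "((real^2) set => real^2) => real" where
 "sq_dev z = (SUM T:\<T>. SUM T':\<T>. load_dev z T * load_dev z T' * gram T T')"

definition sq_coeff :: "(real^2 => real) => ((real^2) set => real^2) => real" where
 "sq_coeff v z = (SUM T:\<T>. area T * (norm (slope v T) * (mean \<sigma> T - \<sigma> (z T)))^2)"

text \<open>Duality: a combination of ball means is an integral of grad w against one combination of
  kernels. The first factor of the bound does not involve \<open>w\<close>, so \<open>w\<close> may
  depend on the sample.\<close>

lemma kernel_combination:
 assumes w: "w : fe_space D \<T>"
 shows "\<bar>SUM T:\<T>. \<xi> T * ball_mean w T\<bar> <=
  sqrt (SUM T:\<T>. SUM T':\<T>. \<xi> T * \<xi> T' * gram T T') * sqrt (SUM i:UNIV. nsq D (pgrad w i))"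
  "0 <= (SUM T:\<T>. SUM T':\<T>. \<xi> T * \<xi> T' * gram T T')"
proof -
 define K where "K T i x = cutoff_kernel \<rho> i (x - centre T) * ind D x" for T i x
 define H where "H i x = (SUM T:\<T>. \<xi> T * K T i x)" for i x
 have K: "L2_on D (K T i)" for T i
  unfolding K_def by (rule L2_on_mult_indicator_bounded[OF D_measurable D(2) _ cutoff_kernel_bound(2)[OF rho_pos]]) measurable
 have K1: "L2_on D (%x. \<xi> T * K T i x)" for T i using L2_on_add_cmult[OF K K, of "\<xi> T" T i 0] by simp
 have H: "L2_on D (H i)" for i unfolding H_def[abs_def] by (rule L2_on_sum) (use K1 in auto)
 note pL = pc_L2[of "%T. slope w T $ i" for i, folded pgrad_pc]
 have bm: "ball_mean w T = - (1 / (2 * pi)) * (SUM i:UNIV. LBINT x. pgrad w i x * K T i x)" for T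
 proof -
  have "(%x. pgrad w i x * K T i x) = (%x. pgrad w i x * cutoff_kernel \<rho> i (x - centre T))" for i
   using L2_onD(2)[OF pL, of _ i] by (auto simp: K_def indicator_def fun_eq_iff)
  thus ?thesis unfolding ball_mean_eq[OF w] by simp
 qed
 have eq: "(SUM i:UNIV. nsq D (H i)) = (SUM T:\<T>. SUM T':\<T>. \<xi> T * \<xi> T' * gram T T')"
 proof -
  have "nsq D (H i) = (SUM T:\<T>. SUM T':\<T>. \<xi> T * \<xi> T' * (LBINT x. K T i x * K T' i x))" for i
  proof -
   have "nsq D (H i) = (LBINT x. (SUM T:\<T>. SUM T':\<T>. \<xi> T * \<xi> T' * (K T i x * K T' i x)))"
    unfolding nsq_L2_on[OF H] unfolding H_def power2_eq_square sum_product by (simp add: mult_ac)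
   also have "... = (SUM T:\<T>. SUM T':\<T>. LBINT x. \<xi> T * \<xi> T' * (K T i x * K T' i x))"
    using L2_Cauchy_Schwarz(1)[OF K K]
    by (subst Bochner_Integration.integral_sum; (intro Bochner_Integration.integrable_sum sum.cong refl Bochner_Integration.integral_sum)?; simp)
   finally show ?thesis by simp
  qed
  hence "(SUM i:UNIV. nsq D (H i)) = (SUM T:\<T>. SUM T':\<T>. SUM i:UNIV. \<xi> T * \<xi> T' * (LBINT x. K T i x * K T' i x))"
   by (simp add: sum_2 sum.distrib)
  also have "... = (SUM T:\<T>. SUM T':\<T>. \<xi> T * \<xi> T' * gram T T')"
  proof -
   have "K T i x * K T' i x = ind D x * (cutoff_kernel \<rho> i (x - centre T) * cutoff_kernel \<rho> i (x - centre T'))" for T T' i x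
    by (simp add: K_def indicator_def)
   thus ?thesis by (simp add: gram_def sum_distrib_left)
  qed
  finally show ?thesis .
 qed
 show "0 <= (SUM T:\<T>. SUM T':\<T>. \<xi> T * \<xi> T' * gram T T')"
  unfolding eq[symmetric] by (intro sum_nonneg nsq_nonneg)
 have "(SUM T:\<T>. \<xi> T * ball_mean w T) = - (1 / (2 * pi)) * (SUM i:UNIV. SUM T:\<T>. \<xi> T * (LBINT x. pgrad w i x * K T i x))"
  unfolding bm by (subst sum.swap) (simp add: sum_distrib_left mult_ac)
 also have "... = - (1 / (2 * pi)) * (SUM i:UNIV. LBINT x. pgrad w i x * H i x)"
 proof -
  have "(LBINT x. pgrad w i x * H i x) = (SUM T:\<T>. \<xi> T * (LBINT x. pgrad w i x * K T i x))" for i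
  proof -
   have "(LBINT x. pgrad w i x * H i x) = (LBINT x. (SUM T:\<T>. \<xi> T * (pgrad w i x * K T i x)))"
    by (simp add: H_def sum_distrib_left mult_ac)
   also have "... = (SUM T:\<T>. LBINT x. \<xi> T * (pgrad w i x * K T i x))"
    using L2_Cauchy_Schwarz(1)[OF pL K] by (intro Bochner_Integration.integral_sum) auto
   finally show ?thesis by simp
  qed
  thus ?thesis by simp
 qed
 finally have "\<bar>SUM T:\<T>. \<xi> T * ball_mean w T\<bar> = 1 / (2 * pi) * \<bar>SUM i:UNIV. LBINT x. pgrad w i x * H i x\<bar>"
  by (simp add: abs_mult)
 also have "... <= 1 * \<bar>SUM i:UNIV. LBINT x. pgrad w i x * H i x\<bar>" using pi_ge_two by (intro mult_right_mono) auto
 also have "... <= 1 * (SUM i:UNIV. sqrt (nsq D (H i)) * sqrt (nsq D (pgrad w i)))"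
  using L2_Cauchy_Schwarz(2)[OF H pL] by (intro mult_left_mono order_trans[OF sum_abs sum_mono]) (auto simp: mult.commute)
 also have "... <= sqrt (SUM i:UNIV. nsq D (H i)) * sqrt (SUM i:UNIV. nsq D (pgrad w i))"
  using sum_sqrt_mult_le[of UNIV "%i. nsq D (H i)" "%i. nsq D (pgrad w i)"] nsq_nonneg by simp
 finally show "\<bar>SUM T:\<T>. \<xi> T * ball_mean w T\<bar> <=
  sqrt (SUM T:\<T>. SUM T':\<T>. \<xi> T * \<xi> T' * gram T T') * sqrt (SUM i:UNIV. nsq D (pgrad w i))" unfolding eq .
qed

text \<open>On a triangle all values of \<open>w\<close> are within h |grad w| of the ball mean.
  Replacing \<open>w\<close> by this mean at the sample point and under the integral gives two terms
  of order h; the deviations \<open>load_dev\<close> tested with ball means remain.\<close>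

lemma load_error:
 assumes w: "w : fe_space D \<T>" and z: "!!T. T : \<T> ==> z T : T"
 shows "\<bar>(SUM T:\<T>. area T * f (z T) * w (z T)) - (LBINT x. f x * ext w x)\<bar> <=
  (h * sqrt (sq_load z) + h * sqrt (nsq D f) + sqrt (sq_dev z)) * sqrt (SUM T:\<T>. area T * (norm (slope w T))^2)"
  (is "_ <= _ * sqrt ?N")
proof -
 let ?m = "ball_mean w"
 note fi = L2_L1[OF f D(1,2)]
 have i1: "L1 (%x. f x * ext w x)" by (rule L2_Cauchy_Schwarz(1)[OF f H1_data.u[OF fe_H1_data[OF w]]])
 have i2: "L1 (%x. f x * pc ?m x)" by (rule L2_Cauchy_Schwarz(1)[OF f pc_L2])
 have split: "(SUM T:\<T>. area T * f (z T) * w (z T)) - (LBINT x. f x * ext w x) =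
   (SUM T:\<T>. area T * (f (z T) * (w (z T) - ?m T))) - (LBINT x. f x * (ext w x - pc ?m x)) + (SUM T:\<T>. load_dev z T * ?m T)"
  using i1 i2 integral_mult_pc[OF fi, of ?m]
  by (simp add: load_dev_def right_diff_distrib left_diff_distrib sum_subtractf mult_ac)
 have A: "\<bar>SUM T:\<T>. area T * (f (z T) * (w (z T) - ?m T))\<bar> <= h * sqrt (sq_load z) * sqrt ?N"
 proof -
  have "\<bar>SUM T:\<T>. area T * (f (z T) * (w (z T) - ?m T))\<bar> <=
    (SUM T:\<T>. h * (sqrt (area T * (f (z T))^2) * sqrt (area T * (norm (slope w T))^2)))"
  proof (intro order_trans[OF sum_abs sum_mono])
   fix T assume T: "T : \<T>"
   have "\<bar>area T * (f (z T) * (w (z T) - ?m T))\<bar> <= area T * (\<bar>f (z T)\<bar> * (h * norm (slope w T)))"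
    unfolding abs_mult using T_area_pos[OF T] ball_mean_close[OF w T z[OF T]] by (intro mult_mono) auto
   also have "... = h * (sqrt (area T * (f (z T))^2) * sqrt (area T * (norm (slope w T))^2))"
    using T_area_pos[OF T] by (simp add: real_sqrt_mult)
   finally show "\<bar>area T * (f (z T) * (w (z T) - ?m T))\<bar> <=
    h * (sqrt (area T * (f (z T))^2) * sqrt (area T * (norm (slope w T))^2))" .
  qed
  also have "... <= h * (sqrt (sq_load z) * sqrt ?N)"
   unfolding sum_distrib_left[symmetric] sq_load_def using h by (intro mult_left_mono sum_sqrt_mult_le) auto
  finally show ?thesis by (simp add: mult.assoc)
 qed
 have Bd: "\<bar>LBINT x. f x * (ext w x - pc ?m x)\<bar> <= h * sqrt (nsq D f) * sqrt ?N"
 proof -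
  let ?q = "%T. norm (slope w T)"
  have fa: "L2_on D (%x. \<bar>f x\<bar>)" using L2_onD[OF f] by (auto simp: L2_on_def)
  have iq: "L1 (%x. \<bar>f x\<bar> * pc ?q x)" by (rule L2_Cauchy_Schwarz(1)[OF fa pc_L2])
  have "\<bar>LBINT x. f x * (ext w x - pc ?m x)\<bar> <= (LBINT x. \<bar>f x * (ext w x - pc ?m x)\<bar>)" by (rule integral_abs_bound)
  also have "... <= (LBINT x. h * (\<bar>f x\<bar> * pc ?q x))"
  proof (rule integral_mono_AE)
   show "L1 (%x. \<bar>f x * (ext w x - pc ?m x)\<bar>)" using i1 i2 by (simp add: right_diff_distrib)
   show "L1 (%x. h * (\<bar>f x\<bar> * pc ?q x))" using iq by simp
   show "AE x in lborel. \<bar>f x * (ext w x - pc ?m x)\<bar> <= h * (\<bar>f x\<bar> * pc ?q x)" using AE_in_some_T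
   proof eventually_elim
    fix x assume x: "x : D --> (EX T:\<T>. x : T)"
    show "\<bar>f x * (ext w x - pc ?m x)\<bar> <= h * (\<bar>f x\<bar> * pc ?q x)"
    proof (cases "x : D")
     case True
     then obtain T where T: "T : \<T>" "x : T" using x by blast
     have "\<bar>f x\<bar> * \<bar>w x - ?m T\<bar> <= \<bar>f x\<bar> * (h * norm (slope w T))"
      using ball_mean_close[OF w T] by (intro mult_left_mono) auto
     thus ?thesis using T True by (simp add: abs_mult pc_at ext_def mult_ac)
    qed (use L2_onD(2)[OF f] in simp)
   qed
  qed
  also have "... = h * (LBINT x. \<bar>f x\<bar> * pc ?q x)" by simp
  also have "... <= h * (sqrt (nsq D (%x. \<bar>f x\<bar>)) * sqrt (nsq D (pc ?q)))"
   using h L2_Cauchy_Schwarz(2)[OF fa pc_L2[of ?q]] by (intro mult_left_mono) auto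
  also have "nsq D (%x. \<bar>f x\<bar>) = nsq D f" by (simp add: nsq_def)
  finally show ?thesis by (simp add: nsq_pc mult.assoc)
 qed
 have Cd: "\<bar>SUM T:\<T>. load_dev z T * ?m T\<bar> <= sqrt (sq_dev z) * sqrt ?N"
  using kernel_combination(1)[OF w, of "load_dev z"] by (simp add: sq_dev_def nsq_pgrad)
 show ?thesis unfolding split using A Bd Cd by (simp add: distrib_right)
qed

lemma pathwise_error:
 assumes v: "v : fe_space D \<T>" and U: "U : fe_space D \<T>"
  and z: "!!T. T : \<T> ==> z T : T" "!!T. T : \<T> ==> \<sigma>\<^sub>0 <= \<sigma> (z T)"
  and MC: "!!w. w : fe_space D \<T> ==> (SUM T:\<T>. area T * \<sigma> (z T) * (slope U T \<bullet> slope w T)) =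
   (SUM T:\<T>. area T * f (z T) * w (z T))"
 shows "grad_err U <= 2 * grad_err v + 10 / \<sigma>\<^sub>0\<^sup>2 *
  (B^2 * grad_err v + sq_coeff v z + h^2 * sq_load z + h^2 * nsq D f + sq_dev z)"
proof -
 define w where "w x = U x - v x" for x
 have w: "w : fe_space D \<T>" unfolding w_def[abs_def] by (rule fe_diff(1)[OF U v])
 have sw: "slope w T = slope U T - slope v T" if "T : \<T>" for T unfolding w_def[abs_def] by (rule fe_diff(2)[OF U v that])
 define N where "N = (SUM T:\<T>. area T * (norm (slope w T))^2)"
 have N0: "0 <= N" unfolding N_def by (intro sum_nonneg) auto
 have sgm: "\<sigma> : bmeas" using L2_onD[OF sg(1)] by simp
 note pL = pc_L2[of "%T. slope v T $ i" for v i, folded pgrad_pc]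
 have dL: "L2_on D (%x. g i x - pgrad v i x)" for v i using L2_on_add_cmult[OF g[of i] pL[of v i], of 1 "-1"] by simp
 have sL: "L2_on D (%x. \<sigma> x * (g i x - pgrad v i x))" "L2_on D (%x. \<sigma> x * pgrad v i x)" "L2_on D (%x. \<sigma> x * g i x)" for i
  using L2_on_mult_bounded(1)[OF dL sgm sg(2)] L2_on_mult_bounded(1)[OF pL sgm sg(2)] L2_on_mult_bounded(1)[OF g sgm sg(2)] by auto
 have vw: "(LBINT x. \<sigma> x * (SUM i:UNIV. pgrad v i x * pgrad w i x)) =
   (SUM T:\<T>. (slope v T \<bullet> slope w T) * (LBINT x. ind T x * \<sigma> x))"
 proof -
  have "(SUM i:UNIV. pgrad v i x * pgrad w i x) = pc (%T. slope v T \<bullet> slope w T) x" for x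
   by (cases "EX T:\<T>. x : T") (auto simp: pgrad_at pgrad_outside pc_at pc_outside inner_vec_def)
  thus ?thesis using integral_mult_pc[OF L2_L1[OF sg(1) D(1,2)]] by simp
 qed
 have gw: "(LBINT x. \<sigma> x * (SUM i:UNIV. g i x * pgrad w i x)) - (LBINT x. \<sigma> x * (SUM i:UNIV. pgrad v i x * pgrad w i x)) =
   (SUM i:UNIV. LBINT x. (\<sigma> x * (g i x - pgrad v i x)) * pgrad w i x)"
 proof -
  have e: "(LBINT x. \<sigma> x * (SUM i:UNIV. a i x * pgrad w i x)) = (SUM i:UNIV. LBINT x. (\<sigma> x * a i x) * pgrad w i x)"
   if "!!i. L2_on D (%x. \<sigma> x * a i x)" for a :: "2 => real^2 => real"
   unfolding sum_distrib_left mult.assoc[symmetric]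
   using L2_Cauchy_Schwarz(1)[OF that pL] by (intro Bochner_Integration.integral_sum) auto
  have "(LBINT x. (\<sigma> x * g i x) * pgrad w i x) - (LBINT x. (\<sigma> x * pgrad v i x) * pgrad w i x) =
    (LBINT x. (\<sigma> x * (g i x - pgrad v i x)) * pgrad w i x)" for i
   unfolding right_diff_distrib left_diff_distrib
   by (rule Bochner_Integration.integral_diff[symmetric, OF L2_Cauchy_Schwarz(1)[OF sL(3) pL] L2_Cauchy_Schwarz(1)[OF sL(2) pL]])
  thus ?thesis unfolding e[OF sL(3)] e[OF sL(2)] by (simp add: sum_subtractf[symmetric])
 qed
 have t2: "\<bar>SUM i:UNIV. LBINT x. (\<sigma> x * (g i x - pgrad v i x)) * pgrad w i x\<bar> <= sqrt (B^2 * grad_err v) * sqrt N"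
 proof -
  have "\<bar>SUM i:UNIV. LBINT x. (\<sigma> x * (g i x - pgrad v i x)) * pgrad w i x\<bar> <=
    (SUM i:UNIV. sqrt (B^2 * nsq D (%x. g i x - pgrad v i x)) * sqrt (nsq D (pgrad w i)))"
  proof (intro order_trans[OF sum_abs sum_mono])
   fix i
   have "\<bar>LBINT x. (\<sigma> x * (g i x - pgrad v i x)) * pgrad w i x\<bar> <=
     sqrt (nsq D (%x. \<sigma> x * (g i x - pgrad v i x))) * sqrt (nsq D (pgrad w i))"
    by (rule L2_Cauchy_Schwarz(2)[OF sL(1) pL])
   also have "... <= sqrt (B^2 * nsq D (%x. g i x - pgrad v i x)) * sqrt (nsq D (pgrad w i))"
    using L2_on_mult_bounded(2)[OF dL sgm sg(2)] by (intro mult_right_mono) (auto simp: nsq_nonneg)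
   finally show "\<bar>LBINT x. (\<sigma> x * (g i x - pgrad v i x)) * pgrad w i x\<bar> <=
     sqrt (B^2 * nsq D (%x. g i x - pgrad v i x)) * sqrt (nsq D (pgrad w i))" .
  qed
  also have "... <= sqrt (SUM i:UNIV. B^2 * nsq D (%x. g i x - pgrad v i x)) * sqrt (SUM i:UNIV. nsq D (pgrad w i))"
   by (rule sum_sqrt_mult_le) (auto simp: nsq_nonneg)
  finally show ?thesis unfolding grad_err_def N_def nsq_pgrad sum_distrib_left[symmetric] .
 qed
 have t3: "\<bar>SUM T:\<T>. (slope v T \<bullet> slope w T) * (area T * (mean \<sigma> T - \<sigma> (z T)))\<bar> <= sqrt (sq_coeff v z) * sqrt N"
 proof -
  have "\<bar>SUM T:\<T>. (slope v T \<bullet> slope w T) * (area T * (mean \<sigma> T - \<sigma> (z T)))\<bar> <=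
    (SUM T:\<T>. sqrt (area T * (norm (slope v T) * (mean \<sigma> T - \<sigma> (z T)))^2) * sqrt (area T * (norm (slope w T))^2))"
  proof (intro order_trans[OF sum_abs sum_mono])
   fix T assume T: "T : \<T>"
   have "\<bar>(slope v T \<bullet> slope w T) * (area T * (mean \<sigma> T - \<sigma> (z T)))\<bar> <=
     (norm (slope v T) * norm (slope w T)) * (area T * \<bar>mean \<sigma> T - \<sigma> (z T)\<bar>)"
    unfolding abs_mult using Cauchy_Schwarz_ineq2[of "slope v T" "slope w T"] T_area_pos[OF T] by (intro mult_mono) auto
   also have "... = sqrt (area T * (norm (slope v T) * (mean \<sigma> T - \<sigma> (z T)))^2) * sqrt (area T * (norm (slope w T))^2)"
    using T_area_pos[OF T] by (simp add: real_sqrt_mult abs_mult)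
   finally show "\<bar>(slope v T \<bullet> slope w T) * (area T * (mean \<sigma> T - \<sigma> (z T)))\<bar> <=
    sqrt (area T * (norm (slope v T) * (mean \<sigma> T - \<sigma> (z T)))^2) * sqrt (area T * (norm (slope w T))^2)" .
  qed
  also have "... <= sqrt (sq_coeff v z) * sqrt N" unfolding sq_coeff_def N_def by (rule sum_sqrt_mult_le) auto
  finally show ?thesis .
 qed
 define X where "X = sqrt (B^2 * grad_err v) + sqrt (sq_coeff v z) + h * sqrt (sq_load z) + h * sqrt (nsq D f) + sqrt (sq_dev z)"
 have "\<sigma>\<^sub>0 * N <= (SUM T:\<T>. area T * \<sigma> (z T) * (slope w T \<bullet> slope w T))"
  unfolding N_def sum_distrib_left
 proof (intro sum_mono)
  fix T assume T: "T : \<T>"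
  have "\<sigma>\<^sub>0 * (area T * (norm (slope w T))^2) <= \<sigma> (z T) * (area T * (norm (slope w T))^2)"
   using z(2)[OF T] T_area_pos[OF T] by (intro mult_right_mono) auto
  thus "\<sigma>\<^sub>0 * (area T * (norm (slope w T))^2) <= area T * \<sigma> (z T) * (slope w T \<bullet> slope w T)"
   by (simp add: power2_norm_eq_inner mult_ac)
 qed
 also have "... = (SUM T:\<T>. area T * f (z T) * w (z T)) - (SUM T:\<T>. area T * \<sigma> (z T) * (slope v T \<bullet> slope w T))"
  unfolding MC[OF w, symmetric] sum_subtractf[symmetric]
  by (intro sum.cong refl) (simp add: sw inner_diff_left right_diff_distrib)
 also have "... = ((SUM T:\<T>. area T * f (z T) * w (z T)) - (LBINT x. f x * ext w x)) +
   (SUM i:UNIV. LBINT x. (\<sigma> x * (g i x - pgrad v i x)) * pgrad w i x) +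
   (SUM T:\<T>. (slope v T \<bullet> slope w T) * (area T * (mean \<sigma> T - \<sigma> (z T))))"
 proof -
  have "(SUM T:\<T>. (slope v T \<bullet> slope w T) * (area T * (mean \<sigma> T - \<sigma> (z T)))) =
    (LBINT x. \<sigma> x * (SUM i:UNIV. pgrad v i x * pgrad w i x)) - (SUM T:\<T>. area T * \<sigma> (z T) * (slope v T \<bullet> slope w T))"
   unfolding vw sum_subtractf[symmetric]
  proof (intro sum.cong refl)
   fix T assume T: "T : \<T>"
   have "area T * (mean \<sigma> T - \<sigma> (z T)) = (LBINT x. ind T x * \<sigma> x) - area T * \<sigma> (z T)"
    unfolding mean_def right_diff_distrib using less_imp_neq[OF T_area_pos[OF T]] by simp
   thus "(slope v T \<bullet> slope w T) * (area T * (mean \<sigma> T - \<sigma> (z T))) =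
    (slope v T \<bullet> slope w T) * (LBINT x. ind T x * \<sigma> x) - area T * \<sigma> (z T) * (slope v T \<bullet> slope w T)"
    by (simp add: right_diff_distrib mult_ac)
  qed
  thus ?thesis using gw weak[OF w] by simp
 qed
 also have "... <= X * sqrt N" using load_error[OF w z(1), folded N_def] t2 t3 unfolding X_def distrib_right by linarith
 finally have main: "\<sigma>\<^sub>0 * N <= X * sqrt N" .
 \<comment> \<open>One factor sqrt N is cancelled before squaring; for N = 0 nothing is to be
   shown.\<close>
 have "\<sigma>\<^sub>0\<^sup>2 * N <= X^2"
 proof (cases "N = 0")
  case False
  hence sN: "0 < sqrt N" using N0 by simp
  have "(\<sigma>\<^sub>0 * sqrt N) * sqrt N <= X * sqrt N" using main N0 by (simp add: mult.assoc)
  hence "\<sigma>\<^sub>0 * sqrt N <= X" using sN by simp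
  hence "(\<sigma>\<^sub>0 * sqrt N)^2 <= X^2" using \<sigma>\<^sub>0 sN by (intro power_mono) auto
  thus ?thesis using N0 by (simp add: power_mult_distrib)
 qed simp
 also have "X^2 <= 5 * (B^2 * grad_err v + sq_coeff v z + h^2 * sq_load z + h^2 * nsq D f + sq_dev z)"
 proof -
  \<comment> \<open>Five terms cost a factor 5 when squared; the factor 10 of the statement comes
    from the doubling in \<open>grad_err U <= 2 * grad_err v + 2 * N\<close>.\<close>
  have five: "(a + b + c + d + e)^2 <= 5 * (a^2 + b^2 + c^2 + d^2 + e^2)" for a b c d e :: real
  proof -
   have "0 <= (a - b)^2 + (a - c)^2 + (a - d)^2 + (a - e)^2 + (b - c)^2 + (b - d)^2 + (b - e)^2 + (c - d)^2 + (c - e)^2 + (d - e)^2"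
    by (intro add_nonneg_nonneg) auto
   thus ?thesis by (simp add: power2_eq_square algebra_simps)
  qed
  have nn: "0 <= B^2 * grad_err v" "0 <= sq_coeff v z" "0 <= sq_load z"
   unfolding grad_err_def sq_coeff_def sq_load_def by (auto intro!: mult_nonneg_nonneg sum_nonneg nsq_nonneg)
  moreover have "0 <= sq_dev z" unfolding sq_dev_def by (rule kernel_combination(2)[OF w])
  ultimately show ?thesis unfolding X_def using nsq_nonneg[of D f]
   by (rule_tac order_trans[OF five]) (simp add: power_mult_distrib)
 qed
 finally have Nb: "N <= 5 / \<sigma>\<^sub>0\<^sup>2 * (B^2 * grad_err v + sq_coeff v z + h^2 * sq_load z + h^2 * nsq D f + sq_dev z)"
  using \<sigma>\<^sub>0 by (simp add: field_simps)
 have "grad_err U <= (SUM i:UNIV. 2 * nsq D (%x. g i x - pgrad v i x) + 2 * nsq D (pgrad w i))" unfolding grad_err_def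
 proof (intro sum_mono)
  fix i
  have "pgrad U i x = pgrad v i x + pgrad w i x" for x
   by (cases "EX T:\<T>. x : T") (auto simp: pgrad_at pgrad_outside sw)
  hence "(g i x - pgrad U i x)^2 <= 2 * (g i x - pgrad v i x)^2 + 2 * (pgrad w i x)^2" for x
   using power2_sum_le[of "g i x - pgrad v i x" "- pgrad w i x"] by (simp add: diff_diff_eq)
  hence "nsq D (%x. g i x - pgrad U i x) <= (LBINT x. 2 * (g i x - pgrad v i x)^2 + 2 * (pgrad w i x)^2)"
   unfolding nsq_L2_on[OF dL] using L2_onD(3)[OF dL] L2_onD(3)[OF pL] by (intro integral_mono) auto
  thus "nsq D (%x. g i x - pgrad U i x) <= 2 * nsq D (%x. g i x - pgrad v i x) + 2 * nsq D (pgrad w i)"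
   unfolding nsq_L2_on[OF dL] nsq_L2_on[OF pL] using L2_onD(3)[OF dL] L2_onD(3)[OF pL] by simp
 qed
 also have "... = 2 * grad_err v + 2 * N"
  unfolding sum.distrib sum_distrib_left[symmetric] nsq_pgrad by (simp add: grad_err_def N_def)
 finally have "grad_err U <= 2 * grad_err v + 2 * N" .
 also have "... <= 2 * grad_err v + 2 * (5 / \<sigma>\<^sub>0\<^sup>2 *
   (B^2 * grad_err v + sq_coeff v z + h^2 * sq_load z + h^2 * nsq D f + sq_dev z))"
  by (intro add_left_mono mult_left_mono Nb) simp
 finally show ?thesis by (simp add: mult.assoc[symmetric])
qed

end


section \<open>The mean square error\<close>

context triangulation
begin

text \<open>The law of \<open>Z\<close> has the density 1/|T| on \<open>T\<close>, through which
  integrals and null sets are transferred. In particular, conditions holding almost everywhere on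
  \<open>D\<close> hold almost surely at the sample points.\<close>

lemma uniform_sample:
 assumes Z: "Z : measurable P borel" "distr P lborel Z = uniform_measure lborel T" and T: "T : \<T>"
  and [measurable]: "F : bmeas" and F: "L1 (%x. ind T x * (F x :: real))"
 shows "integrable P (%om. F (Z om))"
  "area T * (LINT om|P. F (Z om)) = (LBINT x. ind T x * F x)"
  and uniform_sample_AE: "AE x in lborel. x : D --> Q x ==> AE om in P. Z om : T & Q (Z om)"
proof -
 let ?a = "area T"
 have a: "0 < ?a" by (rule T_area_pos[OF T])
 have Zl: "Z : measurable P lborel" using Z(1) by simp
 have [measurable]: "T : sets borel" using T by simp
 have "uniform_measure lborel T = density lborel (%x. ennreal (ind T x / ?a))"
  unfolding uniform_measure_def T_area[OF T] using a
  by (intro density_cong) (auto simp: indicator_def divide_ennreal[symmetric] intro!: AE_I2)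
 hence d: "distr P lborel Z = density lborel (%x. ennreal (ind T x / ?a))" using Z(2) by simp
 have Fa: "L1 (%x. (ind T x / ?a) *\<^sub>R F x)" using integrable_divide[OF F, of ?a] by simp
 have "integrable (distr P lborel Z) F" unfolding d using a Fa by (subst integrable_density) (auto intro!: AE_I2)
 thus "integrable P (%om. F (Z om))" by (subst (asm) integrable_distr_eq[OF Zl]) auto
 have "(LINT om|P. F (Z om)) = (LINT x|distr P lborel Z. F x)" by (rule integral_distr[symmetric, OF Zl]) simp
 also have "... = (LBINT x. (ind T x / ?a) *\<^sub>R F x)"
  unfolding d using a by (intro integral_density) (auto intro!: AE_I2)
 finally show "?a * (LINT om|P. F (Z om)) = (LBINT x. ind T x * F x)" using a by simp
 assume Q: "AE x in lborel. x : D --> Q x"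
 have "AE x in distr P lborel Z. x : T & Q x"
  unfolding d using a T_sub[OF T] Q by (subst AE_density) (auto simp: indicator_def elim!: eventually_mono)
 thus "AE om in P. Z om : T & Q (Z om)" by (rule AE_distrD[OF Zl])
qed

lemma sum_nsq: "L2_on D w ==> (SUM T:\<T>. nsq T w) = nsq D w"
proof -
 assume w: "L2_on D w"
 hence [measurable]: "w : bmeas" by (rule L2_onD)
 have [measurable]: "pc (%T. 1) : bmeas" by (rule L2_onD(1)[OF pc_L2])
 have "(SUM T:\<T>. nsq T w) = (LBINT x. (w x)^2 * pc (%T. 1) x)"
  unfolding integral_mult_pc[OF L2_onD(3)[OF w]] by (simp add: nsq_def)
 also have "... = (LBINT x. ind D x * (w x)^2)"
 proof (rule integral_cong_AE)
  show "AE x in lborel. (w x)^2 * pc (%T. 1) x = ind D x * (w x)^2"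
   using sum_indicator_T by eventually_elim (simp add: pc_def)
 qed measurable
 finally show ?thesis by (simp add: nsq_def)
qed

text \<open>A triangle of diameter at most \<open>h\<close> lies in a disc of radius
  \<open>h\<close>, and pi < 4.\<close>

lemma T_area_le: "T : \<T> ==> area T <= 4 * h^2"
proof -
 assume T: "T : \<T>"
 then obtain x where x: "x : T" using T_nonempty by blast
 have "T \<subseteq> cball x h"
  using T_diam[OF T subsetD[OF closure_subset x] subsetD[OF closure_subset]] by (auto simp: dist_norm norm_minus_commute)
 hence "emeasure lborel T <= emeasure lborel (cball x h)" by (intro emeasure_mono) auto
 also have "... = ennreal (pi * h^2)" using h by (simp add: emeasure_cball unit_ball_vol_2)
 finally have "area T <= pi * h^2" unfolding T_area[OF T] by (subst (asm) ennreal_le_iff) auto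
 also have "... <= 4 * h^2" using pi_less_4 by (intro mult_right_mono) auto
 finally show ?thesis .
qed

end

context sampled_fem
begin

text \<open>Diagonal entries suffice: in expectation the products of deviations on different
  triangles vanish.\<close>

lemma gram_diagonal:
 assumes "nnI D (%x. SUM i:UNIV. (cutoff_kernel \<rho> i (x - centre T))^2) <= ennreal K" "0 <= K"
 shows "0 <= gram T T" "gram T T <= K"
proof -
 have L: "L2_on D (%x. cutoff_kernel \<rho> i (x - centre T) * ind D x)" for i
  by (rule L2_on_mult_indicator_bounded[OF D_measurable D(2) _ cutoff_kernel_bound(2)[OF rho_pos]]) measurable
 have g: "gram T T = (SUM i:UNIV. nsq D (%x. cutoff_kernel \<rho> i (x - centre T) * ind D x))" unfolding gram_def nsq_def
  by (intro sum.cong refl Bochner_Integration.integral_cong) (auto simp: indicator_def power2_eq_square)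
 thus "0 <= gram T T" by (simp add: sum_nonneg nsq_nonneg)
 have "ennreal (gram T T) = (SUM i:UNIV. \<integral>\<^sup>+ x. ennreal ((cutoff_kernel \<rho> i (x - centre T) * ind D x)^2) * ind D x \<partial>lborel)"
  unfolding g nn_integral_nsq[OF L D_measurable] by (subst sum_ennreal) (auto simp: nsq_nonneg)
 also have "... = NI (%x. (SUM i:UNIV. ennreal ((cutoff_kernel \<rho> i (x - centre T) * ind D x)^2) * ind D x))"
  by (rule nn_integral_sum[symmetric]) simp
 also have "... = nnI D (%x. SUM i:UNIV. (cutoff_kernel \<rho> i (x - centre T))^2)"
  by (intro nn_integral_cong) (simp add: indicator_def)
 finally have "ennreal (gram T T) <= ennreal K" using assms(1) by simp
 thus "gram T T <= K" using assms(2) by (subst (asm) ennreal_le_iff)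
qed

lemma expected_error:
 assumes P: "prob_space P" and Z: "uniform_samples P \<T> Z"
  and v: "v : fe_space D \<T>" and U: "!!om. om : space P ==> U om : fe_space D \<T>"
  and lower: "AE x in lborel. x : D --> \<sigma>\<^sub>0 <= \<sigma> x"
  and MC: "AE om in P. ALL w:fe_space D \<T>. (SUM T:\<T>. area T * \<sigma> (Z T om) * (slope (U om) T \<bullet> slope w T)) =
   (SUM T:\<T>. area T * f (Z T om) * w (Z T om))"
  and K: "!!T. T : \<T> ==> 0 <= gram T T" "!!T. T : \<T> ==> gram T T <= K"
 shows "(\<integral>\<^sup>+ om. ennreal (grad_err (U om)) \<partial>P) <= ennreal (2 * grad_err v + 10 / \<sigma>\<^sub>0\<^sup>2 *
  (B^2 * grad_err v + (SUM T:\<T>. area T * (norm (slope v T))^2 * var \<sigma> T) + (2 + 4 * K) * h^2 * nsq D f))"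
proof -
 interpret P: prob_space P by (rule P)
 let ?z = "%om T. Z T om"
 have ind: "P.indep_vars (%_. borel) Z \<T>" and Zd: "!!T. T : \<T> ==> distr P lborel (Z T) = uniform_measure lborel T"
  using Z by (auto simp: uniform_samples_def)
 have Zm: "Z T : measurable P borel" if "T : \<T>" for T using ind that by (simp add: P.indep_vars_def)
 have fm [measurable]: "f : bmeas" and sm [measurable]: "\<sigma> : bmeas" using L2_onD(1)[OF f] L2_onD(1)[OF sg(1)] by auto
 note us = uniform_sample[OF Zm Zd]
 have iTf: "L1 (%x. ind T x * f x)" if "T : \<T>" for T
  using integrable_real_mult_indicator[OF _ L2_L1[OF f D(1,2)], of T] that by (simp add: mult.commute)
 note f1 = us[OF _ _ _ fm iTf]
 note f2 = us[where F="%x. (f x)^2", OF _ _ _ _ L2_square[OF f T_borel]]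
 have AEz: "AE om in P. ALL T:\<T>. Z T om : T & \<sigma>\<^sub>0 <= \<sigma> (Z T om)"
  by (intro AE_finite_allI finite_T) (rule uniform_sample_AE[OF Zm Zd _ fm iTf lower]; assumption)
 have sl: "integrable P (%om. sq_load (?z om))" "(LINT om|P. sq_load (?z om)) = nsq D f"
 proof -
  show "integrable P (%om. sq_load (?z om))"
   unfolding sq_load_def using f2(1) by (intro Bochner_Integration.integrable_sum) auto
  have "(LINT om|P. sq_load (?z om)) = (SUM T:\<T>. area T * (LINT om|P. (f (Z T om))^2))"
   unfolding sq_load_def using f2(1) by (subst Bochner_Integration.integral_sum) auto
  also have "... = (SUM T:\<T>. nsq T f)" unfolding nsq_def using f2(2) by (intro sum.cong) auto
  finally show "(LINT om|P. sq_load (?z om)) = nsq D f" by (simp add: sum_nsq[OF f])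
 qed
 have sc: "integrable P (%om. sq_coeff v (?z om))"
  "(LINT om|P. sq_coeff v (?z om)) = (SUM T:\<T>. area T * (norm (slope v T))^2 * var \<sigma> T)"
 proof -
  have s2: "integrable P (%om. (mean \<sigma> T - \<sigma> (Z T om))^2)"
   "area T * (LINT om|P. (mean \<sigma> T - \<sigma> (Z T om))^2) = area T * var \<sigma> T" if T: "T : \<T>" for T
  proof -
   have "L1 (%x. ind T x * (mean \<sigma> T - \<sigma> x)^2)"
    using nsq_mean_le(2)[OF sg(1) D(1,2) T_borel[OF T] T_sub[OF T] T_area[OF T] T_area_pos[OF T]] by (simp add: power2_commute[of "mean \<sigma> T"])
   from us[OF T T T _ this]
   show "integrable P (%om. (mean \<sigma> T - \<sigma> (Z T om))^2)"
    "area T * (LINT om|P. (mean \<sigma> T - \<sigma> (Z T om))^2) = area T * var \<sigma> T"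
    using T_area_pos[OF T] by (auto simp: var_def power2_commute[of "mean \<sigma> T"])
  qed
  show "integrable P (%om. sq_coeff v (?z om))"
   unfolding sq_coeff_def power_mult_distrib using s2(1) by (intro Bochner_Integration.integrable_sum) auto
  have "(LINT om|P. sq_coeff v (?z om)) = (SUM T:\<T>. (norm (slope v T))^2 * (area T * (LINT om|P. (mean \<sigma> T - \<sigma> (Z T om))^2)))"
   unfolding sq_coeff_def power_mult_distrib using s2(1) by (subst Bochner_Integration.integral_sum) (auto simp: mult_ac)
  also have "... = (SUM T:\<T>. (norm (slope v T))^2 * (area T * var \<sigma> T))" using s2(2) by (intro sum.cong) auto
  finally show "(LINT om|P. sq_coeff v (?z om)) = (SUM T:\<T>. area T * (norm (slope v T))^2 * var \<sigma> T)"
   by (simp add: mult_ac)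
 qed
 define \<xi> where "\<xi> T om = load_dev (?z om) T" for T om
 have xi: "integrable P (\<xi> T)" "(LINT om|P. \<xi> T om) = 0" "integrable P (%om. \<xi> T om * \<xi> T om)"
  "(LINT om|P. \<xi> T om * \<xi> T om) <= 4 * h^2 * nsq T f" if T: "T : \<T>" for T
 proof -
  let ?a = "area T" and ?I = "LBINT x. ind T x * f x"
  note F1 = f1[OF T T T T] and F2 = f2[OF T T T _ T]
  show "integrable P (\<xi> T)" unfolding \<xi>_def load_dev_def using F1(1) by auto
  show "(LINT om|P. \<xi> T om) = 0" unfolding \<xi>_def load_dev_def using F1 by (simp add: P.prob_space)
  have e: "(%om. \<xi> T om * \<xi> T om) = (%om. ?a^2 * (f (Z T om))^2 - 2 * ?I * ?a * f (Z T om) + ?I^2)"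
   by (simp add: fun_eq_iff \<xi>_def load_dev_def power2_eq_square algebra_simps)
  show "integrable P (%om. \<xi> T om * \<xi> T om)" unfolding e using F1(1) F2(1) by auto
  \<comment> \<open>The variance formula: |T| times the integral of f^2 over \<open>T\<close>, minus
    the squared integral of f; the area |T| is at most 4 h^2.\<close>
  have "(LINT om|P. \<xi> T om * \<xi> T om) = ?a^2 * (LINT om|P. (f (Z T om))^2) - 2 * ?I * ?a * (LINT om|P. f (Z T om)) + ?I^2"
   unfolding e using F1(1) F2(1) by (simp add: P.prob_space)
  also have "... = ?a * nsq T f - ?I^2" using F1(2) F2(2) by (simp add: nsq_def power2_eq_square mult.assoc)
  also have "... <= 4 * h^2 * nsq T f"
   using mult_right_mono[OF T_area_le[OF T] nsq_nonneg[of T f]] zero_le_power2[of ?I] by linarith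
  finally show "(LINT om|P. \<xi> T om * \<xi> T om) <= 4 * h^2 * nsq T f" .
 qed
 \<comment> \<open>Deviations on different triangles are functions of independent samples with mean
   zero, so mixed products integrate to zero.\<close>
 have orth: "integrable P (%om. \<xi> T om * \<xi> T' om)" "(LINT om|P. \<xi> T om * \<xi> T' om) = 0"
  if T: "T : \<T>" "T' : \<T>" "T ~= T'" for T T'
 proof -
  have "P.indep_vars (%_. borel) (%T om. (%x. area T * f x - (LBINT x. ind T x * f x)) (Z T om)) {T, T'}"
   by (rule P.indep_vars_compose2[OF P.indep_vars_subset[OF ind]]) (use T in auto)
  hence i: "P.indep_vars (%_. borel) \<xi> {T, T'}" unfolding \<xi>_def[abs_def] load_dev_def .
  show "(LINT om|P. \<xi> T om * \<xi> T' om) = 0" using P.indep_vars_lebesgue_integral[OF _ i] xi(1,2) T by auto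
  show "integrable P (%om. \<xi> T om * \<xi> T' om)" using P.indep_vars_integrable[OF _ i] xi(1) T by auto
 qed
 have sd: "integrable P (%om. sq_dev (?z om))" "(LINT om|P. sq_dev (?z om)) <= 4 * K * h^2 * nsq D f"
 proof -
  have e: "sq_dev (?z om) = (SUM T:\<T>. SUM T':\<T>. gram T T' * (\<xi> T om * \<xi> T' om))" for om
   unfolding sq_dev_def \<xi>_def by (simp add: mult_ac)
  have i: "integrable P (%om. gram T T' * (\<xi> T om * \<xi> T' om))" if "T : \<T>" "T' : \<T>" for T T'
   using orth(1)[OF that] xi(3)[OF that(1)] by (cases "T = T'") auto
  show "integrable P (%om. sq_dev (?z om))" unfolding e using i by (intro Bochner_Integration.integrable_sum) auto
  have "(LINT om|P. sq_dev (?z om)) = (SUM T:\<T>. SUM T':\<T>. LINT om|P. gram T T' * (\<xi> T om * \<xi> T' om))"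
   unfolding e using i
   by (subst Bochner_Integration.integral_sum; (intro Bochner_Integration.integrable_sum sum.cong refl Bochner_Integration.integral_sum)?; simp)
  also have "... = (SUM T:\<T>. SUM T':\<T>. if T' = T then gram T T * (LINT om|P. \<xi> T om * \<xi> T om) else 0)"
   using orth(2) by (intro sum.cong) auto
  also have "... = (SUM T:\<T>. gram T T * (LINT om|P. \<xi> T om * \<xi> T om))" by simp
  also have "... <= (SUM T:\<T>. K * (4 * h^2 * nsq T f))"
  proof (intro sum_mono)
   fix T assume T: "T : \<T>"
   have "gram T T * (LINT om|P. \<xi> T om * \<xi> T om) <= gram T T * (4 * h^2 * nsq T f)"
    by (intro mult_left_mono xi(4) K(1) T)
   also have "... <= K * (4 * h^2 * nsq T f)" by (intro mult_right_mono K(2) T mult_nonneg_nonneg nsq_nonneg) auto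
   finally show "gram T T * (LINT om|P. \<xi> T om * \<xi> T om) <= K * (4 * h^2 * nsq T f)" .
  qed
  also have "... = 4 * K * h^2 * nsq D f" unfolding sum_nsq[OF f, symmetric] sum_distrib_left by (simp add: mult_ac)
  finally show "(LINT om|P. sq_dev (?z om)) <= 4 * K * h^2 * nsq D f" .
 qed
 define X where "X om = 2 * grad_err v + 10 / \<sigma>\<^sub>0\<^sup>2 *
  (B^2 * grad_err v + sq_coeff v (?z om) + h^2 * sq_load (?z om) + h^2 * nsq D f + sq_dev (?z om))" for om
 \<comment> \<open>The expectation is estimated through the integrable bound \<open>X\<close>, which
   depends only on the samples; the discrete solution itself may fail to be measurable in
   \<open>om\<close>.\<close>
 have bound: "AE om in P. grad_err (U om) <= X om" using AEz MC AE_space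
 proof eventually_elim
  case (elim om)
  thus ?case unfolding X_def using U by (intro pathwise_error[OF v]) auto
 qed
 have ge0: "0 <= grad_err w" for w unfolding grad_err_def by (intro sum_nonneg nsq_nonneg)
 have X0: "AE om in P. 0 <= X om" using bound by eventually_elim (use ge0 order_trans in blast)
 have iX: "integrable P X" unfolding X_def using sl(1) sc(1) sd(1) by auto
 have "(\<integral>\<^sup>+ om. ennreal (grad_err (U om)) \<partial>P) <= (\<integral>\<^sup>+ om. ennreal (X om) \<partial>P)"
  using bound by (intro nn_integral_mono_AE) (auto elim!: eventually_mono intro: ennreal_leI)
 also have "... = ennreal (LINT om|P. X om)" by (rule nn_integral_eq_integral[OF iX X0])
 also have "(LINT om|P. X om) = 2 * grad_err v + 10 / \<sigma>\<^sub>0\<^sup>2 *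
  (B^2 * grad_err v + (SUM T:\<T>. area T * (norm (slope v T))^2 * var \<sigma> T) + h^2 * nsq D f + h^2 * nsq D f + (LINT om|P. sq_dev (?z om)))"
  unfolding X_def using sl sc sd(1) by (simp add: P.prob_space)
 also have "... <= 2 * grad_err v + 10 / \<sigma>\<^sub>0\<^sup>2 *
  (B^2 * grad_err v + (SUM T:\<T>. area T * (norm (slope v T))^2 * var \<sigma> T) + (2 + 4 * K) * h^2 * nsq D f)"
  using sd(2) by (intro add_left_mono mult_left_mono) (auto simp: algebra_simps)
 finally show ?thesis by (simp add: ennreal_leI)
qed

end


section \<open>Borel representatives of Sobolev functions\<close>

context convex_domain
begin

text \<open>A Borel function on the plane standing for \<open>w\<close> on \<open>D\<close>. The
  notions of the statement use the completed measure restricted to \<open>D\<close>, the estimates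
  use \<open>lborel\<close>; this relation links the two.\<close>

definition agrees :: "(real^2 => real) => (real^2 => real) => bool" where
 "agrees w w' \<longleftrightarrow> w' : bmeas & (AE x in lborel. x : D --> w x = w' x)"

lemma AE_lebesgue_on: "(AE x in lebesgue_on D. Q x) \<longleftrightarrow> (AE x in lborel. x : D --> Q x)"
 using D(1) by (subst AE_restrict_space_iff) (auto simp: AE_completion_iff)

lemma agreesD:
 assumes "agrees w w'"
 shows "w' : bmeas" "AE x in lborel. x : D --> w x = w' x"
  and agrees_measurable: "w : borel_measurable (lebesgue_on D)"
  and agrees_integrable: "integrable (lebesgue_on D) w \<longleftrightarrow> L1 (%x. ind D x * w' x)"
  and agrees_integral: "(LINT x|lebesgue_on D. w x) = (LBINT x. ind D x * w' x)"
proof -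
 show w' [measurable]: "w' : bmeas" and ae: "AE x in lborel. x : D --> w x = w' x" using assms by (auto simp: agrees_def)
 have ae': "AE x in lebesgue. ind D x * w' x = ind D x * w x"
  using ae by (auto simp: AE_completion_iff indicator_def elim!: eventually_mono)
 have m': "(%x. ind D x * w' x) : borel_measurable lebesgue" by (rule measurable_completion) simp
 \<comment> \<open>Preimages under the two functions differ by a null set only, so completeness of
   the measure transfers measurability.\<close>
 have m: "(%x. ind D x * w x) : borel_measurable lebesgue"
 proof (rule measurableI)
  fix A :: "real set" assume A: "A : sets borel"
  show "(%x. ind D x * w x) -` A \<inter> space lebesgue : sets lebesgue"
  proof (rule completion.in_sets_AE)
   show "(%x. ind D x * w' x) -` A \<inter> space lebesgue : sets lebesgue" by (rule measurable_sets[OF m' A])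
   show "AE x in lebesgue. (x : (%x. ind D x * w' x) -` A \<inter> space lebesgue) = (x : (%x. ind D x * w x) -` A \<inter> space lebesgue)"
    using ae' by eventually_elim auto
  qed auto
 qed auto
 have DL: "D \<inter> space lebesgue : sets lebesgue" using D(1) by simp
 show "w : borel_measurable (lebesgue_on D)"
  using m by (subst borel_measurable_restrict_space_iff[OF DL]) (simp add: mult.commute)
 have m2: "(%x. ind D x * w' x) : borel_measurable lborel" by simp
 show "integrable (lebesgue_on D) w \<longleftrightarrow> L1 (%x. ind D x * w' x)"
  unfolding integrable_restrict_space[OF DL] integrable_completion[OF m2, symmetric] real_scaleR_def
  by (intro integrable_cong_AE m m' ) (use ae' in auto)
 show "(LINT x|lebesgue_on D. w x) = (LBINT x. ind D x * w' x)"
  unfolding integral_restrict_space[OF DL] integral_completion[OF m2, symmetric] real_scaleR_def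
  by (intro integral_cong_AE m m') (use ae' in auto)
qed

lemma agrees_exists:
 assumes "w : borel_measurable (lebesgue_on D)"
 obtains w' where "agrees w w'" "!!x. x \<notin> D ==> w' x = 0"
proof -
 have DL: "D \<inter> space lebesgue : sets lebesgue" using D(1) by simp
 have "(%x. ind D x * w x) : borel_measurable lebesgue"
  using assms by (subst (asm) borel_measurable_restrict_space_iff[OF DL]) (simp add: mult.commute)
 from completion_ex_borel_measurable_real[OF this] obtain k where k: "k : borel_measurable lborel" "AE x in lborel. ind D x * w x = k x"
  by blast
 have [measurable]: "k : bmeas" using k(1) by simp
 have "agrees w (%x. ind D x * k x)" unfolding agrees_def using k(2) by (auto elim!: eventually_mono)
 thus ?thesis by (rule that) simp
qed

lemma agrees_borel: "w : bmeas ==> agrees w w"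
 by (simp add: agrees_def)

lemma agrees_comp2:
 assumes "agrees v v'" "agrees w w'" and F: "(%x. F (v' x) (w' x)) : bmeas"
 shows "agrees (%x. F (v x) (w x)) (%x. F (v' x) (w' x))"
 unfolding agrees_def
proof
 show "AE x in lborel. x : D --> F (v x) (w x) = F (v' x) (w' x)"
  using agreesD(2)[OF assms(1)] agreesD(2)[OF assms(2)] by eventually_elim auto
qed (rule F)

lemma agrees_arith:
 assumes v: "agrees v v'" and w: "agrees w w'"
 shows "agrees (%x. v x * w x) (%x. v' x * w' x)" "agrees (%x. v x - w x) (%x. v' x - w' x)"
  "agrees (%x. v x + w x) (%x. v' x + w' x)" "agrees (%x. \<bar>v x\<bar> powr p) (%x. \<bar>v' x\<bar> powr p)"
  "agrees (%x. (v x)^2) (%x. (v' x)^2)"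
proof -
 have [measurable]: "v' : bmeas" "w' : bmeas" using agreesD(1) v w by auto
 show "agrees (%x. v x * w x) (%x. v' x * w' x)" by (rule agrees_comp2[OF v w]) measurable
 show "agrees (%x. v x - w x) (%x. v' x - w' x)" by (rule agrees_comp2[OF v w]) measurable
 show "agrees (%x. v x + w x) (%x. v' x + w' x)" by (rule agrees_comp2[OF v w]) measurable
 show "agrees (%x. \<bar>v x\<bar> powr p) (%x. \<bar>v' x\<bar> powr p)"
  by (rule agrees_comp2[OF v v, where F="%a b. \<bar>a\<bar> powr p"]) measurable
 show "agrees (%x. (v x)^2) (%x. (v' x)^2)" by (rule agrees_comp2[OF v v, where F="%a b. a^2"]) measurable
qed

lemma Lp_agrees:
 assumes w: "agrees w w'" and p: "0 < p"
 shows "w : Lp_space (ereal p) D \<longleftrightarrow> L1 (%x. ind D x * \<bar>w' x\<bar> powr p)"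
  "Lp_norm (ereal p) D w powr p = (LBINT x. ind D x * \<bar>w' x\<bar> powr p)"
proof -
 note a = agrees_arith(4)[OF w w, of p]
 show "w : Lp_space (ereal p) D \<longleftrightarrow> L1 (%x. ind D x * \<bar>w' x\<bar> powr p)"
  using agrees_measurable[OF w] agrees_integrable[OF a] by (simp add: Lp_space_def)
 have "0 <= (LBINT x. ind D x * \<bar>w' x\<bar> powr p)" by (intro Bochner_Integration.integral_nonneg) auto
 thus "Lp_norm (ereal p) D w powr p = (LBINT x. ind D x * \<bar>w' x\<bar> powr p)"
  using p by (simp add: Lp_norm_def agrees_integral[OF a] powr_powr)
qed

lemma L2_agrees:
 assumes w: "agrees w w'" and w0: "!!x. x \<notin> D ==> w' x = 0"
 shows "w : Lp_space 2 D \<longleftrightarrow> L2_on D w'" "(Lp_norm 2 D w)^2 = nsq D w'"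
proof -
 have two: "(2::ereal) = ereal 2" by simp
 have e: "\<bar>w' x\<bar> powr 2 = (w' x)^2" "ind D x * (w' x)^2 = (w' x)^2" for x
  using w0[of x] by (auto simp: indicator_def)
 show "w : Lp_space 2 D \<longleftrightarrow> L2_on D w'"
  unfolding two Lp_agrees(1)[OF w zero_less_numeral] e L2_on_def using agreesD(1)[OF w] w0 by auto
 have "0 <= Lp_norm 2 D w" unfolding Lp_norm_def by (simp add: two)
 hence "(Lp_norm 2 D w)^2 = Lp_norm 2 D w powr 2" by simp
 also have "... = nsq D w'" unfolding two Lp_agrees(2)[OF w zero_less_numeral] e(1) nsq_def ..
 finally show "(Lp_norm 2 D w)^2 = nsq D w'" .
qed

lemma weak_partial_iff:
 assumes v: "agrees v v'" and g: "agrees g g'"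
  and v0: "!!x. x \<notin> D ==> v' x = 0" and g0: "!!x. x \<notin> D ==> g' x = 0"
 shows "weak_partial D i v' g' \<longleftrightarrow> (ALL ph. test_function D ph -->
    (LINT x|lebesgue_on D. v x * pd i ph x) = - (LINT x|lebesgue_on D. g x * ph x))"
proof -
 have "(LINT x|lebesgue_on D. v x * pd i ph x) = (LBINT x. v' x * pd i ph x)"
  "(LINT x|lebesgue_on D. g x * ph x) = (LBINT x. g' x * ph x)" if ph: "test_function D ph" for ph
 proof -
  note m = tf_measurable[OF ph] tf_measurable[OF tf_partial[OF ph]]
  have z: "ind D x * (v' x * a) = v' x * a" "ind D x * (g' x * a) = g' x * a" for x a
   using v0[of x] g0[of x] by (auto simp: indicator_def)
  show "(LINT x|lebesgue_on D. v x * pd i ph x) = (LBINT x. v' x * pd i ph x)"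
   "(LINT x|lebesgue_on D. g x * ph x) = (LBINT x. g' x * ph x)"
   unfolding agrees_integral[OF agrees_arith(1)[OF v agrees_borel[OF m(2)]]] agrees_integral[OF agrees_arith(1)[OF g agrees_borel[OF m(1)]]] z
   by (rule refl)+
 qed
 thus ?thesis unfolding weak_partial_def by auto
qed

lemma L2_locally_integrable:
 assumes w: "agrees w w'" and L: "L2_on D w'"
 shows "locally_integrable D w"
 unfolding locally_integrable_def
proof (intro allI impI)
 fix K assume K: "compact K & K \<subseteq> D"
 have DL: "D \<inter> space lebesgue : sets lebesgue" using D(1) by simp
 have "(%x. ind D x * w' x) = w'" using L2_onD(2)[OF L] by (auto simp: fun_eq_iff indicator_def)
 hence "integrable (lebesgue_on D) w" using agrees_integrable[OF w] L2_L1[OF L D(1,2)] by simp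
 hence "set_integrable lebesgue D w" unfolding integrable_restrict_space[OF DL] set_integrable_def .
 thus "set_integrable lebesgue K w" by (rule set_integrable_subset) (use K lmeasurable_compact in blast)+
qed

text \<open>Borel representatives for the chosen weak derivatives turn a member of
  \<open>H1_space\<close> into an instance of the locale.\<close>

lemma H1_space_agrees:
 assumes v: "v : H1_space D" and v': "agrees v v'" and v'0: "!!x. x \<notin> D ==> v' x = 0"
 obtains g where "H1_data D v' g" "!!i. agrees (weak_deriv D i v) (g i)"
proof -
 have "EX g'. L2_on D g' & agrees (weak_deriv D i v) g'" for i
 proof -
  obtain g where g: "g : Lp_space 2 D" "is_weak_deriv D i v g" using v unfolding W1_space_def by blast
  hence "g : borel_measurable (lebesgue_on D)" by (simp add: Lp_space_def)
  then obtain g' where g': "agrees g g'" "!!x. x \<notin> D ==> g' x = 0" by (rule agrees_exists) blast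
  have "AE x in lborel. x : D --> weak_deriv D i v x = g' x"
   using weak_deriv_eq[OF D(1) g(2), unfolded AE_lebesgue_on] agreesD(2)[OF g'(1)] by eventually_elim auto
  hence "agrees (weak_deriv D i v) g'" using agreesD(1)[OF g'(1)] by (simp add: agrees_def)
  thus ?thesis using L2_agrees(1)[OF g'] g(1) by blast
 qed
 then obtain g where g: "!!i. L2_on D (g i)" "!!i. agrees (weak_deriv D i v) (g i)" by metis
 have vL: "v : Lp_space 2 D" using v by (simp add: W1_space_def)
 have "weak_partial D i v' (g i)" for i
 proof -
  have wd: "is_weak_deriv D i v (weak_deriv D i v)" using v is_weak_deriv_weak_deriv unfolding W1_space_def by blast
  show ?thesis
   by (rule iffD2[OF weak_partial_iff[OF v' g(2)[of i] v'0 L2_onD(2)[OF g(1)[of i]]]]) (use wd in \<open>auto simp: is_weak_deriv_def\<close>)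
 qed
 hence "H1_data D v' g" using D g(1) L2_agrees(1)[OF v' v'0] vL by unfold_locales auto
 thus ?thesis using g(2) by (rule that)
qed

lemma H1_data_diff:
 assumes "H1_data D v g" "H1_data D w k"
 shows "H1_data D (%x. v x - w x) (%i x. g i x - k i x)"
proof -
 interpret v: H1_data D v g by fact
 interpret w: H1_data D w k by fact
 have L: "L2_on D (%x. a x - b x)" if "L2_on D a" "L2_on D b" for a b
  using L2_on_add_cmult[OF that, of 1 "-1"] by simp
 have i: "L1 (%x. a x * ph x)" if a: "L2_on D a" and ph: "test_function D ph" for a ph
 proof -
  obtain B where B: "!!x. \<bar>ph x\<bar> <= B" using tf_bounded[OF ph] by metis
  have "L1 (%x. ph x * a x)" by (rule L1_bounded_mult[OF L2_L1[OF a D(1,2)] _ B]) (use tf_measurable[OF ph] in simp)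
  thus ?thesis by (simp add: mult.commute)
 qed
 show ?thesis
 proof
  show "weak_partial D i (%x. v x - w x) (%x. g i x - k i x)" for i
   unfolding weak_partial_def left_diff_distrib
  proof (intro allI impI)
   fix ph assume ph: "test_function D ph"
   show "(LBINT x. v x * pd i ph x - w x * pd i ph x) = - (LBINT x. g i x * ph x - k i x * ph x)"
    using i[OF v.u tf_partial[OF ph]] i[OF w.u tf_partial[OF ph]] i[OF v.g ph] i[OF w.g ph]
     v.u_g[unfolded weak_partial_def] w.u_g[unfolded weak_partial_def] ph by simp
  qed
 qed (use L v.u w.u v.g w.g in auto)
qed

lemma H1_data_test_function:
 assumes ph: "test_function D ph"
 shows "H1_data D ph (%i. pd i ph)"
proof -
 have L: "L2_on D ps" if ps: "test_function D ps" for ps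
 proof -
  obtain B where "!!x. \<bar>ps x\<bar> <= B" using tf_bounded[OF ps] by metis
  from L2_on_mult_indicator_bounded[OF D_measurable D(2) tf_measurable[OF ps] this]
  have "L2_on D (%x. ps x * ind D x)" .
  moreover have "(%x. ps x * ind D x) = ps"
   using ps closure_subset[of "{x. ps x ~= 0}"] by (fastforce simp: test_function_def fun_eq_iff indicator_def)
  ultimately show ?thesis by simp
 qed
 show ?thesis
 proof
  show "weak_partial D i ph (pd i ph)" for i
   unfolding weak_partial_def
  proof (intro allI impI)
   fix ps assume ps: "test_function D ps"
   obtain M where M: "!!x y. \<bar>ph x - ph y\<bar> <= M * norm (x - y)" using tf_lipschitz[OF ph] by metis
   obtain B where B: "!!x. \<bar>ph x\<bar> <= B" using tf_bounded[OF ph] by metis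
   show "(LBINT x. ph x * pd i ps x) = - (LBINT x. pd i ph x * ps x)"
    by (rule lipschitz_integration_by_parts_test_function[OF M B tf_measurable[OF tf_partial[OF ph]] _ ps])
     (use tf_difference_quotient[OF ph] in auto)
  qed
 qed (use L ph tf_partial in auto)
qed

end

text \<open>The way back: the locale data determine the abstract weak derivatives, norms and
  seminorms of every function that agrees with them.\<close>

lemma (in H1_data) H1_agrees:
 assumes v: "agrees v u"
 shows "is_weak_deriv D i v (g i)" "agrees (weak_deriv D i v) (g i)" "v : H1_space D"
  "(Lp_norm 2 D v)^2 = nsq D u" "(H1_seminorm D v)^2 = (SUM i:UNIV. nsq D (g i))"
  "(H1_norm D v)^2 = nsq D u + (SUM i:UNIV. nsq D (g i))"
proof -
 have ga: "agrees (g i) (g i)" for i by (intro agrees_borel) simp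
 have wd: "is_weak_deriv D i v (g i)" for i
  unfolding is_weak_deriv_def
  using weak_partial_iff[OF v ga L2_onD(2)[OF u] L2_onD(2)[OF g]] u_g L2_locally_integrable[OF v u] L2_locally_integrable[OF ga g] by blast
 thus "is_weak_deriv D i v (g i)" .
 have wa: "agrees (weak_deriv D i v) (g i)" for i
  using weak_deriv_eq[OF D(1) wd, unfolded AE_lebesgue_on] by (simp add: agrees_def)
 thus "agrees (weak_deriv D i v) (g i)" .
 show "v : H1_space D"
  unfolding W1_space_def using wd L2_agrees(1)[OF v L2_onD(2)[OF u]] u L2_agrees(1)[OF ga L2_onD(2)[OF g]] g by blast
 show L: "(Lp_norm 2 D v)^2 = nsq D u" by (rule L2_agrees(2)[OF v L2_onD(2)[OF u]])
 have "agrees (%x. (weak_deriv D 1 v x)^2 + (weak_deriv D 2 v x)^2) (%x. (g 1 x)^2 + (g 2 x)^2)"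
  by (intro agrees_arith(3)[OF agrees_arith(5)[OF wa wa] agrees_arith(5)[OF wa wa]])
 from agrees_integral[OF this]
 have "(LINT x|lebesgue_on D. (norm (weak_gradient D v x))^2) = (LBINT x. ind D x * (g 1 x)^2 + ind D x * (g 2 x)^2)"
  by (simp add: norm_square_2 sum_2 weak_gradient_def distrib_left)
 also have "... = (SUM i:UNIV. nsq D (g i))" using L2_square[OF g D_measurable] by (simp add: nsq_def sum_2)
 finally show S: "(H1_seminorm D v)^2 = (SUM i:UNIV. nsq D (g i))"
  unfolding H1_seminorm_def by (simp add: sum_nonneg nsq_nonneg)
 show "(H1_norm D v)^2 = nsq D u + (SUM i:UNIV. nsq D (g i))" unfolding H1_norm_def L S by (simp add: sum_nonneg nsq_nonneg)
qed

text \<open>Closeness in the \<open>H1\<close> norm is equivalent to closeness of the function and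
  of both derivatives in square mean; three errors of e^2/4 stay below e^2.\<close>

lemma (in H1_data) H10_space_iff:
 assumes v: "agrees v u"
 shows "v : H10_space D \<longleftrightarrow> H10_limit"
proof -
 have key: "(H1_norm D (%x. v x - ph x))^2 = nsq D (%x. u x - ph x) + (SUM i:UNIV. nsq D (%x. g i x - pd i ph x))"
  "ennreal (nsq D (%x. u x - ph x)) = nnI D (%x. (ph x - u x)^2)"
  "ennreal (nsq D (%x. g i x - pd i ph x)) = nnI D (%x. (pd i ph x - g i x)^2)"
  if ph: "test_function D ph" for ph i
 proof -
  interpret d: H1_data D "%x. u x - ph x" "%i x. g i x - pd i ph x"
   by (rule H1_data_diff[OF H1_data_axioms H1_data_test_function[OF ph]])
  show "(H1_norm D (%x. v x - ph x))^2 = nsq D (%x. u x - ph x) + (SUM i:UNIV. nsq D (%x. g i x - pd i ph x))"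
   by (rule d.H1_agrees(6)[OF agrees_arith(2)[OF v agrees_borel[OF tf_measurable[OF ph]]]])
  show "ennreal (nsq D (%x. u x - ph x)) = nnI D (%x. (ph x - u x)^2)"
   using nn_integral_nsq[OF d.u D_measurable] by (simp add: power2_commute)
  show "ennreal (nsq D (%x. g i x - pd i ph x)) = nnI D (%x. (pd i ph x - g i x)^2)"
   using nn_integral_nsq[OF d.g D_measurable] by (simp add: power2_commute)
 qed
 have lim: "H10_limit \<longleftrightarrow> (ALL e>0. EX ph. test_function D ph & nsq D (%x. u x - ph x) <= e & (ALL i. nsq D (%x. g i x - pd i ph x) <= e))"
  unfolding H10_limit_def by (intro all_cong ex_cong1 conj_cong refl) (simp_all add: key(2,3)[symmetric])
 have n0: "0 <= H1_norm D w" for w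
  unfolding H1_norm_def by simp
 show ?thesis unfolding H10_space_def mem_Collect_eq lim
 proof (intro iffI conjI allI impI)
  show "v : H1_space D" by (rule H1_agrees(3)[OF v])
  fix e :: real assume e: "0 < e"
  {
   assume "v : H1_space D & (ALL \<epsilon>>0. EX ph. test_function D ph & H1_norm D (%x. v x - ph x) < \<epsilon>)"
   then obtain ph where ph: "test_function D ph" "H1_norm D (%x. v x - ph x) < sqrt e" using e by (metis real_sqrt_gt_zero)
   have "(H1_norm D (%x. v x - ph x))^2 <= (sqrt e)^2" using ph(2) n0 by (intro power_mono) auto
   hence le: "nsq D (%x. u x - ph x) + (nsq D (%x. g 1 x - pd 1 ph x) + nsq D (%x. g 2 x - pd 2 ph x)) <= e"
    unfolding key(1)[OF ph(1)] using e by (simp add: sum_2)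
   have "ALL i. nsq D (%x. g i x - pd i ph x) <= e"
    using le nsq_nonneg[of D "%x. u x - ph x"] nsq_nonneg[of D "%x. g 1 x - pd 1 ph x"] nsq_nonneg[of D "%x. g 2 x - pd 2 ph x"]
    unfolding forall_2 by linarith
   moreover have "nsq D (%x. u x - ph x) <= e"
    using le nsq_nonneg[of D "%x. g 1 x - pd 1 ph x"] nsq_nonneg[of D "%x. g 2 x - pd 2 ph x"] by linarith
   ultimately show "EX ph. test_function D ph & nsq D (%x. u x - ph x) <= e & (ALL i. nsq D (%x. g i x - pd i ph x) <= e)"
    using ph(1) by blast
  next
   assume "ALL e>0. EX ph. test_function D ph & nsq D (%x. u x - ph x) <= e & (ALL i. nsq D (%x. g i x - pd i ph x) <= e)"
   moreover have "0 < e^2 / 4" using e by simp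
   ultimately obtain ph where ph: "test_function D ph" "nsq D (%x. u x - ph x) <= e^2 / 4"
    "!!i. nsq D (%x. g i x - pd i ph x) <= e^2 / 4" by blast
   have "(H1_norm D (%x. v x - ph x))^2 <= e^2 / 4 + (e^2 / 4 + e^2 / 4)"
    unfolding key(1)[OF ph(1)] sum_2 by (intro add_mono ph(2,3))
   also have "... < e^2" using e by simp
   finally have "H1_norm D (%x. v x - ph x) < e" using e by (intro power2_less_imp_less[of _ e]) auto
   thus "EX ph. test_function D ph & H1_norm D (%x. v x - ph x) < e" using ph(1) by blast
  }
 qed
qed


context convex_domain
begin

lemma nn_integral_lebesgue_on:
 assumes "AE x in lborel. x : D --> F x = F' x"
 shows "(\<integral>\<^sup>+ x. F x \<partial>lebesgue_on D) = NI (%x. F' x * ind D x)"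
proof -
 have DL: "D \<inter> space lebesgue : sets lebesgue" using D(1) by simp
 show ?thesis
  unfolding nn_integral_restrict_space[OF DL] nn_integral_completion using assms
  by (intro nn_integral_cong_AE) (auto simp: indicator_def elim!: eventually_mono)
qed

text \<open>Jensen's inequality with exponent p/2 on the bounded set \<open>D\<close>; p = 2 is
  treated apart because that inequality is stated for exponents above 1.\<close>

lemma Lp_L2:
 assumes p: "2 <= p" and w: "w : Lp_space (ereal p) D" and w': "agrees w w'" "!!x. x \<notin> D ==> w' x = 0"
  and A0: "emeasure lborel D = ennreal A0" "0 < A0"
 shows "L2_on D w'" "nsq D w' <= A0 * (1 / A0) powr (2 / p) * (Lp_norm (ereal p) D w)^2" "0 <= Lp_norm (ereal p) D w"
proof -
 let ?J = "LBINT x. ind D x * \<bar>w' x\<bar> powr p"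
 have p0: "0 < p" using p by simp
 have [measurable]: "w' : bmeas" by (rule agreesD(1)[OF w'(1)])
 have ip: "L1 (%x. ind D x * \<bar>w' x\<bar> powr p)" using w Lp_agrees(1)[OF w'(1) p0] by simp
 show N0: "0 <= Lp_norm (ereal p) D w" by (simp add: Lp_norm_def)
 have J: "Lp_norm (ereal p) D w powr p = ?J" by (rule Lp_agrees(2)[OF w'(1) p0])
 have "L1 (%x. (w' x)^2)"
 proof (rule Bochner_Integration.integrable_bound)
  show "L1 (%x. ind D x + ind D x * \<bar>w' x\<bar> powr p)" using ip integrable_ind[OF D_measurable D(2)] by auto
  show "AE x in lborel. norm ((w' x)^2) <= norm (ind D x + ind D x * \<bar>w' x\<bar> powr p)"
  proof (intro AE_I2)
   fix x
   have "(w' x)^2 <= 1 + \<bar>w' x\<bar> powr p"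
   proof (cases "\<bar>w' x\<bar> <= 1")
    case True
    hence "(w' x)^2 <= 1" by (simp add: abs_square_le_1)
    thus ?thesis using powr_ge_zero[of "\<bar>w' x\<bar>" p] by linarith
   next
    case False
    hence "\<bar>w' x\<bar> powr 2 <= \<bar>w' x\<bar> powr p" using p by (intro powr_mono) auto
    thus ?thesis by simp
   qed
   thus "norm ((w' x)^2) <= norm (ind D x + ind D x * \<bar>w' x\<bar> powr p)"
    using w'(2)[of x] by (cases "x : D") auto
  qed
 qed measurable
 thus L: "L2_on D w'" using w'(2) by (auto simp: L2_on_def)
 show "nsq D w' <= A0 * (1 / A0) powr (2 / p) * (Lp_norm (ereal p) D w)^2"
 proof (cases "p = 2")
  case True
  thus ?thesis using L2_agrees(2)[OF w'] A0 by simp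
 next
  case False
  have "ennreal (A0 * (nsq D w' / A0) powr (p / 2)) <= nnI D (%x. ((w' x)^2) powr (p / 2))"
   using False p nn_integral_nsq[OF L D_measurable] nsq_nonneg by (intro powr_mean_le A0) auto
  also have "... = NI (%x. ennreal (ind D x * \<bar>w' x\<bar> powr p))"
  proof (intro nn_integral_cong)
   fix x
   have "((w' x)^2) powr (p / 2) = \<bar>w' x\<bar> powr p" using powr_powr[of "\<bar>w' x\<bar>" 2 "p / 2"] by simp
   thus "ennreal (((w' x)^2) powr (p / 2)) * ind D x = ennreal (ind D x * \<bar>w' x\<bar> powr p)"
    by (simp add: indicator_def)
  qed
  also have "... = ennreal ?J" by (rule nn_integral_eq_integral[OF ip]) simp
  finally have "A0 * (nsq D w' / A0) powr (p / 2) <= Lp_norm (ereal p) D w powr p"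
   unfolding J[symmetric] by (subst (asm) ennreal_le_iff) auto
  hence "(nsq D w' / A0) powr (p / 2) <= (1 / A0) * Lp_norm (ereal p) D w powr p" using A0 by (simp add: field_simps)
  hence "((nsq D w' / A0) powr (p / 2)) powr (2 / p) <= ((1 / A0) * Lp_norm (ereal p) D w powr p) powr (2 / p)"
   using p by (intro powr_mono2) auto
  hence "nsq D w' / A0 <= (1 / A0) powr (2 / p) * (Lp_norm (ereal p) D w)^2"
   unfolding powr_mult using p A0 N0 nsq_nonneg[of D w'] by (simp add: powr_powr)
  thus ?thesis using A0 by (simp add: field_simps)
 qed
qed

lemma Linfty_AE:
 assumes w: "w : Lp_space \<infinity> D"
 shows "AE x in lborel. x : D --> \<bar>w x\<bar> <= Lp_norm \<infinity> D w" "0 <= Lp_norm \<infinity> D w"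
proof -
 let ?s = "esssup (lebesgue_on D) (%x. ereal \<bar>w x\<bar>)"
 have fin: "?s < \<infinity>" using w by (simp add: Lp_space_def)
 have "AE x in lborel. x : D --> ereal \<bar>w x\<bar> <= ?s"
  using esssup_AE[of "%x. ereal \<bar>w x\<bar>" "lebesgue_on D"] unfolding AE_lebesgue_on .
 thus ae: "AE x in lborel. x : D --> \<bar>w x\<bar> <= Lp_norm \<infinity> D w"
 proof eventually_elim
  fix x assume "x : D --> ereal \<bar>w x\<bar> <= ?s"
  thus "x : D --> \<bar>w x\<bar> <= Lp_norm \<infinity> D w"
   using fin by (cases ?s) (auto simp: Lp_norm_def)
 qed
 show "0 <= Lp_norm \<infinity> D w"
 proof (rule ccontr)
  assume "~ 0 <= Lp_norm \<infinity> D w"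
  hence "AE x in lborel. x \<notin> D" using ae by (auto elim!: eventually_mono)
  hence "emeasure lborel D = 0" by (subst (asm) AE_iff_measurable[of D]) auto
  moreover obtain A0 where "emeasure lborel D = ennreal A0" "0 < A0" using area by blast
  ultimately show False by simp
 qed
qed

text \<open>Values above the essential supremum are set to zero, so that the bound holds at every
  point, as the estimates for products and variances require.\<close>

lemma Linfty_agrees:
 assumes w: "w : Lp_space \<infinity> D"
 obtains w' where "agrees w w'" "L2_on D w'" "!!x. \<bar>w' x\<bar> <= Lp_norm \<infinity> D w"
proof -
 let ?B = "Lp_norm \<infinity> D w"
 note B = Linfty_AE[OF w]
 have "w : borel_measurable (lebesgue_on D)" using w by (simp add: Lp_space_def)
 then obtain k where k: "agrees w k" "!!x. x \<notin> D ==> k x = 0" by (rule agrees_exists) blast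
 have [measurable]: "k : bmeas" by (rule agreesD(1)[OF k(1)])
 define w' where "w' x = (if \<bar>k x\<bar> <= ?B then k x else 0)" for x
 have w'm [measurable]: "w' : bmeas" unfolding w'_def[abs_def] by measurable
 have "AE x in lborel. x : D --> w x = w' x" using B(1) agreesD(2)[OF k(1)] by eventually_elim (auto simp: w'_def)
 hence a: "agrees w w'" by (simp add: agrees_def)
 have b: "\<bar>w' x\<bar> <= ?B" for x using B(2) by (simp add: w'_def)
 have "L2_on D (%x. w' x * ind D x)" by (rule L2_on_mult_indicator_bounded[OF D_measurable D(2) w'm b])
 moreover have "(%x. w' x * ind D x) = w'" using k(2) by (auto simp: fun_eq_iff w'_def indicator_def)
 ultimately show ?thesis using that a b by simp
qed

text \<open>One interface for finite and infinite \<open>p\<close>: of the load, the estimates use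
  square integrability and a bound of its square norm by the \<open>Lp\<close> norm.\<close>

lemma Lp_agrees_L2:
 assumes p: "2 <= p" and w: "w : Lp_space p D"
 obtains w' C where "agrees w w'" "L2_on D w'" "0 <= C" "nsq D w' <= (C * Lp_norm p D w)^2" "0 <= Lp_norm p D w"
proof -
 obtain A0 where A0: "emeasure lborel D = ennreal A0" "0 < A0" using area by blast
 show ?thesis
 proof (cases p)
  case (real r)
  hence r: "2 <= r" "w : Lp_space (ereal r) D" using p w by auto
  have "w : borel_measurable (lebesgue_on D)" using w by (simp add: Lp_space_def)
  then obtain w' where w': "agrees w w'" "!!x. x \<notin> D ==> w' x = 0" by (rule agrees_exists) blast
  note L = Lp_L2[OF r w' A0]
  have "A0 * (1 / A0) powr (2 / r) * (Lp_norm (ereal r) D w)^2 = (sqrt (A0 * (1 / A0) powr (2 / r)) * Lp_norm p D w)^2"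
   using A0 real by (simp add: power_mult_distrib)
  thus ?thesis using L w'(1) A0 real by (intro that[of w' "sqrt (A0 * (1 / A0) powr (2 / r))"]) auto
 next
  case PInf
  hence w: "w : Lp_space \<infinity> D" using w by simp
  obtain w' where w': "agrees w w'" "L2_on D w'" "!!x. \<bar>w' x\<bar> <= Lp_norm \<infinity> D w"
   by (rule Linfty_agrees[OF w]) blast
  have [measurable]: "w' : bmeas" by (rule agreesD(1)[OF w'(1)])
  have "nsq D w' <= (LBINT x. ind D x * (Lp_norm \<infinity> D w)^2)" unfolding nsq_def
  proof (rule integral_mono)
   have "(w' x)^2 <= (Lp_norm \<infinity> D w)^2" for x using w'(3)[of x] by (metis abs_ge_zero power2_abs power_mono)
   thus "ind D x * (w' x)^2 <= ind D x * (Lp_norm \<infinity> D w)^2" for x by (simp add: indicator_def)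
  qed (use L2_square[OF w'(2) D_measurable] integrable_ind[OF D_measurable D(2)] in auto)
  also have "... = A0 * (Lp_norm \<infinity> D w)^2" using A0 by (simp add: measure_def)
  also have "... = (sqrt A0 * Lp_norm p D w)^2" using A0 PInf by (simp add: power_mult_distrib)
  finally show ?thesis using w'(1,2) A0 PInf Linfty_AE(2)[OF w] by (intro that[of w' "sqrt A0"]) auto
 qed (use p in auto)
qed

end

text \<open>Both definitions of the seminorm lead to the factor h powr (s q), with the constant 1/c
  for s < 1 and 32 powr (q/2) for s = 1; the sum of the constants serves both.\<close>

lemma (in triangulation) var_at_W_seminorm:
 assumes s: "0 < s" "s <= 1" and q: "2 < q" and w: "w : W_space s q D" and w': "agrees w w'" "L2_on D w'"
 shows "nnI D (%x. var_at w' x powr (q / 2)) <=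
  ennreal ((1 / c + 32 powr (q / 2)) * (h powr (s * q) * W_seminorm s q D w powr q))"
proof (cases "s = 1")
 case False
 let ?Q = "%w x z. ennreal (\<bar>w x - w z :: real\<bar> powr q / norm (x - z) powr (2 + s * q))"
 let ?S = "slobodeckij_integral s q D w"
 have fin: "?S < \<infinity>" and W: "W_seminorm s q D w = enn2real ?S powr (1 / q)"
  using w False by (auto simp: W_space_def W_seminorm_def)
 note ae = agreesD(2)[OF w'(1)]
 have "?S = NI (%x. (NI (%z. ?Q w' x z * ind D z)) * ind D x)" unfolding slobodeckij_integral_def
 proof (rule nn_integral_lebesgue_on)
  show "AE x in lborel. x : D --> (\<integral>\<^sup>+ z. ?Q w x z \<partial>lebesgue_on D) = NI (%z. ?Q w' x z * ind D z)"
   using ae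
  proof eventually_elim
   fix x assume x: "x : D --> w x = w' x"
   show "x : D --> (\<integral>\<^sup>+ z. ?Q w x z \<partial>lebesgue_on D) = NI (%z. ?Q w' x z * ind D z)"
   proof
    assume "x : D"
    thus "(\<integral>\<^sup>+ z. ?Q w x z \<partial>lebesgue_on D) = NI (%z. ?Q w' x z * ind D z)"
     using ae x by (intro nn_integral_lebesgue_on) (auto elim!: eventually_mono)
   qed
  qed
 qed
 hence "nnI D (%x. var_at w' x powr (q / 2)) <= ennreal (h powr (s * q) / c) * ?S"
  using var_at_slobodeckij[OF w'(2) s(1) q] by simp
 also have "?S = ennreal (W_seminorm s q D w powr q)" unfolding W using fin q by (simp add: powr_powr ennreal_enn2real_if)
 also have "ennreal (h powr (s * q) / c) * ennreal (W_seminorm s q D w powr q) =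
   ennreal ((1 / c) * (h powr (s * q) * W_seminorm s q D w powr q))"
  using c by (simp add: ennreal_mult[symmetric])
 also have "... <= ennreal ((1 / c + 32 powr (q / 2)) * (h powr (s * q) * W_seminorm s q D w powr q))"
  by (intro ennreal_leI mult_right_mono) auto
 finally show ?thesis .
next
 case True
 have q0: "0 < q" using q by simp
 obtain A0 where A0: "emeasure lborel D = ennreal A0" "0 < A0" using area by blast
 have w1: "w : Lp_space (ereal q) D" "!!i. EX g:Lp_space (ereal q) D. is_weak_deriv D i w g"
  using w True by (auto simp: W_space_def W1_space_def)
 have two: "2 <= q" using q by simp
 have L2I: "g : Lp_space 2 D" if g: "g : Lp_space (ereal q) D" for g
 proof -
  have "g : borel_measurable (lebesgue_on D)" using g by (simp add: Lp_space_def)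
  then obtain g' where g': "agrees g g'" "!!x. x \<notin> D ==> g' x = 0" by (rule agrees_exists) blast
  show ?thesis using L2_agrees(1)[OF g'] Lp_L2(1)[OF two g g' A0] by simp
 qed
 have wH: "w : H1_space D" unfolding W1_space_def using w1 L2I by blast
 obtain g where g: "H1_data D w' g" "!!i. agrees (weak_deriv D i w) (g i)"
  by (rule H1_space_agrees[OF wH w'(1) L2_onD(2)[OF w'(2)]]) (auto intro: that)
 have ig: "L1 (%x. ind D x * \<bar>g i x\<bar> powr q)" for i
 proof -
  obtain k where k: "k : Lp_space (ereal q) D" "is_weak_deriv D i w k" using w1(2) by blast
  have "AE x in lborel. x : D --> k x = g i x"
   using weak_deriv_eq[OF D(1) k(2), unfolded AE_lebesgue_on] agreesD(2)[OF g(2)[of i]] by eventually_elim auto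
  hence "agrees k (g i)" using agreesD(1)[OF g(2)] by (simp add: agrees_def)
  thus ?thesis using Lp_agrees(1)[OF _ q0] k(1) by blast
 qed
 have "nnI D (%x. \<bar>g i x\<bar> powr q) = ennreal (Lp_norm (ereal q) D (weak_deriv D i w) powr q)" for i
 proof -
  have "nnI D (%x. \<bar>g i x\<bar> powr q) = NI (%x. ennreal (ind D x * \<bar>g i x\<bar> powr q))"
   by (intro nn_integral_cong) (auto simp: indicator_def)
  also have "... = ennreal (LBINT x. ind D x * \<bar>g i x\<bar> powr q)" by (rule nn_integral_eq_integral[OF ig]) simp
  finally show ?thesis unfolding Lp_agrees(2)[OF g(2) q0] .
 qed
 hence "nnI D (%x. var_at w' x powr (q / 2)) <=
   ennreal (32 powr (q / 2) * h powr q) * (SUM i:UNIV. ennreal (Lp_norm (ereal q) D (weak_deriv D i w) powr q))"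
  using var_at_H1[OF g(1) q] by simp
 also have "(SUM i:UNIV. ennreal (Lp_norm (ereal q) D (weak_deriv D i w) powr q)) = ennreal (W_seminorm s q D w powr q)"
  using True q0 by (subst sum_ennreal) (auto simp: W_seminorm_def powr_powr sum_nonneg)
 also have "ennreal (32 powr (q / 2) * h powr q) * ennreal (W_seminorm s q D w powr q) =
   ennreal (32 powr (q / 2) * (h powr (s * q) * W_seminorm s q D w powr q))"
  using True by (simp add: ennreal_mult[symmetric] mult.assoc)
 also have "... <= ennreal ((1 / c + 32 powr (q / 2)) * (h powr (s * q) * W_seminorm s q D w powr q))"
  using c by (intro ennreal_leI mult_right_mono) auto
 finally show ?thesis .
qed

lemma (in sampled_fem) mean_square_error:
 assumes u0: H10_limit
  and P: "prob_space P" and Z: "uniform_samples P \<T> Z"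
  and U: "!!om. om : space P ==> U om : fe_space D \<T>"
  and lower: "AE x in lborel. x : D --> \<sigma>\<^sub>0 <= \<sigma> x"
  and MC: "AE om in P. ALL w:fe_space D \<T>. (SUM T:\<T>. area T * \<sigma> (Z T om) * (slope (U om) T \<bullet> slope w T)) =
   (SUM T:\<T>. area T * f (Z T om) * w (Z T om))"
  and A0: "emeasure lborel D = ennreal A0" "0 < A0"
  and R: "0 < R" "!!x y. x : closure D ==> y : closure D ==> norm (y - x) <= R"
  and q: "2 < q" and A: "0 <= A" and W: "0 <= W"
  and VA: "nnI D (%x. var_at \<sigma> x powr (q / 2)) <= ennreal (A * (h powr (s * q) * W powr q))"
 shows "(\<integral>\<^sup>+ om. ennreal (grad_err (U om)) \<partial>P) <= ennreal (
  (32 + 18 / c^2) * (2 + 30 * B^2 / \<sigma>\<^sub>0\<^sup>2) * (h^2 * ((SUM i:UNIV. nsq D (g i)) + hess D)) +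
  20 / \<sigma>\<^sub>0\<^sup>2 * (A / A0) powr (2 / q) * (16 + 40 * R^2 / (1 - 2 / q)^2) * ((h powr s)^2 * W^2 * ((SUM i:UNIV. nsq D (g i)) + hess D)) +
  10 / \<sigma>\<^sub>0\<^sup>2 * (2 + 16 * pi * (2 + (\<bar>ln (3 * R / (2 * c))\<bar> + 1) / ln 2)) * (max 1 (ln (1 / h)) * h^2 * nsq D f))"
proof -
 let ?H = "(SUM i:UNIV. nsq D (g i)) + hess D" and ?l = "max 1 (ln (1 / h))" and ?C = "32 + 18 / c^2"
  and ?K = "2 + (\<bar>ln (3 * R / (2 * c))\<bar> + 1) / ln 2" and ?w = "16 + 40 * R^2 / (1 - 2 / q)^2"
 have g0: "0 <= (SUM i:UNIV. nsq D (g i))" by (intro sum_nonneg nsq_nonneg)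
 obtain v where v: "v : fe_space D \<T>"
  "(SUM T:\<T>. SUM i:UNIV. LBINT x. ind T x * (g i x - slope v T $ i)^2) <= ?C * h^2 * hess D"
  by (rule interpolation_error[OF u0]) blast
 have "?C * h^2 * hess D <= ?C * h^2 * ?H" using g0 c by (intro mult_left_mono) auto
 hence E: "grad_err v <= ?C * h^2 * ?H"
  using v(2) unfolding gradient_error_eq grad_err_def by (rule order_trans[rotated])
 have Rd: "norm (y - x) <= R" if "x : D" "y : D" for x y using R(2) that closure_subset[of D] by blast
 have "0 <= A * (h powr (s * q) * W powr q)" using A by simp
 from variance_term[OF sg A0 Rd q this VA, of v]
 have V: "(SUM T:\<T>. area T * (norm (slope v T))^2 * var \<sigma> T) <=
   2 * B^2 * grad_err v + 2 * ((A * (h powr (s * q) * W powr q) / A0) powr (2 / q) * ?w * ?H)"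
  unfolding gradient_error_eq grad_err_def .
 \<comment> \<open>The weighted Sobolev inequality takes the root of order q/2, and powr (2/q) turns
   h powr (s q) and W powr q into squares.\<close>
 have pw: "(A * (h powr (s * q) * W powr q) / A0) powr (2 / q) = (A / A0) powr (2 / q) * ((h powr s)^2 * W^2)"
 proof -
  have "(A * (h powr (s * q) * W powr q) / A0) powr (2 / q) = (A / A0) powr (2 / q) * ((h powr (s * q)) powr (2 / q) * (W powr q) powr (2 / q))"
   using A A0 by (simp add: powr_mult[symmetric])
  also have "(h powr (s * q)) powr (2 / q) = (h powr s)^2" using q h by (simp add: powr_powr powr_power mult.commute)
  also have "(W powr q) powr (2 / q) = W^2" using q W by (simp add: powr_powr)
  finally show ?thesis .
 qed
 have K: "0 <= gram T T" "gram T T <= 4 * pi * ?K * ?l" if T: "T : \<T>" for T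
  using gram_diagonal[OF kernel_bound[OF T R]] by (auto intro!: mult_nonneg_nonneg add_nonneg_nonneg divide_nonneg_nonneg)
 \<comment> \<open>The load term without logarithm is absorbed into the logarithmic one, because max
   1 (ln (1/h)) is at least 1.\<close>
 have gen: "2 + 4 * (4 * pi * k * l) <= (2 + 16 * pi * k) * l" if "1 <= l" for k l :: real
  using that by (simp add: distrib_right)
 have K0: "0 <= ?K" by (intro add_nonneg_nonneg divide_nonneg_nonneg) auto
 have "2 * grad_err v + 10 / \<sigma>\<^sub>0\<^sup>2 *
   (B^2 * grad_err v + (SUM T:\<T>. area T * (norm (slope v T))^2 * var \<sigma> T) + (2 + 4 * (4 * pi * ?K * ?l)) * h^2 * nsq D f)
  <= 2 * grad_err v + 10 / \<sigma>\<^sub>0\<^sup>2 *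
   (B^2 * grad_err v + (2 * B^2 * grad_err v + 2 * ((A / A0) powr (2 / q) * ((h powr s)^2 * W^2) * ?w * ?H)) + (2 + 16 * pi * ?K) * ?l * h^2 * nsq D f)"
 proof (intro add_left_mono mult_left_mono add_mono mult_right_mono)
  show "(SUM T:\<T>. area T * (norm (slope v T))^2 * var \<sigma> T) <=
    2 * B^2 * grad_err v + 2 * ((A / A0) powr (2 / q) * ((h powr s)^2 * W^2) * ?w * ?H)"
   using V unfolding pw .
  show "2 + 4 * (4 * pi * ?K * ?l) <= (2 + 16 * pi * ?K) * ?l" by (rule gen) simp
 qed (auto simp: nsq_nonneg)
 also have "... = (2 + 30 * B^2 / \<sigma>\<^sub>0\<^sup>2) * grad_err v +
   20 / \<sigma>\<^sub>0\<^sup>2 * (A / A0) powr (2 / q) * ?w * ((h powr s)^2 * W^2 * ?H) +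
   10 / \<sigma>\<^sub>0\<^sup>2 * (2 + 16 * pi * ?K) * (?l * h^2 * nsq D f)"
  by (simp add: algebra_simps add_divide_distrib)
 also have "... <= (2 + 30 * B^2 / \<sigma>\<^sub>0\<^sup>2) * (?C * h^2 * ?H) +
   20 / \<sigma>\<^sub>0\<^sup>2 * (A / A0) powr (2 / q) * ?w * ((h powr s)^2 * W^2 * ?H) +
   10 / \<sigma>\<^sub>0\<^sup>2 * (2 + 16 * pi * ?K) * (?l * h^2 * nsq D f)"
  by (intro add_right_mono mult_left_mono E) auto
 also have "(2 + 30 * B^2 / \<sigma>\<^sub>0\<^sup>2) * (?C * h^2 * ?H) = ?C * (2 + 30 * B^2 / \<sigma>\<^sub>0\<^sup>2) * (h^2 * ?H)" by (simp only: mult_ac)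
 finally show ?thesis
  by (intro order_trans[OF expected_error[OF P Z v(1) U lower MC K]] ennreal_leI)
qed


section \<open>From the mean square error to the stated norms\<close>

lemma L2_H10_norm_le:
 assumes "(\<integral>\<^sup>+ om. ennreal ((H1_seminorm D (X om))^2) \<partial>P) <= ennreal x" "x <= y^2" "0 <= y"
 shows "L2_H10_norm P D X <= ennreal y"
proof -
 let ?E = "\<integral>\<^sup>+ om. ennreal ((H1_seminorm D (X om))^2) \<partial>P"
 have E: "?E <= ennreal (y^2)" using assms(1) ennreal_leI[OF assms(2)] by (rule order_trans)
 hence fin: "?E ~= \<infinity>" by (auto simp: top_unique)
 have "enn2real ?E <= y^2" using enn2real_mono[OF E] by simp
 hence "sqrt (enn2real ?E) <= y" using assms(3) by (intro real_le_lsqrt) auto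
 thus ?thesis unfolding L2_H10_norm_def Let_def using fin by (simp add: ennreal_leI)
qed

text \<open>A logarithm is dominated by every power; the exponent 4/r becomes 2/r under the root,
  and this turns the factor h into exactly h powr (1 - 2/r).\<close>

lemma sqrt_log_mult_le:
 assumes h: "0 < h" "h <= 1" and r: "0 < r"
 shows "sqrt (max 1 (ln (1 / h))) * h <= sqrt (max 1 (r / 4)) * h powr (1 - 2 / r)"
proof -
 have ge: "1 <= (1 / h) powr (4 / r)" using h r by (intro ge_one_powr_ge_zero) auto
 have "ln (1 / h) <= (1 / h) powr (4 / r) / (4 / r)" using h r by (intro ln_powr_bound) auto
 also have "... = (r / 4) * (1 / h) powr (4 / r)" by simp
 also have "... <= max 1 (r / 4) * (1 / h) powr (4 / r)" by (intro mult_right_mono) auto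
 finally have "max 1 (ln (1 / h)) <= max 1 (r / 4) * (1 / h) powr (4 / r)"
  using mult_mono[of 1 "max 1 (r / 4)" 1 "(1 / h) powr (4 / r)"] ge by auto
 hence "sqrt (max 1 (ln (1 / h))) <= sqrt (max 1 (r / 4)) * sqrt ((1 / h) powr (4 / r))"
  unfolding real_sqrt_mult[symmetric] by simp
 also have "sqrt ((1 / h) powr (4 / r)) = h powr (- 2 / r)"
 proof (rule real_sqrt_unique)
  show "(h powr (- 2 / r))^2 = (1 / h) powr (4 / r)"
   using h by (simp add: power2_eq_square powr_add[symmetric] powr_divide powr_minus_divide)
 qed simp
 finally have "sqrt (max 1 (ln (1 / h))) * h <= sqrt (max 1 (r / 4)) * h powr (- 2 / r) * h"
  using h by (intro mult_right_mono) auto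
 also have "... = sqrt (max 1 (r / 4)) * h powr (1 - 2 / r)"
 proof -
  have "h powr (- 2 / r) * h powr 1 = h powr (1 - 2 / r)" unfolding powr_add[symmetric] by simp
  thus ?thesis using h by simp
 qed
 finally show ?thesis .
qed

lemma (in triangulation) gradient_fe: "v : fe_space D \<T> ==> T : \<T> ==> x : T ==> gradient v x = slope v T"
 by (rule fe_affine) auto

theorem theorem3p5:
  fixes D :: "(real^2) set"
    and \<sigma> f u :: "real^2 \<Rightarrow> real"
    and s q \<sigma>\<^sub>0 :: real
    and p :: ereal
    and \<T> :: "real \<Rightarrow> (real^2) set set"
    and P :: "'w measure"
    and Z :: "real \<Rightarrow> (real^2) set \<Rightarrow> 'w \<Rightarrow> real^2"
    and u_MC :: "real \<Rightarrow> 'w \<Rightarrow> real^2 \<Rightarrow> real"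
  assumes "convex_polygonal_domain D"
    and "0 < s" "s \<le> 1" "2 < q"
    and "\<sigma> \<in> Lp_space \<infinity> D \<inter> W_space s q D"
    and "0 < \<sigma>\<^sub>0" "AE x in lebesgue_on D. \<sigma>\<^sub>0 \<le> \<sigma> x"
    and "\<And>h. h \<in> {0<..1} \<Longrightarrow> admissible_triangulation D (\<T> h)"
    and "\<And>h. h \<in> {0<..1} \<Longrightarrow> mesh_size (\<T> h) = h"
    and "quasi_uniform \<T>"
    and "2 \<le> p" "f \<in> Lp_space p D"
    and "weak_solution D \<sigma> f u"
    and "u \<in> H10_space D \<inter> H2_space D"
    and "prob_space P"
    and "\<And>h. h \<in> {0<..1} \<Longrightarrow> uniform_samples P (\<T> h) (Z h)"
    and "\<And>h. h \<in> {0<..1} \<Longrightarrow> MC_solution P D (\<T> h) \<sigma> f (Z h) (u_MC h)"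
  shows "\<exists>C::real. 0 < C \<and>
    (p < \<infinity> \<longrightarrow> (\<forall>h\<in>{0<..1}.
       L2_H10_norm P D (\<lambda>\<omega> x. u x - u_MC h \<omega> x)
       \<le> ennreal (C * h * H2_norm D u
           + C * h powr s * H2_norm D u * W_seminorm s q D \<sigma>
           + C * h powr (1 - 2 / real_of_ereal p) * Lp_norm p D f))) \<and>
    (p = \<infinity> \<longrightarrow> (\<forall>h\<in>{0<..1}.
       L2_H10_norm P D (\<lambda>\<omega> x. u x - u_MC h \<omega> x)
       \<le> ennreal (C * h * H2_norm D u
           + C * h powr s * H2_norm D u * W_seminorm s q D \<sigma>
           + C * sqrt (max 1 (ln (1 / h))) * h * Lp_norm \<infinity> D f)))"
proof -
 interpret convex_domain D
  using assms(1) by unfold_locales (auto simp: convex_polygonal_domain_def)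
 obtain A0 where A0: "emeasure lborel D = ennreal A0" "0 < A0" using area by blast
 obtain R where R: "0 < R" "!!x y. x : closure D ==> y : closure D ==> norm (y - x) <= R"
  using diam_bound by blast
 obtain c where c: "0 < c" "!!h T. h : {0<..1} ==> T : \<T> h ==> c * h^2 <= area T"
  using assms(10) unfolding quasi_uniform_def by blast
 define B where "B = Lp_norm \<infinity> D \<sigma>"
 have sgL: "\<sigma> : Lp_space \<infinity> D" and sgW: "\<sigma> : W_space s q D" using assms(5) by auto
 obtain \<sigma>' where sg': "agrees \<sigma> \<sigma>'" "L2_on D \<sigma>'" "!!x. \<bar>\<sigma>' x\<bar> <= B"
  unfolding B_def by (rule Linfty_agrees[OF sgL]) (auto intro: that)
 obtain f' CF where f': "agrees f f'" "L2_on D f'" "0 <= CF" "nsq D f' <= (CF * Lp_norm p D f)^2" and F0: "0 <= Lp_norm p D f"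
  by (rule Lp_agrees_L2[OF assms(11,12)]) (auto intro: that)
 have uH: "u : H10_space D" "u : H1_space D" "!!i. weak_deriv D i u : H1_space D" using assms(14) by (auto simp: H2_space_def)
 have "u : borel_measurable (lebesgue_on D)" using uH(2) by (simp add: W1_space_def Lp_space_def)
 then obtain u' where u': "agrees u u'" "!!x. x \<notin> D ==> u' x = 0" by (rule agrees_exists) blast
 obtain g where g: "H1_data D u' g" "!!i. agrees (weak_deriv D i u) (g i)"
  by (rule H1_space_agrees[OF uH(2) u']) (auto intro: that)
 interpret u: H1_data D u' g by (rule g(1))
 have "EX k. H1_data D (g i) k & (ALL j. agrees (weak_deriv D j (weak_deriv D i u)) (k j))" for i
  by (rule H1_space_agrees[OF uH(3) g(2) L2_onD(2)[OF u.g]]) blast+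
 then obtain k where k: "!!i. H1_data D (g i) (k i)" "!!i j. agrees (weak_deriv D j (weak_deriv D i u)) (k i j)" by metis
 interpret u: H2_data D u' g k
  using k(1) by unfold_locales (auto simp: H1_data_def H1_data_axioms_def)
 have u0: u.H10_limit using u.H10_space_iff[OF u'(1)] uH(1) by simp
 let ?N = "H2_norm D u" and ?W = "W_seminorm s q D \<sigma>" and ?F = "Lp_norm p D f"
  and ?H = "(SUM i:UNIV. nsq D (g i)) + u.hess D"
 have N0: "0 <= ?N" unfolding H2_norm_def by (intro real_sqrt_ge_zero add_nonneg_nonneg sum_nonneg) auto
 have W0: "0 <= ?W" by (simp add: W_seminorm_def)
 have "?N^2 = nsq D u' + (SUM i:UNIV. nsq D (g i)) + u.hess D"
 proof -
  have "(Lp_norm 2 D (weak_deriv D j (weak_deriv D i u)))^2 = nsq D (k i j)" for i j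
   by (rule L2_agrees(2)[OF k(2) L2_onD(2)[OF u.k]])
  moreover have "(Lp_norm 2 D (weak_deriv D i u))^2 = nsq D (g i)" for i by (rule L2_agrees(2)[OF g(2) L2_onD(2)[OF u.g]])
  moreover have "(Lp_norm 2 D u)^2 = nsq D u'" by (rule L2_agrees(2)[OF u'])
  ultimately show ?thesis
   unfolding H2_norm_def u.hess_def by (subst real_sqrt_pow2) (auto intro!: add_nonneg_nonneg sum_nonneg nsq_nonneg)
 qed
 hence H: "?H <= ?N^2" using nsq_nonneg[of D u'] by simp
 have H0: "0 <= ?H" by (intro add_nonneg_nonneg sum_nonneg nsq_nonneg u.hess_nonneg)
 have lower: "AE x in lborel. x : D --> \<sigma>\<^sub>0 <= \<sigma>' x"
  using assms(7)[unfolded AE_lebesgue_on] agreesD(2)[OF sg'(1)] by eventually_elim auto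
 \<comment> \<open>The squares of the constants of the three terms, the last one up to
   \<open>CF\<close>; none depends on \<open>h\<close>.\<close>
 define a b d where
  "a = (32 + 18 / c^2) * (2 + 30 * B^2 / \<sigma>\<^sub>0\<^sup>2)" and
  "b = 20 / \<sigma>\<^sub>0\<^sup>2 * ((1 / c + 32 powr (q / 2)) / A0) powr (2 / q) * (16 + 40 * R^2 / (1 - 2 / q)^2)" and
  "d = 10 / \<sigma>\<^sub>0\<^sup>2 * (2 + 16 * pi * (2 + (\<bar>ln (3 * R / (2 * c))\<bar> + 1) / ln 2))"
 have abd: "0 <= a" "0 <= b" "0 <= d"
  unfolding a_def b_def d_def by (intro mult_nonneg_nonneg add_nonneg_nonneg divide_nonneg_nonneg; simp)+
 \<comment> \<open>One estimate for every \<open>p\<close>, with the root of the logarithm; the two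
   cases differ only in how the last term is rewritten.\<close>
 have core: "L2_H10_norm P D (%om x. u x - u_MC h om x) <=
   ennreal (sqrt a * (h * ?N) + sqrt b * (h powr s * ?N * ?W) + sqrt d * CF * (sqrt (max 1 (ln (1 / h))) * h * ?F))"
  if hI: "h : {0<..1}" for h
 proof -
  have h1: "0 < h" "h <= 1" using hI by auto
  interpret triangulation D "\<T> h" h c
   using assms(8,9) c hI by unfold_locales auto
  \<comment> \<open>Finite element functions lie in \<open>H10_space\<close>, so the weak equation
    may be tested with them; it is then rewritten in Borel representatives.\<close>
  have solution: "(LBINT x. \<sigma>' x * (SUM i:UNIV. g i x * pgrad w i x)) = (LBINT x. f' x * ext w x)"
   if w: "w : fe_space D (\<T> h)" for w
  proof -
   interpret w: H1_data D "ext w" "pgrad w" by (rule fe_H1_data[OF w])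
   have wa: "agrees w (ext w)" using ext_measurable[OF w] by (simp add: agrees_def ext_def)
   have "w : H10_space D" using w.H10_space_iff[OF wa] fe_H10[OF w] by simp
   hence "(LINT x|lebesgue_on D. \<sigma> x * (weak_gradient D u x \<bullet> weak_gradient D w x)) = (LINT x|lebesgue_on D. f x * w x)"
    using assms(13) by (simp add: weak_solution_def)
   moreover have "(LINT x|lebesgue_on D. \<sigma> x * (weak_gradient D u x \<bullet> weak_gradient D w x)) =
     (LBINT x. \<sigma>' x * (SUM i:UNIV. g i x * pgrad w i x))"
   proof -
    have "agrees (%x. \<sigma> x * (weak_deriv D 1 u x * weak_deriv D 1 w x + weak_deriv D 2 u x * weak_deriv D 2 w x))
      (%x. \<sigma>' x * (g 1 x * pgrad w 1 x + g 2 x * pgrad w 2 x))"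
     by (intro agrees_arith(1)[OF sg'(1) agrees_arith(3)] agrees_arith(1)[OF g(2) w.H1_agrees(2)[OF wa]])
    from agrees_integral[OF this] show ?thesis
     using L2_onD(2)[OF sg'(2)]
     by (simp add: weak_gradient_def inner_vec_def sum_2) (intro Bochner_Integration.integral_cong; auto simp: indicator_def)
   qed
   moreover have "(LINT x|lebesgue_on D. f x * w x) = (LBINT x. f' x * ext w x)"
    unfolding agrees_integral[OF agrees_arith(1)[OF f'(1) wa]]
    using L2_onD(2)[OF f'(2)] by (intro Bochner_Integration.integral_cong) (auto simp: indicator_def)
   ultimately show ?thesis by simp
  qed
  interpret sampled_fem D "\<T> h" h c u' g k \<sigma>' f' B \<sigma>\<^sub>0
   using sg'(2,3) f'(2) assms(6) solution by unfold_locales auto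
  note us = assms(16)[OF hI]
  have Zm: "Z h T : measurable P borel" if "T : \<T> h" for T
   using us that by (simp add: uniform_samples_def prob_space.indep_vars_def[OF assms(15)])
  have U: "u_MC h om : fe_space D (\<T> h)" if "om : space P" for om
   using assms(17)[OF hI] that by (simp add: MC_solution_def)
  have ae: "AE x in lborel. x : D --> \<sigma> x = \<sigma>' x & f x = f' x"
   using agreesD(2)[OF sg'(1)] agreesD(2)[OF f'(1)] by eventually_elim auto
  \<comment> \<open>Almost surely the samples avoid the null set on which the given data differ from
    their Borel representatives.\<close>
  have "AE om in P. Z h T om : T & \<sigma> (Z h T om) = \<sigma>' (Z h T om) & f (Z h T om) = f' (Z h T om)" if T: "T : \<T> h" for T
  proof (rule uniform_sample_AE[OF Zm[OF T] _ T L2_onD(1)[OF f'(2)] _ ae])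
   show "distr P lborel (Z h T) = uniform_measure lborel T" using us T by (simp add: uniform_samples_def)
   show "L1 (%x. ind T x * f' x)"
    using integrable_real_mult_indicator[OF _ L2_L1[OF f'(2) D(1,2)], of T] T by (simp add: mult.commute)
  qed
  hence "AE om in P. ALL T:\<T> h. Z h T om : T & \<sigma> (Z h T om) = \<sigma>' (Z h T om) & f (Z h T om) = f' (Z h T om)"
   by (intro AE_finite_allI finite_T) auto
  moreover have "AE om in P. ALL w:fe_space D (\<T> h). a_MC (\<T> h) \<sigma> (%T. Z h T om) (u_MC h om) w = F_MC (\<T> h) f (%T. Z h T om) w"
   using assms(17)[OF hI] by (simp add: MC_solution_def)
  ultimately have MC: "AE om in P. ALL w:fe_space D (\<T> h).
    (SUM T:\<T> h. area T * \<sigma>' (Z h T om) * (slope (u_MC h om) T \<bullet> slope w T)) =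
    (SUM T:\<T> h. area T * f' (Z h T om) * w (Z h T om))"
   using AE_space
  proof eventually_elim
   case (elim om)
   show ?case
   proof
    fix w assume w: "w : fe_space D (\<T> h)"
    have "(SUM T:\<T> h. area T * \<sigma>' (Z h T om) * (slope (u_MC h om) T \<bullet> slope w T)) =
      a_MC (\<T> h) \<sigma> (%T. Z h T om) (u_MC h om) w"
     unfolding a_MC_def using elim(1,3) U gradient_fe w by (intro sum.cong) auto
    also have "... = F_MC (\<T> h) f (%T. Z h T om) w" using elim(2) w by blast
    also have "... = (SUM T:\<T> h. area T * f' (Z h T om) * w (Z h T om))"
     unfolding F_MC_def using elim(1) by (intro sum.cong) auto
    finally show "(SUM T:\<T> h. area T * \<sigma>' (Z h T om) * (slope (u_MC h om) T \<bullet> slope w T)) =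
      (SUM T:\<T> h. area T * f' (Z h T om) * w (Z h T om))" .
   qed
  qed
  have seminorm: "(H1_seminorm D (%x. u x - u_MC h om x))^2 = grad_err (u_MC h om)" if "om : space P" for om
  proof -
   note w = U[OF that]
   interpret e: H1_data D "%x. u' x - ext (u_MC h om) x" "%i x. g i x - pgrad (u_MC h om) i x"
    by (rule H1_data_diff[OF g(1) fe_H1_data[OF w]])
   have "agrees (u_MC h om) (ext (u_MC h om))" using ext_measurable[OF w] by (simp add: agrees_def ext_def)
   from e.H1_agrees(5)[OF agrees_arith(2)[OF u'(1) this]] show ?thesis by (simp add: grad_err_def)
  qed
  let ?l = "max 1 (ln (1 / h))"
  define x where "x = a * (h^2 * ?H) + b * ((h powr s)^2 * ?W^2 * ?H) + d * (?l * h^2 * nsq D f')"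
  define x1 x2 x3 where "x1 = sqrt a * (h * ?N)" and "x2 = sqrt b * (h powr s * ?N * ?W)"
   and "x3 = sqrt d * CF * (sqrt ?l * h * ?F)"
  have x0: "0 <= x1" "0 <= x2" "0 <= x3"
   unfolding x1_def x2_def x3_def using abd h N0 W0 F0 f'(3) by (intro mult_nonneg_nonneg; simp)+
  have "(\<integral>\<^sup>+ om. ennreal ((H1_seminorm D (%x. u x - u_MC h om x))^2) \<partial>P) = (\<integral>\<^sup>+ om. ennreal (grad_err (u_MC h om)) \<partial>P)"
   using seminorm by (intro nn_integral_cong) simp
  also have "... <= ennreal x" unfolding x_def a_def b_def d_def
   by (rule mean_square_error[OF u0 assms(15) us U lower MC A0 R assms(4) _ W0
    var_at_W_seminorm[OF assms(2,3,4) sgW sg'(1,2)]]) (use c in auto)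
  finally have E: "(\<integral>\<^sup>+ om. ennreal ((H1_seminorm D (%x. u x - u_MC h om x))^2) \<partial>P) <= ennreal x" .
  have "x <= a * (h^2 * ?N^2) + b * ((h powr s)^2 * ?W^2 * ?N^2) + d * (?l * h^2 * (CF * ?F)^2)"
   unfolding x_def using abd H f'(4) by (intro add_mono mult_left_mono) auto
  also have "... = x1^2 + x2^2 + x3^2" unfolding x1_def x2_def x3_def using abd by (simp add: power_mult_distrib mult_ac)
  \<comment> \<open>The numbers are nonnegative, so the root of the sum of squares is at most their
    sum.\<close>
  also have "... <= (x1 + x2 + x3)^2"
   using x0 mult_nonneg_nonneg[OF x0(1,2)] mult_nonneg_nonneg[OF x0(1,3)] mult_nonneg_nonneg[OF x0(2,3)]
   by (simp add: power2_eq_square algebra_simps)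
  finally show ?thesis
   using L2_H10_norm_le[OF E, of "x1 + x2 + x3"] x0 by (simp add: x1_def x2_def x3_def)
 qed
 \<comment> \<open>For infinite \<open>p\<close> this is 0 by the convention of
   \<open>real_of_ereal\<close>; the factor max 1 (r/4) is then 1, so one constant \<open>C\<close>
   covers both cases.\<close>
 define r where "r = real_of_ereal p"
 define C where "C = sqrt a + sqrt b + sqrt d * CF * sqrt (max 1 (r / 4)) + sqrt d * CF + 1"
 have nn: "0 <= sqrt a" "0 <= sqrt b" "0 <= sqrt d * CF * sqrt (max 1 (r / 4))" "0 <= sqrt d * CF"
  using abd f'(3) by (auto intro!: mult_nonneg_nonneg)
 have C: "0 < C" "sqrt a <= C" "sqrt b <= C" "sqrt d * CF * sqrt (max 1 (r / 4)) <= C" "sqrt d * CF <= C"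
  unfolding C_def using nn by linarith+
 have est: "sqrt a * (h * ?N) + sqrt b * (h powr s * ?N * ?W) + sqrt d * CF * (sqrt (max 1 (ln (1 / h))) * h * ?F) <=
   C * h * ?N + C * h powr s * ?N * ?W + Y" if "h : {0<..1}" "sqrt d * CF * (sqrt (max 1 (ln (1 / h))) * h * ?F) <= Y" for h Y
  unfolding mult.assoc[of C] using that C N0 W0
  by (intro add_mono mult_mono mult_nonneg_nonneg) (auto simp: mult.assoc intro!: mult_mono mult_nonneg_nonneg)
 show ?thesis
 proof (intro exI[of _ C] conjI impI ballI)
  show "0 < C" by (rule C)
  fix h :: real assume h: "h : {0<..1}"
  {
   assume "p < \<infinity>"
   hence r: "0 < r" using assms(11) unfolding r_def by (cases p) auto
   have "sqrt d * CF * (sqrt (max 1 (ln (1 / h))) * h * ?F) <= sqrt d * CF * (sqrt (max 1 (r / 4)) * h powr (1 - 2 / r) * ?F)"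
    using sqrt_log_mult_le[of h r] h r F0 nn(4) by (intro mult_left_mono mult_right_mono) auto
   also have "... = (sqrt d * CF * sqrt (max 1 (r / 4))) * (h powr (1 - 2 / r) * ?F)" by (simp add: mult_ac)
   also have "... <= C * (h powr (1 - 2 / r) * ?F)" using F0 by (intro mult_right_mono C) auto
   finally have "sqrt d * CF * (sqrt (max 1 (ln (1 / h))) * h * ?F) <= C * h powr (1 - 2 / r) * ?F" by (simp add: mult.assoc)
   from order_trans[OF core[OF h] ennreal_leI[OF est[OF h this]]]
   show "L2_H10_norm P D (%om x. u x - u_MC h om x) <= ennreal (C * h * ?N + C * h powr s * ?N * ?W
     + C * h powr (1 - 2 / real_of_ereal p) * Lp_norm p D f)" by (simp add: r_def)
  next
   assume p: "p = \<infinity>"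
   have "sqrt d * CF * (sqrt (max 1 (ln (1 / h))) * h * ?F) <= C * (sqrt (max 1 (ln (1 / h))) * h * ?F)"
    using F0 h by (intro mult_right_mono C mult_nonneg_nonneg) auto
   hence "sqrt d * CF * (sqrt (max 1 (ln (1 / h))) * h * ?F) <= C * sqrt (max 1 (ln (1 / h))) * h * ?F" by (simp add: mult.assoc)
   from order_trans[OF core[OF h] ennreal_leI[OF est[OF h this]]]
   show "L2_H10_norm P D (%om x. u x - u_MC h om x) <= ennreal (C * h * ?N + C * h powr s * ?N * ?W
     + C * sqrt (max 1 (ln (1 / h))) * h * Lp_norm \<infinity> D f)" by (simp add: p)
  }
 qed
qed

end
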